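(* Let $n\ge 3$ and let $\lambda=(\lambda_1<\dots<\lambda_n)$ be a simple real spectrum. The image of the map $p\colon X_{n,\lambda}\to\mathbb{C}$, $p(L)=\prod_{i=1}^n b_i$, is the set $$\mathbb{B}=\left\{z\in\mathbb{C}\ \Big|\ |z|\le \tfrac12\min\left(\frac{m}{1+\cos\operatorname{Arg} z},\frac{M}{1-\cos\operatorname{Arg} z}\right)\right\}.$$ The preimages of points under the induced map $\tilde p\colon Q_{n,\lambda}\to\mathbb{B}$ are as follows. (1) If $z$ lies in the interior of $\mathbb{B}$, then $\tilde p^{-1}(z)$ is homeomorphic to a compact torus of dimension $n-1$. (2) If $z\in\partial\mathbb{B}$ and $\frac{M}{1-\cos\operatorname{Arg} z}<\frac{m}{1+\cos\operatorname{Arg} z}$, then $\tilde p^{-1}(z)$ is homeomorphic to a torus of dimension $n-1-n_+$. (3) If $z\in\partial\mathbb{B}$ and $\frac{m}{1+\cos\operatorname{Arg} z}<\frac{M}{1-\cos\operatorname{Arg} z}$, then $\tilde p^{-1}(z)$ is homeomorphic to a torus of dimension $n-1-n_-$. (4) If $z\in\partial\mathbb{B}$ and $\frac{m}{1+\cos\operatorname{Arg} z}=\frac{M}{1-\cos\operatorname{Arg} z}$, then $\tilde p^{-1}(z)$ is homeomorphic to a torus of dimension $n-1-n_+-n_-$.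
   Context: A periodic tridiagonal matrix is a Hermitian $n\times n$ matrix $L=L(\underline a,\underline b)$, $a_i\in\mathbb{R}$, $b_i\in\mathbb{C}$, with diagonal entries $L_{ii}=a_i$, with $L_{i,i+1}=b_i$, $L_{i+1,i}=\overline{b_i}$ for $1\le i\le n-1$, $L_{n,1}=b_n$, $L_{1,n}=\overline{b_n}$, and all other entries $0$. $X_{n,\lambda}$ is the space of all such matrices with spectrum $\lambda$. The torus $T^n$ of diagonal unitary matrices acts on $X_{n,\lambda}$ by conjugation, $(t_1,\dots,t_n)$ sending $(a_i;b_i)$ to $(a_i;t_it_{i+1}^{-1}b_i)$ with indices mod $n$; the diagonal circle $\Delta$ acts trivially, and $T=T^{n-1}=T^n/\Delta$ acts effectively. $Q_{n,\lambda}=X_{n,\lambda}/T$. The action preserves $\prod b_i$, so $p$ induces $\tilde p\colon Q_{n,\lambda}\to\mathbb{C}$. Let $F(x)=\prod_{i=1}^n(x-\lambda_i)$ and let $x_1<\dots<x_{n-1}$ be its critical points, so that $x_{n-1},x_{n-3},\dots$ are local minima and $x_{n-2},x_{n-4},\dots$ are local maxima. Put $M=\min_{i\text{ even}}F(x_{n-i})>0$ and $m=\min_{i\text{ odd}}(-F(x_{n-i}))>0$, where $1\le i\le n-1$. Let $n_+$ be the number of local maxima of $F$ at which the value $M$ is attained, and $n_-$ the number of local minima at which the value $-m$ is attained. Conventions: a fraction with positive numerator and zero denominator is $+\infty$, and $0\in\mathbb{B}$ (in its interior). *)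

theory Defs
  imports "HOL-Analysis.Analysis" "Jordan_Normal_Form.Spectral_Radius"
begin

section \<open>Spaces of matrices, quotients, tori\<close>

text \<open>The type of matrices carries no topology; \<open>n \<times> n\<close> matrices get the one
  they have as points of \<open>\<complex>\<^sup>n\<^sup>\<times>\<^sup>n\<close>.\<close>

definition mat_topology :: "nat \<Rightarrow> complex mat topology" where
  "mat_topology n =
     pullback_topology (carrier_mat n n)
       (\<lambda>L. restrict (\<lambda>ij. L $$ ij) ({..<n} \<times> {..<n}))
       (product_topology (\<lambda>_. euclidean) ({..<n} \<times> {..<n}))"

definition quotient_topology :: "'a topology \<Rightarrow> ('a \<Rightarrow> 'b) \<Rightarrow> 'b topology" where
  "quotient_topology X q =
     topology (\<lambda>U. U \<subseteq> q ` topspace X \<and> openin X {x \<in> topspace X. q x \<in> U})"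

lemma openin_quotient_topology:
  "openin (quotient_topology X q) U \<longleftrightarrow>
     U \<subseteq> q ` topspace X \<and> openin X {x \<in> topspace X. q x \<in> U}"
proof -
  have "istopology (\<lambda>U. U \<subseteq> q ` topspace X \<and> openin X {x \<in> topspace X. q x \<in> U})"
    unfolding istopology_def
  proof (intro conjI allI impI)
    fix S T
    assume S: "S \<subseteq> q ` topspace X \<and> openin X {x \<in> topspace X. q x \<in> S}"
      and T: "T \<subseteq> q ` topspace X \<and> openin X {x \<in> topspace X. q x \<in> T}"
    show "S \<inter> T \<subseteq> q ` topspace X" using S by blast
    have "{x \<in> topspace X. q x \<in> S \<inter> T} =
        {x \<in> topspace X. q x \<in> S} \<inter> {x \<in> topspace X. q x \<in> T}" by blast
    then show "openin X {x \<in> topspace X. q x \<in> S \<inter> T}" using S T by auto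
  next
    fix K
    assume K: "\<forall>U\<in>K. U \<subseteq> q ` topspace X \<and> openin X {x \<in> topspace X. q x \<in> U}"
    then show "\<Union>K \<subseteq> q ` topspace X" by blast
    have "{x \<in> topspace X. q x \<in> \<Union>K} = (\<Union>U\<in>K. {x \<in> topspace X. q x \<in> U})" by blast
    then show "openin X {x \<in> topspace X. q x \<in> \<Union>K}" using K by auto
  qed
  then show ?thesis by (simp add: quotient_topology_def)
qed

lemma topspace_quotient_topology [simp]:
  "topspace (quotient_topology X q) = q ` topspace X"
proof
  show "topspace (quotient_topology X q) \<subseteq> q ` topspace X"
    using openin_topspace[of "quotient_topology X q"]
    unfolding openin_quotient_topology by blast
  have "{x \<in> topspace X. q x \<in> q ` topspace X} = topspace X" by blast
  then have "openin (quotient_topology X q) (q ` topspace X)"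
    by (simp add: openin_quotient_topology)
  then show "q ` topspace X \<subseteq> topspace (quotient_topology X q)"
    by (rule openin_subset)
qed

lemma quotient_map_quotient_topology: "quotient_map X (quotient_topology X q) q"
  by (auto simp: quotient_map_def openin_quotient_topology)

definition torus :: "nat \<Rightarrow> (nat \<Rightarrow> complex) topology" where
  "torus k = product_topology (\<lambda>_. top_of_set (sphere 0 1)) {..<k}"


section \<open>Isospectral periodic tridiagonal matrices\<close>

text \<open>Rows, columns and the parameters \<open>a\<close>, \<open>b\<close> are indexed by \<open>0, \<dots>, n - 1\<close>, so
  that \<open>a i\<close>, \<open>b i\<close> are \<open>a\<^sub>i\<^sub>+\<^sub>1\<close>, \<open>b\<^sub>i\<^sub>+\<^sub>1\<close> in the usual notation; the entry
  at \<open>(i, i + 1 mod n)\<close> is \<open>b i\<close>. The three cases are disjoint only for \<open>n \<ge> 3\<close>.\<close>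

definition periodic_tridiagonal :: "nat \<Rightarrow> (nat \<Rightarrow> real) \<Rightarrow> (nat \<Rightarrow> complex) \<Rightarrow> complex mat" where
  "periodic_tridiagonal n a b = Matrix.mat n n (\<lambda>(i, j).
     if j = i then complex_of_real (a i)
     else if j = Suc i mod n then b i
     else if i = Suc j mod n then cnj (b j)
     else 0)"

text \<open>The spectrum is a set here. As \<open>lam 1, \<dots>, lam n\<close> will be distinct, equality of sets
  forces every eigenvalue of the \<open>n \<times> n\<close> matrix to be simple.\<close>

definition isospectral :: "nat \<Rightarrow> (nat \<Rightarrow> real) \<Rightarrow> complex mat set" where
  "isospectral n lam =
     {L. (\<exists>a b. L = periodic_tridiagonal n a b) \<and>
         spectrum L = (\<lambda>i. complex_of_real (lam i)) ` {1..n}}"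

definition isospectral_space :: "nat \<Rightarrow> (nat \<Rightarrow> real) \<Rightarrow> complex mat topology" where
  "isospectral_space n lam = subtopology (mat_topology n) (isospectral n lam)"

text \<open>Conjugation by the diagonal unitary matrices. The scalar matrices act trivially, so the
  orbits of \<open>T\<^sup>n\<close> are those of its quotient by the diagonal circle.\<close>

definition torus_orbit :: "nat \<Rightarrow> complex mat \<Rightarrow> complex mat set" where
  "torus_orbit n L =
     {mat_diag n t * L * mat_diag n (\<lambda>i. inverse (t i)) | t. t \<in> topspace (torus n)}"

definition orbit_space :: "nat \<Rightarrow> (nat \<Rightarrow> real) \<Rightarrow> complex mat set topology" where
  "orbit_space n lam = quotient_topology (isospectral_space n lam) (torus_orbit n)"

definition off_diagonal_prod :: "nat \<Rightarrow> complex mat \<Rightarrow> complex" where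
  "off_diagonal_prod n L = (\<Prod>i<n. L $$ (i, Suc i mod n))"

definition induced_prod :: "nat \<Rightarrow> complex mat set \<Rightarrow> complex" where
  "induced_prod n orb = the_elem (off_diagonal_prod n ` orb)"

definition fiber :: "nat \<Rightarrow> (nat \<Rightarrow> real) \<Rightarrow> complex \<Rightarrow> complex mat set topology" where
  "fiber n lam z =
     subtopology (orbit_space n lam) {orb \<in> topspace (orbit_space n lam). induced_prod n orb = z}"

lemma cyclic_succ_facts:
  assumes "3 \<le> n" "i < n"
  shows "Suc i mod n < n" "Suc i mod n \<noteq> i" "i \<noteq> Suc (Suc i mod n) mod n"
  using assms by (auto simp: mod_Suc)

lemma periodic_tridiagonal_hermitian:
  assumes "3 \<le> n" "i < n" "j < n"
  shows "cnj (periodic_tridiagonal n a b $$ (j, i)) = periodic_tridiagonal n a b $$ (i, j)"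
  using assms cyclic_succ_facts[of n i] cyclic_succ_facts[of n j]
  by (auto simp: periodic_tridiagonal_def)

lemma off_diagonal_prod_periodic_tridiagonal:
  assumes "3 \<le> n"
  shows "off_diagonal_prod n (periodic_tridiagonal n a b) = (\<Prod>i<n. b i)"
  unfolding off_diagonal_prod_def
  using assms cyclic_succ_facts[of n]
  by (intro prod.cong refl) (auto simp: periodic_tridiagonal_def)

lemma conjugate_periodic_tridiagonal:
  assumes n: "3 \<le> n" and t: "t \<in> topspace (torus n)"
  shows "mat_diag n t * periodic_tridiagonal n a b * mat_diag n (\<lambda>i. inverse (t i)) =
         periodic_tridiagonal n a (\<lambda>i. t i * inverse (t (Suc i mod n)) * b i)"
proof -
  have u: "norm (t i) = 1" if "i < n" for i
    using t that by (auto simp: torus_def PiE_iff)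
  have inv: "inverse (t i) = cnj (t i)" if "i < n" for i
    using u[OF that] by (simp add: inverse_complex_def complex_eq_iff cmod_def)
  have unit: "t i * cnj (t i) = 1" if "i < n" for i
    using u[OF that] by (simp add: complex_norm_square[symmetric])
  have c: "periodic_tridiagonal n a b \<in> carrier_mat n n" for a b
    by (simp add: periodic_tridiagonal_def)
  have "mat_diag n t * periodic_tridiagonal n a b * mat_diag n (\<lambda>i. inverse (t i)) =
      Matrix.mat n n (\<lambda>(i, j). t i * periodic_tridiagonal n a b $$ (i, j) * inverse (t j))"
    by (subst mat_diag_mult_left[OF c], subst mat_diag_mult_right[of _ n])
      (auto intro!: eq_matI)
  also have "\<dots> = periodic_tridiagonal n a (\<lambda>i. t i * inverse (t (Suc i mod n)) * b i)"
    using n inv unit cyclic_succ_facts[of n]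
    by (intro eq_matI) (auto simp: periodic_tridiagonal_def)
  finally show ?thesis .
qed

lemma induced_prod_torus_orbit:
  assumes n: "3 \<le> n" and L: "L \<in> isospectral n lam"
  shows "induced_prod n (torus_orbit n L) = off_diagonal_prod n L"
proof -
  obtain a b where ab: "L = periodic_tridiagonal n a b"
    using L by (auto simp: isospectral_def)
  have "off_diagonal_prod n L' = (\<Prod>i<n. b i)" if mem: "L' \<in> torus_orbit n L" for L'
  proof -
    obtain t where t: "t \<in> topspace (torus n)"
      and "L' = mat_diag n t * L * mat_diag n (\<lambda>i. inverse (t i))"
      using mem unfolding torus_orbit_def by blast
    then have L': "L' = periodic_tridiagonal n a (\<lambda>i. t i * inverse (t (Suc i mod n)) * b i)"
      by (simp only: ab conjugate_periodic_tridiagonal[OF n t])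
    have "t i \<noteq> 0" if "i < n" for i
      using t that by (force simp: torus_def PiE_iff)
    then have t0: "(\<Prod>i<n. t i) \<noteq> 0" by simp
    have bij: "bij_betw (\<lambda>i. Suc i mod n) {..<n} {..<n}"
    proof -
      have inj: "inj_on (\<lambda>i. Suc i mod n) {..<n}"
        by (auto simp: inj_on_def mod_Suc split: if_splits)
      moreover have "(\<lambda>i. Suc i mod n) ` {..<n} \<subseteq> {..<n}" using n by auto
      ultimately show ?thesis by (simp add: bij_betw_def endo_inj_surj)
    qed
    have "(\<Prod>i<n. t (Suc i mod n)) = (\<Prod>i<n. t i)"
      by (rule prod.reindex_bij_betw[OF bij])
    then have "(\<Prod>i<n. t i * inverse (t (Suc i mod n)) * b i) = (\<Prod>i<n. b i)"
      using t0 prod_inversef[of "\<lambda>i. t (Suc i mod n)" "{..<n}"]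
      by (simp add: prod.distrib o_def)
    then show ?thesis by (simp add: L' off_diagonal_prod_periodic_tridiagonal[OF n])
  qed
  moreover have "torus_orbit n L \<noteq> {}"
  proof -
    have "(\<lambda>i\<in>{..<n}. 1) \<in> topspace (torus n)" by (auto simp: torus_def)
    then show ?thesis by (auto simp: torus_orbit_def)
  qed
  ultimately have "off_diagonal_prod n ` torus_orbit n L = {\<Prod>i<n. b i}" by force
  then show ?thesis
    by (simp add: induced_prod_def ab off_diagonal_prod_periodic_tridiagonal[OF n])
qed


section \<open>The region in the plane\<close>

definition spectral_poly :: "nat \<Rightarrow> (nat \<Rightarrow> real) \<Rightarrow> real \<Rightarrow> real" where
  "spectral_poly n lam x = (\<Prod>i=1..n. x - lam i)"

text \<open>\<open>crit_pt n lam j\<close>, for \<open>1 \<le> j \<le> n - 1\<close>, is the \<open>j\<close>-th critical point in increasing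
  order.\<close>

definition crit_pt :: "nat \<Rightarrow> (nat \<Rightarrow> real) \<Rightarrow> nat \<Rightarrow> real" where
  "crit_pt n lam j = sorted_list_of_set {x. deriv (spectral_poly n lam) x = 0} ! (j - 1)"

definition lowest_max :: "nat \<Rightarrow> (nat \<Rightarrow> real) \<Rightarrow> real" where
  "lowest_max n lam = Min {spectral_poly n lam (crit_pt n lam (n - i)) | i. i \<in> {1..n-1} \<and> even i}"

definition lowest_min_depth :: "nat \<Rightarrow> (nat \<Rightarrow> real) \<Rightarrow> real" where
  "lowest_min_depth n lam =
     Min {- spectral_poly n lam (crit_pt n lam (n - i)) | i. i \<in> {1..n-1} \<and> odd i}"

definition num_maxima :: "nat \<Rightarrow> (nat \<Rightarrow> real) \<Rightarrow> nat" where
  "num_maxima n lam =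
     card {x. (\<forall>\<^sub>F y in nhds x. spectral_poly n lam y \<le> spectral_poly n lam x) \<and>
              spectral_poly n lam x = lowest_max n lam}"

definition num_minima :: "nat \<Rightarrow> (nat \<Rightarrow> real) \<Rightarrow> nat" where
  "num_minima n lam =
     card {x. (\<forall>\<^sub>F y in nhds x. spectral_poly n lam y \<ge> spectral_poly n lam x) \<and>
              spectral_poly n lam x = - lowest_min_depth n lam}"

text \<open>Extended reals realise the convention that a positive number divided by \<open>0\<close> is \<open>\<infinity>\<close>.\<close>

lemma "0 < c \<Longrightarrow> ereal c / ereal 0 = \<infinity>"
  by (simp add: divide_ereal_def)

definition max_bound :: "nat \<Rightarrow> (nat \<Rightarrow> real) \<Rightarrow> complex \<Rightarrow> ereal" where
  "max_bound n lam z = ereal (lowest_max n lam) / ereal (1 - cos (Arg z))"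

definition min_bound :: "nat \<Rightarrow> (nat \<Rightarrow> real) \<Rightarrow> complex \<Rightarrow> ereal" where
  "min_bound n lam z = ereal (lowest_min_depth n lam) / ereal (1 + cos (Arg z))"

text \<open>\<open>Arg 0 = 0\<close> in the library, and any value would do: \<open>0\<close> satisfies the inequality
  because both bounds are positive.\<close>

definition region :: "nat \<Rightarrow> (nat \<Rightarrow> real) \<Rightarrow> complex set" where
  "region n lam = {z. ereal (cmod z) \<le> ereal (1/2) * min (min_bound n lam z) (max_bound n lam z)}"

end

theory Submission
  imports Defs "HOL-Homology.Invariance_of_Domain"
begin

text \<open>Let \<open>z \<noteq> 0\<close>. Up to the torus a matrix with product \<open>z\<close> is given by \<open>a\<close> and the moduli
  \<open>\<bar>b\<bar>\<close>, and its characteristic polynomial is \<open>\<Delta>(x) - 2 Re z\<close> with a discriminant \<open>\<Delta>\<close> that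
  depends on \<open>a\<close> and \<open>\<bar>b\<bar>\<close> only, so the fibre consists of the solutions of \<open>\<Delta> = F + 2 Re z\<close>,
  \<open>\<Prod>\<bar>b\<bar> = \<bar>z\<bar>\<close>. The leading minor of order \<open>n - 1\<close> has one root \<open>\<mu>\<^sub>j\<close> in each gap, the part of
  \<open>[\<lambda>\<^sub>j, \<lambda>\<^sub>j\<^sub>+\<^sub>1]\<close> where \<open>\<bar>\<Delta>\<bar> \<ge> 2\<bar>z\<bar>\<close>; together with a point \<open>w\<^sub>j\<close> of the curve
  \<open>w + \<bar>z\<bar>\<^sup>2/w = \<Delta>(\<mu>\<^sub>j)\<close> these roots determine the matrix, and all choices occur. Over a gap the real
  points of the curve form a circle, or a single point if the gap degenerates to a critical point of
  \<open>F\<close> of height \<open>2(\<bar>z\<bar> \<mp> Re z)\<close>. Hence the fibre is a product of circles, one for each open gap.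

  If \<open>z = 0\<close>, some \<open>b\<^sub>k\<close> vanishes and cutting the cycle there leaves a Jacobi matrix, possibly with
  zero off-diagonal entries. These matrices are parametrised by orthonormal frames, and the moment map
  of the torus identifies them with the permutohedron. The \<open>n\<close> possible cuts give \<open>n\<close> permutohedra,
  which are glued along their facets as in the tiling of a hyperplane by translates of one
  permutohedron modulo a lattice, that is, to a torus of dimension \<open>n - 1\<close>.\<close>


section \<open>Torus orbits and fibres\<close>

text \<open>No inverse of a map into a torus is ever built: a compact space is mapped continuously
  onto the fibre and onto the torus, and only the kernels of the two maps are compared. The shape of
  the region comes from the gaps. Over the gap in which \<open>F\<close> has the sign
  \<open>s\<close>, the curve has real points where \<open>s * F\<close> is at least
  \<open>2 * (cmod z - s * Re z)\<close>. Every gap contains such a point iff all critical points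
  satisfy this, and the lowest maximum and the lowest minimum are decisive: they produce
  \<open>M\<close> with \<open>1 - cos\<close> and \<open>m\<close> with \<open>1 + cos\<close>.
  Equality at a critical point closes its gap and costs one circle. The point \<open>z = 0\<close>
  needs another method because the product of the two curve coordinates is then 0, and the curve no
  longer recovers the moduli. There the weights \<open>0, ..., n - 1\<close> of the moment map are
  essential. Counting sites from a cut without reduction modulo \<open>n\<close>, a change of the
  cut alters weights only by \<open>n\<close>; so the heights, offset by the number of the cut, are
  well defined modulo \<open>n\<close> and serve as angles.\<close>

text \<open>A continuous surjection from a compact space to a Hausdorff space is a quotient map, so
  two of them with the same kernel factor through each other.\<close>

lemma homeomorphic_space_same_kernel:
  assumes "compact_space X" "Hausdorff_space Y" "Hausdorff_space Z"
    and f: "continuous_map X Y f" "f ` topspace X = topspace Y"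
    and g: "continuous_map X Z g" "g ` topspace X = topspace Z"
    and eq: "\<And>x y. x \<in> topspace X \<Longrightarrow> y \<in> topspace X \<Longrightarrow> f x = f y \<longleftrightarrow> g x = g y"
  shows "Y homeomorphic_space Z"
proof -
  have qf: "quotient_map X Y f" and qg: "quotient_map X Z g"
    using assms by (auto intro: continuous_imp_quotient_map)
  obtain h where h: "continuous_map Y Z h" "\<And>x. x \<in> topspace X \<Longrightarrow> h (f x) = g x"
    using quotient_map_lift_exists[OF qf g(1)] eq by (metis (no_types, lifting))
  obtain k where k: "continuous_map Z Y k" "\<And>x. x \<in> topspace X \<Longrightarrow> k (g x) = f x"
    using quotient_map_lift_exists[OF qg f(1)] eq by (metis (no_types, lifting))
  have "homeomorphic_maps Y Z h k"
    unfolding homeomorphic_maps_def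
    using h k by (auto simp flip: f(2) g(2))
  then show ?thesis by (rule homeomorphic_maps_imp_homeomorphic_space)
qed

lemma periodic_tridiagonal_carrier [simp]: "periodic_tridiagonal n a b \<in> carrier_mat n n"
  by (simp add: periodic_tridiagonal_def)

lemma periodic_tridiagonal_cong:
  assumes "\<And>i. i < n \<Longrightarrow> a i = a' i" "\<And>i. i < n \<Longrightarrow> b i = b' i"
  shows "periodic_tridiagonal n a b = periodic_tridiagonal n a' b'"
  unfolding periodic_tridiagonal_def using assms by (intro eq_matI) auto

lemma periodic_tridiagonal_diag:
  "i < n \<Longrightarrow> periodic_tridiagonal n a b $$ (i, i) = complex_of_real (a i)"
  by (simp add: periodic_tridiagonal_def)

lemma periodic_tridiagonal_superdiag:
  "3 \<le> n \<Longrightarrow> i < n \<Longrightarrow> periodic_tridiagonal n a b $$ (i, Suc i mod n) = b i"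
  using cyclic_succ_facts[of n i] by (simp add: periodic_tridiagonal_def)

lemma torus_topspace_iff:
  "t \<in> topspace (torus n) \<longleftrightarrow> (\<forall>i<n. cmod (t i) = 1) \<and> t \<in> extensional {..<n}"
  by (auto simp: torus_def PiE_iff)

lemma prod_mod_Suc:
  fixes f :: "nat \<Rightarrow> 'a::comm_monoid_mult"
  assumes "0 < n"
  shows "(\<Prod>i<n. f (Suc i mod n)) = (\<Prod>i<n. f i)"
proof -
  have "inj_on (\<lambda>i. Suc i mod n) {..<n}"
    by (auto simp: inj_on_def mod_Suc split: if_splits)
  moreover have "(\<lambda>i. Suc i mod n) ` {..<n} \<subseteq> {..<n}" using assms by auto
  ultimately have "bij_betw (\<lambda>i. Suc i mod n) {..<n} {..<n}"
    by (simp add: bij_betw_def endo_inj_surj)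
  then show ?thesis by (rule prod.reindex_bij_betw)
qed

text \<open>If the product vanishes, the phase at an index with \<open>b k = 0\<close> is free and makes up for the
  others, so that the phases always come from a point of the torus.\<close>

lemma torus_phases_exist:
  fixes b b' :: "nat \<Rightarrow> complex"
  assumes n: "0 < n" and nb: "\<And>i. i < n \<Longrightarrow> cmod (b' i) = cmod (b i)"
    and pr: "(\<Prod>i<n. b' i) = (\<Prod>i<n. b i)"
  obtains t where "t \<in> topspace (torus n)"
    "\<And>i. i < n \<Longrightarrow> t i * inverse (t (Suc i mod n)) * b i = b' i"
proof -
  have "\<exists>u::nat \<Rightarrow> complex. (\<forall>i<n. cmod (u i) = 1 \<and> u i * b i = b' i) \<and> (\<Prod>i<n. u i) = 1"
  proof (cases "\<exists>k<n. b k = 0")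
    case False
    then have "cmod (b' i / b i) = 1" if "i < n" for i using that nb by (simp add: norm_divide)
    moreover have "(\<Prod>i<n. b' i / b i) = 1" using False pr by (simp add: prod_dividef)
    ultimately show ?thesis using False by (intro exI[of _ "\<lambda>i. b' i / b i"]) auto
  next
    case True
    then obtain k where k: "k < n" "b k = 0" by blast
    define v where "v i = (if b i = 0 then 1 else b' i / b i)" for i
    have v: "cmod (v i) = 1" "v i * b i = b' i" if "i < n" for i
      using nb[OF that] by (auto simp: v_def norm_divide)
    define u where "u = v(k := inverse (\<Prod>i\<in>{..<n} - {k}. v i))"
    have nz: "cmod (\<Prod>i\<in>{..<n} - {k}. v i) = 1" using v(1) by (simp add: prod_norm[symmetric])
    have "(\<Prod>i<n. u i) = u k * (\<Prod>i\<in>{..<n} - {k}. u i)"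
      using k by (simp add: prod.remove)
    also have "(\<Prod>i\<in>{..<n} - {k}. u i) = (\<Prod>i\<in>{..<n} - {k}. v i)"
      by (intro prod.cong) (auto simp: u_def)
    finally have pu: "(\<Prod>i<n. u i) = u k * (\<Prod>i\<in>{..<n} - {k}. v i)" .
    have "(\<Prod>i\<in>{..<n} - {k}. v i) \<noteq> 0" using nz norm_zero zero_neq_one by metis
    with pu have "(\<Prod>i<n. u i) = 1" by (simp add: u_def del: prod_zero_iff)
    moreover have "cmod (u i) = 1 \<and> u i * b i = b' i" if "i < n" for i
      using v[OF that] nz k nb[OF k(1)] by (auto simp: u_def norm_inverse)
    ultimately show ?thesis by blast
  qed
  then obtain u :: "nat \<Rightarrow> complex" where
    u: "\<And>i. i < n \<Longrightarrow> cmod (u i) = 1" "\<And>i. i < n \<Longrightarrow> u i * b i = b' i" "(\<Prod>i<n. u i) = 1"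
    by blast
  \<comment> \<open>With \<open>t i\<close> the inverse of a partial product,
    \<open>t i / t (Suc i)\<close> is \<open>u i\<close>; at the last index the cycle closes because
    the full product is 1.\<close>
  define t where "t = restrict (\<lambda>i. inverse (\<Prod>j<i. u j)) {..<n}"
  have nu: "cmod (\<Prod>j<i. u j) = 1" if "i \<le> n" for i
    using u(1) that by (simp add: prod_norm[symmetric])
  have nz: "(\<Prod>j<i. u j) \<noteq> 0" if "i \<le> n" for i
    using nu[OF that] norm_zero zero_neq_one by metis
  have "t i * inverse (t (Suc i mod n)) = u i" if "i < n" for i
  proof (cases "Suc i = n")
    case True
    then have "(\<Prod>j<i. u j) * u i = 1" using u(3) by (metis prod.lessThan_Suc)
    then show ?thesis using True n nz[of i] by (simp add: t_def field_simps)
  next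
    case False
    then show ?thesis using that nz[of i] by (simp add: t_def)
  qed
  moreover have "t \<in> topspace (torus n)"
    using nu by (simp add: torus_topspace_iff t_def norm_inverse)
  ultimately show ?thesis using that u(2) by metis
qed

text \<open>Conjugation multiplies the entries by phases with product 1 around the cycle, and
  \<open>torus_phases_exist\<close> realises all such changes, also when some entries vanish. So the
  diagonal, the moduli and the product separate orbits.\<close>

lemma torus_orbit_periodic_tridiagonal:
  assumes n: "3 \<le> n"
  shows "torus_orbit n (periodic_tridiagonal n a b) =
    {periodic_tridiagonal n a b' | b'. (\<forall>i<n. cmod (b' i) = cmod (b i)) \<and> (\<Prod>i<n. b' i) = (\<Prod>i<n. b i)}"
    (is "?L = ?R")
proof
  show "?L \<subseteq> ?R"
  proof
    fix L assume "L \<in> ?L"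
    then obtain t where t: "t \<in> topspace (torus n)"
      and L: "L = periodic_tridiagonal n a (\<lambda>i. t i * inverse (t (Suc i mod n)) * b i)"
      unfolding torus_orbit_def using conjugate_periodic_tridiagonal[OF n] by force
    have nt: "cmod (t i) = 1" if "i < n" for i using t that by (simp add: torus_topspace_iff)
    have "(\<Prod>i<n. t i * inverse (t (Suc i mod n)) * b i)
        = (\<Prod>i<n. t i) * (\<Prod>i<n. inverse (t (Suc i mod n))) * (\<Prod>i<n. b i)"
      by (simp add: prod.distrib)
    also have "(\<Prod>i<n. inverse (t (Suc i mod n))) = (\<Prod>i<n. inverse (t i))"
      using prod_mod_Suc[of n "\<lambda>i. inverse (t i)"] n by simp
    also have "(\<Prod>i<n. t i) * (\<Prod>i<n. inverse (t i)) = (\<Prod>i<n. 1)"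
      unfolding prod.distrib[symmetric] using nt
    proof (intro prod.cong refl)
      fix i assume "i \<in> {..<n}"
      then have "t i \<noteq> 0" using nt[of i] by auto
      then show "t i * inverse (t i) = 1" by simp
    qed
    finally have "(\<Prod>i<n. t i * inverse (t (Suc i mod n)) * b i) = (\<Prod>i<n. b i)" by simp
    moreover have "\<forall>i<n. cmod (t i * inverse (t (Suc i mod n)) * b i) = cmod (b i)"
      using nt cyclic_succ_facts(1)[OF n] by (simp add: norm_mult norm_inverse)
    ultimately show "L \<in> ?R" using L by blast
  qed
  show "?R \<subseteq> ?L"
  proof
    fix L assume "L \<in> ?R"
    then obtain b' where b': "\<forall>i<n. cmod (b' i) = cmod (b i)" "(\<Prod>i<n. b' i) = (\<Prod>i<n. b i)"
      and L: "L = periodic_tridiagonal n a b'" by blast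
    have "0 < n" using n by simp
    from torus_phases_exist[OF this, of b' b] b' obtain t where t: "t \<in> topspace (torus n)"
      "\<And>i. i < n \<Longrightarrow> t i * inverse (t (Suc i mod n)) * b i = b' i" by blast
    have "L = periodic_tridiagonal n a (\<lambda>i. t i * inverse (t (Suc i mod n)) * b i)"
      unfolding L using t(2) by (intro periodic_tridiagonal_cong) auto
    then show "L \<in> ?L" unfolding torus_orbit_def
      using t(1) conjugate_periodic_tridiagonal[OF n t(1), of a b, symmetric] by (simp only: mem_Collect_eq) blast
  qed
qed

lemma topspace_mat_topology [simp]: "topspace (mat_topology n) = carrier_mat n n"
  by (auto simp: mat_topology_def topspace_pullback_topology)

lemma isospectral_carrier: "isospectral n lam \<subseteq> carrier_mat n n"
  by (auto simp: isospectral_def)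

lemma topspace_isospectral_space [simp]: "topspace (isospectral_space n lam) = isospectral n lam"
  using isospectral_carrier by (auto simp: isospectral_space_def)

lemma continuous_map_mat_entry:
  assumes "i < n" "j < n"
  shows "continuous_map (mat_topology n) euclidean (\<lambda>L. L $$ (i, j))"
proof -
  have "continuous_map (product_topology (\<lambda>_. euclidean) ({..<n} \<times> {..<n})) euclidean
      (\<lambda>f. f (i, j) :: complex)"
    using assms by (intro continuous_map_product_projection) auto
  then have "continuous_map (mat_topology n) euclidean
     ((\<lambda>f. f (i, j)) \<circ> (\<lambda>L. restrict (\<lambda>ij. L $$ ij) ({..<n} \<times> {..<n})))"
    unfolding mat_topology_def by (rule continuous_map_pullback)
  then show ?thesis using assms by (simp add: o_def)
qed

lemma continuous_map_into_mat_topology: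
  assumes "\<And>x. x \<in> topspace X \<Longrightarrow> M x \<in> carrier_mat n n"
    and "\<And>i j. i < n \<Longrightarrow> j < n \<Longrightarrow> continuous_map X euclidean (\<lambda>x. M x $$ (i, j))"
  shows "continuous_map X (mat_topology n) M"
  unfolding mat_topology_def
proof (rule continuous_map_pullback')
  show "continuous_map X (product_topology (\<lambda>_. euclidean) ({..<n} \<times> {..<n}))
     ((\<lambda>L. restrict (\<lambda>ij. L $$ ij) ({..<n} \<times> {..<n})) \<circ> M)"
    using assms(2) by (auto simp: continuous_map_componentwise o_def)
qed (use assms(1) in auto)

text \<open>Orbits over \<open>z\<close> correspond to pairs of a diagonal and moduli, so it
  suffices to have a compact \<open>X\<close> that maps onto these pairs by \<open>A\<close>,
  \<open>B\<close> and onto a torus by \<open>g\<close>, with equal kernels. The representative of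
  an orbit carries the whole phase of \<open>z\<close> in its last entry; for \<open>z = 0\<close>
  any unit \<open>\<omega>\<close> does.\<close>

lemma fiber_homeomorphic_torus:
  fixes n :: nat and A B :: "'x \<Rightarrow> nat \<Rightarrow> real" and z \<omega> :: complex
  defines "ph \<equiv> \<lambda>x i. if i = n - 1 then \<omega> * of_real (B x i) else of_real (B x i)"
  assumes n: "3 \<le> n" and X: "compact_space X"
    and cA: "\<And>i. i < n \<Longrightarrow> continuous_map X euclideanreal (\<lambda>x. A x i)"
    and cB: "\<And>i. i < n \<Longrightarrow> continuous_map X euclideanreal (\<lambda>x. B x i)"
    and B0: "\<And>x i. x \<in> topspace X \<Longrightarrow> i < n \<Longrightarrow> 0 \<le> B x i"
    and \<omega>: "cmod \<omega> = 1" "z = \<omega> * of_real (cmod z)"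
    and prodB: "\<And>x. x \<in> topspace X \<Longrightarrow> (\<Prod>i<n. B x i) = cmod z"
    and iso: "\<And>x. x \<in> topspace X \<Longrightarrow> periodic_tridiagonal n (A x) (ph x) \<in> isospectral n lam"
    and surj: "\<And>a b. periodic_tridiagonal n a b \<in> isospectral n lam \<Longrightarrow> (\<Prod>i<n. b i) = z \<Longrightarrow>
       \<exists>x\<in>topspace X. \<forall>i<n. A x i = a i \<and> B x i = cmod (b i)"
    and g: "continuous_map X (torus d) g" "g ` topspace X = topspace (torus d)"
    and ker: "\<And>x y. x \<in> topspace X \<Longrightarrow> y \<in> topspace X \<Longrightarrow>
       g x = g y \<longleftrightarrow> (\<forall>i<n. A x i = A y i \<and> B x i = B y i)"
  shows "fiber n lam z homeomorphic_space torus d"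
proof (rule homeomorphic_space_same_kernel[OF X _ _ _ _ g])
  define M where "M x = periodic_tridiagonal n (A x) (ph x)" for x
  \<comment> \<open>Diagonal and moduli are constant on orbits, hence descend to the orbit space.
    They are injective on the fibre, which makes it Hausdorff although the quotient topology gives
    no separation by itself.\<close>
  define I :: "complex mat \<Rightarrow> nat \<Rightarrow> real \<times> real"
    where "I L = (\<lambda>i\<in>{..<n}. (Re (L $$ (i, i)), cmod (L $$ (i, Suc i mod n))))" for L
  have I_pt: "I (periodic_tridiagonal n a b) = (\<lambda>i\<in>{..<n}. (a i, cmod (b i)))" for a b
    unfolding I_def
    by (rule restrict_ext) (use n in \<open>simp add: periodic_tridiagonal_diag periodic_tridiagonal_superdiag\<close>)
  have modph: "cmod (ph x i) = B x i" if "x \<in> topspace X" "i < n" for x i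
    using B0[OF that] \<omega>(1) by (auto simp: ph_def norm_mult)
  have prodph: "(\<Prod>i<n. ph x i) = z" if "x \<in> topspace X" for x
  proof -
    obtain m where m: "n = Suc m" using n by (cases n) auto
    have "(\<Prod>i<n. ph x i) = (\<Prod>i<m. of_real (B x i)) * (\<omega> * of_real (B x m))"
      by (simp add: m ph_def)
    also have "\<dots> = \<omega> * of_real (\<Prod>i<n. B x i)" by (simp add: m)
    finally show ?thesis using prodB[OF that] \<omega>(2) by simp
  qed
  have orbit_eq: "torus_orbit n (periodic_tridiagonal n a b) = torus_orbit n (periodic_tridiagonal n a' b')"
    if "\<And>i. i < n \<Longrightarrow> a i = a' i" "\<And>i. i < n \<Longrightarrow> cmod (b i) = cmod (b' i)"
       "(\<Prod>i<n. b i) = (\<Prod>i<n. b' i)" for a b a' b'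
  proof -
    have "periodic_tridiagonal n a c = periodic_tridiagonal n a' c" for c
      using that(1) by (rule periodic_tridiagonal_cong) auto
    then show ?thesis unfolding torus_orbit_periodic_tridiagonal[OF n] using that by auto
  qed
  have I_orbit: "I L = I L'" if LL: "L \<in> isospectral n lam" "L' \<in> isospectral n lam"
    "torus_orbit n L = torus_orbit n L'" for L L'
  proof -
    obtain a b a' b' where L: "L = periodic_tridiagonal n a b" "L' = periodic_tridiagonal n a' b'"
      using LL(1,2) unfolding isospectral_def by blast
    have "L \<in> torus_orbit n L"
      unfolding L torus_orbit_periodic_tridiagonal[OF n] by blast
    then have "L \<in> torus_orbit n L'" by (simp only: LL(3))
    then obtain b'' where "L = periodic_tridiagonal n a' b''" "\<forall>i<n. cmod (b'' i) = cmod (b' i)"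
      unfolding L torus_orbit_periodic_tridiagonal[OF n] by blast
    then show ?thesis unfolding L(2) by (simp add: I_pt cong: restrict_cong)
  qed
  have cI: "continuous_map (isospectral_space n lam) (product_topology (\<lambda>_. euclidean) {..<n}) I"
  proof -
    have "continuous_map (isospectral_space n lam) euclidean
        (\<lambda>L. (Re (L $$ (i, i)), cmod (L $$ (i, Suc i mod n))))" if "i < n" for i
    proof -
      have c: "continuous_map (isospectral_space n lam) euclidean (\<lambda>L. L $$ (i, j))" if "j < n" for j
        unfolding isospectral_space_def
        by (rule continuous_map_from_subtopology[OF continuous_map_mat_entry[OF \<open>i < n\<close> that]])
      have c1: "continuous_map (isospectral_space n lam) euclideanreal (\<lambda>L. Re (L $$ (i, i)))"
        using continuous_map_compose[OF c[OF that], of euclideanreal Re]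
        by (simp add: o_def continuous_on_Re)
      have c2: "continuous_map (isospectral_space n lam) euclideanreal (\<lambda>L. cmod (L $$ (i, Suc i mod n)))"
        using continuous_map_compose[OF c[OF cyclic_succ_facts(1)[OF n that]], of euclideanreal cmod]
        by (simp add: o_def continuous_on_norm_id)
      show ?thesis using continuous_map_pairedI[OF c1 c2] by (simp add: euclidean_product_topology)
    qed
    then show ?thesis unfolding I_def by (auto simp: continuous_map_componentwise)
  qed
  obtain H where H: "continuous_map (orbit_space n lam) (product_topology (\<lambda>_. euclidean) {..<n}) H"
    "\<And>L. L \<in> isospectral n lam \<Longrightarrow> H (torus_orbit n L) = I L"
    using quotient_map_lift_exists[OF quotient_map_quotient_topology cI, of "torus_orbit n"] I_orbit
    unfolding orbit_space_def topspace_isospectral_space by metis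
  have fibE: "\<exists>a b. orb = torus_orbit n (periodic_tridiagonal n a b) \<and>
       periodic_tridiagonal n a b \<in> isospectral n lam \<and> (\<Prod>i<n. b i) = z"
    if orb: "orb \<in> topspace (fiber n lam z)" for orb
  proof -
    obtain L where L: "L \<in> isospectral n lam" "orb = torus_orbit n L" "induced_prod n orb = z"
      using orb by (auto simp: fiber_def orbit_space_def)
    obtain a b where ab: "L = periodic_tridiagonal n a b" using L by (auto simp: isospectral_def)
    show ?thesis
      using L induced_prod_torus_orbit[OF n L(1)] off_diagonal_prod_periodic_tridiagonal[OF n, of a b]
      unfolding ab by metis
  qed
  have fibI: "torus_orbit n (periodic_tridiagonal n a b) \<in> topspace (fiber n lam z)"
    if "periodic_tridiagonal n a b \<in> isospectral n lam" "(\<Prod>i<n. b i) = z" for a b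
    using that induced_prod_torus_orbit[OF n that(1)] off_diagonal_prod_periodic_tridiagonal[OF n, of a b]
    by (auto simp: fiber_def orbit_space_def)
  show "Hausdorff_space (fiber n lam z)"
  proof (rule Hausdorff_space_injective_preimage)
    show "Hausdorff_space (product_topology (\<lambda>_. euclidean::(real\<times>real) topology) {..<n})"
      by (simp add: Hausdorff_space_product_topology)
    show "continuous_map (fiber n lam z) (product_topology (\<lambda>_. euclidean) {..<n}) H"
      unfolding fiber_def by (rule continuous_map_from_subtopology[OF H(1)])
    show "inj_on H (topspace (fiber n lam z))"
    proof (rule inj_onI)
      fix u v assume uv: "u \<in> topspace (fiber n lam z)" "v \<in> topspace (fiber n lam z)" "H u = H v"
      obtain a b where ab: "u = torus_orbit n (periodic_tridiagonal n a b)"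
        "periodic_tridiagonal n a b \<in> isospectral n lam" "(\<Prod>i<n. b i) = z" using fibE[OF uv(1)] by blast
      obtain a' b' where ab': "v = torus_orbit n (periodic_tridiagonal n a' b')"
        "periodic_tridiagonal n a' b' \<in> isospectral n lam" "(\<Prod>i<n. b' i) = z" using fibE[OF uv(2)] by blast
      have *: "(\<lambda>i\<in>{..<n}. (a i, cmod (b i))) = (\<lambda>i\<in>{..<n}. (a' i, cmod (b' i)))"
        using uv(3) H(2) ab ab' by (simp add: I_pt)
      have "(a i, cmod (b i)) = (a' i, cmod (b' i))" if "i < n" for i
        using fun_cong[OF *, of i] that by simp
      then show "u = v" unfolding ab(1) ab'(1) using ab(3) ab'(3) by (intro orbit_eq) auto
    qed
  qed
  show "Hausdorff_space (torus d)"
    unfolding torus_def by (simp add: Hausdorff_space_product_topology Hausdorff_space_subtopology)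
  have cM: "continuous_map X (isospectral_space n lam) M"
    unfolding isospectral_space_def continuous_map_in_subtopology
  proof
    show "M \<in> topspace X \<rightarrow> isospectral n lam" using iso by (auto simp: M_def)
    show "continuous_map X (mat_topology n) M"
    proof (rule continuous_map_into_mat_topology)
      fix i j assume ij: "i < n" "j < n"
      have r: "continuous_map X euclidean (\<lambda>x. complex_of_real (f x))" if "continuous_map X euclideanreal f" for f
        using continuous_map_compose[OF that, of euclidean complex_of_real]
        by (simp add: o_def continuous_on_of_real)
      have m: "continuous_map X euclidean (\<lambda>x. w * f x)" if "continuous_map X euclidean f" for f and w :: complex
        using continuous_map_compose[OF that, of euclidean "\<lambda>y. w * y"]
        by (simp add: o_def continuous_on_mult_left)
      have p: "continuous_map X euclidean (\<lambda>x. ph x i)" if "i < n" for i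
        using r[OF cB[OF that]] m[OF r[OF cB[OF that]], of \<omega>] by (cases "i = n - 1") (auto simp: ph_def)
      have pc: "continuous_map X euclidean (\<lambda>x. cnj (ph x i))" if "i < n" for i
        using continuous_map_compose[OF p[OF that], of euclidean cnj]
        by (simp add: o_def continuous_on_cnj)
      consider "j = i" | "j \<noteq> i" "j = Suc i mod n" | "j \<noteq> i" "j \<noteq> Suc i mod n" "i = Suc j mod n"
        | "j \<noteq> i" "j \<noteq> Suc i mod n" "i \<noteq> Suc j mod n" by blast
      then show "continuous_map X euclidean (\<lambda>x. M x $$ (i, j))"
        using ij r[OF cA] p pc by cases (auto simp: M_def periodic_tridiagonal_def)
    qed (simp add: M_def)
  qed
  have tM: "torus_orbit n (M x) \<in> topspace (fiber n lam z)" if "x \<in> topspace X" for x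
    unfolding M_def using iso[OF that] prodph[OF that] by (rule fibI)
  show "continuous_map X (fiber n lam z) (\<lambda>x. torus_orbit n (M x))"
    unfolding fiber_def continuous_map_in_subtopology
  proof
    show "continuous_map X (orbit_space n lam) (\<lambda>x. torus_orbit n (M x))"
      using continuous_map_compose[OF cM, of "orbit_space n lam" "torus_orbit n"]
        quotient_map_quotient_topology[of "isospectral_space n lam" "torus_orbit n"]
      unfolding orbit_space_def o_def by (simp add: quotient_imp_continuous_map)
  qed (use tM in \<open>auto simp: fiber_def\<close>)
  show "(\<lambda>x. torus_orbit n (M x)) ` topspace X = topspace (fiber n lam z)"
  proof
    show "(\<lambda>x. torus_orbit n (M x)) ` topspace X \<subseteq> topspace (fiber n lam z)" using tM by blast
    show "topspace (fiber n lam z) \<subseteq> (\<lambda>x. torus_orbit n (M x)) ` topspace X"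
    proof
      fix u assume "u \<in> topspace (fiber n lam z)"
      then obtain a b where ab: "u = torus_orbit n (periodic_tridiagonal n a b)"
        "periodic_tridiagonal n a b \<in> isospectral n lam" "(\<Prod>i<n. b i) = z" using fibE by blast
      obtain x where x: "x \<in> topspace X" "\<forall>i<n. A x i = a i \<and> B x i = cmod (b i)"
        using surj[OF ab(2,3)] by blast
      have "u = torus_orbit n (M x)" unfolding ab(1) M_def
        using x ab(3) prodph[OF x(1)] modph[OF x(1)] by (intro orbit_eq) auto
      then show "u \<in> (\<lambda>x. torus_orbit n (M x)) ` topspace X" using x(1) by blast
    qed
  qed
  fix x y assume xy: "x \<in> topspace X" "y \<in> topspace X"
  show "(torus_orbit n (M x) = torus_orbit n (M y)) = (g x = g y)"
  proof
    assume "torus_orbit n (M x) = torus_orbit n (M y)"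
    then have *: "(\<lambda>i\<in>{..<n}. (A x i, cmod (ph x i))) = (\<lambda>i\<in>{..<n}. (A y i, cmod (ph y i)))"
      using I_orbit[OF iso[OF xy(1)] iso[OF xy(2)]] by (simp add: M_def I_pt)
    have "A x i = A y i \<and> B x i = B y i" if "i < n" for i
      using fun_cong[OF *, of i] that xy modph by simp
    then show "g x = g y" using ker[OF xy] by blast
  next
    assume "g x = g y"
    then have "\<forall>i<n. A x i = A y i \<and> B x i = B y i" using ker[OF xy] by blast
    then show "torus_orbit n (M x) = torus_orbit n (M y)"
      unfolding M_def using xy modph prodph by (intro orbit_eq) auto
  qed
qed


section \<open>Orthonormal frames and the diagonalisation of symmetric forms\<close>

lemma sum_swap3:
  fixes f :: "'a \<Rightarrow> 'b \<Rightarrow> 'c \<Rightarrow> 'd::comm_monoid_add"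
  shows "(\<Sum>i\<in>A. \<Sum>s\<in>B. \<Sum>t\<in>C. f i s t) = (\<Sum>s\<in>B. \<Sum>t\<in>C. \<Sum>i\<in>A. f i s t)"
  by (rule trans[OF sum.swap], intro sum.cong refl, rule sum.swap)

lemma compact_fun_box:
  fixes K :: "'a \<Rightarrow> 'b::topological_space set"
  assumes "\<And>i. compact (K i)"
  shows "compact {f. \<forall>i. f i \<in> K i}"
proof -
  have "compactin (product_topology (\<lambda>_. euclidean) UNIV) (PiE UNIV K)"
    using assms by (simp add: compactin_PiE)
  moreover have "PiE UNIV K = {f. \<forall>i. f i \<in> K i}" by auto
  ultimately show ?thesis by (simp add: euclidean_product_topology)
qed

lemma continuous_on_entry:
  "continuous_on S (\<lambda>U :: 'a \<Rightarrow> 'b \<Rightarrow> 'c::topological_space. U a s)"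
proof -
  have "continuous_on S (\<lambda>U :: 'a \<Rightarrow> 'b \<Rightarrow> 'c. U a)"
    by (rule continuous_on_product_then_coordinatewise[where f = "\<lambda>U. U", OF continuous_on_id])
  then show ?thesis by (rule continuous_on_product_then_coordinatewise)
qed

text \<open>Frames are functions on all of \<open>nat\<close>, so compactness is that of a product
  of intervals; this is why entries outside the relevant block are set to zero below.\<close>

lemma compact_bounded_entries:
  fixes C :: "(nat \<Rightarrow> nat \<Rightarrow> real) set"
  assumes "closed C" "\<And>U a s. U \<in> C \<Longrightarrow> \<bar>U a s\<bar> \<le> 1"
  shows "compact C"
proof -
  have "compact {U :: nat \<Rightarrow> nat \<Rightarrow> real. \<forall>a. U a \<in> {u. \<forall>s. u s \<in> {-1..1}}}"
    by (intro compact_fun_box compact_Icc)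
  then have "compact (C \<inter> {U. \<forall>a. U a \<in> {u. \<forall>s. u s \<in> {-1..1}}})"
    using assms(1) by (metis Int_commute compact_Int_closed)
  moreover have "C \<inter> {U. \<forall>a. U a \<in> {u. \<forall>s. u s \<in> {-1..1}}} = C"
    using assms(2) by (force simp: abs_le_iff)
  ultimately show ?thesis by simp
qed

definition orthonormal_rows :: "nat \<Rightarrow> nat \<Rightarrow> (nat \<Rightarrow> nat \<Rightarrow> real) \<Rightarrow> bool" where
  "orthonormal_rows m n U \<longleftrightarrow> (\<forall>a<m. \<forall>b<m. (\<Sum>s<n. U a s * U b s) = (if a = b then 1 else 0))"

lemma orthonormal_rowsD:
  "orthonormal_rows m n U \<Longrightarrow> a < m \<Longrightarrow> b < m \<Longrightarrow> (\<Sum>s<n. U a s * U b s) = (if a = b then 1 else 0)"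
  by (simp add: orthonormal_rows_def)

lemma orthonormal_rows_entry_bound:
  assumes "orthonormal_rows m n U" "a < m" "s < n"
  shows "\<bar>U a s\<bar> \<le> 1"
proof -
  have "(U a s)\<^sup>2 \<le> (\<Sum>s<n. (U a s)\<^sup>2)"
    using assms(3) by (intro member_le_sum) auto
  also have "\<dots> = 1" using orthonormal_rowsD[OF assms(1,2,2)] by (simp add: power2_eq_square)
  finally show ?thesis by (simp add: abs_square_le_1)
qed

lemma closed_orthonormal_rows: "closed {U. orthonormal_rows m n U}"
  unfolding orthonormal_rows_def
  by (intro closed_Collect_all closed_Collect_imp closed_Collect_eq continuous_intros continuous_on_entry
      open_Collect_const)

lemma closed_zero_entries: "closed {U :: nat \<Rightarrow> nat \<Rightarrow> real. \<forall>a s. P a s \<longrightarrow> U a s = 0}"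
  by (intro closed_Collect_all closed_Collect_imp closed_Collect_eq continuous_intros continuous_on_entry
      open_Collect_const)

lemma orthonormal_rows_transpose:
  assumes "orthonormal_rows n n U"
  shows "orthonormal_rows n n (\<lambda>i s. U s i)"
proof -
  define A where "A = Matrix.mat n n (\<lambda>(s, i). U s i)"
  have A: "A \<in> carrier_mat n n" by (simp add: A_def)
  have AT: "transpose_mat A \<in> carrier_mat n n" using A by simp
  have "A * transpose_mat A = 1\<^sub>m n"
    using assms
    by (intro eq_matI) (auto simp: A_def scalar_prod_def orthonormal_rows_def atLeast0LessThan)
  then have "transpose_mat A * A = 1\<^sub>m n" using mat_mult_left_right_inverse[OF A AT] by simp
  then have *: "(transpose_mat A * A) $$ (i, k) = (1\<^sub>m n :: real mat) $$ (i, k)" for i k by simp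
  show ?thesis unfolding orthonormal_rows_def
  proof (intro allI impI)
    fix i k assume "i < n" "k < n"
    then show "(\<Sum>s<n. U s i * U s k) = (if i = k then 1 else 0)"
      using *[of i k] by (simp add: A_def scalar_prod_def atLeast0LessThan)
  qed
qed

lemma orthonormal_rows_sum_cols:
  assumes "orthonormal_rows n n U"
  shows "i < n \<Longrightarrow> k < n \<Longrightarrow> (\<Sum>s<n. U s i * U s k) = (if i = k then 1 else 0)"
  using orthonormal_rowsD[OF orthonormal_rows_transpose[OF assms]] by simp

text \<open>A maximiser of \<open>\<Sum>a. a \<cdot> B(U\<^sub>a, U\<^sub>a)\<close> over orthonormal frames is diagonal for \<open>B\<close>, because it
  cannot be improved by rotating two of its vectors.\<close>

lemma symmetric_form_diagonalizable:
  fixes B :: "nat \<Rightarrow> nat \<Rightarrow> real"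
  assumes sym: "\<And>s t. B s t = B t s"
  obtains U where "orthonormal_rows j j U"
    "\<And>a b. a < j \<Longrightarrow> b < j \<Longrightarrow> a \<noteq> b \<Longrightarrow> (\<Sum>s<j. \<Sum>t<j. U a s * B s t * U b t) = 0"
proof -
  define S where "S = {U. orthonormal_rows j j U} \<inter> {U. \<forall>a s. \<not> (a < j \<and> s < j) \<longrightarrow> U a s = 0}"
  define q where "q u v = (\<Sum>s<j. \<Sum>t<j. u s * B s t * v t)" for u v :: "nat \<Rightarrow> real"
  \<comment> \<open>The distinct weights matter: with equal weights the sum would be the trace, the
    same for all frames, and a maximiser would say nothing.\<close>
  define F where "F U = (\<Sum>a<j. real a * q (U a) (U a))" for U :: "nat \<Rightarrow> nat \<Rightarrow> real"
  have "closed S" unfolding S_def by (intro closed_Int closed_orthonormal_rows closed_zero_entries)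
  moreover have "\<bar>U a s\<bar> \<le> 1" if "U \<in> S" for U a s
    using that orthonormal_rows_entry_bound[of j j U a s] by (cases "a < j \<and> s < j") (auto simp: S_def)
  ultimately have "compact S" by (rule compact_bounded_entries)
  moreover have "S \<noteq> {}"
  proof -
    have "(\<lambda>a s. if a = s \<and> a < j then 1 else 0) \<in> S"
      by (auto simp: S_def orthonormal_rows_def if_distrib[of "\<lambda>x. x * _"] cong: if_cong)
    then show ?thesis by blast
  qed
  moreover have "continuous_on S F"
    unfolding F_def q_def by (intro continuous_intros continuous_on_entry)
  ultimately obtain U where U: "U \<in> S" "\<And>V. V \<in> S \<Longrightarrow> F V \<le> F U"
    using continuous_attains_sup[of S F] by blast
  have UO: "orthonormal_rows j j U" using U(1) by (simp add: S_def)
  have qsym: "q u v = q v u" for u v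
    unfolding q_def by (subst sum.swap) (simp add: sym mult_ac)
  have qlin: "q (\<lambda>s. x * u s + y * v s) (\<lambda>s. x * u s + y * v s)
       = x\<^sup>2 * q u u + 2 * (x * y) * q u v + y\<^sup>2 * q v v" for x y u v
  proof -
    have "q (\<lambda>s. x * u s + y * v s) (\<lambda>s. x * u s + y * v s)
        = x\<^sup>2 * q u u + x * y * q u v + x * y * q v u + y\<^sup>2 * q v v"
      unfolding q_def sum_distrib_left sum.distrib[symmetric]
      by (intro sum.cong refl) (simp add: algebra_simps power2_eq_square)
    then show ?thesis by (simp add: qsym[of v u])
  qed
  have diag: "q (U a) (U b) = 0" if ab: "a < b" "b < j" for a b
  proof (rule ccontr)
    assume nz: "q (U a) (U b) \<noteq> 0"
    define X where "X = q (U a) (U b)"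
    define D where "D = q (U a) (U a) - q (U b) (U b)"
    \<comment> \<open>Rotating rows \<open>a\<close> and \<open>b\<close> by the angle with tangent
      \<open>t\<close> changes \<open>F\<close> by \<open>b - a\<close> times this quantity over
      \<open>1 + t\<^sup>2\<close>.\<close>
    have main: "t\<^sup>2 * D - 2 * t * X \<le> 0" for t
    proof -
      define r where "r = sqrt (1 + t\<^sup>2)"
      have r: "r > 0" "r\<^sup>2 = 1 + t\<^sup>2" by (auto simp: r_def add_pos_nonneg)
      define x where "x = 1 / r"
      define y where "y = t / r"
      have "1 + t\<^sup>2 > 0" by (simp add: add_pos_nonneg)
      then have xy: "x\<^sup>2 + y\<^sup>2 = 1"
        using r by (simp add: x_def y_def power_divide add_divide_distrib[symmetric])
      define V where "V = U(a := (\<lambda>s. x * U a s + y * U b s), b := (\<lambda>s. x * U b s + (-y) * U a s))"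
      have Va: "V a = (\<lambda>s. x * U a s + y * U b s)" and Vb: "V b = (\<lambda>s. x * U b s + (-y) * U a s)"
        and Vc: "\<And>c. c \<noteq> a \<Longrightarrow> c \<noteq> b \<Longrightarrow> V c = U c"
        using ab by (auto simp: V_def)
      have ip: "(\<Sum>s<j. (p * U c s + p' * U c' s) * (r * U d s + r' * U d' s)) =
         p * r * (if c = d then 1 else 0) + p * r' * (if c = d' then 1 else 0)
         + p' * r * (if c' = d then 1 else 0) + p' * r' * (if c' = d' then 1 else 0)"
        if "c < j" "c' < j" "d < j" "d' < j" for p p' r r' c c' d d'
      proof -
        have "(\<Sum>s<j. (p * U c s + p' * U c' s) * (r * U d s + r' * U d' s)) =
          p * r * (\<Sum>s<j. U c s * U d s) + p * r' * (\<Sum>s<j. U c s * U d' s)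
         + p' * r * (\<Sum>s<j. U c' s * U d s) + p' * r' * (\<Sum>s<j. U c' s * U d' s)"
          unfolding sum_distrib_left sum.distrib[symmetric]
          by (intro sum.cong refl) (simp add: algebra_simps)
        then show ?thesis using orthonormal_rowsD[OF UO] that by simp
      qed
      have VS: "V \<in> S"
      proof -
        have "(\<Sum>s<j. V c s * V d s) = (if c = d then 1 else 0)" if cd: "c < j" "d < j" for c d
        proof -
          have form: "\<exists>p p' e e'. V c = (\<lambda>s. p * U e s + p' * U e' s) \<and> e < j \<and> e' < j \<and>
             (c = a \<and> p = x \<and> p' = y \<and> e = a \<and> e' = b \<or> c = b \<and> p = x \<and> p' = -y \<and> e = b \<and> e' = a
              \<or> c \<noteq> a \<and> c \<noteq> b \<and> p = 1 \<and> p' = 0 \<and> e = c \<and> e' = c)" if "c < j" for c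
          proof -
            consider "c = a" | "c = b" | "c \<noteq> a" "c \<noteq> b" by blast
            then show ?thesis
            proof cases
              case 1 then show ?thesis using Va ab by (intro exI[of _ x] exI[of _ y] exI[of _ a] exI[of _ b]) auto
            next
              case 2 then show ?thesis using Vb ab by (intro exI[of _ x] exI[of _ "-y"] exI[of _ b] exI[of _ a]) auto
            next
              case 3 then show ?thesis using Vc that by (intro exI[of _ 1] exI[of _ 0] exI[of _ c] exI[of _ c]) auto
            qed
          qed
          obtain p p' e e' where c: "V c = (\<lambda>s. p * U e s + p' * U e' s)" "e < j" "e' < j"
             "(c = a \<and> p = x \<and> p' = y \<and> e = a \<and> e' = b \<or> c = b \<and> p = x \<and> p' = -y \<and> e = b \<and> e' = a
              \<or> c \<noteq> a \<and> c \<noteq> b \<and> p = 1 \<and> p' = 0 \<and> e = c \<and> e' = c)" using form[OF cd(1)] by blast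
          obtain r r' f f' where d: "V d = (\<lambda>s. r * U f s + r' * U f' s)" "f < j" "f' < j"
             "(d = a \<and> r = x \<and> r' = y \<and> f = a \<and> f' = b \<or> d = b \<and> r = x \<and> r' = -y \<and> f = b \<and> f' = a
              \<or> d \<noteq> a \<and> d \<noteq> b \<and> r = 1 \<and> r' = 0 \<and> f = d \<and> f' = d)" using form[OF cd(2)] by blast
          have "(\<Sum>s<j. V c s * V d s) = p * r * (if e = f then 1 else 0) + p * r' * (if e = f' then 1 else 0)
         + p' * r * (if e' = f then 1 else 0) + p' * r' * (if e' = f' then 1 else 0)"
            unfolding c(1) d(1) by (rule ip[OF c(2,3) d(2,3)])
          also have "\<dots> = (if c = d then 1 else 0)"
            using c(4) d(4) ab(1) xy by (elim disjE conjE) (simp_all add: power2_eq_square)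
          finally show ?thesis .
        qed
        moreover have "V c s = 0" if "\<not> (c < j \<and> s < j)" for c s
          using that U(1) ab by (cases "c = a"; cases "c = b") (auto simp: S_def V_def)
        ultimately show ?thesis by (auto simp: S_def orthonormal_rows_def)
      qed
      have split: "F W = (\<Sum>c\<in>{..<j} - {a, b}. real c * q (W c) (W c)) + real a * q (W a) (W a) + real b * q (W b) (W b)" for W
      proof -
        have "F W = real a * q (W a) (W a) + (\<Sum>c\<in>{..<j} - {a}. real c * q (W c) (W c))"
          unfolding F_def using ab by (intro sum.remove) auto
        also have "(\<Sum>c\<in>{..<j} - {a}. real c * q (W c) (W c)) =
           real b * q (W b) (W b) + (\<Sum>c\<in>{..<j} - {a} - {b}. real c * q (W c) (W c))"
          using ab by (intro sum.remove) auto
        also have "{..<j} - {a} - {b} = {..<j} - {a, b}" by blast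
        finally show ?thesis by simp
      qed
      have "F V - F U = real a * (q (V a) (V a) - q (U a) (U a)) + real b * (q (V b) (V b) - q (U b) (U b))"
        unfolding split[of V] split[of U] using Vc by (simp add: algebra_simps cong: sum.cong_simp)
      also have "q (V a) (V a) = x\<^sup>2 * q (U a) (U a) + 2 * (x * y) * X + y\<^sup>2 * q (U b) (U b)"
        unfolding Va qlin X_def ..
      also have "q (V b) (V b) = x\<^sup>2 * q (U b) (U b) + 2 * (x * (-y)) * X + y\<^sup>2 * q (U a) (U a)"
        unfolding Vb qlin X_def by (simp add: qsym)
      also have "x\<^sup>2 = 1 - y\<^sup>2" using xy by simp
      finally have "F V - F U = (real b - real a) * (y\<^sup>2 * D - 2 * (x * y) * X)"
        by (simp add: D_def algebra_simps)
      moreover have "F V - F U \<le> 0" using U(2)[OF VS] by simp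
      ultimately have "y\<^sup>2 * D - 2 * (x * y) * X \<le> 0"
        using ab(1) by (simp add: mult_le_0_iff)
      then have "(t\<^sup>2 * D - 2 * t * X) / r\<^sup>2 \<le> 0"
        by (simp add: x_def y_def power_divide diff_divide_distrib power2_eq_square)
      then show ?thesis using r(1) by (simp add: divide_le_0_iff)
    qed
    \<comment> \<open>Small enough that the quadratic term cannot outweigh the linear one: at
      \<open>t = - e * X\<close> the bound reads \<open>e * X\<^sup>2 * (e * D + 2) \<le> 0\<close>,
      while \<open>e * \<bar>D\<bar> < 1\<close>.\<close>
    define e where "e = 1 / (\<bar>D\<bar> + 1)"
    have e: "e > 0" "e * \<bar>D\<bar> < 1" by (auto simp: e_def divide_simps)
    have "e * X\<^sup>2 * (e * D + 2) \<le> 0"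
      using main[of "- e * X"] by (simp add: algebra_simps power2_eq_square)
    moreover have "e * D \<ge> - (e * \<bar>D\<bar>)" using e(1) by (simp add: abs_if)
    then have "e * D + 2 > 0" using e by linarith
    moreover have "e * X\<^sup>2 > 0" using e nz by (simp add: X_def)
    ultimately show False using mult_pos_pos[of "e * X\<^sup>2" "e * D + 2"] by linarith
  qed
  show ?thesis
  proof (rule that[OF UO])
    fix a b assume ab: "a < j" "b < j" "a \<noteq> b"
    have "q (U a) (U b) = 0"
      using ab diag[of a b] diag[of b a] qsym[of "U a" "U b"] by (cases a b rule: linorder_cases) auto
    then show "(\<Sum>s<j. \<Sum>t<j. U a s * B s t * U b t) = 0" by (simp add: q_def)
  qed
qed

section \<open>Diagonal scaling and orthogonal projections\<close>

text \<open>Chebyshev's correlation inequality: \<open>g\<close> and \<open>ln g\<close> grow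
  together, so \<open>(g i - g k) * (ln (g i) - ln (g k))\<close> is never negative, and its mean
  with the weights \<open>p i * p k\<close> is \<open>2 * N\<close> times the sum in question. The
  mean vanishes only if \<open>g\<close> is constant where \<open>p\<close> is positive, and then
  reweighting by \<open>g\<close> changes nothing.\<close>

lemma weighted_mean_ln_mono:
  fixes p g :: "nat \<Rightarrow> real"
  assumes p: "\<And>i. i < n \<Longrightarrow> 0 \<le> p i" "(\<Sum>i<n. p i) = 1" and g: "\<And>i. i < n \<Longrightarrow> 0 < g i"
  defines "N \<equiv> \<Sum>i<n. p i * g i"
  shows "N > 0" "0 \<le> (\<Sum>i<n. ln (g i) * (p i * g i / N - p i))"
    "(\<Sum>i<n. ln (g i) * (p i * g i / N - p i)) = 0 \<Longrightarrow> i < n \<Longrightarrow> p i * g i / N = p i"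
proof -
  obtain k where k: "k < n" "p k > 0"
  proof (rule ccontr)
    assume "\<not> thesis"
    then have "\<not> 0 < p k" if "k < n" for k using that \<open>\<And>k. k < n \<Longrightarrow> 0 < p k \<Longrightarrow> thesis\<close> by blast
    then have "p k = 0" if "k < n" for k using p(1)[OF that] that by force
    then show False using p(2) by simp
  qed
  have "p k * g k \<le> N" unfolding N_def
    using k p(1) g by (intro member_le_sum) (auto intro: mult_nonneg_nonneg less_imp_le)
  moreover have "p k * g k > 0" using k g by simp
  ultimately show N: "N > 0" by linarith
  define y where "y i = ln (g i)" for i
  define T where "T i k = p i * p k * (g i - g k) * (y i - y k)" for i k
  have T0: "T i k \<ge> 0" if "i < n" "k < n" for i k
  proof -
    have "(g i - g k) * (y i - y k) \<ge> 0"
    proof (cases "g i \<le> g k")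
      case True
      then have "y i \<le> y k" using g that by (simp add: y_def)
      then show ?thesis using True by (simp add: mult_nonpos_nonpos)
    next
      case False
      then have "y k \<le> y i" using g that by (simp add: y_def)
      then show ?thesis using False by simp
    qed
    then show ?thesis unfolding T_def mult.assoc using p(1) that by simp
  qed
  have sumT: "(\<Sum>i<n. \<Sum>k<n. T i k) = 2 * N * (\<Sum>i<n. y i * (p i * g i / N - p i))"
  proof -
    have "(\<Sum>i<n. \<Sum>k<n. T i k) = (\<Sum>i<n. \<Sum>k<n. (p i * g i * y i) * p k - (p i * y i) * (p k * g k)
        - (p i * g i) * (p k * y k) + p i * (p k * g k * y k))"
      unfolding T_def by (intro sum.cong refl) (simp add: algebra_simps)
    also have "\<dots> = (\<Sum>i<n. p i * g i * y i) * (\<Sum>k<n. p k) - (\<Sum>i<n. p i * y i) * N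
        - N * (\<Sum>k<n. p k * y k) + (\<Sum>i<n. p i) * (\<Sum>k<n. p k * g k * y k)"
      unfolding sum.distrib sum_subtractf sum_product N_def by (simp add: algebra_simps)
    also have "\<dots> = 2 * ((\<Sum>i<n. p i * g i * y i) - N * (\<Sum>i<n. p i * y i))"
      by (simp add: p(2))
    also have "(\<Sum>i<n. p i * g i * y i) - N * (\<Sum>i<n. p i * y i) = (\<Sum>i<n. N * (y i * (p i * g i / N - p i)))"
      using N unfolding sum_distrib_left sum_subtractf[symmetric]
      by (intro sum.cong refl) (simp add: field_simps)
    finally show ?thesis by (simp add: sum_distrib_left mult.assoc)
  qed
  have "0 \<le> (\<Sum>i<n. \<Sum>k<n. T i k)" using T0 by (intro sum_nonneg) auto
  then show "0 \<le> (\<Sum>i<n. ln (g i) * (p i * g i / N - p i))"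
    using N unfolding sumT by (simp add: y_def zero_le_mult_iff)
  assume "(\<Sum>i<n. ln (g i) * (p i * g i / N - p i)) = 0" and i: "i < n"
  then have "(\<Sum>i<n. \<Sum>k<n. T i k) = 0" unfolding sumT by (simp add: y_def)
  then have "(\<Sum>k<n. T i k) = 0"
    using i T0 by (subst (asm) sum_nonneg_eq_0_iff) (auto intro!: sum_nonneg)
  then have Tz: "T i k = 0" if "k < n" for k
    using that i T0 by (subst (asm) sum_nonneg_eq_0_iff) auto
  show "p i * g i / N = p i"
  proof (cases "p i = 0")
    case False
    have "p k * g k = p k * g i" if "k < n" for k
      using Tz[OF that] False g[OF that] g[OF i] by (auto simp: T_def y_def)
    then have "N = (\<Sum>k<n. p k * g i)" unfolding N_def by (intro sum.cong) auto
    then have "N = g i" using p(2) by (simp add: sum_distrib_right[symmetric])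
    then show ?thesis using N by simp
  qed simp
qed

text \<open>Both sides are the diagonal entry at \<open>i\<close> of the orthogonal projection onto
  one subspace: the transition matrix \<open>W\<close> between the two orthonormal bases is
  orthogonal, so it drops out.\<close>

lemma span_orthonormal_sum_squares:
  assumes v: "orthonormal_rows j n v" and r: "orthonormal_rows j n r"
    and W: "\<And>s i. s < j \<Longrightarrow> i < n \<Longrightarrow> r s i = (\<Sum>a<j. W s a * v a i)" and i: "i < n"
  shows "(\<Sum>s<j. (r s i)\<^sup>2) = (\<Sum>a<j. (v a i)\<^sup>2)"
proof -
  have "orthonormal_rows j j W" unfolding orthonormal_rows_def
  proof (intro allI impI)
    fix s t assume st: "s < j" "t < j"
    have "(\<Sum>i<n. r s i * r t i) = (\<Sum>i<n. \<Sum>a<j. \<Sum>b<j. W s a * W t b * (v a i * v b i))"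
      using W st by (intro sum.cong refl) (simp add: sum_product mult_ac)
    also have "\<dots> = (\<Sum>a<j. \<Sum>b<j. W s a * W t b * (\<Sum>i<n. v a i * v b i))"
      unfolding sum_distrib_left
      by (rule sum_swap3)
    also have "\<dots> = (\<Sum>a<j. W s a * W t a)"
      using orthonormal_rowsD[OF v] by (intro sum.cong refl) (simp add: if_distrib[of "\<lambda>x. _ * x"] cong: if_cong)
    finally show "(\<Sum>a<j. W s a * W t a) = (if s = t then 1 else 0)"
      using orthonormal_rowsD[OF r st] by simp
  qed
  note WO = orthonormal_rows_sum_cols[OF this]
  have "(\<Sum>s<j. (r s i)\<^sup>2) = (\<Sum>s<j. \<Sum>a<j. \<Sum>b<j. W s a * W s b * (v a i * v b i))"
    using W i by (intro sum.cong refl) (simp add: power2_eq_square sum_product mult_ac)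
  also have "\<dots> = (\<Sum>a<j. \<Sum>b<j. (\<Sum>s<j. W s a * W s b) * (v a i * v b i))"
    unfolding sum_distrib_right
    by (rule sum_swap3)
  also have "\<dots> = (\<Sum>a<j. (v a i)\<^sup>2)"
    using WO by (intro sum.cong refl) (simp add: if_distrib[of "\<lambda>x. x * _"] power2_eq_square cong: if_cong)
  finally show ?thesis .
qed

text \<open>Multiplying a subspace by \<open>h\<close> increases its orthogonal projection in the direction
  \<open>ln h\<^sup>2\<close>: for an orthonormal basis that stays orthogonal after multiplication this is the
  previous monotonicity, applied to each basis vector.\<close>

lemma scaled_frame_monotone:
  assumes r: "orthonormal_rows j n r" and r': "orthonormal_rows j n r'"
    and h: "\<And>i. i < n \<Longrightarrow> h i \<noteq> 0"
    and R: "\<And>s i. s < j \<Longrightarrow> i < n \<Longrightarrow> r' s i = h i * (\<Sum>u<j. R s u * r u i)"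
  shows "0 \<le> (\<Sum>i<n. ln ((h i)\<^sup>2) * ((\<Sum>s<j. (r' s i)\<^sup>2) - (\<Sum>s<j. (r s i)\<^sup>2)))"
    "(\<Sum>i<n. ln ((h i)\<^sup>2) * ((\<Sum>s<j. (r' s i)\<^sup>2) - (\<Sum>s<j. (r s i)\<^sup>2))) = 0 \<Longrightarrow> i < n \<Longrightarrow>
      (\<Sum>s<j. (r' s i)\<^sup>2) = (\<Sum>s<j. (r s i)\<^sup>2)"
proof -
  define g where "g i = (h i)\<^sup>2" for i
  have g: "g i > 0" if "i < n" for i using h[OF that] by (simp add: g_def)
  \<comment> \<open>Gram matrix of the rows after scaling by \<open>h\<close>. An orthonormal basis
    of the span that diagonalises it stays orthogonal under the scaling.\<close>
  define B where "B s t = (\<Sum>i<n. g i * r s i * r t i)" for s t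
  have "B s t = B t s" for s t unfolding B_def by (simp add: mult_ac)
  then obtain U where U: "orthonormal_rows j j U"
    "\<And>a b. a < j \<Longrightarrow> b < j \<Longrightarrow> a \<noteq> b \<Longrightarrow> (\<Sum>s<j. \<Sum>t<j. U a s * B s t * U b t) = 0"
    by (rule symmetric_form_diagonalizable[of B j]) blast
  note UC = orthonormal_rows_sum_cols[OF U(1)]
  define v where "v a i = (\<Sum>s<j. U a s * r s i)" for a i
  have vv: "(\<Sum>i<n. f i * v a i * v b i) = (\<Sum>s<j. \<Sum>t<j. U a s * (\<Sum>i<n. f i * r s i * r t i) * U b t)" for f a b
  proof -
    have "(\<Sum>i<n. f i * v a i * v b i) = (\<Sum>i<n. \<Sum>s<j. \<Sum>t<j. U a s * (f i * r s i * r t i) * U b t)"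
      unfolding v_def by (intro sum.cong refl) (simp add: mult.assoc sum_product sum_distrib_left mult_ac)
    also have "\<dots> = (\<Sum>s<j. \<Sum>t<j. U a s * (\<Sum>i<n. f i * r s i * r t i) * U b t)"
      unfolding sum_distrib_left sum_distrib_right
      by (rule sum_swap3)
    finally show ?thesis .
  qed
  have v: "orthonormal_rows j n v" unfolding orthonormal_rows_def
  proof (intro allI impI)
    fix a b assume ab: "a < j" "b < j"
    have "(\<Sum>i<n. v a i * v b i) = (\<Sum>s<j. \<Sum>t<j. U a s * (if s = t then 1 else 0) * U b t)"
      using vv[of "\<lambda>_. 1" a b] orthonormal_rowsD[OF r] by simp
    also have "\<dots> = (\<Sum>s<j. U a s * U b s)"
      by (intro sum.cong refl) (simp add: if_distrib[of "\<lambda>x. _ * x * _"] cong: if_cong)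
    finally show "(\<Sum>i<n. v a i * v b i) = (if a = b then 1 else 0)"
      using orthonormal_rowsD[OF U(1) ab] by simp
  qed
  have rv: "r u i = (\<Sum>a<j. U a u * v a i)" if "u < j" for u i
  proof -
    have "(\<Sum>a<j. U a u * v a i) = (\<Sum>s<j. (\<Sum>a<j. U a u * U a s) * r s i)"
      unfolding v_def sum_distrib_left sum_distrib_right
      by (subst sum.swap) (simp add: mult_ac)
    also have "\<dots> = (\<Sum>s<j. (if u = s then 1 else 0) * r s i)"
      using UC[OF that] by (intro sum.cong refl) simp
    also have "\<dots> = r u i" using that by (simp add: if_distrib[of "\<lambda>x. x * _"] cong: if_cong)
    finally show ?thesis by simp
  qed
  define N where "N a = (\<Sum>i<n. (v a i)\<^sup>2 * g i)" for a
  have p1: "(\<Sum>i<n. (v a i)\<^sup>2) = 1" if "a < j" for a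
    using orthonormal_rowsD[OF v that that] by (simp add: power2_eq_square)
  have mono: "N a > 0" "0 \<le> (\<Sum>i<n. ln (g i) * ((v a i)\<^sup>2 * g i / N a - (v a i)\<^sup>2))"
    "(\<Sum>i<n. ln (g i) * ((v a i)\<^sup>2 * g i / N a - (v a i)\<^sup>2)) = 0 \<Longrightarrow> i < n \<Longrightarrow> (v a i)\<^sup>2 * g i / N a = (v a i)\<^sup>2"
    if "a < j" for a i
    unfolding N_def
    by (rule weighted_mean_ln_mono[of n "\<lambda>i. (v a i)\<^sup>2" g, OF zero_le_power2 p1[OF that] g]; assumption)+
  \<comment> \<open>Only the lengths remain to be normalised, and the squares of each vector become
    their reweighting by \<open>g\<close>, the situation of
    \<open>weighted_mean_ln_mono\<close>.\<close>
  define v' where "v' a i = h i * v a i / sqrt (N a)" for a i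
  have v'2: "(v' a i)\<^sup>2 = (v a i)\<^sup>2 * g i / N a" if "a < j" for a i
    using mono(1)[OF that] by (simp add: v'_def g_def power_mult_distrib power_divide)
  have v': "orthonormal_rows j n v'" unfolding orthonormal_rows_def
  proof (intro allI impI)
    fix a b assume ab: "a < j" "b < j"
    show "(\<Sum>i<n. v' a i * v' b i) = (if a = b then 1 else 0)"
    proof (cases "a = b")
      case True
      have "(\<Sum>i<n. v' a i * v' b i) = (\<Sum>i<n. (v a i)\<^sup>2 * g i / N a)"
        using True v'2[OF ab(1)] by (simp add: power2_eq_square)
      also have "\<dots> = 1" using mono(1)[OF ab(1)] by (simp add: N_def sum_divide_distrib[symmetric])
      finally show ?thesis using True by simp
    next
      case False
      have "(\<Sum>i<n. v' a i * v' b i) = (\<Sum>i<n. g i * v a i * v b i) / (sqrt (N a) * sqrt (N b))"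
        unfolding sum_divide_distrib by (intro sum.cong refl) (simp add: v'_def g_def power2_eq_square)
      also have "(\<Sum>i<n. g i * v a i * v b i) = 0"
        using U(2)[OF ab False] unfolding vv B_def by simp
      finally show ?thesis using False by simp
    qed
  qed
  have r'v': "r' s i = (\<Sum>a<j. ((\<Sum>u<j. R s u * U a u) * sqrt (N a)) * v' a i)" if "s < j" "i < n" for s i
  proof -
    have "r' s i = h i * (\<Sum>u<j. \<Sum>a<j. R s u * U a u * v a i)"
      unfolding R[OF that] by (intro arg_cong2[of _ _ _ _ "(*)"] refl sum.cong)
        (simp add: rv sum_distrib_left mult.assoc)
    also have "\<dots> = (\<Sum>a<j. (\<Sum>u<j. R s u * U a u) * (h i * v a i))"
      unfolding sum_distrib_left sum_distrib_right by (subst sum.swap) (simp add: mult_ac)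
    also have "\<dots> = (\<Sum>a<j. ((\<Sum>u<j. R s u * U a u) * sqrt (N a)) * v' a i)"
    proof (intro sum.cong refl)
      fix a assume "a \<in> {..<j}"
      then have "N a > 0" using mono(1) by simp
      then show "(\<Sum>u<j. R s u * U a u) * (h i * v a i) = (\<Sum>u<j. R s u * U a u) * sqrt (N a) * v' a i"
        by (simp add: v'_def)
    qed
    finally show ?thesis .
  qed
  have s': "(\<Sum>s<j. (r' s i)\<^sup>2) = (\<Sum>a<j. (v' a i)\<^sup>2)" if "i < n" for i
    by (rule span_orthonormal_sum_squares[OF v' r' r'v' that])
  have s: "(\<Sum>s<j. (r s i)\<^sup>2) = (\<Sum>a<j. (v a i)\<^sup>2)" if "i < n" for i
    by (rule span_orthonormal_sum_squares[OF v r rv that])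
  have diff: "(\<Sum>s<j. (r' s i)\<^sup>2) - (\<Sum>s<j. (r s i)\<^sup>2) = (\<Sum>a<j. (v a i)\<^sup>2 * g i / N a - (v a i)\<^sup>2)"
    if "i < n" for i
    using s[OF that] s'[OF that] v'2 by (simp add: sum_subtractf)
  have tot: "(\<Sum>i<n. ln ((h i)\<^sup>2) * ((\<Sum>s<j. (r' s i)\<^sup>2) - (\<Sum>s<j. (r s i)\<^sup>2)))
      = (\<Sum>a<j. \<Sum>i<n. ln (g i) * ((v a i)\<^sup>2 * g i / N a - (v a i)\<^sup>2))"
    by (subst sum.swap, intro sum.cong refl) (simp add: diff g_def sum_distrib_left)
  show "0 \<le> (\<Sum>i<n. ln ((h i)\<^sup>2) * ((\<Sum>s<j. (r' s i)\<^sup>2) - (\<Sum>s<j. (r s i)\<^sup>2)))"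
    unfolding tot by (rule sum_nonneg) (simp add: mono(2))
  assume "(\<Sum>i<n. ln ((h i)\<^sup>2) * ((\<Sum>s<j. (r' s i)\<^sup>2) - (\<Sum>s<j. (r s i)\<^sup>2))) = 0" and i: "i < n"
  then have "(\<Sum>i<n. ln (g i) * ((v a i)\<^sup>2 * g i / N a - (v a i)\<^sup>2)) = 0" if "a < j" for a
    unfolding tot using mono(2) that by (subst (asm) sum_nonneg_eq_0_iff) auto
  then have "(v a i)\<^sup>2 * g i / N a - (v a i)\<^sup>2 = 0" if "a < j" for a
    using mono(3)[OF that _ i] that by simp
  then show "(\<Sum>s<j. (r' s i)\<^sup>2) = (\<Sum>s<j. (r s i)\<^sup>2)" using diff[OF i] by simp
qed


section \<open>Tridiagonal frames and their heights\<close>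

text \<open>The sum is least when the mass fills the first \<open>p\<close> slots. Measured from
  \<open>p - 1/2\<close>, every deviation from that filling makes a nonnegative contribution; the
  half keeps the factor away from zero, so that equality leaves no deviation.\<close>

lemma weighted_index_sum_ge:
  fixes x :: "nat \<Rightarrow> real"
  assumes x: "\<And>s. s < n \<Longrightarrow> 0 \<le> x s" "\<And>s. s < n \<Longrightarrow> x s \<le> 1" "(\<Sum>s<n. x s) = real p" and p: "p \<le> n"
  shows "real p * (real p - 1) / 2 \<le> (\<Sum>s<n. real s * x s)"
    "(\<Sum>s<n. real s * x s) = real p * (real p - 1) / 2 \<Longrightarrow> s < n \<Longrightarrow> x s = (if s < p then 1 else 0)"
proof -
  define d where "d s = (real s - (real p - 1/2)) * (x s - (if s < p then 1 else 0))" for s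
  have d0: "0 \<le> d s" if "s < n" for s
  proof (cases "s < p")
    case True
    then have "real s \<le> real p - 1" by linarith
    then show ?thesis using True x(2)[OF that] by (simp add: d_def mult_nonpos_nonpos)
  next
    case False
    then show ?thesis using x(1)[OF that] by (simp add: d_def)
  qed
  have lt: "{..<n} \<inter> {s. s < p} = {..<p}" using p by auto
  have s1: "(\<Sum>s<n. if s < p then 1 else (0::real)) = real p"
    by (simp add: sum.If_cases lt)
  have s2: "(\<Sum>s<n. if s < p then real s else 0) = real p * (real p - 1) / 2"
  proof -
    have "(\<Sum>s<n. if s < p then real s else 0) = (\<Sum>s<p. real s)" by (simp add: sum.If_cases lt)
    also have "\<dots> = real p * (real p - 1) / 2" by (induction p) (auto simp: field_simps)
    finally show ?thesis .
  qed
  have "(\<Sum>s<n. d s) = (\<Sum>s<n. real s * x s) - (\<Sum>s<n. if s < p then real s else 0)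
      - (real p - 1/2) * ((\<Sum>s<n. x s) - (\<Sum>s<n. if s < p then 1 else 0))"
    unfolding sum_subtractf[symmetric] sum_distrib_left d_def
    by (intro sum.cong refl) (simp add: algebra_simps)
  then have eq: "(\<Sum>s<n. d s) = (\<Sum>s<n. real s * x s) - real p * (real p - 1) / 2"
    by (simp add: s1 s2 x(3))
  have "0 \<le> (\<Sum>s<n. d s)" using d0 by (intro sum_nonneg) auto
  then show "real p * (real p - 1) / 2 \<le> (\<Sum>s<n. real s * x s)" using eq by simp
  assume "(\<Sum>s<n. real s * x s) = real p * (real p - 1) / 2" and s: "s < n"
  then have "(\<Sum>s<n. d s) = 0" using eq by simp
  then have "d s = 0" using d0 s by (subst (asm) sum_nonneg_eq_0_iff) auto
  moreover have "real s - (real p - 1/2) \<noteq> 0"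
  proof
    assume "real s - (real p - 1/2) = 0"
    then have "real (2 * s + 1) = real (2 * p)" by simp
    then have "2 * s + 1 = 2 * p" by (simp only: of_nat_eq_iff)
    then show False by presburger
  qed
  ultimately show "x s = (if s < p then 1 else 0)" by (simp add: d_def)
qed

lemma sum_of_partial_sums:
  fixes x :: "nat \<Rightarrow> real"
  shows "(\<Sum>j<n. \<Sum>s<j. x s) = (\<Sum>s<n. (real n - 1 - real s) * x s)"
proof (induction n)
  case (Suc n)
  have "(\<Sum>s<Suc n. (real (Suc n) - 1 - real s) * x s) = (\<Sum>s<n. (real n - 1 - real s) * x s) + (\<Sum>s<n. x s)"
    by (simp add: sum.distrib[symmetric] algebra_simps)
  then show ?case using Suc by simp
qed simp

section \<open>Flags spanned by frames\<close>

definition in_span :: "nat \<Rightarrow> (nat \<Rightarrow> nat \<Rightarrow> real) \<Rightarrow> nat \<Rightarrow> (nat \<Rightarrow> real) \<Rightarrow> bool" where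
  "in_span n Q s f \<longleftrightarrow> (\<exists>R. \<forall>i<n. f i = (\<Sum>u\<le>s. R u * Q u i))"

lemma in_span_cong: "(\<And>i. i < n \<Longrightarrow> f i = g i) \<Longrightarrow> in_span n Q s f \<Longrightarrow> in_span n Q s g"
  unfolding in_span_def by fastforce

lemma in_span_base: "u \<le> s \<Longrightarrow> in_span n Q s (Q u)"
  unfolding in_span_def
  by (rule exI[of _ "\<lambda>v. if v = u then 1 else 0"]) (simp add: if_distrib[of "\<lambda>x. x * _"] cong: if_cong)

lemma in_span_scale: "in_span n Q s f \<Longrightarrow> in_span n Q s (\<lambda>i. c * f i)"
  unfolding in_span_def
proof (elim exE)
  fix R assume "\<forall>i<n. f i = (\<Sum>u\<le>s. R u * Q u i)"
  then show "\<exists>R. \<forall>i<n. c * f i = (\<Sum>u\<le>s. R u * Q u i)"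
    by (intro exI[of _ "\<lambda>u. c * R u"]) (simp add: sum_distrib_left mult.assoc)
qed

lemma in_span_add:
  assumes "in_span n Q s f" "in_span n Q s g"
  shows "in_span n Q s (\<lambda>i. f i + g i)"
proof -
  obtain R where R: "\<forall>i<n. f i = (\<Sum>u\<le>s. R u * Q u i)" using assms(1) unfolding in_span_def by blast
  obtain R' where R': "\<forall>i<n. g i = (\<Sum>u\<le>s. R' u * Q u i)" using assms(2) unfolding in_span_def by blast
  show ?thesis unfolding in_span_def
    using R R' by (intro exI[of _ "\<lambda>u. R u + R' u"]) (simp add: sum.distrib algebra_simps)
qed

lemma in_span_sum:
  assumes "\<And>a. a \<in> A \<Longrightarrow> in_span n Q s (f a)"
  shows "in_span n Q s (\<lambda>i. \<Sum>a\<in>A. f a i)"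
proof -
  have "in_span n Q s (\<lambda>i. 0)"
    unfolding in_span_def by (rule exI[of _ "\<lambda>_. 0"]) simp
  then show ?thesis using assms
    by (induction A rule: infinite_finite_induct) (auto intro: in_span_add)
qed

lemma in_span_mono: "in_span n Q s f \<Longrightarrow> s \<le> t \<Longrightarrow> in_span n Q t f"
  unfolding in_span_def
proof (elim exE)
  fix R assume R: "\<forall>i<n. f i = (\<Sum>u\<le>s. R u * Q u i)" and st: "s \<le> t"
  have "(\<Sum>u\<le>t. (if u \<le> s then R u else 0) * Q u i) = (\<Sum>u\<le>s. R u * Q u i)" for i
    using st by (intro sum.mono_neutral_cong_right) auto
  then show "\<exists>R. \<forall>i<n. f i = (\<Sum>u\<le>t. R u * Q u i)"
    using R by (intro exI[of _ "\<lambda>u. if u \<le> s then R u else 0"]) simp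
qed

locale simple_spectrum =
  fixes n :: nat and l :: "nat \<Rightarrow> real"
  assumes inj_l: "inj_on l {..<n}" and n_pos: "0 < n"
begin

text \<open>Columns of \<open>Q\<close> are normalised eigenvectors for the eigenvalues
  \<open>l i\<close>, rows are sites, so this is the entry \<open>(s, r)\<close> of the symmetric
  matrix with these spectral data.\<close>

definition ent :: "(nat \<Rightarrow> nat \<Rightarrow> real) \<Rightarrow> nat \<Rightarrow> nat \<Rightarrow> real" where
  "ent Q s r = (\<Sum>i<n. l i * Q s i * Q r i)"

definition tridiag_frame :: "(nat \<Rightarrow> nat \<Rightarrow> real) \<Rightarrow> bool" where
  "tridiag_frame Q \<longleftrightarrow> orthonormal_rows n n Q \<and> (\<forall>s r. Suc s < r \<and> r < n \<longrightarrow> ent Q s r = 0) \<and>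
     (\<forall>s. Suc s < n \<longrightarrow> 0 \<le> ent Q s (Suc s))"

text \<open>The moment map of the closed orbit of the positive torus in the flag variety, for the
  weights \<open>0, 1, \<dots>, n - 1\<close>.\<close>

definition height :: "(nat \<Rightarrow> nat \<Rightarrow> real) \<Rightarrow> nat \<Rightarrow> real" where
  "height Q i = (\<Sum>s<n. real s * (Q s i)\<^sup>2)"

lemma ent_sym: "ent Q s r = ent Q r s"
  unfolding ent_def by (simp add: mult_ac)

lemma tridiag_frame_orthonormal: "tridiag_frame Q \<Longrightarrow> orthonormal_rows n n Q"
  by (simp add: tridiag_frame_def)

lemma ent_expand:
  assumes "orthonormal_rows n n Q" "i < n"
  shows "l i * Q s i = (\<Sum>r<n. ent Q s r * Q r i)"
proof -
  have "(\<Sum>r<n. ent Q s r * Q r i) = (\<Sum>k<n. l k * Q s k * (\<Sum>r<n. Q r k * Q r i))"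
    unfolding ent_def sum_distrib_left sum_distrib_right by (subst sum.swap) (simp add: mult_ac)
  also have "\<dots> = (\<Sum>k<n. l k * Q s k * (if k = i then 1 else 0))"
    using orthonormal_rows_sum_cols[OF assms(1) _ assms(2)] by (intro sum.cong refl) simp
  also have "\<dots> = l i * Q s i" using assms(2) by (simp add: if_distrib[of "\<lambda>x. _ * x"] cong: if_cong)
  finally show ?thesis by simp
qed

lemma ent_three_term:
  assumes Q: "tridiag_frame Q" and "Suc s < n" "i < n"
  shows "l i * Q s i = (\<Sum>r\<le>s. ent Q s r * Q r i) + ent Q s (Suc s) * Q (Suc s) i"
proof -
  have "l i * Q s i = (\<Sum>r<n. ent Q s r * Q r i)"
    using ent_expand[OF tridiag_frame_orthonormal[OF Q] assms(3)] .
  also have "\<dots> = (\<Sum>r\<le>Suc s. ent Q s r * Q r i)"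
    using Q assms(2) by (intro sum.mono_neutral_right) (auto simp: tridiag_frame_def)
  finally show ?thesis by simp
qed

text \<open>The flag of a tridiagonal frame is of Krylov type: by the three-term recurrence,
  multiplication by the eigenvalues moves it up by a single step.\<close>

lemma in_span_mult:
  assumes Q: "tridiag_frame Q" and f: "in_span n Q s f" and "Suc s < n"
  shows "in_span n Q (Suc s) (\<lambda>i. l i * f i)"
proof -
  obtain R where R: "\<forall>i<n. f i = (\<Sum>u\<le>s. R u * Q u i)" using f unfolding in_span_def by blast
  have "in_span n Q (Suc s) (\<lambda>i. l i * Q u i)" if "u \<le> s" for u
  proof -
    have "in_span n Q (Suc s) (\<lambda>i. (\<Sum>r\<le>u. ent Q u r * Q r i) + ent Q u (Suc u) * Q (Suc u) i)"
      using that by (intro in_span_add in_span_sum in_span_scale in_span_base) auto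
    then show ?thesis
      by (rule in_span_cong[rotated]) (use ent_three_term[OF Q, of u] that assms(3) in auto)
  qed
  then have "in_span n Q (Suc s) (\<lambda>i. \<Sum>u\<le>s. R u * (l i * Q u i))"
    by (intro in_span_sum in_span_scale) auto
  then show ?thesis
    by (rule in_span_cong[rotated]) (use R in \<open>simp add: sum_distrib_left mult_ac\<close>)
qed

lemma height_sum:
  assumes Q: "orthonormal_rows n n Q" and A: "A \<subseteq> {..<n}"
  shows "(\<Sum>i\<in>A. height Q i) = (\<Sum>s<n. real s * (\<Sum>i\<in>A. (Q s i)\<^sup>2))"
  unfolding height_def by (subst sum.swap) (simp add: sum_distrib_left)

lemma orthonormal_col_sq:
  assumes "orthonormal_rows n n Q" "i < n"
  shows "(\<Sum>s<n. (Q s i)\<^sup>2) = 1"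
  using orthonormal_rows_sum_cols[OF assms(1,2,2)] by (simp add: power2_eq_square)

lemma orthonormal_row_sq:
  assumes "orthonormal_rows m n Q" "s < m"
  shows "(\<Sum>i<n. (Q s i)\<^sup>2) = 1"
  using orthonormal_rowsD[OF assms(1,2,2)] by (simp add: power2_eq_square)

text \<open>The inequalities that define the permutohedron. The mass \<open>x s\<close> of row
  \<open>s\<close> in the columns \<open>A\<close> lies between 0 and 1 and has total
  \<open>card A\<close>, so \<open>weighted_index_sum_ge\<close> applies; on the facet of
  \<open>A\<close> the mass is 0 or 1, and the frame splits into two blocks.\<close>

lemma height_sum_ge:
  assumes Q: "orthonormal_rows n n Q" and A: "A \<subseteq> {..<n}"
  shows "real (card A) * (real (card A) - 1) / 2 \<le> (\<Sum>i\<in>A. height Q i)"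
    "(\<Sum>i\<in>A. height Q i) = real (card A) * (real (card A) - 1) / 2 \<Longrightarrow> s < n \<Longrightarrow> i < n \<Longrightarrow>
       (s < card A) \<noteq> (i \<in> A) \<Longrightarrow> Q s i = 0"
proof -
  have fA: "finite A" using A finite_subset by blast
  define x where "x s = (\<Sum>i\<in>A. (Q s i)\<^sup>2)" for s
  have x0: "0 \<le> x s" for s unfolding x_def by (intro sum_nonneg) auto
  have x1: "x s \<le> 1" if "s < n" for s
    using sum_mono2[OF _ A, of "\<lambda>i. (Q s i)\<^sup>2"] orthonormal_row_sq[OF Q that] by (simp add: x_def)
  have sx: "(\<Sum>s<n. x s) = real (card A)"
  proof -
    have "(\<Sum>s<n. x s) = (\<Sum>i\<in>A. \<Sum>s<n. (Q s i)\<^sup>2)" unfolding x_def by (rule sum.swap)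
    also have "\<dots> = (\<Sum>i\<in>A. 1)" using A orthonormal_col_sq[OF Q] by (intro sum.cong) auto
    finally show ?thesis by simp
  qed
  have cA: "card A \<le> n" using card_mono[OF _ A] by simp
  have hs: "(\<Sum>i\<in>A. height Q i) = (\<Sum>s<n. real s * x s)"
    unfolding x_def by (rule height_sum[OF Q A])
  show "real (card A) * (real (card A) - 1) / 2 \<le> (\<Sum>i\<in>A. height Q i)"
    unfolding hs by (rule weighted_index_sum_ge(1)[OF x0 x1 sx cA])
  assume eq: "(\<Sum>i\<in>A. height Q i) = real (card A) * (real (card A) - 1) / 2"
    and s: "s < n" and i: "i < n" and ne: "(s < card A) \<noteq> (i \<in> A)"
  have xs: "x s = (if s < card A then 1 else 0)"
    using weighted_index_sum_ge(2)[OF x0 x1 sx cA] eq s unfolding hs by blast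
  have "(Q s i)\<^sup>2 = 0"
  proof (cases "i \<in> A")
    case True
    then have "(\<Sum>i\<in>A. (Q s i)\<^sup>2) = 0" using ne xs by (simp add: x_def)
    then show ?thesis using True fA by (simp add: sum_nonneg_eq_0_iff)
  next
    case False
    then have "x s = 1" using ne xs by simp
    moreover have "(\<Sum>i<n. (Q s i)\<^sup>2) = x s + (\<Sum>i\<in>{..<n} - A. (Q s i)\<^sup>2)"
      unfolding x_def using A by (subst sum.subset_diff[OF A]) (auto simp: add.commute)
    ultimately have "(\<Sum>i\<in>{..<n} - A. (Q s i)\<^sup>2) = 0" using orthonormal_row_sq[OF Q s] by simp
    then show ?thesis using False i by (simp add: sum_nonneg_eq_0_iff)
  qed
  then show "Q s i = 0" by simp
qed

lemma height_total:
  assumes Q: "orthonormal_rows n n Q"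
  shows "(\<Sum>i<n. height Q i) = real n * (real n - 1) / 2"
proof -
  have "(\<Sum>i<n. height Q i) = (\<Sum>s<n. real s)"
    using height_sum[OF Q subset_refl] orthonormal_row_sq[OF Q] by simp
  also have "\<dots> = real n * (real n - 1) / 2" by (induction n) (auto simp: field_simps)
  finally show ?thesis .
qed

section \<open>Cuts, blocks and facets\<close>

lemma block_ent_zero:
  assumes "\<And>s i. s < n \<Longrightarrow> i < n \<Longrightarrow> (s < p) \<noteq> (i \<in> A) \<Longrightarrow> Q s i = 0" "s < p" "p \<le> r" "r < n"
  shows "ent Q s r = 0"
  unfolding ent_def
proof (intro sum.neutral ballI)
  fix i assume "i \<in> {..<n}"
  then show "l i * Q s i * Q r i = 0"
    using assms(1)[of s i] assms(1)[of r i] assms(2-4) by (cases "i \<in> A") auto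
qed

text \<open>Each eigenvalue is simple, so the projection onto the first block acts on each eigenvector
  as \<open>0\<close> or \<open>1\<close>.\<close>

lemma block_of_ent_zero:
  assumes Q: "orthonormal_rows n n Q" and p: "p \<le> n"
    and ez: "\<And>s r. s < p \<Longrightarrow> p \<le> r \<Longrightarrow> r < n \<Longrightarrow> ent Q s r = 0"
  obtains A where "A \<subseteq> {..<n}" "card A = p"
    "\<And>s i. s < n \<Longrightarrow> i < n \<Longrightarrow> (s < p) \<noteq> (i \<in> A) \<Longrightarrow> Q s i = 0"
    "(\<Sum>i\<in>A. height Q i) = real p * (real p - 1) / 2"
    "\<And>i. i < n \<Longrightarrow> (\<Sum>s<p. (Q s i)\<^sup>2) = (if i \<in> A then 1 else 0)"
proof -
  \<comment> \<open>The projection onto the span of the first \<open>p\<close> rows, written in the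
    eigenbasis. As the matrix does not couple the two groups of rows, this projection commutes with
    multiplication by \<open>l\<close>, hence is diagonal.\<close>
  define B where "B i k = (\<Sum>s<p. Q s i * Q s k)" for i k
  have lB: "l i * B i k = (\<Sum>s<p. \<Sum>r<p. ent Q s r * (Q r i * Q s k))" if "i < n" for i k
  proof -
    have "l i * B i k = (\<Sum>s<p. (l i * Q s i) * Q s k)" unfolding B_def by (simp add: sum_distrib_left mult.assoc)
    also have "\<dots> = (\<Sum>s<p. (\<Sum>r<n. ent Q s r * Q r i) * Q s k)"
      using ent_expand[OF Q that] by simp
    also have "\<dots> = (\<Sum>s<p. (\<Sum>r<p. ent Q s r * Q r i) * Q s k)"
    proof (rule sum.cong[OF refl])
      fix s assume "s \<in> {..<p}"
      then have "(\<Sum>r<n. ent Q s r * Q r i) = (\<Sum>r<p. ent Q s r * Q r i)"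
        using p ez by (intro sum.mono_neutral_right) auto
      then show "(\<Sum>r<n. ent Q s r * Q r i) * Q s k = (\<Sum>r<p. ent Q s r * Q r i) * Q s k" by simp
    qed
    finally show ?thesis by (simp add: sum_distrib_right mult.assoc)
  qed
  have B0: "B i k = 0" if ik: "i < n" "k < n" "i \<noteq> k" for i k
  proof -
    have "l k * B k i = (\<Sum>s<p. \<Sum>r<p. ent Q s r * (Q r i * Q s k))"
      unfolding lB[OF ik(2)] by (subst sum.swap) (simp add: ent_sym mult_ac)
    moreover have "B k i = B i k" unfolding B_def by (simp add: mult.commute)
    ultimately have "(l i - l k) * B i k = 0" using lB[OF ik(1), of k] by (simp add: algebra_simps)
    moreover have "l i \<noteq> l k" using inj_l ik by (auto simp: inj_on_def)
    ultimately show ?thesis by simp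
  qed
  have B1: "B i i = 0 \<or> B i i = 1" if i: "i < n" for i
  proof -
    have "(\<Sum>k<n. (B i k)\<^sup>2) = (\<Sum>k<n. if k = i then (B i i)\<^sup>2 else 0)"
      using B0[OF i] by (intro sum.cong refl) auto
    then have 1: "(\<Sum>k<n. (B i k)\<^sup>2) = (B i i)\<^sup>2" using i by simp
    have "(\<Sum>k<n. (B i k)\<^sup>2) = (\<Sum>k<n. \<Sum>s<p. \<Sum>r<p. Q s i * Q r i * (Q s k * Q r k))"
      unfolding B_def by (simp add: power2_eq_square sum_product mult_ac)
    also have "\<dots> = (\<Sum>s<p. \<Sum>r<p. Q s i * Q r i * (\<Sum>k<n. Q s k * Q r k))"
      unfolding sum_distrib_left by (rule sum_swap3)
    also have "\<dots> = (\<Sum>s<p. \<Sum>r<p. Q s i * Q r i * (if s = r then 1 else 0))"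
      using orthonormal_rowsD[OF Q] p by (intro sum.cong refl) simp
    also have "\<dots> = B i i"
      unfolding B_def by (intro sum.cong refl) (simp add: if_distrib[of "\<lambda>x. _ * x"] cong: if_cong)
    finally have "(B i i)\<^sup>2 = B i i" using 1 by simp
    then have "B i i * (B i i - 1) = 0" by (simp add: power2_eq_square algebra_simps)
    then show ?thesis by auto
  qed
  define A where "A = {i. i < n \<and> B i i = 1}"
  have A: "A \<subseteq> {..<n}" by (auto simp: A_def)
  have BA: "(\<Sum>s<p. (Q s i)\<^sup>2) = (if i \<in> A then 1 else 0)" if "i < n" for i
    using B1[OF that] that by (auto simp: A_def B_def power2_eq_square)
  have cA: "card A = p"
  proof -
    have "(\<Sum>i<n. \<Sum>s<p. (Q s i)\<^sup>2) = (\<Sum>s<p. \<Sum>i<n. (Q s i)\<^sup>2)" by (rule sum.swap)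
    also have "\<dots> = real p" using p orthonormal_row_sq[OF Q] by simp
    also have "(\<Sum>i<n. \<Sum>s<p. (Q s i)\<^sup>2) = (\<Sum>i<n. if i \<in> A then 1 else 0)" using BA by simp
    also have "\<dots> = real (card A)" using A by (simp add: sum.If_cases Int_absorb1)
    finally show ?thesis by simp
  qed
  have supp: "Q s i = 0" if s: "s < n" and i: "i < n" and ne: "(s < p) \<noteq> (i \<in> A)" for s i
  proof (cases "s < p")
    case True
    then have "(\<Sum>s<p. (Q s i)\<^sup>2) = 0" using BA[OF i] ne by simp
    then show ?thesis using True by (simp add: sum_nonneg_eq_0_iff)
  next
    case False
    have "{..<n} = {..<p} \<union> {p..<n}" using p by auto
    then have "(\<Sum>s<n. (Q s i)\<^sup>2) = (\<Sum>s<p. (Q s i)\<^sup>2) + (\<Sum>s=p..<n. (Q s i)\<^sup>2)"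
      by (simp add: sum.union_disjoint ivl_disj_int)
    then have "(\<Sum>s=p..<n. (Q s i)\<^sup>2) = 0"
      using orthonormal_col_sq[OF Q i] BA[OF i] ne False by simp
    then show ?thesis using False s by (simp add: sum_nonneg_eq_0_iff)
  qed
  have "(\<Sum>i\<in>A. height Q i) = (\<Sum>s<n. real s * (\<Sum>i\<in>A. (Q s i)\<^sup>2))" by (rule height_sum[OF Q A])
  also have "\<dots> = (\<Sum>s<p. real s * (\<Sum>i\<in>A. (Q s i)\<^sup>2))"
  proof (intro sum.mono_neutral_right ballI)
    fix s assume "s \<in> {..<n} - {..<p}"
    then have "(\<Sum>i\<in>A. (Q s i)\<^sup>2) = 0" using supp A by (intro sum.neutral) auto
    then show "real s * (\<Sum>i\<in>A. (Q s i)\<^sup>2) = 0" by simp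
  qed (use p in auto)
  also have "\<dots> = (\<Sum>s<p. real s)"
  proof (intro sum.cong refl)
    fix s assume s: "s \<in> {..<p}"
    have "(\<Sum>i\<in>A. (Q s i)\<^sup>2) = (\<Sum>i<n. (Q s i)\<^sup>2)"
      using A supp s p by (intro sum.mono_neutral_left) auto
    then show "real s * (\<Sum>i\<in>A. (Q s i)\<^sup>2) = real s" using orthonormal_row_sq[OF Q] s p by simp
  qed
  also have "\<dots> = real p * (real p - 1) / 2" by (induction p) (auto simp: field_simps)
  finally show ?thesis using that[OF A cA supp _ BA] by blast
qed

lemma tridiag_cut:
  assumes Q: "tridiag_frame Q" and p: "0 < p" "p < n" "ent Q (p - 1) p = 0" and "s < p" "p \<le> r" "r < n"
  shows "ent Q s r = 0"
proof (cases "Suc s < r")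
  case True
  then show ?thesis using Q assms by (simp add: tridiag_frame_def)
next
  case False
  then have "s = p - 1" "r = p" using assms by auto
  then show ?thesis using p by simp
qed

text \<open>A cut puts the heights on a facet, and lying on a facet is a property of the heights
  alone. So frames with equal heights are cut at the same places and along the same sets of
  eigenvalues.\<close>

lemma common_block:
  assumes Q: "tridiag_frame Q" and Q': "tridiag_frame Q'" and h: "\<And>i. i < n \<Longrightarrow> height Q i = height Q' i"
    and p: "0 < p" "p < n" "ent Q (p - 1) p = 0"
  obtains A where "\<And>s i. s < n \<Longrightarrow> i < n \<Longrightarrow> (s < p) \<noteq> (i \<in> A) \<Longrightarrow> Q s i = 0 \<and> Q' s i = 0"
    "ent Q' (p - 1) p = 0"
proof -
  obtain A where A: "A \<subseteq> {..<n}" "card A = p"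
    "\<And>s i. s < n \<Longrightarrow> i < n \<Longrightarrow> (s < p) \<noteq> (i \<in> A) \<Longrightarrow> Q s i = 0"
    "(\<Sum>i\<in>A. height Q i) = real p * (real p - 1) / 2"
  proof (rule block_of_ent_zero[OF tridiag_frame_orthonormal[OF Q], of p])
    show "p \<le> n" using p by simp
  qed (use tridiag_cut[OF Q p] in auto)
  have "(\<Sum>i\<in>A. height Q' i) = (\<Sum>i\<in>A. height Q i)" using A(1) h by (intro sum.cong) auto
  then have *: "Q' s i = 0" if "s < n" "i < n" "(s < p) \<noteq> (i \<in> A)" for s i
    using height_sum_ge(2)[OF tridiag_frame_orthonormal[OF Q'] A(1)] A(2,4) that by simp
  have "ent Q' (p - 1) p = 0"
    using p * by (intro block_ent_zero[of p A]) auto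
  then show ?thesis using that[of A] A(3) * by blast
qed

text \<open>Start of the irreducible block that carries the eigenvalue \<open>l i\<close>: in such a
  block no eigenvector vanishes at the first site.\<close>

definition first_site :: "(nat \<Rightarrow> nat \<Rightarrow> real) \<Rightarrow> nat \<Rightarrow> nat" where
  "first_site Q i = (LEAST s. Q s i \<noteq> 0)"

lemma first_site:
  assumes "orthonormal_rows n n Q" "i < n"
  shows "first_site Q i < n" "Q (first_site Q i) i \<noteq> 0" "\<And>s. s < first_site Q i \<Longrightarrow> Q s i = 0"
proof -
  obtain s where s: "s < n" "Q s i \<noteq> 0"
  proof (rule ccontr)
    assume "\<not> thesis"
    then have "\<forall>s<n. Q s i = 0" using that by blast
    then show False using orthonormal_col_sq[OF assms] by simp
  qed
  show "Q (first_site Q i) i \<noteq> 0" unfolding first_site_def using s(2) by (rule LeastI)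
  have "first_site Q i \<le> s" unfolding first_site_def using s(2) by (rule Least_le)
  then show "first_site Q i < n" using s(1) by simp
  show "Q s i = 0" if "s < first_site Q i" for s
    using not_less_Least[of s "\<lambda>s. Q s i \<noteq> 0"] that unfolding first_site_def by blast
qed

text \<open>In the recurrence for the row before the first site all terms but the last vanish at
  \<open>i\<close>, so the coupling in the last term must vanish too.\<close>

lemma first_site_cut:
  assumes Q: "tridiag_frame Q" and i: "i < n" and pos: "0 < first_site Q i"
  shows "ent Q (first_site Q i - 1) (first_site Q i) = 0"
proof -
  define s where "s = first_site Q i - 1"
  have s: "Suc s = first_site Q i" using pos by (simp add: s_def)
  note f = first_site[OF tridiag_frame_orthonormal[OF Q] i]
  have "(\<Sum>r\<le>s. ent Q s r * Q r i) = 0" using f(3) s by (intro sum.neutral) auto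
  moreover have "Q s i = 0" using f(3) s by simp
  ultimately have "ent Q s (Suc s) * Q (Suc s) i = 0"
    using ent_three_term[OF Q _ i, of s] f(1) s by simp
  then show ?thesis using f(2) s by (auto simp: s_def)
qed

text \<open>The cut in front of the block of \<open>i\<close> in \<open>Q\<close> is also a cut of
  \<open>Q'\<close>, with the same \<open>A\<close>; an earlier start in \<open>Q'\<close> would put
  \<open>i\<close> on both sides of it.\<close>

lemma first_site_le:
  assumes Q: "tridiag_frame Q" and Q': "tridiag_frame Q'" and h: "\<And>i. i < n \<Longrightarrow> height Q i = height Q' i"
    and i: "i < n"
  shows "first_site Q i \<le> first_site Q' i"
proof (rule ccontr)
  assume less: "\<not> ?thesis"
  define p where "p = first_site Q i"
  note f = first_site[OF tridiag_frame_orthonormal[OF Q] i]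
  note f' = first_site[OF tridiag_frame_orthonormal[OF Q'] i]
  have p: "0 < p" "p < n" "ent Q (p - 1) p = 0"
    using less f(1) first_site_cut[OF Q i] by (auto simp: p_def)
  obtain A where A: "\<And>s i. s < n \<Longrightarrow> i < n \<Longrightarrow> (s < p) \<noteq> (i \<in> A) \<Longrightarrow> Q s i = 0 \<and> Q' s i = 0"
    using common_block[OF Q Q' h p] by metis
  show False using A[of p i] A[of "first_site Q' i" i] f f' i p less by (auto simp: p_def)
qed

text \<open>On each block the flags of two frames differ by the diagonal matrix that matches the first
  nonzero rows, hence equal heights force equal squares by \<open>scaled_frame_monotone\<close>.\<close>

theorem height_inj:
  assumes Q: "tridiag_frame Q" and Q': "tridiag_frame Q'" and h: "\<And>i. i < n \<Longrightarrow> height Q i = height Q' i"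
    and si: "s < n" "i < n"
  shows "(Q s i)\<^sup>2 = (Q' s i)\<^sup>2"
proof -
  note O = tridiag_frame_orthonormal[OF Q] and O' = tridiag_frame_orthonormal[OF Q']
  have fs: "first_site Q i = first_site Q' i" if "i < n" for i
    using first_site_le[OF Q Q' h that] first_site_le[OF Q' Q h[symmetric] that] by simp
  define g where "g i = Q' (first_site Q i) i / Q (first_site Q i) i" for i
  have g0: "g i \<noteq> 0" if "i < n" for i
    using first_site(2)[OF O that] first_site(2)[OF O' that] fs[OF that] by (simp add: g_def)
  \<comment> \<open>At the start of a block row \<open>s\<close> itself is matched by
    \<open>g\<close>. Inside a block the recurrence of \<open>Q'\<close> expresses the next row by
    \<open>l\<close> times the previous row and by earlier rows, and \<open>in_span_mult\<close>
    carries this over to the flag of \<open>Q\<close>.\<close>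
  have span: "in_span n Q s (\<lambda>i. Q' s i / g i)" if "s < n" for s
    using that
  proof (induction s rule: less_induct)
    case (less s)
    show ?case
    proof (cases "s = 0 \<or> ent Q' (s - 1) s = 0")
      case True
      have "Q' s i / g i = Q s i" if i: "i < n" for i
      proof -
        consider "first_site Q i = s" | "s < first_site Q i" | "first_site Q i < s" by linarith
        then show ?thesis
        proof cases
          case 1
          then show ?thesis
            using first_site(2)[OF O i] first_site(2)[OF O' i] fs[OF i] by (auto simp: g_def)
        next
          case 2
          then show ?thesis
            using first_site(3)[OF O i] first_site(3)[OF O' i] fs[OF i] by simp
        next
          case 3
          then have "0 < s" "ent Q' (s - 1) s = 0" using True by auto
          then obtain A where "\<And>s' i. s' < n \<Longrightarrow> i < n \<Longrightarrow> (s' < s) \<noteq> (i \<in> A) \<Longrightarrow> Q' s' i = 0 \<and> Q s' i = 0"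
            using common_block[OF Q' Q h[symmetric] _ less.prems] by metis
          then have "Q' s i = 0 \<and> Q s i = 0"
            using 3 first_site(1,2)[OF O i] i less.prems by (metis less_irrefl)
          then show ?thesis by simp
        qed
      qed
      then show ?thesis by (intro in_span_cong[OF _ in_span_base[of s s]]) auto
    next
      case False
      then obtain t where t: "s = Suc t" by (cases s) auto
      define e where "e = ent Q' t (Suc t)"
      have e: "e \<noteq> 0" using False t by (simp add: e_def)
      have IH: "in_span n Q s (\<lambda>i. Q' r i / g i)" if "r \<le> t" for r
        by (rule in_span_mono[OF less.IH[of r]]) (use less.prems that t in auto)
      have "in_span n Q s (\<lambda>i. l i * (Q' t i / g i))"
        unfolding t using less.IH[of t] less.prems t by (intro in_span_mult[OF Q]) auto
      then have "in_span n Q s (\<lambda>i. (1 / e) * (l i * (Q' t i / g i) + (\<Sum>r\<le>t. (- ent Q' t r) * (Q' r i / g i))))"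
        using IH by (intro in_span_scale in_span_add in_span_sum) auto
      moreover have "(1 / e) * (l i * (Q' t i / g i) + (\<Sum>r\<le>t. (- ent Q' t r) * (Q' r i / g i))) = Q' s i / g i"
        if i: "i < n" for i
      proof -
        have "(\<Sum>r\<le>t. (- ent Q' t r) * (Q' r i / g i)) = - (\<Sum>r\<le>t. ent Q' t r * Q' r i) / g i"
          by (simp add: sum_negf sum_divide_distrib)
        moreover have "l i * Q' t i = (\<Sum>r\<le>t. ent Q' t r * Q' r i) + e * Q' s i"
          using ent_three_term[OF Q' _ i, of t] less.prems t by (simp add: e_def)
        ultimately have "l i * (Q' t i / g i) + (\<Sum>r\<le>t. (- ent Q' t r) * (Q' r i / g i)) = e * Q' s i / g i"
          by (simp add: diff_divide_distrib[symmetric])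
        then show ?thesis using e by simp
      qed
      ultimately show ?thesis by (rule in_span_cong[rotated])
    qed
  qed
  define D where "D j i = (\<Sum>s<j. (Q' s i)\<^sup>2) - (\<Sum>s<j. (Q s i)\<^sup>2)" for j i
  have mono: "0 \<le> (\<Sum>i<n. ln ((g i)\<^sup>2) * D j i)"
    "(\<Sum>i<n. ln ((g i)\<^sup>2) * D j i) = 0 \<Longrightarrow> i < n \<Longrightarrow> D j i = 0" if j: "j \<le> n" for j i
  proof -
    have "\<exists>R. \<forall>s<j. \<forall>i<n. Q' s i = g i * (\<Sum>u<j. R s u * Q u i)"
    proof -
      have "\<exists>R. \<forall>i<n. Q' s i = g i * (\<Sum>u<j. R u * Q u i)" if s: "s < j" for s
      proof -
        have "in_span n Q (j - 1) (\<lambda>i. Q' s i / g i)"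
          by (rule in_span_mono[OF span[of s]]) (use s j in auto)
        then obtain R where "\<forall>i<n. Q' s i / g i = (\<Sum>u\<le>j - 1. R u * Q u i)" unfolding in_span_def by blast
        moreover have "{..j - 1} = {..<j}" using s by auto
        ultimately show ?thesis using g0 by (intro exI[of _ R]) (auto simp: field_simps)
      qed
      then show ?thesis by metis
    qed
    then obtain R where R: "\<And>s i. s < j \<Longrightarrow> i < n \<Longrightarrow> Q' s i = g i * (\<Sum>u<j. R s u * Q u i)" by blast
    have "orthonormal_rows j n Q" "orthonormal_rows j n Q'" using O O' j by (auto simp: orthonormal_rows_def)
    note frames = this
    show "0 \<le> (\<Sum>i<n. ln ((g i)\<^sup>2) * D j i)"
      unfolding D_def
      by (rule scaled_frame_monotone(1)[where h = g and R = R, OF frames]) (erule g0, erule (1) R)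
    assume "(\<Sum>i<n. ln ((g i)\<^sup>2) * D j i) = 0" "i < n"
    then have "(\<Sum>s<j. (Q' s i)\<^sup>2) = (\<Sum>s<j. (Q s i)\<^sup>2)"
      unfolding D_def
      by - (rule scaled_frame_monotone(2)[where h = g and R = R, OF frames], erule g0, erule (1) R)
    then show "D j i = 0" by (simp add: D_def)
  qed
  \<comment> \<open>Up to a constant the height is minus the sum, over all steps of the flag, of the
    diagonals of the projections, so equal heights annihilate the sum over \<open>j\<close>. Every
    step contributes a nonnegative amount in the direction \<open>ln (g\<^sup>2)\<close>; hence each
    contributes zero, and the equality case of \<open>mono\<close> applies.\<close>
  have "(\<Sum>j<n. D j i) = 0" if "i < n" for i
  proof -
    have hh: "(\<Sum>j<n. \<Sum>s<j. (P s i)\<^sup>2) = (real n - 1) - height P i" if "orthonormal_rows n n P" for P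
      unfolding sum_of_partial_sums height_def
      using orthonormal_col_sq[OF that \<open>i < n\<close>]
      by (simp add: left_diff_distrib sum_subtractf sum_distrib_left[symmetric])
    show ?thesis unfolding D_def sum_subtractf hh[OF O] hh[OF O'] using h[OF that] by simp
  qed
  then have "(\<Sum>i<n. ln ((g i)\<^sup>2) * (\<Sum>j<n. D j i)) = 0" by simp
  moreover have "(\<Sum>i<n. ln ((g i)\<^sup>2) * (\<Sum>j<n. D j i)) = (\<Sum>j<n. \<Sum>i<n. ln ((g i)\<^sup>2) * D j i)"
    unfolding sum_distrib_left by (rule sum.swap)
  ultimately have "(\<Sum>j<n. \<Sum>i<n. ln ((g i)\<^sup>2) * D j i) = 0" by simp
  then have "(\<Sum>i<n. ln ((g i)\<^sup>2) * D j i) = 0" if "j < n" for j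
    using mono(1) that by (subst (asm) sum_nonneg_eq_0_iff) auto
  then have D0: "D j i = 0" if "j \<le> n" for j
    using mono(2)[of j i] si that orthonormal_col_sq[OF O si(2)] orthonormal_col_sq[OF O' si(2)]
    by (cases "j = n") (auto simp: D_def)
  have "D (Suc s) i - D s i = (Q' s i)\<^sup>2 - (Q s i)\<^sup>2" by (simp add: D_def)
  then show ?thesis using D0[of s] D0[of "Suc s"] si(1) by simp
qed

section \<open>Frames and matrix entries determine each other\<close>

lemma ent_sq_sum:
  assumes "orthonormal_rows n n Q" "s < n"
  shows "(\<Sum>r<n. (ent Q s r)\<^sup>2) = (\<Sum>i<n. (l i)\<^sup>2 * (Q s i)\<^sup>2)"
proof -
  have "(\<Sum>r<n. (ent Q s r)\<^sup>2) = (\<Sum>r<n. \<Sum>i<n. ent Q s r * (l i * Q s i * Q r i))"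
    by (intro sum.cong refl) (simp add: power2_eq_square sum_distrib_left ent_def)
  also have "\<dots> = (\<Sum>i<n. l i * Q s i * (\<Sum>r<n. ent Q s r * Q r i))"
    by (subst sum.swap) (simp add: sum_distrib_left mult_ac)
  also have "\<dots> = (\<Sum>i<n. l i * Q s i * (l i * Q s i))"
    using ent_expand[OF assms(1)] by (intro sum.cong refl) simp
  finally show ?thesis by (simp add: power2_eq_square mult_ac)
qed

text \<open>The diagonal is linear in the squares, and so is the squared length of each matrix row
  by \<open>ent_sq_sum\<close>. Going down the rows, that length fixes the square of the next
  superdiagonal entry, whose sign is prescribed.\<close>

lemma ent_determined_by_squares:
  assumes Q: "tridiag_frame Q" and Q': "tridiag_frame Q'"
    and sq: "\<And>s i. s < n \<Longrightarrow> i < n \<Longrightarrow> (Q s i)\<^sup>2 = (Q' s i)\<^sup>2"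
    and sr: "s < n" "r < n"
  shows "ent Q s r = ent Q' s r"
proof -
  note O = tridiag_frame_orthonormal[OF Q] and O' = tridiag_frame_orthonormal[OF Q']
  have d: "ent Q s s = ent Q' s s" if "s < n" for s
    unfolding ent_def using sq[OF that] by (simp add: mult.assoc power2_eq_square)
  have tot: "(\<Sum>r<n. (ent Q s r)\<^sup>2) = (\<Sum>r<n. (ent Q' s r)\<^sup>2)" if "s < n" for s
    using ent_sq_sum[OF O that] ent_sq_sum[OF O' that] sq[OF that] by simp
  have split: "(\<Sum>r<n. (ent P s r)\<^sup>2) = (\<Sum>r<s. (ent P s r)\<^sup>2) + (ent P s s)\<^sup>2 + (ent P s (Suc s))\<^sup>2"
    if "Suc s < n" "tridiag_frame P" for s P
  proof -
    have "(\<Sum>r<n. (ent P s r)\<^sup>2) = (\<Sum>r<Suc (Suc s). (ent P s r)\<^sup>2)"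
      using that by (intro sum.mono_neutral_right) (auto simp: tridiag_frame_def)
    then show ?thesis by simp
  qed
  have b: "Suc s < n \<Longrightarrow> ent Q s (Suc s) = ent Q' s (Suc s)" for s
  proof (induction s rule: less_induct)
    case (less s)
    have "ent Q s r = ent Q' s r" if "r < s" for r
    proof (cases "Suc r = s")
      case True
      then show ?thesis using less.IH[of r] less.prems by (simp add: ent_sym[of _ s])
    next
      case False
      then show ?thesis using that Q Q' less.prems by (simp add: ent_sym[of _ s] tridiag_frame_def)
    qed
    then have "(ent Q s (Suc s))\<^sup>2 = (ent Q' s (Suc s))\<^sup>2"
      using tot[of s] split[OF less.prems Q] split[OF less.prems Q'] d[of s] less.prems by simp
    then show ?case using Q Q' less.prems by (simp add: tridiag_frame_def)
  qed
  have le: "ent Q s r = ent Q' s r" if "s \<le> r" "r < n" for s r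
  proof -
    consider "s = r" | "r = Suc s" | "Suc s < r" using \<open>s \<le> r\<close> by linarith
    then show ?thesis
      using d b that Q Q' by cases (auto simp: tridiag_frame_def)
  qed
  show ?thesis
    using le[of s r] le[of r s] sr ent_sym[of Q s r] ent_sym[of Q' s r] by linarith
qed

text \<open>Both frames diagonalise one matrix, so \<open>G\<close>, which compares their columns,
  commutes with multiplication by \<open>l\<close>. The simple spectrum makes it diagonal, and the
  unit length of the columns makes its entries 1 or -1.\<close>

lemma squares_determined_by_ent:
  assumes O: "orthonormal_rows n n Q" and O': "orthonormal_rows n n Q'"
    and eq: "\<And>s r. s < n \<Longrightarrow> r < n \<Longrightarrow> ent Q s r = ent Q' s r" and s: "s < n" and k: "k < n"
  shows "(Q s k)\<^sup>2 = (Q' s k)\<^sup>2"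
proof -
  define G where "G i k = (\<Sum>s<n. Q s i * Q' s k)" for i k
  have l1: "l i * G i k = (\<Sum>s<n. \<Sum>r<n. ent Q s r * (Q r i * Q' s k))" if "i < n" for i k
  proof -
    have "l i * G i k = (\<Sum>s<n. (l i * Q s i) * Q' s k)"
      unfolding G_def by (simp add: sum_distrib_left mult.assoc)
    also have "\<dots> = (\<Sum>s<n. \<Sum>r<n. ent Q s r * (Q r i * Q' s k))"
      using ent_expand[OF O that] by (simp add: sum_distrib_right mult.assoc)
    finally show ?thesis .
  qed
  have l2: "l k * G i k = (\<Sum>s<n. \<Sum>r<n. ent Q s r * (Q r i * Q' s k))" if "k < n" for i k
  proof -
    have "l k * G i k = (\<Sum>s<n. Q s i * (l k * Q' s k))"
      unfolding G_def by (simp add: sum_distrib_left mult_ac)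
    also have "\<dots> = (\<Sum>s<n. \<Sum>r<n. ent Q' s r * (Q s i * Q' r k))"
      using ent_expand[OF O' that] by (simp add: sum_distrib_left mult_ac)
    also have "\<dots> = (\<Sum>r<n. \<Sum>s<n. ent Q' s r * (Q s i * Q' r k))" by (rule sum.swap)
    also have "\<dots> = (\<Sum>s<n. \<Sum>r<n. ent Q s r * (Q r i * Q' s k))"
      using eq by (intro sum.cong refl) (simp add: ent_sym[of Q'])
    finally show ?thesis .
  qed
  have G0: "G i k = 0" if "i < n" "i \<noteq> k" for i
  proof -
    have "l i \<noteq> l k" using inj_l that k by (auto simp: inj_on_def)
    moreover have "(l i - l k) * G i k = 0"
      using l1[OF that(1), of k] l2[OF k, of i] by (simp add: left_diff_distrib)
    ultimately show ?thesis by simp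
  qed
  have "Q' s k = G k k * Q s k" if "s < n" for s
  proof -
    have "(\<Sum>i<n. G i k * Q s i) = (\<Sum>r<n. (\<Sum>i<n. Q r i * Q s i) * Q' r k)"
      unfolding G_def sum_distrib_left sum_distrib_right by (subst sum.swap) (simp add: mult_ac)
    also have "\<dots> = (\<Sum>r<n. (if r = s then 1 else 0) * Q' r k)"
      using orthonormal_rowsD[OF O _ that] by (intro sum.cong refl) simp
    also have "\<dots> = Q' s k" using that by (simp add: if_distrib[of "\<lambda>x. x * _"] cong: if_cong)
    finally have "Q' s k = (\<Sum>i<n. G i k * Q s i)" by simp
    also have "\<dots> = (\<Sum>i<n. if i = k then G k k * Q s k else 0)"
      using G0 by (intro sum.cong refl) auto
    also have "\<dots> = G k k * Q s k" using k by simp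
    finally show ?thesis .
  qed
  then have sq: "(Q' s k)\<^sup>2 = (G k k)\<^sup>2 * (Q s k)\<^sup>2" if "s < n" for s
    using that by (simp add: power_mult_distrib)
  have "1 = (G k k)\<^sup>2 * (\<Sum>s<n. (Q s k)\<^sup>2)"
    using orthonormal_col_sq[OF O' k] sq by (simp add: sum_distrib_left)
  then have "(G k k)\<^sup>2 = 1" using orthonormal_col_sq[OF O k] by simp
  then show ?thesis using sq[OF s] by simp
qed

lemma continuous_on_ent: "continuous_on S (\<lambda>Q. ent Q s r)"
  unfolding ent_def by (intro continuous_intros continuous_on_entry)

lemma continuous_on_height: "continuous_on S (\<lambda>Q. height Q i)"
  unfolding height_def by (intro continuous_intros continuous_on_entry)

text \<open>Fixing the entries outside the \<open>n \<times> n\<close> block to zero makes the set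
  compact.\<close>

definition frames :: "(nat \<Rightarrow> nat \<Rightarrow> real) set" where
  "frames = {Q. tridiag_frame Q} \<inter> {Q. \<forall>s i. \<not> (s < n \<and> i < n) \<longrightarrow> Q s i = 0}"

lemma compact_frames: "compact frames"
proof (rule compact_bounded_entries)
  have "{Q. tridiag_frame Q} = {Q. orthonormal_rows n n Q} \<inter>
     ({Q. \<forall>s r. Suc s < r \<and> r < n \<longrightarrow> ent Q s r = 0} \<inter> {Q. \<forall>s. Suc s < n \<longrightarrow> 0 \<le> ent Q s (Suc s)})"
    by (auto simp: tridiag_frame_def)
  also have "closed \<dots>"
    by (intro closed_Int closed_orthonormal_rows closed_Collect_all closed_Collect_imp closed_Collect_eq
        closed_Collect_le continuous_on_const continuous_on_ent open_Collect_const)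
  finally show "closed frames" unfolding frames_def by (intro closed_Int closed_zero_entries)
  fix Q a s assume "Q \<in> frames"
  then show "\<bar>Q a s\<bar> \<le> 1"
    using orthonormal_rows_entry_bound[of n n Q a s]
    by (cases "a < n \<and> s < n") (auto simp: frames_def tridiag_frame_def)
qed

lemma frames_truncate:
  assumes "tridiag_frame Q"
  shows "(\<lambda>s i. if s < n \<and> i < n then Q s i else 0) \<in> frames"
proof -
  define P where "P = (\<lambda>s i. if s < n \<and> i < n then Q s i else 0)"
  have e: "ent P s r = ent Q s r" if "s < n" "r < n" for s r
    unfolding ent_def P_def using that by simp
  have "orthonormal_rows n n P"
    using assms by (simp add: tridiag_frame_def orthonormal_rows_def P_def)
  then have "tridiag_frame P"
    using assms e by (simp add: tridiag_frame_def)
  then show ?thesis by (simp add: frames_def P_def)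
qed

section \<open>The Lanczos process\<close>

text \<open>Gram-Schmidt orthogonalisation of \<open>w\<close>, \<open>l w\<close>,
  \<open>l\<^sup>2 w\<close> and so on, in recursive form, with \<open>w\<close> as the first row.
  Only the rows below \<open>n\<close> count: for admissible \<open>w\<close> the residual of row
  \<open>n - 1\<close> is zero.\<close>

fun lanczos :: "(nat \<Rightarrow> real) \<Rightarrow> nat \<Rightarrow> nat \<Rightarrow> real" where
  "lanczos w 0 = w"
| "lanczos w (Suc s) =
    (let u = (\<lambda>i. l i * lanczos w s i - (\<Sum>r\<le>s. (\<Sum>k<n. l k * lanczos w s k * lanczos w r k) * lanczos w r i))
     in (\<lambda>i. u i / sqrt (\<Sum>k<n. (u k)\<^sup>2)))"

definition residual :: "(nat \<Rightarrow> nat \<Rightarrow> real) \<Rightarrow> nat \<Rightarrow> nat \<Rightarrow> real" where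
  "residual Q s i = l i * Q s i - (\<Sum>r\<le>s. ent Q s r * Q r i)"

lemma lanczos_Suc:
  "lanczos w (Suc s) i = residual (lanczos w) s i / sqrt (\<Sum>k<n. (residual (lanczos w) s k)\<^sup>2)"
  by (simp add: residual_def ent_def Let_def)

declare lanczos.simps(2) [simp del]

text \<open>Row \<open>s\<close> is a polynomial of exact degree \<open>s\<close> in the
  eigenvalues, times \<open>w\<close>. The residual is one of degree \<open>s + 1 < n\<close>, which
  cannot vanish at \<open>n\<close> distinct eigenvalues; as the weights are nonzero, the residual
  is nonzero and can be normalised.\<close>

lemma lanczos_step:
  assumes w: "\<And>i. i < n \<Longrightarrow> w i \<noteq> 0" "(\<Sum>i<n. (w i)\<^sup>2) = 1" and "s < n"
  shows "(\<exists>p. degree p = s \<and> p \<noteq> 0 \<and> (\<forall>i<n. lanczos w s i = poly p (l i) * w i)) \<and>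
     (\<forall>r\<le>s. (\<Sum>i<n. lanczos w s i * lanczos w r i) = (if r = s then 1 else 0)) \<and>
     (Suc s < n \<longrightarrow> 0 < (\<Sum>k<n. (residual (lanczos w) s k)\<^sup>2))"
  using \<open>s < n\<close>
proof (induction s rule: less_induct)
  case (less s)
  define Q where "Q = lanczos w"
  have on: "(\<Sum>i<n. Q r i * Q r' i) = (if r' = r then 1 else 0)" if "r < s" "r' < s" for r r'
  proof (cases "r' \<le> r")
    case True
    then show ?thesis using less.IH[of r] that less.prems by (auto simp: Q_def)
  next
    case False
    then have "(\<Sum>i<n. Q r' i * Q r i) = 0" using less.IH[of r'] that less.prems by (auto simp: Q_def)
    then show ?thesis using False by (simp add: mult.commute)
  qed
  have 1: "\<exists>p. degree p = s \<and> p \<noteq> 0 \<and> (\<forall>i<n. Q s i = poly p (l i) * w i)"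
    and 2: "\<forall>r\<le>s. (\<Sum>i<n. Q s i * Q r i) = (if r = s then 1 else 0)"
  proof -
    have "(\<exists>p. degree p = s \<and> p \<noteq> 0 \<and> (\<forall>i<n. Q s i = poly p (l i) * w i)) \<and>
      (\<forall>r\<le>s. (\<Sum>i<n. Q s i * Q r i) = (if r = s then 1 else 0))"
    proof (cases s)
      case 0
      then show ?thesis using w(2) by (auto simp: Q_def power2_eq_square intro!: exI[of _ "1"])
    next
      case (Suc t)
      define N where "N = sqrt (\<Sum>k<n. (residual Q t k)\<^sup>2)"
      have N: "N > 0" using less.IH[of t] less.prems Suc by (simp add: N_def Q_def)
      have Qs: "Q s i = residual Q t i / N" for i
        unfolding Q_def N_def Suc by (rule lanczos_Suc)
      have "\<exists>P. \<forall>r\<le>t. degree (P r) = r \<and> P r \<noteq> 0 \<and> (\<forall>i<n. Q r i = poly (P r) (l i) * w i)"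
      proof -
        have "\<forall>r. \<exists>p. r \<le> t \<longrightarrow> degree p = r \<and> p \<noteq> 0 \<and> (\<forall>i<n. Q r i = poly p (l i) * w i)"
          using less.IH less.prems Suc by (simp add: Q_def)
        then show ?thesis by metis
      qed
      then obtain P where P: "\<And>r. r \<le> t \<Longrightarrow> degree (P r) = r" "\<And>r. r \<le> t \<Longrightarrow> P r \<noteq> 0"
        "\<And>r i. r \<le> t \<Longrightarrow> i < n \<Longrightarrow> Q r i = poly (P r) (l i) * w i" by blast
      define q where "q = [:0, 1:] * P t - (\<Sum>r\<le>t. Polynomial.smult (ent Q t r) (P r))"
      have d1: "degree ([:0, 1:] * P t) = Suc t"
        using P(1,2)[of t] by (simp add: degree_mult_eq)
      have d2: "degree (\<Sum>r\<le>t. Polynomial.smult (ent Q t r) (P r)) \<le> t"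
        using P(1) by (intro degree_sum_le) (auto intro: order_trans[OF degree_smult_le])
      have dq: "degree q = Suc t"
      proof -
        have "degree q \<le> Suc t" unfolding q_def using d1 d2 by (intro degree_diff_le) auto
        moreover have "Polynomial.coeff q (Suc t) \<noteq> 0"
        proof -
          have "Polynomial.coeff (\<Sum>r\<le>t. Polynomial.smult (ent Q t r) (P r)) (Suc t) = 0"
            using d2 by (intro coeff_eq_0) simp
          moreover have "Polynomial.coeff ([:0, 1:] * P t) (Suc t) \<noteq> 0"
            using d1 P(2)[of t] by (metis leading_coeff_0_iff le_refl mult_eq_0_iff pCons_eq_0_iff zero_neq_one)
          ultimately show ?thesis by (simp add: q_def)
        qed
        ultimately show ?thesis by (meson le_antisym le_degree)
      qed
      have rq: "residual Q t i = poly q (l i) * w i" if "i < n" for i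
        unfolding residual_def q_def using P(3) that
        by (simp add: poly_sum algebra_simps sum_distrib_left)
      have "\<exists>p. degree p = s \<and> p \<noteq> 0 \<and> (\<forall>i<n. Q s i = poly p (l i) * w i)"
      proof (intro exI conjI allI impI)
        show "Q s i = poly (Polynomial.smult (1 / N) q) (l i) * w i" if "i < n" for i
          using rq[OF that] Qs[of i] by simp
      qed (use dq N Suc in auto)
      moreover have "(\<Sum>i<n. Q s i * Q r i) = (if r = s then 1 else 0)" if r: "r \<le> s" for r
      proof (cases "r = s")
        case True
        have "(\<Sum>i<n. Q s i * Q s i) = (\<Sum>i<n. (residual Q t i)\<^sup>2) / N\<^sup>2"
          unfolding sum_divide_distrib by (intro sum.cong refl) (simp add: Qs power2_eq_square)
        also have "\<dots> = 1" using N by (simp add: N_def sum_nonneg)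
        finally show ?thesis using True by simp
      next
        case False
        then have r: "r \<le> t" using r Suc by simp
        have "(\<Sum>i<n. residual Q t i * Q r i) = (\<Sum>i<n. l i * Q t i * Q r i) - (\<Sum>r'\<le>t. ent Q t r' * (\<Sum>i<n. Q r' i * Q r i))"
        proof -
          have "(\<Sum>r'\<le>t. ent Q t r' * (\<Sum>i<n. Q r' i * Q r i)) = (\<Sum>i<n. (\<Sum>r'\<le>t. ent Q t r' * Q r' i) * Q r i)"
            unfolding sum_distrib_left sum_distrib_right by (subst sum.swap) (simp add: mult.assoc)
          then show ?thesis by (simp add: residual_def left_diff_distrib sum_subtractf)
        qed
        also have "(\<Sum>r'\<le>t. ent Q t r' * (\<Sum>i<n. Q r' i * Q r i)) = (\<Sum>r'\<le>t. if r' = r then ent Q t r else 0)"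
          using on r Suc by (intro sum.cong refl) auto
        also have "\<dots> = ent Q t r" using r by simp
        finally have "(\<Sum>i<n. residual Q t i * Q r i) = 0" by (simp add: ent_def)
        then show ?thesis using False unfolding Qs by (simp add: sum_divide_distrib[symmetric])
      qed
      ultimately show ?thesis by blast
    qed
    then show "\<exists>p. degree p = s \<and> p \<noteq> 0 \<and> (\<forall>i<n. Q s i = poly p (l i) * w i)"
      "\<forall>r\<le>s. (\<Sum>i<n. Q s i * Q r i) = (if r = s then 1 else 0)" by blast+
  qed
  have 3: "0 < (\<Sum>k<n. (residual Q s k)\<^sup>2)" if sn: "Suc s < n"
  proof -
    have "\<exists>P. \<forall>r\<le>s. degree (P r) = r \<and> P r \<noteq> 0 \<and> (\<forall>i<n. Q r i = poly (P r) (l i) * w i)"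
    proof -
      have "\<forall>r. \<exists>p. r \<le> s \<longrightarrow> degree p = r \<and> p \<noteq> 0 \<and> (\<forall>i<n. Q r i = poly p (l i) * w i)"
      proof
        fix r show "\<exists>p. r \<le> s \<longrightarrow> degree p = r \<and> p \<noteq> 0 \<and> (\<forall>i<n. Q r i = poly p (l i) * w i)"
          using less.IH[of r] less.prems 1 by (cases "r = s") (auto simp: Q_def)
      qed
      then show ?thesis by metis
    qed
    then obtain P where P: "\<And>r. r \<le> s \<Longrightarrow> degree (P r) = r" "\<And>r. r \<le> s \<Longrightarrow> P r \<noteq> 0"
      "\<And>r i. r \<le> s \<Longrightarrow> i < n \<Longrightarrow> Q r i = poly (P r) (l i) * w i" by blast
    define q where "q = [:0, 1:] * P s - (\<Sum>r\<le>s. Polynomial.smult (ent Q s r) (P r))"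
    have d1: "degree ([:0, 1:] * P s) = Suc s"
      using P(1,2)[of s] by (simp add: degree_mult_eq)
    have d2: "degree (\<Sum>r\<le>s. Polynomial.smult (ent Q s r) (P r)) \<le> s"
      using P(1) by (intro degree_sum_le) (auto intro: order_trans[OF degree_smult_le])
    have q0: "q \<noteq> 0"
    proof
      assume "q = 0"
      then have "[:0, 1:] * P s = (\<Sum>r\<le>s. Polynomial.smult (ent Q s r) (P r))" by (simp add: q_def)
      then show False using d1 d2 by (simp only:)
    qed
    have dq: "degree q \<le> Suc s" unfolding q_def using d1 d2 by (intro degree_diff_le) auto
    have rq: "residual Q s i = poly q (l i) * w i" if "i < n" for i
      unfolding residual_def q_def using P(3) that
      by (simp add: poly_sum algebra_simps sum_distrib_left)
    obtain i where i: "i < n" "poly q (l i) \<noteq> 0"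
    proof (rule ccontr)
      assume "\<not> thesis"
      then have "l ` {..<n} \<subseteq> {x. poly q x = 0}" using that by blast
      then have "card (l ` {..<n}) \<le> card {x. poly q x = 0}" using poly_roots_finite[OF q0] card_mono by blast
      also have "\<dots> \<le> Suc s" using poly_roots_degree[OF q0] dq by simp
      finally show False using card_image[OF inj_l] sn by simp
    qed
    then have "0 < (residual Q s i)\<^sup>2" using rq w(1) by simp
    also have "\<dots> \<le> (\<Sum>k<n. (residual Q s k)\<^sup>2)" using i(1) by (intro member_le_sum) auto
    finally show ?thesis .
  qed
  show ?case using 1 2 3 by (simp add: Q_def)
qed

lemma lanczos_tridiag:
  assumes w: "\<And>i. i < n \<Longrightarrow> w i \<noteq> 0" "(\<Sum>i<n. (w i)\<^sup>2) = 1"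
  shows "tridiag_frame (lanczos w)"
proof -
  define Q where "Q = lanczos w"
  note st = lanczos_step[OF w]
  have on: "(\<Sum>i<n. Q r i * Q r' i) = (if r = r' then 1 else 0)" if "r < n" "r' < n" for r r'
  proof (cases "r' \<le> r")
    case True
    then show ?thesis using st[of r] that by (auto simp: Q_def)
  next
    case False
    then have "(\<Sum>i<n. Q r' i * Q r i) = 0" using st[of r'] that by (auto simp: Q_def)
    then show ?thesis using False by (simp add: mult.commute)
  qed
  define N where "N s = sqrt (\<Sum>k<n. (residual Q s k)\<^sup>2)" for s
  have N: "N s > 0" if "Suc s < n" for s using st[of s] that by (simp add: N_def Q_def)
  have Qs: "residual Q s i = N s * Q (Suc s) i" if "Suc s < n" for s i
    using N[OF that] lanczos_Suc[of w s i] by (simp add: Q_def N_def)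
  have e: "ent Q s r = N s * (if r = Suc s then 1 else 0)" if "s < r" "r < n" for s r
  proof -
    have "ent Q s r = (\<Sum>i<n. (residual Q s i + (\<Sum>r'\<le>s. ent Q s r' * Q r' i)) * Q r i)"
      by (simp add: ent_def residual_def)
    also have "\<dots> = N s * (\<Sum>i<n. Q (Suc s) i * Q r i) + (\<Sum>i<n. (\<Sum>r'\<le>s. ent Q s r' * Q r' i) * Q r i)"
      using Qs[of s] that by (simp add: distrib_right sum.distrib sum_distrib_left mult.assoc)
    also have "(\<Sum>i<n. (\<Sum>r'\<le>s. ent Q s r' * Q r' i) * Q r i) = (\<Sum>r'\<le>s. ent Q s r' * (\<Sum>i<n. Q r' i * Q r i))"
      unfolding sum_distrib_left sum_distrib_right by (subst sum.swap) (simp add: mult.assoc)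
    also have "\<dots> = 0" using on that by (intro sum.neutral ballI) auto
    also have "(\<Sum>i<n. Q (Suc s) i * Q r i) = (if r = Suc s then 1 else 0)" using on that by auto
    finally show ?thesis by simp
  qed
  have "orthonormal_rows n n Q" using on by (simp add: orthonormal_rows_def)
  moreover have "0 \<le> ent Q s (Suc s)" if "Suc s < n" for s using e[of s "Suc s"] N[OF that] that by simp
  ultimately show ?thesis unfolding tridiag_frame_def Q_def[symmetric] using e by auto
qed

text \<open>The recurrence yields each row from the earlier ones, and a positive coupling must be
  the length of the residual.\<close>

lemma lanczos_unique:
  assumes Q: "tridiag_frame Q" and pos: "\<And>s. Suc s < n \<Longrightarrow> 0 < ent Q s (Suc s)"
    and w: "\<And>i. i < n \<Longrightarrow> Q 0 i = w i" and "s < n"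
  shows "\<forall>i<n. lanczos w s i = Q s i"
  using \<open>s < n\<close>
proof (induction s rule: less_induct)
  case (less s)
  show ?case
  proof (cases s)
    case 0
    then show ?thesis using w by simp
  next
    case (Suc t)
    have IH: "lanczos w r i = Q r i" if "r \<le> t" "i < n" for r i
      using less.IH[of r] less.prems Suc that by simp
    have e: "ent (lanczos w) t r = ent Q t r" if "r \<le> t" for r
      unfolding ent_def using IH that by (intro sum.cong) auto
    have r: "residual (lanczos w) t i = ent Q t (Suc t) * Q (Suc t) i" if "i < n" for i
      using ent_three_term[OF Q _ that, of t] less.prems Suc e IH that by (simp add: residual_def)
    have "(\<Sum>k<n. (residual (lanczos w) t k)\<^sup>2) = (ent Q t (Suc t))\<^sup>2 * (\<Sum>k<n. (Q (Suc t) k)\<^sup>2)"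
      unfolding sum_distrib_left by (intro sum.cong refl) (simp add: r power_mult_distrib)
    also have "\<dots> = (ent Q t (Suc t))\<^sup>2"
      using orthonormal_row_sq[OF tridiag_frame_orthonormal[OF Q], of "Suc t"] less.prems Suc by simp
    finally have "sqrt (\<Sum>k<n. (residual (lanczos w) t k)\<^sup>2) = ent Q t (Suc t)"
      using pos[of t] less.prems Suc by simp
    then show ?thesis
      using r pos[of t] less.prems Suc by (simp add: lanczos_Suc)
  qed
qed

lemma continuous_on_lanczos:
  assumes W: "\<And>x i. x \<in> S \<Longrightarrow> i < n \<Longrightarrow> W x i \<noteq> 0" "\<And>x. x \<in> S \<Longrightarrow> (\<Sum>i<n. (W x i)\<^sup>2) = 1"
    and c: "\<And>i. i < n \<Longrightarrow> continuous_on S (\<lambda>x. W x i)" and "s < n"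
  shows "\<forall>i<n. continuous_on S (\<lambda>x. lanczos (W x) s i)"
  using \<open>s < n\<close>
proof (induction s rule: less_induct)
  case (less s)
  show ?case
  proof (cases s)
    case 0
    then show ?thesis using c by simp
  next
    case (Suc t)
    have IH: "continuous_on S (\<lambda>x. lanczos (W x) r i)" if "r \<le> t" "i < n" for r i
      using less.IH[of r] less.prems Suc that by simp
    have r: "continuous_on S (\<lambda>x. residual (lanczos (W x)) t i)" if "i < n" for i
      unfolding residual_def ent_def using IH that by (intro continuous_intros) auto
    have "(\<Sum>k<n. (residual (lanczos (W x)) t k)\<^sup>2) > 0" if "x \<in> S" for x
      using lanczos_step[of "W x" t] W that less.prems Suc by auto
    then show ?thesis unfolding Suc lanczos_Suc
      using r by (intro allI impI continuous_intros) (auto simp: less_imp_neq[THEN not_sym])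
  qed
qed

text \<open>On the facet of \<open>A\<close> row 0 would vanish outside \<open>A\<close>.\<close>

lemma height_sum_gt:
  assumes Q: "orthonormal_rows n n Q" and nz: "\<And>i. i < n \<Longrightarrow> Q 0 i \<noteq> 0"
    and A: "A \<subset> {..<n}" "A \<noteq> {}"
  shows "real (card A) * (real (card A) - 1) / 2 < (\<Sum>i\<in>A. height Q i)"
proof (rule ccontr)
  assume "\<not> ?thesis"
  then have eq: "(\<Sum>i\<in>A. height Q i) = real (card A) * (real (card A) - 1) / 2"
    using height_sum_ge(1)[OF Q, of A] A by auto
  obtain i where i: "i < n" "i \<notin> A" using A by auto
  have "0 < card A" using A finite_subset[of A "{..<n}"] by (auto simp: card_gt_0_iff)
  then show False using height_sum_ge(2)[OF Q _ eq n_pos i(1)] A i nz[OF i(1)] by auto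
qed

text \<open>The interior of the permutohedron is connected, and the image of the open cell, which the
  Lanczos process parametrises by the weights, is open in it by invariance of domain and closed by
  compactness.\<close>

theorem height_surj:
  assumes tot: "(\<Sum>i<n. x i) = real n * (real n - 1) / 2"
    and ge: "\<And>A. A \<subseteq> {..<n} \<Longrightarrow> real (card A) * (real (card A) - 1) / 2 \<le> (\<Sum>i\<in>A. x i)"
  obtains Q where "Q \<in> frames" "\<And>i. i < n \<Longrightarrow> height Q i = x i"
proof -
  \<comment> \<open>Logarithms of the squared weights up to a common factor, normalised by a zero in
    the last place; in this form the parameter space is \<open>Euclidean_space (n - 1)\<close>, as
    invariance of domain demands.\<close>
  define S where "S = {y :: nat \<Rightarrow> real. \<forall>i\<ge>n - 1. y i = 0}"
  have Euc: "Euclidean_space (n - 1) = top_of_set S"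
    by (simp add: Euclidean_space_def S_def euclidean_product_topology)
  define W where "W y i = sqrt (exp (y i) / (\<Sum>k<n. exp (y k)))" for y :: "nat \<Rightarrow> real" and i
  have Z: "(\<Sum>k<n. exp (y k)) > 0" for y :: "nat \<Rightarrow> real"
    using n_pos by (intro sum_pos) auto
  have W2: "(W y i)\<^sup>2 = exp (y i) / (\<Sum>k<n. exp (y k))" for y i
    using Z[of y] by (simp add: W_def)
  have W0: "W y i \<noteq> 0" for y i using Z[of y] by (simp add: W_def)
  have W1: "(\<Sum>i<n. (W y i)\<^sup>2) = 1" for y
    unfolding W2 sum_divide_distrib[symmetric] using Z[of y] by simp
  have cW: "continuous_on T (\<lambda>y. W y i)" for T i
    unfolding W_def using Z
    by (intro continuous_intros continuous_on_product_then_coordinatewise[where f = "\<lambda>y. y", OF continuous_on_id])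
      (auto simp: less_imp_neq[THEN not_sym])
  \<comment> \<open>Heights have a fixed total, so dropping the last one loses nothing and gives
    source and target the same dimension.\<close>
  define \<pi> :: "(nat \<Rightarrow> real) \<Rightarrow> nat \<Rightarrow> real" where "\<pi> f = (\<lambda>i. if i < n - 1 then f i else 0)" for f
  have \<pi>S: "\<pi> f \<in> S" for f by (simp add: \<pi>_def S_def)
  have \<pi>_eq: "f i = g i" if "\<pi> f = \<pi> g" "(\<Sum>i<n. f i) = (\<Sum>i<n. g i)" "i < n" for f g i
  proof -
    have less: "f i = g i" if "i < n - 1" for i
      using fun_cong[OF \<open>\<pi> f = \<pi> g\<close>, of i] that by (simp add: \<pi>_def)
    obtain m where m: "n = Suc m" using n_pos by (cases n) auto
    then have "f m = g m" using that(2) less by simp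
    then show ?thesis using less that(3) m by (cases "i = m") auto
  qed
  define G where "G y = \<pi> (height (lanczos (W y)))" for y
  have tri: "tridiag_frame (lanczos (W y))" for y using W0 W1 by (rule lanczos_tridiag)
  have "continuous_on S G" unfolding G_def \<pi>_def
  proof (rule continuous_on_coordinatewise_then_product)
    fix i
    have "continuous_on S (\<lambda>y. lanczos (W y) s i)" if "s < n" "i < n" for s
      using continuous_on_lanczos[of S W s] W0 W1 cW that by blast
    then show "continuous_on S (\<lambda>y. if i < n - 1 then height (lanczos (W y)) i else 0)"
      unfolding height_def by (cases "i < n - 1") (auto intro!: continuous_intros)
  qed
  moreover have "G \<in> S \<rightarrow> S" using \<pi>S by (simp add: G_def)
  ultimately have "continuous_map (top_of_set S) (top_of_set S) G"
    by (simp add: continuous_map_in_subtopology)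
  then have cG: "continuous_map (subtopology (Euclidean_space (n - 1)) S) (Euclidean_space (n - 1)) G"
    unfolding Euc subtopology_subtopology by simp
  have injG: "inj_on G S"
  proof (rule inj_onI)
    fix y y' assume y: "y \<in> S" "y' \<in> S" "G y = G y'"
    have "height (lanczos (W y)) i = height (lanczos (W y')) i" if "i < n" for i
      by (rule \<pi>_eq[OF y(3)[unfolded G_def] _ that]) (simp add: height_total[OF tridiag_frame_orthonormal[OF tri]])
    from height_inj[OF tri tri this n_pos]
    have sq: "exp (y i) / (\<Sum>k<n. exp (y k)) = exp (y' i) / (\<Sum>k<n. exp (y' k))" if "i < n" for i
      using that W2 by simp
    have "y (n - 1) = 0" "y' (n - 1) = 0" using y by (auto simp: S_def)
    then have "(\<Sum>k<n. exp (y k)) = (\<Sum>k<n. exp (y' k))"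
      using sq[of "n - 1"] n_pos by simp
    then have "y i = y' i" if "i < n" for i using sq[OF that] Z[of y'] by simp
    then have "y i = y' i" for i using y by (cases "i < n") (auto simp: S_def)
    then show "y = y'" by blast
  qed
  have "openin (Euclidean_space (n - 1)) S" unfolding Euc by simp
  from invariance_of_domain_Euclidean_space[OF this cG injG]
  have openG: "openin (top_of_set S) (G ` S)" unfolding Euc .
  define C where "C = (\<lambda>Q. \<pi> (height Q)) ` frames"
  have "continuous_on frames (\<lambda>Q. \<pi> (height Q))" unfolding \<pi>_def
  proof (rule continuous_on_coordinatewise_then_product)
    show "continuous_on frames (\<lambda>Q. if i < n - 1 then height Q i else 0)" for i
      by (cases "i < n - 1") (auto intro: continuous_on_height)
  qed
  then have "compact C" unfolding C_def using compact_frames by (rule compact_continuous_image)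
  then have closedC: "closed C" by (rule compact_imp_closed)
  have hcong: "height (\<lambda>s i. if s < n \<and> i < n then Q s i else 0) i = height Q i" if "i < n" for Q i
    using that by (simp add: height_def)
  have GC: "G y \<in> C" for y
  proof -
    have eq: "\<pi> (height (\<lambda>s i. if s < n \<and> i < n then lanczos (W y) s i else 0)) = G y"
      unfolding G_def \<pi>_def by (rule ext, rule if_cong[OF refl _ refl], rule hcong) simp
    show ?thesis unfolding C_def
      by (rule image_eqI[where f = "\<lambda>Q. \<pi> (height Q)", OF eq[symmetric] frames_truncate[OF tri]])
  qed
  \<comment> \<open>The segment from the heights of the frame with equal weights to
    \<open>x\<close>. Before its end all facet inequalities are strict.\<close>
  define \<gamma> where "\<gamma> t i = (1 - t) * height (lanczos (W (\<lambda>_. 0))) i + t * x i" for t i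
  have \<gamma>tot: "(\<Sum>i<n. \<gamma> t i) = real n * (real n - 1) / 2" for t
    unfolding \<gamma>_def sum.distrib sum_distrib_left[symmetric] tot height_total[OF tridiag_frame_orthonormal[OF tri]]
      distrib_right[symmetric] by simp
  have \<gamma>gt: "real (card A) * (real (card A) - 1) / 2 < (\<Sum>i\<in>A. \<gamma> t i)"
    if A: "A \<subset> {..<n}" "A \<noteq> {}" and t: "0 \<le> t" "t < 1" for A t
  proof -
    define a where "a = real (card A) * (real (card A) - 1) / 2"
    have "lanczos (W (\<lambda>_. 0)) 0 i \<noteq> 0" for i using W0 by simp
    then have "a < (\<Sum>i\<in>A. height (lanczos (W (\<lambda>_. 0))) i)"
      unfolding a_def using A by (intro height_sum_gt[OF tridiag_frame_orthonormal[OF tri]]) auto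
    then have "(1 - t) * a < (1 - t) * (\<Sum>i\<in>A. height (lanczos (W (\<lambda>_. 0))) i)" using t by simp
    moreover have "t * a \<le> t * (\<Sum>i\<in>A. x i)" unfolding a_def using ge[of A] A t by (intro mult_left_mono) auto
    moreover have "(\<Sum>i\<in>A. \<gamma> t i) = (1 - t) * (\<Sum>i\<in>A. height (lanczos (W (\<lambda>_. 0))) i) + t * (\<Sum>i\<in>A. x i)"
      unfolding \<gamma>_def sum.distrib sum_distrib_left ..
    moreover have "(1 - t) * a + t * a = a" by (simp add: algebra_simps)
    ultimately show ?thesis unfolding a_def by linarith
  qed
  \<comment> \<open>A frame over a point with strict inequalities has no cut. Hence its couplings
    are positive and its first row has no zeros; after changes of sign in the columns it is the
    Lanczos frame of its first row.\<close>
  have CG: "\<pi> (\<gamma> t) \<in> G ` S" if C: "\<pi> (\<gamma> t) \<in> C" and t: "0 \<le> t" "t < 1" for t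
  proof -
    obtain Q where Q: "Q \<in> frames" "\<pi> (\<gamma> t) = \<pi> (height Q)" using C by (auto simp: C_def)
    have QT: "tridiag_frame Q" using Q(1) by (simp add: frames_def)
    note QO = tridiag_frame_orthonormal[OF QT]
    have hQ: "height Q i = \<gamma> t i" if "i < n" for i
      by (rule \<pi>_eq[OF Q(2)[symmetric] _ that]) (simp add: \<gamma>tot height_total[OF QO])
    have pos: "0 < ent Q s (Suc s)" if s: "Suc s < n" for s
    proof (rule ccontr)
      assume "\<not> 0 < ent Q s (Suc s)"
      then have ez: "ent Q (Suc s - 1) (Suc s) = 0" using QT s by (force simp: tridiag_frame_def)
      obtain A where A: "A \<subseteq> {..<n}" "card A = Suc s"
        "(\<Sum>i\<in>A. height Q i) = real (Suc s) * (real (Suc s) - 1) / 2"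
      proof (rule block_of_ent_zero[OF QO, of "Suc s"])
        show "Suc s \<le> n" using s by simp
      qed (use tridiag_cut[OF QT _ s ez] in auto)
      have "A \<noteq> {..<n}" using A(2) s by auto
      moreover have "(\<Sum>i\<in>A. height Q i) = (\<Sum>i\<in>A. \<gamma> t i)" using A(1) hQ by (intro sum.cong) auto
      moreover have "A \<subset> {..<n}" "A \<noteq> {}" using A(1,2) \<open>A \<noteq> {..<n}\<close> by auto
      from \<gamma>gt[OF this t] have "real (Suc s) * (real (Suc s) - 1) / 2 < (\<Sum>i\<in>A. \<gamma> t i)"
        by (simp only: A(2))
      ultimately show False using A(3) by linarith
    qed
    have nz: "Q 0 i \<noteq> 0" if i: "i < n" for i
    proof -
      have "first_site Q i = 0"
      proof (rule ccontr)
        assume "first_site Q i \<noteq> 0"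
        then have p: "0 < first_site Q i" by simp
        then have "ent Q (first_site Q i - 1) (first_site Q i) = 0" by (rule first_site_cut[OF QT i])
        then show False using pos[of "first_site Q i - 1"] first_site(1)[OF QO i] p by simp
      qed
      then show ?thesis using first_site(2)[OF QO i] by simp
    qed
    define P where "P s i = sgn (Q 0 i) * Q s i" for s i
    have PP: "P s i * P r i = Q s i * Q r i" if "i < n" for s r i
      using nz[OF that] by (auto simp: P_def sgn_if)
    have eP: "ent P s r = ent Q s r" for s r
      unfolding ent_def mult.assoc using PP by (intro sum.cong) auto
    have PT: "tridiag_frame P" using QT PP by (simp add: tridiag_frame_def eP orthonormal_rows_def)
    define y where "y i = (if i < n - 1 then ln ((Q 0 i)\<^sup>2 / (Q 0 (n - 1))\<^sup>2) else 0)" for i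
    have nn: "Q 0 (n - 1) \<noteq> 0" using nz n_pos by simp
    have ey: "exp (y i) = (Q 0 i)\<^sup>2 / (Q 0 (n - 1))\<^sup>2" if "i < n" for i
    proof (cases "i < n - 1")
      case True
      then show ?thesis using nz[OF that] nn by (simp add: y_def)
    next
      case False
      then have "i = n - 1" using that by simp
      then show ?thesis using nn by (simp add: y_def)
    qed
    have "(\<Sum>k<n. exp (y k)) = (\<Sum>k<n. (Q 0 k)\<^sup>2) / (Q 0 (n - 1))\<^sup>2"
      unfolding sum_divide_distrib using ey by (intro sum.cong) auto
    then have "(\<Sum>k<n. exp (y k)) = 1 / (Q 0 (n - 1))\<^sup>2" using orthonormal_row_sq[OF QO n_pos] by simp
    then have Wy: "P 0 i = W y i" if "i < n" for i
      using ey[OF that] nn nz[OF that] by (simp add: W_def P_def abs_sgn[symmetric] mult.commute)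
    have "lanczos (W y) s i = P s i" if "s < n" "i < n" for s i
      using lanczos_unique[OF PT _ Wy] pos that by (simp add: eP)
    then have "height (lanczos (W y)) i = height Q i" if "i < n" for i
      unfolding height_def using that PP[of i] by (simp add: power2_eq_square)
    then have "G y = \<pi> (height Q)" unfolding G_def \<pi>_def by auto
    moreover have "y \<in> S" by (simp add: y_def S_def)
    ultimately show ?thesis unfolding Q(2) by (intro image_eqI[where f = G and x = y]) (simp_all only:)
  qed
  have c\<gamma>: "continuous_on T (\<lambda>t. \<pi> (\<gamma> t))" for T unfolding \<pi>_def
  proof (rule continuous_on_coordinatewise_then_product)
    show "continuous_on T (\<lambda>t. if i < n - 1 then \<gamma> t i else 0)" for i
      unfolding \<gamma>_def by (cases "i < n - 1") (auto intro!: continuous_intros)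
  qed
  \<comment> \<open>Open by invariance of domain, and closed because for \<open>t < 1\<close>
    membership in the image of the cell is the same as membership in the compact set
    \<open>C\<close>.\<close>
  define T where "T = {0..<1} \<inter> (\<lambda>t. \<pi> (\<gamma> t)) -` (G ` S)"
  have "openin (top_of_set {0..<1}) T"
    unfolding T_def using c\<gamma> \<pi>S openG by (intro continuous_openin_preimage) auto
  moreover have "T = {0..<1} \<inter> (\<lambda>t. \<pi> (\<gamma> t)) -` C" unfolding T_def using CG GC by auto
  then have "closedin (top_of_set {0..<1}) T"
    using c\<gamma> closedC by (simp add: continuous_closedin_preimage)
  moreover have "T \<noteq> {}"
  proof -
    have "\<gamma> 0 = height (lanczos (W (\<lambda>_. 0)))" by (rule ext) (simp add: \<gamma>_def)
    then have "\<pi> (\<gamma> 0) = G (\<lambda>_. 0)" by (simp add: G_def)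
    then have "0 \<in> T" by (auto simp: T_def S_def)
    then show ?thesis by blast
  qed
  moreover have "connected {0..<1::real}" by simp
  ultimately have "T = {0..<1}" unfolding connected_clopen by blast
  then have "{0..<1} \<subseteq> {0..1} \<inter> (\<lambda>t. \<pi> (\<gamma> t)) -` C" unfolding T_def using GC by auto
  moreover have "closed ({0..1} \<inter> (\<lambda>t. \<pi> (\<gamma> t)) -` C)"
    using c\<gamma> closedC by (intro continuous_closed_preimage) auto
  ultimately have "closure {0..<1} \<subseteq> {0..1} \<inter> (\<lambda>t. \<pi> (\<gamma> t)) -` C" by (rule closure_minimal)
  then have "\<pi> (\<gamma> 1) \<in> C" by (simp add: closure_atLeastLessThan subset_iff)
  then obtain Q where Q: "Q \<in> frames" "\<pi> (\<gamma> 1) = \<pi> (height Q)" by (auto simp: C_def)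
  have "orthonormal_rows n n Q" using Q(1) by (simp add: frames_def tridiag_frame_def)
  then have "height Q i = x i" if "i < n" for i
    using \<pi>_eq[OF Q(2) _ that] \<gamma>tot[of 1] height_total[of Q] by (simp add: \<gamma>_def)
  then show ?thesis using Q(1) that by blast
qed

end


section \<open>Cyclic shifts of the permutohedron and the fibre over zero\<close>

lemma mod_Suc_shift: "(Suc j mod n + m) mod n = Suc ((j + m) mod n) mod n"
  by (simp only: mod_add_left_eq mod_Suc_eq add_Suc)

lemma mod_shift_back:
  fixes k n s :: nat
  assumes "k \<le> n" "s < n"
  shows "((s + k) mod n + (n - k)) mod n = s"
proof -
  have "((s + k) mod n + (n - k)) mod n = (s + k + (n - k)) mod n" by (rule mod_add_left_eq)
  also have "s + k + (n - k) = s + n" using assms by simp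
  finally show ?thesis using assms by simp
qed

lemma mod_shift_forth:
  fixes k n s :: nat
  assumes "k \<le> n" "s < n"
  shows "((s + (n - k)) mod n + k) mod n = s"
  using mod_shift_back[of "n - k" n s] assms by simp

lemma bij_betw_mod_shift:
  fixes n k :: nat
  assumes "k \<le> n" "0 < n"
  shows "bij_betw (\<lambda>s. (s + k) mod n) {..<n} {..<n}"
  using assms mod_shift_back[of k n] mod_shift_forth[of k n]
  by (intro bij_betwI[of _ _ _ "\<lambda>s. (s + (n - k)) mod n"]) auto

lemma sum_mod_shift:
  fixes f :: "nat \<Rightarrow> 'a::comm_monoid_add" and n k :: nat
  assumes "k \<le> n" "0 < n"
  shows "(\<Sum>s<n. f ((s + k) mod n)) = (\<Sum>s<n. f s)"
  by (rule sum.reindex_bij_betw[OF bij_betw_mod_shift[OF assms]])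

lemma card_times_sum_squares:
  fixes c :: "nat \<Rightarrow> real"
  shows "(\<Sum>i<n. \<Sum>j<n. (c i - c j)\<^sup>2) = 2 * (real n * (\<Sum>i<n. (c i)\<^sup>2) - (\<Sum>i<n. c i)\<^sup>2)"
proof -
  have "(\<Sum>i<n. \<Sum>j<n. (c i - c j)\<^sup>2) = (\<Sum>i<n. \<Sum>j<n. (c i)\<^sup>2 + (c j)\<^sup>2 - 2 * (c i * c j))"
    by (intro sum.cong refl) (simp add: power2_eq_square algebra_simps)
  also have "\<dots> = (\<Sum>i<n. real n * (c i)\<^sup>2) + real n * (\<Sum>j<n. (c j)\<^sup>2) - 2 * (\<Sum>i<n. \<Sum>j<n. c i * c j)"
    by (simp add: sum.distrib sum_subtractf sum_distrib_left)
  also have "(\<Sum>i<n. \<Sum>j<n. c i * c j) = (\<Sum>i<n. c i)\<^sup>2"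
    by (simp add: power2_eq_square sum_product)
  finally show ?thesis by (simp add: sum_distrib_left[symmetric])
qed

text \<open>Translates of the permutohedron tile the hyperplane: a point of smallest variance in its
  class modulo \<open>n\<int>\<^sup>n\<close> cannot be improved by adding \<open>n\<close> on a subset \<open>A\<close>, which is the
  permutohedral inequality for \<open>A\<close>.\<close>

lemma permutohedral_representative:
  fixes x :: "nat \<Rightarrow> real"
  assumes n: "0 < n" and tot: "(\<Sum>i<n. x i) = real n * (real n - 1) / 2"
  obtains v :: "nat \<Rightarrow> int" and k :: nat where "k < n" "(\<Sum>i<n. v i) = int k"
    "\<And>A. A \<subseteq> {..<n} \<Longrightarrow>
       real k * real (card A) + real (card A) * (real (card A) - 1) / 2 \<le> (\<Sum>i\<in>A. x i + real n * of_int (v i))"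
proof -
  define c where "c v i = x i + real n * of_int (v i)" for v :: "nat \<Rightarrow> int" and i
  define V where "V v = (\<Sum>i<n. \<Sum>j<n. (c v i - c v j)\<^sup>2)" for v
  \<comment> \<open>The variance does not see a common integer added to all coordinates, so
    \<open>v 0 = 0\<close> may be imposed; the competitors that are no worse than zero then form a
    finite set.\<close>
  define S where "S = {v. v 0 = 0 \<and> (\<forall>i\<ge>n. v i = 0) \<and> V v \<le> V (\<lambda>_. 0)}"
  define B where "B = nat \<lceil>\<Sum>i<n. sqrt (V (\<lambda>_. 0)) + \<bar>x i - x 0\<bar>\<rceil>"
  have bound: "\<bar>v i\<bar> \<le> int B" if v: "v \<in> S" and i: "i < n" for v i
  proof -
    have "(c v i - c v 0)\<^sup>2 \<le> (\<Sum>j<n. (c v i - c v j)\<^sup>2)" using n by (intro member_le_sum) auto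
    also have "\<dots> \<le> V v" unfolding V_def
      using i by (intro member_le_sum[of i _ "\<lambda>i. \<Sum>j<n. (c v i - c v j)\<^sup>2"]) (auto intro: sum_nonneg)
    also have "\<dots> \<le> V (\<lambda>_. 0)" using v by (simp add: S_def)
    finally have "\<bar>c v i - c v 0\<bar> \<le> sqrt (V (\<lambda>_. 0))" by (metis real_sqrt_le_iff real_sqrt_abs)
    moreover have "c v i - c v 0 = real n * of_int (v i) + (x i - x 0)" using v by (simp add: c_def S_def)
    ultimately have "\<bar>real n * of_int (v i)\<bar> \<le> sqrt (V (\<lambda>_. 0)) + \<bar>x i - x 0\<bar>" by linarith
    moreover have "1 * \<bar>of_int (v i) :: real\<bar> \<le> real n * \<bar>of_int (v i)\<bar>"
      using n by (intro mult_right_mono) auto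
    ultimately have "\<bar>of_int (v i) :: real\<bar> \<le> sqrt (V (\<lambda>_. 0)) + \<bar>x i - x 0\<bar>" by (simp add: abs_mult)
    also have "\<dots> \<le> (\<Sum>i<n. sqrt (V (\<lambda>_. 0)) + \<bar>x i - x 0\<bar>)"
      using i by (intro member_le_sum[of i _ "\<lambda>i. sqrt (V (\<lambda>_. 0)) + \<bar>x i - x 0\<bar>"])
        (auto simp: V_def intro!: add_nonneg_nonneg sum_nonneg)
    also have "\<dots> \<le> real B" unfolding B_def by linarith
    finally show ?thesis by linarith
  qed
  have "S \<subseteq> {v. \<forall>i. (i \<in> {..<n} \<longrightarrow> v i \<in> {- int B..int B}) \<and> (i \<notin> {..<n} \<longrightarrow> v i = 0)}"
    using bound by (force simp: S_def abs_le_iff)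
  moreover have "finite \<dots>" by (rule finite_set_of_finite_funs) auto
  ultimately have "finite S" by (rule finite_subset)
  moreover have "(\<lambda>_. 0) \<in> S" by (simp add: S_def)
  ultimately obtain w where w: "is_arg_min V (\<lambda>v. v \<in> S) w" using ex_is_arg_min_if_finite by blast
  have wS: "w \<in> S" using w by (simp add: is_arg_min_def)
  have minS: "V w \<le> V v" if "v \<in> S" for v using w that by (force simp: is_arg_min_def)
  have min: "V w \<le> V v" for v
  proof -
    define v' where "v' i = (if i < n then v i - v 0 else 0)" for i
    have "V v' = V v" unfolding V_def
      by (intro sum.cong refl) (simp add: c_def v'_def algebra_simps)
    moreover have "V w \<le> V v'"
    proof (cases "V v' \<le> V (\<lambda>_. 0)")
      case True
      then show ?thesis using n by (intro minS) (auto simp: S_def v'_def)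
    next
      case False
      then show ?thesis using wS by (simp add: S_def)
    qed
    ultimately show ?thesis by simp
  qed
  define k0 where "k0 = (\<Sum>i<n. w i)"
  have sc: "(\<Sum>i<n. c w i) = real n * ((real n - 1) / 2 + of_int k0)"
    unfolding c_def k0_def sum.distrib sum_distrib_left[symmetric] tot by (simp add: algebra_simps)
  have ineq: "of_int k0 * real (card A) + real (card A) * (real (card A) - 1) / 2 \<le> (\<Sum>i\<in>A. c w i)"
    if A: "A \<subseteq> {..<n}" for A
  proof -
    define v where "v i = w i + (if i \<in> A then 1 else 0)" for i
    define p where "p = real (card A)"
    have cv: "c v i = c w i + (if i \<in> A then real n else 0)" for i by (simp add: c_def v_def algebra_simps)
    have sA: "(\<Sum>i<n. if i \<in> A then f i else 0) = (\<Sum>i\<in>A. f i)" for f :: "nat \<Rightarrow> real"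
      using A by (simp add: sum.If_cases Int_absorb1)
    have s1: "(\<Sum>i<n. c v i) = (\<Sum>i<n. c w i) + real n * p"
      unfolding cv sum.distrib sA by (simp add: p_def)
    have "(\<Sum>i<n. (c v i)\<^sup>2) = (\<Sum>i<n. (c w i)\<^sup>2 + (if i \<in> A then 2 * real n * c w i + (real n)\<^sup>2 else 0))"
      by (intro sum.cong refl) (simp add: cv power2_eq_square algebra_simps)
    then have s2: "(\<Sum>i<n. (c v i)\<^sup>2) = (\<Sum>i<n. (c w i)\<^sup>2) + (2 * real n * (\<Sum>i\<in>A. c w i) + (real n)\<^sup>2 * p)"
      unfolding sum.distrib sA by (simp add: sum.distrib sum_distrib_left p_def)
    have "0 \<le> V v - V w" using min by simp
    also have "V v - V w = 2 * (real n * (2 * real n * (\<Sum>i\<in>A. c w i) + (real n)\<^sup>2 * p)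
        - (2 * (\<Sum>i<n. c w i) * (real n * p) + (real n * p)\<^sup>2))"
      unfolding V_def card_times_sum_squares s1 s2 by (simp add: power2_sum algebra_simps)
    also have "\<dots> = 4 * (real n)\<^sup>2 * ((\<Sum>i\<in>A. c w i) - (of_int k0 * p + p * (p - 1) / 2))"
      unfolding sc by (simp add: power2_eq_square field_simps)
    finally show ?thesis using n by (simp add: zero_le_mult_iff p_def)
  qed
  \<comment> \<open>Adding \<open>q\<close> everywhere brings the total into the range from
    \<open>0\<close> to \<open>n - 1\<close>; the result \<open>k\<close> is the number of the tile,
    that is, of the cut.\<close>
  define q where "q = - (k0 div int n)"
  define k where "k = nat (k0 mod int n)"
  have k: "int k = k0 + int n * q" 
  proof -
    have "int k = k0 mod int n" using n by (simp add: k_def)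
    then show ?thesis by (simp add: q_def minus_mult_div_eq_mod)
  qed
  have kn: "k < n" using n by (simp add: k_def nat_less_iff)
  show ?thesis
  proof (rule that[OF kn, of "\<lambda>i. w i + q"])
    show "(\<Sum>i<n. w i + q) = int k" by (simp add: sum.distrib k k0_def)
    fix A assume A: "A \<subseteq> {..<n}"
    have "real k = of_int (int k)" by simp
    also have "\<dots> = of_int k0 + real n * of_int q" unfolding k by simp
    finally have "real k = of_int k0 + real n * of_int q" .
    moreover have "(\<Sum>i\<in>A. x i + real n * of_int (w i + q)) = (\<Sum>i\<in>A. c w i) + real n * of_int q * real (card A)"
      by (simp add: c_def sum.distrib algebra_simps sum_distrib_left)
    ultimately show "real k * real (card A) + real (card A) * (real (card A) - 1) / 2
        \<le> (\<Sum>i\<in>A. x i + real n * of_int (w i + q))"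
      using ineq[OF A] by (simp add: algebra_simps)
  qed
qed

text \<open>Made for a congruence summed over the \<open>p\<close> indices where the lattice
  coordinate takes its extreme value \<open>M\<close>: the permutohedral bounds for \<open>S\<close>
  and \<open>S'\<close> leave a slack of \<open>p * (n - p)\<close>, and division by
  \<open>p\<close> bounds \<open>M\<close>.\<close>

lemma tile_difference_le:
  fixes p n d S S' M :: real
  assumes "p * d + S' - S = n * M * p" "S' \<le> p * (n - p) + p * (p - 1) / 2" "p * (p - 1) / 2 \<le> S" "0 < p"
  shows "n * M \<le> d + (n - p)"
proof -
  have "p * (n * M) = p * d + S' - S" using assms(1) by (simp add: mult_ac)
  also have "\<dots> \<le> p * d + p * (n - p)" using assms(2,3) by linarith
  also have "\<dots> = p * (d + (n - p))" by (simp only: distrib_left)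
  finally show ?thesis using assms(4) by simp
qed

lemma cis_eq_iff_Ints: "cis (2 * pi * x) = cis (2 * pi * y) \<longleftrightarrow> x - y \<in> \<int>"
proof -
  have "cis (2 * pi * x) = cis (2 * pi * y) \<longleftrightarrow> cis (2 * pi * (x - y)) = 1"
    by (simp add: right_diff_distrib cis_divide[symmetric])
  also have "\<dots> \<longleftrightarrow> cos (2 * pi * (x - y)) = 1"
    by (auto simp: complex_eq_iff sin_cos_eq_iff cos_one_sin_zero)
  also have "\<dots> \<longleftrightarrow> x - y \<in> \<int>"
  proof
    assume "cos (2 * pi * (x - y)) = 1"
    then obtain m :: int where "2 * pi * (x - y) = of_int m * 2 * pi" unfolding cos_one_2pi_int ..
    then have "2 * pi * (x - y - of_int m) = 0" by (simp add: algebra_simps)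
    then have "x - y = of_int m" by simp
    then show "x - y \<in> \<int>" by simp
  next
    assume "x - y \<in> \<int>"
    then obtain m :: int where "x - y = of_int m" by (rule Ints_cases)
    then have "2 * pi * (x - y) = of_int m * 2 * pi" by simp
    then show "cos (2 * pi * (x - y)) = 1" unfolding cos_one_2pi_int by blast
  qed
  finally show ?thesis .
qed

context simple_spectrum
begin

section \<open>Jacobi matrices placed on the cycle\<close>

text \<open>Site \<open>s\<close> of the Jacobi matrix goes to position \<open>s + k\<close> of the
  cycle, so the missing coupling is the one that enters position \<open>k\<close>; adding
  \<open>n - k\<close> is subtracting \<open>k\<close> modulo \<open>n\<close>.\<close>

definition cyc :: "nat \<Rightarrow> (nat \<Rightarrow> nat \<Rightarrow> real) \<Rightarrow> nat \<Rightarrow> nat \<Rightarrow> real" where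
  "cyc k Q j = Q ((j + (n - k)) mod n)"

lemma ent_cyc: "ent (cyc k Q) j m = ent Q ((j + (n - k)) mod n) ((m + (n - k)) mod n)"
  by (simp add: ent_def cyc_def)

lemma orthonormal_cyc:
  assumes "orthonormal_rows n n Q" "k \<le> n"
  shows "orthonormal_rows n n (cyc k Q)"
proof -
  show ?thesis unfolding orthonormal_rows_def
  proof (intro allI impI)
    fix a b assume ab: "a < n" "b < n"
    have "(a + (n - k)) mod n = (b + (n - k)) mod n \<longleftrightarrow> a = b"
      using mod_shift_forth[OF assms(2) ab(1)] mod_shift_forth[OF assms(2) ab(2)] by metis
    then show "(\<Sum>s<n. cyc k Q a s * cyc k Q b s) = (if a = b then 1 else 0)"
      using orthonormal_rowsD[OF assms(1), of "(a + (n - k)) mod n" "(b + (n - k)) mod n"] n_pos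
      by (simp add: cyc_def)
  qed
qed

lemma tridiag_ent_cases:
  assumes Q: "tridiag_frame Q" and n: "3 \<le> n" and "s < n" "r < n"
    "r \<noteq> s" "r \<noteq> Suc s mod n" "s \<noteq> Suc r mod n"
  shows "ent Q s r = 0"
proof -
  have "Suc s < r \<or> Suc r < s" using assms by (auto simp: mod_Suc split: if_splits)
  then show ?thesis using Q assms ent_sym[of Q s r] by (auto simp: tridiag_frame_def)
qed

lemma cyc_entries:
  assumes Q: "tridiag_frame Q" and n: "3 \<le> n" and k: "k < n" and j: "j < n" "m < n"
  shows "ent (cyc k Q) j m = (if m = j then ent (cyc k Q) j j else if m = Suc j mod n then ent (cyc k Q) j (Suc j mod n)
     else if j = Suc m mod n then ent (cyc k Q) m (Suc m mod n) else 0)"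
proof -
  have inj: "i = i'" if "(i + (n - k)) mod n = (i' + (n - k)) mod n" "i < n" "i' < n" for i i'
    using arg_cong[OF that(1), of "\<lambda>x. (x + k) mod n"]
    unfolding mod_shift_forth[OF less_imp_le[OF k] that(2)] mod_shift_forth[OF less_imp_le[OF k] that(3)] .
  consider "m = j" | "m \<noteq> j" "m = Suc j mod n" | "m \<noteq> j" "m \<noteq> Suc j mod n" "j = Suc m mod n"
    | "m \<noteq> j" "m \<noteq> Suc j mod n" "j \<noteq> Suc m mod n" by blast
  then show ?thesis
  proof cases
    case 3
    then show ?thesis using ent_sym[of "cyc k Q" j m] by simp
  next
    case 4
    define s where "s = (j + (n - k)) mod n"
    define r where "r = (m + (n - k)) mod n"
    have "s < n" "r < n" using n by (auto simp: s_def r_def)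
    moreover have "r \<noteq> s" unfolding s_def r_def using 4 inj j by blast
    moreover have "r \<noteq> Suc s mod n"
      unfolding s_def r_def mod_Suc_shift[symmetric] using 4 inj[of m "Suc j mod n"] j n by auto
    moreover have "s \<noteq> Suc r mod n"
      unfolding s_def r_def mod_Suc_shift[symmetric] using 4 inj[of j "Suc m mod n"] j n by auto
    ultimately have "ent Q s r = 0" by (intro tridiag_ent_cases[OF Q n]) auto
    then show ?thesis using 4 by (simp add: ent_cyc s_def r_def)
  qed auto
qed

lemma cyc_superdiag_nonneg:
  assumes Q: "tridiag_frame Q" and n: "3 \<le> n" and k: "k < n" "j < n"
  shows "0 \<le> ent (cyc k Q) j (Suc j mod n)"
    "j = (n - 1 + k) mod n \<Longrightarrow> ent (cyc k Q) j (Suc j mod n) = 0"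
proof -
  define s where "s = (j + (n - k)) mod n"
  have sn: "s < n" using n by (simp add: s_def)
  have e: "ent (cyc k Q) j (Suc j mod n) = ent Q s (Suc s mod n)"
    unfolding ent_cyc mod_Suc_shift s_def ..
  have z: "ent Q (n - 1) 0 = 0" using Q n ent_sym[of Q 0 "n - 1"] by (simp add: tridiag_frame_def)
  show "0 \<le> ent (cyc k Q) j (Suc j mod n)"
  proof (cases "Suc s < n")
    case False
    then have "Suc s = n" using sn by simp
    then have "s = n - 1" "Suc s mod n = 0" by auto
    then show "0 \<le> ent (cyc k Q) j (Suc j mod n)" unfolding e using z by simp
  qed (use Q in \<open>simp add: e tridiag_frame_def\<close>)
  assume "j = (n - 1 + k) mod n"
  then have "s = n - 1" using mod_shift_back[of k n "n - 1"] k n by (simp add: s_def)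
  then show "ent (cyc k Q) j (Suc j mod n) = 0" unfolding e using z n by simp
qed

text \<open>Read on the cycle, the weight of a position is its number counted upward from the cut
  \<open>k\<close>, without reduction modulo \<open>n\<close>. Moving the cut to a later
  \<open>k'\<close> therefore raises the weights of the positions from \<open>k\<close> to
  \<open>k' - 1\<close> by \<open>n\<close> and keeps the others.\<close>

lemma cyc_height:
  assumes O: "orthonormal_rows n n Q" and k: "k < n" and i: "i < n"
  shows "real k + height Q i = (\<Sum>j<n. real (if k \<le> j then j else j + n) * (cyc k Q j i)\<^sup>2)"
proof -
  define d where "d j = (if k \<le> j then j else j + n)" for j
  have "real k + height Q i = (\<Sum>s<n. real (s + k) * (Q s i)\<^sup>2)"
    using orthonormal_col_sq[OF O i]
    by (simp add: height_def distrib_right sum.distrib sum_distrib_left[symmetric] add.commute)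
  also have "\<dots> = (\<Sum>s<n. real (d ((s + k) mod n)) * (cyc k Q ((s + k) mod n) i)\<^sup>2)"
  proof (intro sum.cong refl)
    fix s assume s: "s \<in> {..<n}"
    have "d ((s + k) mod n) = s + k"
    proof (cases "s + k < n")
      case False
      then have "(s + k) mod n = s + k - n" using s k by (simp add: mod_if)
      then show ?thesis using False s k by (simp add: d_def)
    qed (simp add: d_def)
    moreover have "cyc k Q ((s + k) mod n) = Q s"
      using mod_shift_back[of k n s] s k by (simp add: cyc_def)
    ultimately show "real (s + k) * (Q s i)\<^sup>2 = real (d ((s + k) mod n)) * (cyc k Q ((s + k) mod n) i)\<^sup>2"
      by simp
  qed
  also have "\<dots> = (\<Sum>j<n. real (d j) * (cyc k Q j i)\<^sup>2)"
    using sum_mod_shift[of k n "\<lambda>j. real (d j) * (cyc k Q j i)\<^sup>2"] k by simp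
  finally show ?thesis by (simp add: d_def)
qed

text \<open>If one cyclic matrix is cut at \<open>k\<close> and at \<open>k'\<close>, the shifted
  heights differ by \<open>n\<close> times the mass of column \<open>i\<close> on the sites between
  the cuts. Those sites form a block, so the mass is 0 or 1.\<close>

lemma cyc_same_imp_height_cong:
  assumes Q: "tridiag_frame Q" and Q': "tridiag_frame Q'" and n: "3 \<le> n" and k: "k \<le> k'" "k' < n"
    and eq: "\<And>j m. j < n \<Longrightarrow> m < n \<Longrightarrow> ent (cyc k Q) j m = ent (cyc k' Q') j m" and i: "i < n"
  shows "(real k' + height Q' i) - (real k + height Q i) \<in> {0, real n}"
proof (cases "k = k'")
  case True
  have "(cyc k Q j i)\<^sup>2 = (cyc k' Q' j i)\<^sup>2" if "j < n" for j
    using that i eq k by (intro squares_determined_by_ent orthonormal_cyc tridiag_frame_orthonormal Q Q') auto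
  then show ?thesis
    using cyc_height[OF tridiag_frame_orthonormal[OF Q] _ i, of k] True k
      cyc_height[OF tridiag_frame_orthonormal[OF Q'] _ i, of k'] by simp
next
  case False
  note O = tridiag_frame_orthonormal[OF Q] and O' = tridiag_frame_orthonormal[OF Q']
  define p where "p = k' - k"
  have p: "0 < p" "p < n" "k' = k + p" using False k by (auto simp: p_def)
  have sq: "(cyc k Q j i)\<^sup>2 = (cyc k' Q' j i)\<^sup>2" if "j < n" for j
    using that i eq k by (intro squares_determined_by_ent orthonormal_cyc O O') auto
  have "(real k' + height Q' i) - (real k + height Q i) =
     (\<Sum>j<n. (real (if k' \<le> j then j else j + n) - real (if k \<le> j then j else j + n)) * (cyc k Q j i)\<^sup>2)"
    using cyc_height[OF O _ i, of k] cyc_height[OF O' _ i, of k'] sq k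
    by (simp add: left_diff_distrib sum_subtractf)
  also have "\<dots> = (\<Sum>j<n. if j \<in> {k..<k'} then real n * (cyc k Q j i)\<^sup>2 else 0)"
    using k by (intro sum.cong refl) auto
  also have "\<dots> = (\<Sum>j\<in>{k..<k'}. real n * (cyc k Q j i)\<^sup>2)"
    using k by (intro sum.inter_restrict[symmetric, THEN trans[OF _ sum.cong]]) auto
  also have "\<dots> = real n * (\<Sum>j\<in>{k..<k'}. (cyc k Q j i)\<^sup>2)" by (simp add: sum_distrib_left)
  also have "(\<Sum>j\<in>{k..<k'}. (cyc k Q j i)\<^sup>2) = (\<Sum>s<p. (Q s i)\<^sup>2)"
  proof (rule sum.reindex_bij_witness[of _ "\<lambda>s. s + k" "\<lambda>j. j - k"])
    fix j assume j: "j \<in> {k..<k'}"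
    then have jk: "j - k < n" "j - k + k = j" "j < n" "k \<le> n" using k by auto
    have "(j + (n - k)) mod n = j - k"
      using mod_shift_back[OF jk(4,1)] unfolding jk(2) by (simp only: mod_less[OF jk(3)])
    then show "(Q (j - k) i)\<^sup>2 = (cyc k Q j i)\<^sup>2" by (simp add: cyc_def)
  qed (use p in auto)
  finally have main: "(real k' + height Q' i) - (real k + height Q i) = real n * (\<Sum>s<p. (Q s i)\<^sup>2)" .
  have "ent Q (p - 1) p = 0"
  proof -
    have "(n - 1 + k') mod n = k' - 1"
    proof -
      have "n - 1 + k' = k' - 1 + n" using p n_pos by simp
      then have "(n - 1 + k') mod n = (k' - 1) mod n" by (simp only: mod_add_self2)
      then show ?thesis using k by simp
    qed
    then have "ent (cyc k' Q') (k' - 1) (Suc (k' - 1) mod n) = 0"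
      using k p by (intro cyc_superdiag_nonneg(2)[OF Q' n]) auto
    then have "ent (cyc k Q) (k' - 1) k' = 0" using eq[of "k' - 1" k'] p k by simp
    moreover have "(k' - 1 + (n - k)) mod n = p - 1" "(k' + (n - k)) mod n = p"
      using mod_shift_back[of k n "p - 1"] mod_shift_back[of k n p] p k by (auto simp: add.commute)
    ultimately show ?thesis by (simp add: ent_cyc)
  qed
  note cut = tridiag_cut[OF Q p(1,2) this]
  have "(\<Sum>s<p. (Q s i)\<^sup>2) \<in> {0, 1}"
  proof (rule block_of_ent_zero[OF O, of p])
    show "p \<le> n" using p by simp
    show "ent Q s r = 0" if "s < p" "p \<le> r" "r < n" for s r using cut that by blast
    fix A assume "\<And>i. i < n \<Longrightarrow> (\<Sum>s<p. (Q s i)\<^sup>2) = (if i \<in> A then 1 else 0)"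
    from this[OF i] show "(\<Sum>s<p. (Q s i)\<^sup>2) \<in> {0, 1}" by simp
  qed
  then show ?thesis unfolding main by auto
qed

text \<open>Crossing a facet: the block of \<open>A\<close> is taken from the front of the chain and
  appended at the back. Its sites go up by \<open>n - p\<close>, all others down by
  \<open>p\<close>. The old cut becomes the open end, and the old ends meet with coupling
  zero.\<close>

lemma rotate_frame:
  assumes Q: "tridiag_frame Q" and n: "3 \<le> n" and p: "0 < p" "p < n"
    and A: "\<And>s i. s < n \<Longrightarrow> i < n \<Longrightarrow> (s < p) \<noteq> (i \<in> A) \<Longrightarrow> Q s i = 0"
  shows "tridiag_frame (cyc (n - p) Q)"
    "i < n \<Longrightarrow> height (cyc (n - p) Q) i = height Q i - real p + (if i \<in> A then real n else 0)"
proof -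
  note O = tridiag_frame_orthonormal[OF Q]
  define R where "R = cyc (n - p) Q"
  have Rs: "R s = Q ((s + p) mod n)" for s using p by (simp add: R_def cyc_def)
  have RO: "orthonormal_rows n n R" unfolding R_def by (rule orthonormal_cyc[OF O]) simp
  have e: "ent R s r = ent Q ((s + p) mod n) ((r + p) mod n)" for s r
    by (simp add: ent_def Rs)
  have "ent R s r = 0" if sr: "Suc s < r" "r < n" for s r
  proof -
    have c: "ent R s r = (if r = s then ent R s s else if r = Suc s mod n then ent R s (Suc s mod n)
     else if s = Suc r mod n then ent R r (Suc r mod n) else 0)"
      unfolding R_def using p sr by (intro cyc_entries[OF Q n]) auto
    show ?thesis
    proof (cases "s = Suc r mod n")
      case True
      then have "s = 0" "r = n - 1" using sr by (auto simp: mod_Suc split: if_splits)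
      then have "ent R s r = ent Q (p mod n) ((n - 1 + p) mod n)" by (simp add: e)
      also have "(n - 1 + p) mod n = p - 1"
        using mod_shift_back[of 1 n "p - 1"] p n by (simp add: add.commute)
      also have "ent Q (p mod n) (p - 1) = 0"
        using block_ent_zero[OF A, where s = "p - 1" and r = p] p ent_sym[of Q p "p - 1"] by simp
      finally show ?thesis .
    next
      case False
      then show ?thesis using c sr by simp
    qed
  qed
  moreover have "0 \<le> ent R s (Suc s)" if "Suc s < n" for s
    using cyc_superdiag_nonneg(1)[OF Q n, of "n - p" s] p that by (simp add: R_def)
  ultimately show "tridiag_frame (cyc (n - p) Q)" using RO by (simp add: tridiag_frame_def R_def)
  assume i: "i < n"
  have "height R i = (\<Sum>s<n. real s * (Q ((s + p) mod n) i)\<^sup>2)" by (simp add: height_def Rs)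
  also have "\<dots> = (\<Sum>s<n. (\<lambda>j. real ((j + (n - p)) mod n) * (Q j i)\<^sup>2) ((s + p) mod n))"
    using mod_shift_back[of p n] p by (intro sum.cong refl) simp
  also have "\<dots> = (\<Sum>j<n. real ((j + (n - p)) mod n) * (Q j i)\<^sup>2)"
    using p by (intro sum_mod_shift) auto
  also have "\<dots> = (\<Sum>j<n. real j * (Q j i)\<^sup>2 - real p * (Q j i)\<^sup>2 + (if i \<in> A then real n else 0) * (Q j i)\<^sup>2)"
  proof (intro sum.cong refl)
    fix j assume j: "j \<in> {..<n}"
    show "real ((j + (n - p)) mod n) * (Q j i)\<^sup>2 = real j * (Q j i)\<^sup>2 - real p * (Q j i)\<^sup>2 + (if i \<in> A then real n else 0) * (Q j i)\<^sup>2"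
    proof (cases "Q j i = 0")
      case False
      then have iA: "j < p \<longleftrightarrow> i \<in> A" using A j i by blast
      show ?thesis
      proof (cases "j < p")
        case True
        then have "(j + (n - p)) mod n = j + (n - p)" using p by simp
        then show ?thesis using True iA p by (simp add: algebra_simps of_nat_diff)
      next
        case f: False
        then have "(j + (n - p)) mod n = j - p" using mod_shift_back[of p n "j - p"] p j by simp
        then show ?thesis using f iA p by (simp add: algebra_simps of_nat_diff)
      qed
    qed simp
  qed
  also have "\<dots> = height Q i - real p + (if i \<in> A then real n else 0)"
    unfolding sum.distrib sum_subtractf sum_distrib_left[symmetric] orthonormal_col_sq[OF O i]
    by (simp add: height_def)
  finally show "height (cyc (n - p) Q) i = height Q i - real p + (if i \<in> A then real n else 0)"
    by (simp add: R_def)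
qed

text \<open>The lower bound for the complement of \<open>A\<close>, subtracted from the
  total.\<close>

lemma height_sum_le:
  assumes O: "orthonormal_rows n n Q" and A: "A \<subseteq> {..<n}"
  shows "(\<Sum>i\<in>A. height Q i) \<le> real (card A) * (real n - real (card A)) + real (card A) * (real (card A) - 1) / 2"
proof -
  have c: "card ({..<n} - A) = n - card A" using A by (simp add: card_Diff_subset finite_subset)
  have "card A \<le> n" using card_mono[OF _ A] by simp
  then have "(real n - real (card A)) * (real n - real (card A) - 1) / 2 \<le> (\<Sum>i\<in>{..<n} - A. height Q i)"
    using height_sum_ge(1)[OF O, of "{..<n} - A"] by (simp add: c of_nat_diff)
  moreover have "(\<Sum>i<n. height Q i) = (\<Sum>i\<in>{..<n} - A. height Q i) + (\<Sum>i\<in>A. height Q i)"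
    by (rule sum.subset_diff[OF A]) simp
  ultimately show ?thesis using height_total[OF O] by (simp add: field_simps)
qed

text \<open>Two points of the permutohedra number \<open>k\<close> and \<open>k'\<close> that are congruent modulo
  \<open>n\<int>\<^sup>n\<close> differ by \<open>n\<close> on a set \<open>A\<close> and then lie on the facets that belong to \<open>A\<close>.\<close>

lemma height_cong_imp_cyc_same:
  assumes Q: "tridiag_frame Q" and Q': "tridiag_frame Q'" and n: "3 \<le> n" and k: "k \<le> k'" "k' < n"
    and v: "\<And>i. i < n \<Longrightarrow> (real k' + height Q' i) - (real k + height Q i) = real n * of_int (v i)"
    and jm: "j < n" "m < n"
  shows "ent (cyc k Q) j m = ent (cyc k' Q') j m"
proof -
  note O = tridiag_frame_orthonormal[OF Q] and O' = tridiag_frame_orthonormal[OF Q']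
  define N where "N = {..<n}"
  have N: "finite (v ` N)" "v ` N \<noteq> {}" using n_pos by (auto simp: N_def)
  define M where "M = Max (v ` N)"
  define \<mu> where "\<mu> = Min (v ` N)"
  define A where "A = {i\<in>N. v i = M}"
  define B where "B = {i\<in>N. v i = \<mu>}"
  have "M \<in> v ` N" "\<mu> \<in> v ` N" using Max_in[OF N] Min_in[OF N] by (auto simp: M_def \<mu>_def)
  then have ne: "A \<noteq> {}" "B \<noteq> {}" by (auto simp: A_def B_def)
  have AB: "A \<subseteq> {..<n}" "B \<subseteq> {..<n}" by (auto simp: A_def B_def N_def)
  then have fin: "finite A" "finite B" using finite_subset by auto
  define p where "p = card A"
  define q where "q = card B"
  have pq: "0 < p" "0 < q" using ne fin by (auto simp: p_def q_def card_gt_0_iff)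
  have range: "\<mu> \<le> v i" "v i \<le> M" if "i < n" for i
    using that N(1) by (auto simp: M_def \<mu>_def N_def)
  have sv: "int k' - int k = (\<Sum>i<n. v i)"
  proof -
    have "(\<Sum>i<n. (real k' + height Q' i) - (real k + height Q i)) = (\<Sum>i<n. real n * of_int (v i))"
      using v by (intro sum.cong) auto
    then have "real n * (real k' - real k) = real n * of_int (\<Sum>i<n. v i)"
      by (simp add: sum.distrib sum_subtractf height_total[OF O] height_total[OF O'] sum_distrib_left algebra_simps)
    then have "real k' - real k = of_int (\<Sum>i<n. v i)" using n_pos by simp
    then have "of_int (int k' - int k) = (of_int (\<Sum>i<n. v i) :: real)" by simp
    then show ?thesis by (simp only: of_int_eq_iff)
  qed
  have sumA: "real (card C) * (real k' - real k) + (\<Sum>i\<in>C. height Q' i) - (\<Sum>i\<in>C. height Q i) = real n * of_int y * real (card C)"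
    if "C \<subseteq> {..<n}" "\<And>i. i \<in> C \<Longrightarrow> v i = y" for C y
  proof -
    have "(\<Sum>i\<in>C. (real k' + height Q' i) - (real k + height Q i)) = (\<Sum>i\<in>C. real n * of_int y)"
      using v that by (intro sum.cong refl) (metis lessThan_iff subsetD)
    then show ?thesis by (simp add: sum.distrib sum_subtractf algebra_simps)
  qed
  have SA: "real p * (real k' - real k) + (\<Sum>i\<in>A. height Q' i) - (\<Sum>i\<in>A. height Q i) = real n * of_int M * real p"
    using sumA[OF AB(1), of M] by (simp add: A_def p_def)
  have SB: "real q * (real k' - real k) + (\<Sum>i\<in>B. height Q' i) - (\<Sum>i\<in>B. height Q i) = real n * of_int \<mu> * real q"
    using sumA[OF AB(2), of \<mu>] by (simp add: B_def q_def)
  have M_le: "real n * of_int M \<le> real k' - real k + (real n - real p)"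
    using SA height_sum_le[OF O' AB(1)] height_sum_ge(1)[OF O AB(1)] pq(1)
    by (intro tile_difference_le) (simp_all add: p_def)
  have "real q * (real k - real k') + (\<Sum>i\<in>B. height Q i) - (\<Sum>i\<in>B. height Q' i) = real n * (- of_int \<mu>) * real q"
    using SB by (simp add: right_diff_distrib)
  then have "real n * (- of_int \<mu>) \<le> real k - real k' + (real n - real q)"
    using height_sum_le[OF O AB(2)] height_sum_ge(1)[OF O' AB(2)] pq(2)
    by (intro tile_difference_le) (simp_all add: q_def)
  then have \<mu>_ge: "real k' - real k - (real n - real q) \<le> real n * of_int \<mu>" by simp
  \<comment> \<open>The two bounds together leave room for at most two adjacent values of
    \<open>v\<close>: distinct tiles touch only along their boundary.\<close>
  have "real n * (of_int M - of_int \<mu>) < real n * 2"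
    using M_le \<mu>_ge pq by (simp add: algebra_simps)
  then have "of_int M - of_int \<mu> < (2::real)" using n_pos by simp
  then have M1: "M \<le> \<mu> + 1" by linarith
  have \<mu>M: "\<mu> \<le> M" using range n_pos by force
  show ?thesis
  proof (cases "M = \<mu>")
    case True
    then have vM: "v i = M" if "i < n" for i using range[OF that] by simp
    then have nM: "int n * M = int k' - int k" using sv by simp
    have "M = 0"
    proof -
      have "0 \<le> int n * M" "int n * M < int n * 1" using nM k by auto
      then show ?thesis using n_pos by (simp add: zero_le_mult_iff)
    qed
    then have "k = k'" using nM by simp
    then have "height Q i = height Q' i" if "i < n" for i using v[OF that] vM[OF that] \<open>M = 0\<close> by simp
    then have "ent Q s r = ent Q' s r" if "s < n" "r < n" for s r
      using height_inj[OF Q Q'] that by (intro ent_determined_by_squares[OF Q Q']) auto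
    then show ?thesis using \<open>k = k'\<close> n_pos by (simp add: ent_cyc)
  next
    case False
    then have M: "M = \<mu> + 1" using M1 \<mu>M by simp
    have vv: "v i = \<mu> + (if i \<in> A then 1 else 0)" if "i < n" for i
      using range[OF that] that M by (auto simp: A_def N_def)
    have "(\<Sum>i<n. v i) = int n * \<mu> + int p"
    proof -
      have "(\<Sum>i<n. v i) = (\<Sum>i<n. \<mu> + (if i \<in> A then 1 else 0))" using vv by simp
      also have "\<dots> = int n * \<mu> + int (card A)"
        using AB(1) by (simp add: sum.distrib sum.If_cases Int_absorb1)
      finally show ?thesis by (simp add: p_def)
    qed
    with sv have kk: "int k' - int k = int n * \<mu> + int p" by simp
    have "A \<noteq> {..<n}"
    proof -
      obtain i where "i \<in> B" using ne by blast
      then have "i < n" "i \<notin> A" using M by (auto simp: A_def B_def N_def)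
      then show ?thesis by blast
    qed
    then have pn: "p < n" using AB(1) psubset_card_mono[of "{..<n}" A] by (auto simp: p_def)
    have "\<mu> = 0"
    proof -
      have "int n * (- 1) < int n * \<mu>" "int n * \<mu> < int n * 1" using kk k pn pq by linarith+
      then have "- 1 < \<mu>" "\<mu> < 1" using n_pos by (simp_all only: mult_less_cancel_left_pos of_nat_0_less_iff)
      then show ?thesis by simp
    qed
    then have k': "k' = k + p" using kk by simp
    have M: "M = 1" using M \<open>\<mu> = 0\<close> by simp
    \<comment> \<open>The congruence turns the upper bound for \<open>Q'\<close> on \<open>A\<close>
      into the reverse of the lower bound for \<open>Q\<close>. So \<open>Q\<close> lies on the
      facet of \<open>A\<close> and splits into two blocks.\<close>
    have "(\<Sum>i\<in>A. height Q i) \<le> real p * (real p - 1) / 2"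
    proof -
      have "real p * real p + (\<Sum>i\<in>A. height Q' i) - (\<Sum>i\<in>A. height Q i) = real n * real p"
        using SA unfolding M k' by simp
      moreover have "(\<Sum>i\<in>A. height Q' i) \<le> real p * (real n - real p) + real p * (real p - 1) / 2"
        using height_sum_le[OF O' AB(1)] by (simp add: p_def)
      moreover have "real p * (real n - real p) = real n * real p - real p * real p"
        by (simp add: right_diff_distrib)
      ultimately show ?thesis by linarith
    qed
    then have eqA: "(\<Sum>i\<in>A. height Q i) = real (card A) * (real (card A) - 1) / 2"
      using height_sum_ge(1)[OF O AB(1)] by (simp add: p_def)
    have supp: "Q s i = 0" if "s < n" "i < n" "(s < p) \<noteq> (i \<in> A)" for s i
      using height_sum_ge(2)[OF O AB(1) eqA that(1,2)] that(3) by (simp add: p_def)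
    \<comment> \<open>Crossing that facet gives a frame with the heights of \<open>Q'\<close>, and
      \<open>height_inj\<close> identifies the two matrices.\<close>
    define R where "R = cyc (n - p) Q"
    have RT: "tridiag_frame R" and Rh: "\<And>i. i < n \<Longrightarrow> height R i = height Q i - real p + (if i \<in> A then real n else 0)"
      unfolding R_def using rotate_frame[OF Q n pq(1) pn supp] by auto
    have "height R i = height Q' i" if "i < n" for i
      using v[OF that] Rh[OF that] vv[OF that] \<open>\<mu> = 0\<close> k' by (auto split: if_splits)
    then have eR: "ent R s r = ent Q' s r" if "s < n" "r < n" for s r
      using height_inj[OF RT Q'] that by (intro ent_determined_by_squares[OF RT Q']) auto
    have "cyc k' R j' = cyc k Q j'" for j'
    proof -
      have "((j' + (n - k')) mod n + p) mod n = (j' + (n - k)) mod n"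
        using k k' by (simp add: mod_add_left_eq)
      then show ?thesis using pn by (simp add: cyc_def R_def)
    qed
    then have "ent (cyc k Q) j m = ent (cyc k' R) j m" by (simp add: ent_def)
    also have "\<dots> = ent (cyc k' Q') j m" unfolding ent_cyc using n_pos by (intro eR) auto
    finally show ?thesis .
  qed
qed

end

section \<open>Matrices and their frames\<close>

lemma spectrum_similar_mat:
  fixes A B :: "complex mat"
  assumes "similar_mat A B" "A \<in> carrier_mat n n" "B \<in> carrier_mat n n"
  shows "spectrum A = spectrum B"
  unfolding spectrum_def
  using eigenvalue_root_char_poly[OF assms(2)] eigenvalue_root_char_poly[OF assms(3)]
    char_poly_similar[OF assms(1)] by auto

lemma isospectral_torus_orbit:
  assumes n: "3 \<le> n" and L: "L \<in> isospectral n lam" and L': "L' \<in> torus_orbit n L"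
  shows "L' \<in> isospectral n lam"
proof -
  obtain a b where ab: "L = periodic_tridiagonal n a b" using L by (auto simp: isospectral_def)
  obtain t where t: "t \<in> topspace (torus n)" and L't: "L' = mat_diag n t * L * mat_diag n (\<lambda>i. inverse (t i))"
    using L' unfolding torus_orbit_def by blast
  have nz: "t i \<noteq> 0" if "i < n" for i using t that by (force simp: torus_topspace_iff)
  have c: "L \<in> carrier_mat n n" "L' \<in> carrier_mat n n" by (simp_all add: ab L't conjugate_periodic_tridiagonal[OF n t])
  have "mat_diag n t * mat_diag n (\<lambda>i. inverse (t i)) = 1\<^sub>m n"
    unfolding mat_diag_diag using nz by (intro eq_matI) (auto simp: mat_diag_def)
  moreover have "mat_diag n (\<lambda>i. inverse (t i)) * mat_diag n t = 1\<^sub>m n"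
    unfolding mat_diag_diag using nz by (intro eq_matI) (auto simp: mat_diag_def)
  ultimately have "similar_mat_wit L' L (mat_diag n t) (mat_diag n (\<lambda>i. inverse (t i)))"
    using c L't by (intro similar_mat_witI[where n = n]) simp_all
  then have "similar_mat L' L" by (auto simp: similar_mat_def)
  then have "spectrum L' = spectrum L" using c(2,1) by (rule spectrum_similar_mat)
  moreover have "\<exists>a b. L' = periodic_tridiagonal n a b"
    using L' unfolding ab torus_orbit_periodic_tridiagonal[OF n] by blast
  ultimately show ?thesis using L by (simp add: isospectral_def)
qed

context simple_spectrum
begin

lemma spectrum_of_frame:
  assumes O: "orthonormal_rows n n P" and L: "L = Matrix.mat n n (\<lambda>(j, m). complex_of_real (ent P j m))"
  shows "spectrum L = (\<lambda>i. complex_of_real (l i)) ` {..<n}"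
proof -
  have c: "L \<in> carrier_mat n n" by (simp add: L)
  have "(\<lambda>i. complex_of_real (l i)) ` {..<n} \<subseteq> spectrum L"
  proof
    fix x assume "x \<in> (\<lambda>i. complex_of_real (l i)) ` {..<n}"
    then obtain i where i: "i < n" "x = complex_of_real (l i)" by blast
    define v where "v = vec n (\<lambda>j. complex_of_real (P j i))"
    have "v \<noteq> 0\<^sub>v n"
    proof
      assume "v = 0\<^sub>v n"
      then have "v $ j = 0" if "j < n" for j using that by simp
      then have "P j i = 0" if "j < n" for j using that by (simp add: v_def)
      then show False using orthonormal_col_sq[OF O i(1)] by simp
    qed
    moreover have "L *\<^sub>v v = x \<cdot>\<^sub>v v"
    proof (rule eq_vecI)
      fix j assume "j < dim_vec (x \<cdot>\<^sub>v v)"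
      then have j: "j < n" by (simp add: v_def)
      have "(L *\<^sub>v v) $ j = (\<Sum>m<n. complex_of_real (ent P j m * P m i))"
        using j by (simp add: L v_def scalar_prod_def atLeast0LessThan)
      also have "\<dots> = complex_of_real (\<Sum>m<n. ent P j m * P m i)" by simp
      also have "\<dots> = complex_of_real (l i * P j i)" by (simp add: ent_expand[OF O i(1)])
      finally show "(L *\<^sub>v v) $ j = (x \<cdot>\<^sub>v v) $ j" using j i by (simp add: v_def)
    qed (simp add: L v_def)
    ultimately have "eigenvector L v x" by (simp add: eigenvector_def L v_def)
    then show "x \<in> spectrum L" by (auto simp: spectrum_def eigenvalue_def)
  qed
  moreover have "card ((\<lambda>i. complex_of_real (l i)) ` {..<n}) = n"
    using inj_l by (subst card_image) (auto simp: inj_on_def)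
  ultimately show ?thesis
    using card_finite_spectrum[OF c] by (metis card_seteq)
qed

text \<open>For a real eigenvalue of a real matrix the real or the imaginary part of a complex
  eigenvector is a real eigenvector; symmetry and distinct eigenvalues make these
  orthogonal.\<close>

lemma real_symmetric_frame:
  fixes M :: "nat \<Rightarrow> nat \<Rightarrow> real"
  assumes sym: "\<And>j m. j < n \<Longrightarrow> m < n \<Longrightarrow> M j m = M m j"
    and spec: "spectrum (Matrix.mat n n (\<lambda>(j, m). complex_of_real (M j m))) = (\<lambda>i. complex_of_real (l i)) ` {..<n}"
  obtains P where "orthonormal_rows n n P" "\<And>j m. j < n \<Longrightarrow> m < n \<Longrightarrow> ent P j m = M j m"
proof -
  define L where "L = Matrix.mat n n (\<lambda>(j, m). complex_of_real (M j m))"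
  have "\<exists>u. (\<Sum>j<n. (u j)\<^sup>2) = 1 \<and> (\<forall>j<n. (\<Sum>m<n. M j m * u m) = l i * u j)" if i: "i < n" for i
  proof -
    have "complex_of_real (l i) \<in> spectrum L" using spec i by (auto simp: L_def)
    then obtain v where v: "eigenvector L v (complex_of_real (l i))" by (auto simp: spectrum_def eigenvalue_def)
    then have vc: "dim_vec v = n" "v \<noteq> 0\<^sub>v n" "L *\<^sub>v v = complex_of_real (l i) \<cdot>\<^sub>v v"
      by (auto simp: eigenvector_def L_def)
    have ev: "(\<Sum>m<n. complex_of_real (M j m) * v $ m) = complex_of_real (l i) * v $ j" if "j < n" for j
    proof -
      have "(L *\<^sub>v v) $ j = (\<Sum>m<n. complex_of_real (M j m) * v $ m)"
        using that vc(1) by (simp add: L_def scalar_prod_def atLeast0LessThan)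
      then show ?thesis using vc(3) that vc(1) by simp
    qed
    have ReIm: "(\<Sum>m<n. M j m * Re (v $ m)) = l i * Re (v $ j)"
      "(\<Sum>m<n. M j m * Im (v $ m)) = l i * Im (v $ j)" if "j < n" for j
      using arg_cong[OF ev[OF that], of Re] arg_cong[OF ev[OF that], of Im] by (simp_all add: Re_sum Im_sum)
    have "\<exists>u. (\<exists>j<n. u j \<noteq> 0) \<and> (\<forall>j<n. (\<Sum>m<n. M j m * u m) = l i * u j)"
    proof (cases "\<exists>j<n. Re (v $ j) \<noteq> 0")
      case True
      then show ?thesis using ReIm(1) by (intro exI[of _ "\<lambda>j. Re (v $ j)"]) blast
    next
      case False
      have "\<exists>j<n. v $ j \<noteq> 0"
      proof (rule ccontr)
        assume "\<not> ?thesis"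
        then have "v = 0\<^sub>v n" using vc(1) by (intro eq_vecI) auto
        then show False using vc(2) by simp
      qed
      then have "\<exists>j<n. Im (v $ j) \<noteq> 0" using False by (auto simp: complex_eq_iff)
      then show ?thesis using ReIm(2) by (intro exI[of _ "\<lambda>j. Im (v $ j)"]) blast
    qed
    then obtain u where u: "\<exists>j<n. u j \<noteq> 0" "\<forall>j<n. (\<Sum>m<n. M j m * u m) = l i * u j" by blast
    define N where "N = (\<Sum>j<n. (u j)\<^sup>2)"
    obtain j where j: "j < n" "u j \<noteq> 0" using u by blast
    have "0 < (u j)\<^sup>2" using j by simp
    also have "\<dots> \<le> N" unfolding N_def using j by (intro member_le_sum) auto
    finally have N: "N > 0" .
    have "(\<Sum>j<n. (u j / sqrt N)\<^sup>2) = 1"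
      using N by (simp add: power_divide N_def[symmetric] sum_divide_distrib[symmetric])
    moreover have "(\<Sum>m<n. M j m * (u m / sqrt N)) = l i * (u j / sqrt N)" if "j < n" for j
      using u(2) that by (simp add: sum_divide_distrib[symmetric])
    ultimately show ?thesis by (intro exI[of _ "\<lambda>j. u j / sqrt N"]) blast
  qed
  then obtain U where U: "\<And>i. i < n \<Longrightarrow> (\<Sum>j<n. (U i j)\<^sup>2) = 1"
    "\<And>i j. i < n \<Longrightarrow> j < n \<Longrightarrow> (\<Sum>m<n. M j m * U i m) = l i * U i j" by metis
  have "orthonormal_rows n n U" unfolding orthonormal_rows_def
  proof (intro allI impI)
    fix i k assume ik: "i < n" "k < n"
    show "(\<Sum>j<n. U i j * U k j) = (if i = k then 1 else 0)"
    proof (cases "i = k")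
      case True
      then show ?thesis using U(1)[OF ik(1)] by (simp add: power2_eq_square)
    next
      case False
      have "l i * (\<Sum>j<n. U i j * U k j) = (\<Sum>j<n. (\<Sum>m<n. M j m * U i m) * U k j)"
        using U(2)[OF ik(1)] by (simp add: sum_distrib_left mult.assoc)
      also have "\<dots> = (\<Sum>j<n. \<Sum>m<n. M j m * U i m * U k j)" by (simp add: sum_distrib_right)
      also have "\<dots> = (\<Sum>m<n. \<Sum>j<n. M j m * U i m * U k j)" by (rule sum.swap)
      also have "\<dots> = (\<Sum>m<n. U i m * (\<Sum>j<n. M m j * U k j))"
        unfolding sum_distrib_left using sym by (intro sum.cong refl) simp
      also have "\<dots> = l k * (\<Sum>j<n. U i j * U k j)"
        using U(2)[OF ik(2)] by (simp add: sum_distrib_left mult_ac)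
      finally have "(l i - l k) * (\<Sum>j<n. U i j * U k j) = 0" by (simp add: left_diff_distrib)
      moreover have "l i \<noteq> l k" using inj_l ik False by (auto simp: inj_on_def)
      ultimately show ?thesis using False by simp
    qed
  qed
  then have O: "orthonormal_rows n n (\<lambda>j i. U i j)" by (rule orthonormal_rows_transpose)
  show ?thesis
  proof (rule that[OF O])
    fix j m assume jm: "j < n" "m < n"
    have "ent (\<lambda>j i. U i j) j m = (\<Sum>i<n. (\<Sum>q<n. M j q * U i q) * U i m)"
      unfolding ent_def using U(2) jm by (intro sum.cong refl) simp
    also have "\<dots> = (\<Sum>q<n. M j q * (\<Sum>i<n. U i q * U i m))"
      unfolding sum_distrib_left sum_distrib_right by (subst sum.swap) (simp add: mult.assoc)
    also have "\<dots> = (\<Sum>q<n. M j q * (if q = m then 1 else 0))"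
      using orthonormal_rowsD[OF O _ jm(2)] by (intro sum.cong refl) simp
    also have "\<dots> = M j m" using jm by (simp add: if_distrib[of "\<lambda>x. _ * x"] cong: if_cong)
    finally show "ent (\<lambda>j i. U i j) j m = M j m" .
  qed
qed

text \<open>Tiles are numbered by the position \<open>k\<close> of the first site behind a vanishing
  entry, and \<open>g\<close> records the shifted heights modulo \<open>n\<close> as angles. The
  last angle is left out because the total is known modulo \<open>n\<close>.\<close>

theorem fiber_zero_homeomorphic_torus:
  assumes n: "3 \<le> n" and lam: "\<And>i. i < n \<Longrightarrow> lam (Suc i) = l i"
  shows "fiber n lam 0 homeomorphic_space torus (n - 1)"
proof -
  define X where "X = prod_topology (discrete_topology {..<n}) (top_of_set frames)"
  define A where "A x j = ent (cyc (fst x) (snd x)) j j" for x j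
  define B where "B x j = ent (cyc (fst x) (snd x)) j (Suc j mod n)" for x j
  define C where "C x i = real (fst x) + height (snd x) i" for x i
  define g where "g x = (\<lambda>i\<in>{..<n - 1}. cis (2 * pi * (C x i / real n)))" for x
  have tX: "x \<in> topspace X \<longleftrightarrow> fst x < n \<and> snd x \<in> frames" for x
    by (cases x) (auto simp: X_def)
  have TX: "tridiag_frame (snd x)" "fst x < n" if "x \<in> topspace X" for x
    using that by (auto simp: tX frames_def)
  have lamset: "(\<lambda>i. complex_of_real (lam i)) ` {1..n} = (\<lambda>i. complex_of_real (l i)) ` {..<n}"
  proof -
    have "{1..n} = Suc ` {..<n}" by (metis One_nat_def image_Suc_lessThan)
    then show ?thesis using lam by (simp add: image_image cong: image_cong_simp)
  qed
  have cont: "continuous_map X euclideanreal f"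
    if "\<And>k. k < n \<Longrightarrow> continuous_on frames (\<lambda>Q. f (k, Q))" for f :: "nat \<times> (nat \<Rightarrow> nat \<Rightarrow> real) \<Rightarrow> real"
    unfolding continuous_map_def
  proof (intro conjI allI impI)
    fix U :: "real set" assume U: "openin euclideanreal U"
    have "openin X ({k} \<times> {Q \<in> frames. f (k, Q) \<in> U})" if k: "k < n" for k
      unfolding X_def openin_prod_Times_iff
      using openin_continuous_map_preimage[of "top_of_set frames" euclideanreal "\<lambda>Q. f (k, Q)" U] U
        \<open>k < n\<close> that(1) \<open>\<And>k. k < n \<Longrightarrow> continuous_on frames (\<lambda>Q. f (k, Q))\<close>[OF k]
      by auto
    then have "openin X (\<Union>k\<in>{..<n}. {k} \<times> {Q \<in> frames. f (k, Q) \<in> U})" by (intro openin_Union) auto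
    moreover have "(\<Union>k\<in>{..<n}. {k} \<times> {Q \<in> frames. f (k, Q) \<in> U}) = {x \<in> topspace X. f x \<in> U}"
      by (auto simp: tX)
    ultimately show "openin X {x \<in> topspace X. f x \<in> U}" by simp
  qed auto
  have AB_iff: "(\<forall>i<n. A x i = A y i \<and> B x i = B y i) \<longleftrightarrow>
      (\<forall>j<n. \<forall>m<n. ent (cyc (fst x) (snd x)) j m = ent (cyc (fst y) (snd y)) j m)"
    if xy: "x \<in> topspace X" "y \<in> topspace X" for x y
  proof
    assume AB: "\<forall>i<n. A x i = A y i \<and> B x i = B y i"
    show "\<forall>j<n. \<forall>m<n. ent (cyc (fst x) (snd x)) j m = ent (cyc (fst y) (snd y)) j m"
    proof (intro allI impI)
      fix j m assume jm: "j < n" "m < n"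
      show "ent (cyc (fst x) (snd x)) j m = ent (cyc (fst y) (snd y)) j m"
        unfolding cyc_entries[OF TX(1)[OF xy(1)] n TX(2)[OF xy(1)] jm] cyc_entries[OF TX(1)[OF xy(2)] n TX(2)[OF xy(2)] jm]
        using AB jm by (simp add: A_def B_def)
    qed
  next
    assume "\<forall>j<n. \<forall>m<n. ent (cyc (fst x) (snd x)) j m = ent (cyc (fst y) (snd y)) j m"
    then show "\<forall>i<n. A x i = A y i \<and> B x i = B y i" using n by (simp add: A_def B_def)
  qed
  have mat: "periodic_tridiagonal n (A x) (\<lambda>j. complex_of_real (B x j)) =
      Matrix.mat n n (\<lambda>(j, m). complex_of_real (ent (cyc (fst x) (snd x)) j m))" if x: "x \<in> topspace X" for x
  proof (rule eq_matI)
    fix j m assume "j < dim_row (Matrix.mat n n (\<lambda>(j, m). complex_of_real (ent (cyc (fst x) (snd x)) j m)))"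
      "m < dim_col (Matrix.mat n n (\<lambda>(j, m). complex_of_real (ent (cyc (fst x) (snd x)) j m)))"
    then have jm: "j < n" "m < n" by auto
    have "complex_of_real (ent (cyc (fst x) (snd x)) j m) = (if m = j then complex_of_real (A x j)
       else if m = Suc j mod n then complex_of_real (B x j) else if j = Suc m mod n then complex_of_real (B x m) else 0)"
      unfolding cyc_entries[OF TX(1)[OF x] n TX(2)[OF x] jm] by (simp add: A_def B_def)
    then show "periodic_tridiagonal n (A x) (\<lambda>j. complex_of_real (B x j)) $$ (j, m) =
      Matrix.mat n n (\<lambda>(j, m). complex_of_real (ent (cyc (fst x) (snd x)) j m)) $$ (j, m)"
      using jm by (simp add: periodic_tridiagonal_def)
  qed (auto simp: periodic_tridiagonal_def)
  show ?thesis
  proof (rule fiber_homeomorphic_torus[where X = X and A = A and B = B and \<omega> = 1 and g = g, OF n])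
    show "compact_space X"
      unfolding X_def
      by (simp add: compact_space_prod_topology compact_space_subtopology compactin_euclidean_iff
          compact_frames compact_space_discrete_topology)
    show "continuous_map X euclideanreal (\<lambda>x. A x i)" for i
      unfolding A_def cyc_def ent_def by (rule cont) (auto intro!: continuous_intros continuous_on_entry)
    show "continuous_map X euclideanreal (\<lambda>x. B x i)" for i
      unfolding B_def cyc_def ent_def by (rule cont) (auto intro!: continuous_intros continuous_on_entry)
    show "0 \<le> B x i" if "x \<in> topspace X" "i < n" for x i
      unfolding B_def using cyc_superdiag_nonneg(1)[OF TX(1)[OF that(1)] n TX(2)[OF that(1)] that(2)] .
    show "(\<Prod>i<n. B x i) = cmod 0" if x: "x \<in> topspace X" for x
    proof -
      define j where "j = (n - 1 + fst x) mod n"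
      have j: "j < n" using n by (simp add: j_def)
      have "B x j = 0"
        unfolding B_def using cyc_superdiag_nonneg(2)[OF TX(1)[OF x] n TX(2)[OF x] j j_def] .
      then show ?thesis using j by auto
    qed
    show "periodic_tridiagonal n (A x) (\<lambda>i. if i = n - 1 then 1 * complex_of_real (B x i) else complex_of_real (B x i))
         \<in> isospectral n lam" if x: "x \<in> topspace X" for x
    proof -
      have "spectrum (periodic_tridiagonal n (A x) (\<lambda>j. complex_of_real (B x j))) = (\<lambda>i. complex_of_real (lam i)) ` {1..n}"
        unfolding lamset using TX[OF x]
        by (intro spectrum_of_frame[OF orthonormal_cyc mat[OF x]] tridiag_frame_orthonormal) auto
      moreover have "(\<lambda>i. if i = n - 1 then 1 * complex_of_real (B x i) else complex_of_real (B x i)) =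
          (\<lambda>j. complex_of_real (B x j))" by auto
      ultimately show ?thesis by (auto simp: isospectral_def)
    qed
    show "\<exists>x\<in>topspace X. \<forall>i<n. A x i = a i \<and> B x i = cmod (b i)"
      if iso: "periodic_tridiagonal n a b \<in> isospectral n lam" and pb: "(\<Prod>i<n. b i) = 0" for a b
    proof -
      define c where "c i = complex_of_real (cmod (b i))" for i
      define L where "L = periodic_tridiagonal n a c"
      have "(\<Prod>i<n. c i) = 0" using pb by (auto simp: c_def)
      then have "(\<Prod>i<n. c i) = (\<Prod>i<n. b i)" using pb by (simp only:)
      then have "L \<in> torus_orbit n (periodic_tridiagonal n a b)"
        unfolding torus_orbit_periodic_tridiagonal[OF n] L_def by (auto simp: c_def)
      then have LI: "L \<in> isospectral n lam" by (rule isospectral_torus_orbit[OF n iso])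
      define M where "M j m = (if m = j then a j else if m = Suc j mod n then cmod (b j)
         else if j = Suc m mod n then cmod (b m) else 0)" for j m
      have LM: "L = Matrix.mat n n (\<lambda>(j, m). complex_of_real (M j m))"
        unfolding L_def periodic_tridiagonal_def by (intro eq_matI) (auto simp: M_def c_def)
      have symM: "M j m = M m j" if "j < n" "m < n" for j m
        using cyclic_succ_facts[OF n that(1)] cyclic_succ_facts[OF n that(2)] by (auto simp: M_def)
      have "spectrum (Matrix.mat n n (\<lambda>(j, m). complex_of_real (M j m))) = (\<lambda>i. complex_of_real (l i)) ` {..<n}"
        using LI lamset by (simp add: isospectral_def LM[symmetric])
      from real_symmetric_frame[OF symM this] obtain P where P: "orthonormal_rows n n P"
        "\<And>j m. j < n \<Longrightarrow> m < n \<Longrightarrow> ent P j m = M j m" by blast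
      \<comment> \<open>The cycle is opened behind a vanishing entry, so the first site of the chain
        is the next position.\<close>
      obtain k' where k': "k' < n" "b k' = 0" using pb by auto
      define k where "k = Suc k' mod n"
      have k: "k < n" using n by (simp add: k_def)
      have nk: "(n - 1 + k) mod n = k'"
      proof -
        have "(n - 1 + k) mod n = (n - 1 + Suc k') mod n" by (simp only: k_def mod_add_right_eq)
        also have "n - 1 + Suc k' = k' + n" using n by simp
        finally show ?thesis using k' by simp
      qed
      define Q where "Q s i = (if s < n \<and> i < n then P ((s + k) mod n) i else 0)" for s i
      have eQ: "ent Q s r = M ((s + k) mod n) ((r + k) mod n)" if "s < n" "r < n" for s r
      proof -
        have "ent Q s r = ent P ((s + k) mod n) ((r + k) mod n)" using that by (simp add: ent_def Q_def)
        then show ?thesis using P(2) n_pos by simp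
      qed
      have "orthonormal_rows n n Q"
        using orthonormal_cyc[OF P(1), of "n - k"] k n_pos
        by (simp add: orthonormal_rows_def cyc_def Q_def)
      moreover have "ent Q s r = 0" if sr: "Suc s < r" "r < n" for s r
      proof -
        have inj: "(s + k) mod n = (r + k) mod n \<longleftrightarrow> s = r" if "s < n" "r < n" for s r
          using mod_shift_back[of k n s] mod_shift_back[of k n r] k that by (metis less_imp_le)
        have 1: "(r + k) mod n \<noteq> (s + k) mod n" using inj[of s r] sr by auto
        have 2: "(r + k) mod n \<noteq> Suc ((s + k) mod n) mod n"
          unfolding mod_Suc_shift[symmetric] using inj[of r "Suc s"] sr by auto
        show ?thesis
        proof (cases "(s + k) mod n = Suc ((r + k) mod n) mod n")
          case True
          then have "s = Suc r mod n"
            unfolding mod_Suc_shift[symmetric] using inj[of s "Suc r mod n"] sr by auto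
          then have "s = 0" "r = n - 1" using sr by (auto simp: mod_Suc split: if_splits)
          then have "M ((s + k) mod n) ((r + k) mod n) = cmod (b k')"
            using 1 2 True nk by (simp add: M_def)
          then show ?thesis using eQ[of s r] sr k' by simp
        next
          case False
          then show ?thesis using eQ[of s r] sr 1 2 by (simp add: M_def)
        qed
      qed
      moreover have "0 \<le> ent Q s (Suc s)" if s: "Suc s < n" for s
      proof -
        have "(Suc s + k) mod n = Suc ((s + k) mod n) mod n"
          using mod_Suc_shift[of s n k] s by simp
        moreover have "(s + k) mod n < n" using n by simp
        ultimately show ?thesis using eQ[of s "Suc s"] s cyclic_succ_facts(2)[OF n, of "(s + k) mod n"]
          by (simp add: M_def)
      qed
      ultimately have "tridiag_frame Q" by (simp add: tridiag_frame_def)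
      then have xX: "(k, Q) \<in> topspace X" using k by (auto simp: tX frames_def Q_def)
      have eC: "ent (cyc k Q) j m = M j m" if "j < n" "m < n" for j m
        unfolding ent_cyc using eQ n_pos mod_shift_forth[of k n] k that by simp
      have "A (k, Q) i = a i \<and> B (k, Q) i = cmod (b i)" if "i < n" for i
        using eC[OF that that] eC[OF that, of "Suc i mod n"] n cyclic_succ_facts[OF n that]
        by (simp add: A_def B_def M_def)
      then show ?thesis using xX by blast
    qed
    show "continuous_map X (torus (n - 1)) g"
      unfolding torus_def g_def
    proof (subst continuous_map_componentwise, intro conjI ballI)
      show "(\<lambda>x. \<lambda>i\<in>{..<n - 1}. cis (2 * pi * (C x i / real n))) ` topspace X \<subseteq> extensional {..<n - 1}" by auto
      fix i assume i: "i \<in> {..<n - 1}"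
      have "continuous_map X euclideanreal (\<lambda>x. C x i)"
        unfolding C_def by (rule cont) (auto intro!: continuous_intros continuous_on_height)
      moreover have "continuous_map euclideanreal (top_of_set (sphere 0 1)) (\<lambda>y. cis (2 * pi * (y / real n)))"
        using n_pos by (auto simp: continuous_map_in_subtopology intro!: continuous_intros)
      ultimately have "continuous_map X (top_of_set (sphere 0 1)) ((\<lambda>y. cis (2 * pi * (y / real n))) \<circ> (\<lambda>x. C x i))"
        by (rule continuous_map_compose)
      then show "continuous_map X (top_of_set (sphere 0 1)) (\<lambda>x. (\<lambda>i\<in>{..<n - 1}. cis (2 * pi * (C x i / real n))) i)"
        using i by (simp add: o_def)
    qed
    have gin: "g x \<in> topspace (torus (n - 1))" for x by (simp add: torus_topspace_iff g_def)
    show "g ` topspace X = topspace (torus (n - 1))"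
    proof
      show "g ` topspace X \<subseteq> topspace (torus (n - 1))" using gin by blast
      show "topspace (torus (n - 1)) \<subseteq> g ` topspace X"
      proof
        fix \<theta> assume \<theta>: "\<theta> \<in> topspace (torus (n - 1))"
        \<comment> \<open>A lift of the angles to the hyperplane of the permutohedron; the last
          coordinate corrects the total.\<close>
        define x where "x i = (if i < n - 1 then real n / (2 * pi) * Arg (\<theta> i)
           else real n * (real n - 1) / 2 - (\<Sum>i<n - 1. real n / (2 * pi) * Arg (\<theta> i)))" for i
        have "(\<Sum>i<n. x i) = real n * (real n - 1) / 2"
        proof -
          obtain m where "n = Suc m" using n_pos by (cases n) auto
          then show ?thesis by (simp add: x_def)
        qed
        then obtain v :: "nat \<Rightarrow> int" and k :: nat where v: "k < n" "(\<Sum>i<n. v i) = int k"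
          "\<And>A. A \<subseteq> {..<n} \<Longrightarrow> real k * real (card A) + real (card A) * (real (card A) - 1) / 2
             \<le> (\<Sum>i\<in>A. x i + real n * of_int (v i))"
          by (rule permutohedral_representative[OF n_pos]) blast
        define c where "c i = x i + real n * of_int (v i) - real k" for i
        have ctot: "(\<Sum>i<n. c i) = real n * (real n - 1) / 2"
        proof -
          have "(\<Sum>i<n. real_of_int (v i)) = real k"
            using arg_cong[OF v(2), of real_of_int] by simp
          then show ?thesis using \<open>(\<Sum>i<n. x i) = _\<close>
            by (simp add: c_def sum.distrib sum_subtractf sum_distrib_left[symmetric])
        qed
        have cge: "real (card A) * (real (card A) - 1) / 2 \<le> (\<Sum>i\<in>A. c i)" if "A \<subseteq> {..<n}" for A
          using v(3)[OF that] by (simp add: c_def sum_subtractf mult.commute)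
        obtain Q where Q: "Q \<in> frames" "\<And>i. i < n \<Longrightarrow> height Q i = c i"
          using height_surj[OF ctot cge] by metis
        have "g (k, Q) = \<theta>"
        proof
          fix i
          show "g (k, Q) i = \<theta> i"
          proof (cases "i < n - 1")
            case True
            then have u: "cmod (\<theta> i) = 1" using \<theta> by (simp add: torus_topspace_iff)
            have "C (k, Q) i / real n = Arg (\<theta> i) / (2 * pi) + of_int (v i)"
              using True Q(2)[of i] n_pos by (simp add: C_def c_def x_def field_simps)
            then have "C (k, Q) i / real n - Arg (\<theta> i) / (2 * pi) \<in> \<int>" by simp
            then have "cis (2 * pi * (C (k, Q) i / real n)) = cis (2 * pi * (Arg (\<theta> i) / (2 * pi)))"
              by (simp only: cis_eq_iff_Ints)
            also have "\<dots> = cis (Arg (\<theta> i))" by simp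
            also have "\<dots> = \<theta> i"
            proof -
              have "\<theta> i \<noteq> 0" using u by auto
              then show ?thesis using u cis_Arg[of "\<theta> i"] by (simp add: sgn_div_norm)
            qed
            finally show ?thesis using True by (simp add: g_def)
          next
            case False
            then show ?thesis using \<theta> by (auto simp: g_def torus_topspace_iff extensional_def)
          qed
        qed
        moreover have "(k, Q) \<in> topspace X" using v(1) Q(1) by (simp add: tX)
        ultimately show "\<theta> \<in> g ` topspace X" by blast
      qed
    qed
    have g_iff: "g x = g y \<longleftrightarrow> (\<forall>i<n - 1. C y i / real n - C x i / real n \<in> \<int>)" for x y
    proof
      assume eq: "g x = g y"
      show "\<forall>i<n - 1. C y i / real n - C x i / real n \<in> \<int>"
      proof (intro allI impI)
        fix i assume "i < n - 1"
        then have "cis (2 * pi * (C y i / real n)) = cis (2 * pi * (C x i / real n))"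
          using fun_cong[OF eq, of i] by (simp add: g_def)
        then show "C y i / real n - C x i / real n \<in> \<int>" by (simp only: cis_eq_iff_Ints)
      qed
    next
      assume "\<forall>i<n - 1. C y i / real n - C x i / real n \<in> \<int>"
      then have "cis (2 * pi * (C y i / real n)) = cis (2 * pi * (C x i / real n))" if "i < n - 1" for i
        using that by (simp only: cis_eq_iff_Ints)
      then show "g x = g y" unfolding g_def by (intro restrict_ext) simp
    qed
    have ker: "g x = g y \<longleftrightarrow> (\<forall>i<n. A x i = A y i \<and> B x i = B y i)"
      if xy: "x \<in> topspace X" "y \<in> topspace X" and le: "fst x \<le> fst y" for x y
    proof
      assume "g x = g y"
      then have int: "C y i / real n - C x i / real n \<in> \<int>" if "i < n - 1" for i using that g_iff by blast
      have tot: "(\<Sum>i<n. C x i) = real n * real (fst x) + real n * (real n - 1) / 2" if "x \<in> topspace X" for x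
        using height_total[OF tridiag_frame_orthonormal[OF TX(1)[OF that]]] by (simp add: C_def sum.distrib)
      \<comment> \<open>The remaining coordinate also differs by an integer, because the totals do:
        their difference over \<open>n\<close> is the difference of the cut numbers.\<close>
      have all: "C y i / real n - C x i / real n \<in> \<int>" if i: "i < n" for i
      proof (cases "i < n - 1")
        case False
        obtain m where m: "n = Suc m" using n_pos by (cases n) auto
        then have im: "i = m" using False i by simp
        have "(\<Sum>i<n. C y i / real n - C x i / real n) = real (fst y) - real (fst x)"
          using n_pos unfolding sum_subtractf sum_divide_distrib[symmetric] tot[OF xy(1)] tot[OF xy(2)]
          by (simp add: field_simps)
        then have "C y m / real n - C x m / real n =
            real (fst y) - real (fst x) - (\<Sum>i<m. C y i / real n - C x i / real n)"
          unfolding m by simp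
        moreover have "(\<Sum>i<m. C y i / real n - C x i / real n) \<in> \<int>"
          using int m by (intro Ints_sum) auto
        moreover have "real (fst y) - real (fst x) \<in> \<int>" by simp
        ultimately show ?thesis unfolding im by (simp only: Ints_diff)
      qed (rule int)
      have "\<exists>w. C y i - C x i = real n * of_int w" if i: "i < n" for i
      proof -
        obtain w where "C y i / real n - C x i / real n = of_int w" using all[OF i] by (rule Ints_cases)
        then show ?thesis using n_pos by (intro exI[of _ w]) (simp add: field_simps)
      qed
      then obtain w where w: "\<And>i. i < n \<Longrightarrow> C y i - C x i = real n * of_int (w i)" by metis
      show "\<forall>i<n. A x i = A y i \<and> B x i = B y i"
        unfolding AB_iff[OF xy]
        using height_cong_imp_cyc_same[OF TX(1)[OF xy(1)] TX(1)[OF xy(2)] n le TX(2)[OF xy(2)] w[unfolded C_def]]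
        by blast
    next
      assume "\<forall>i<n. A x i = A y i \<and> B x i = B y i"
      then have eq: "ent (cyc (fst x) (snd x)) j m = ent (cyc (fst y) (snd y)) j m" if "j < n" "m < n" for j m
        using AB_iff[OF xy] that by blast
      have "C y i / real n - C x i / real n \<in> \<int>" if i: "i < n" for i
      proof -
        have "C y i - C x i \<in> {0, real n}"
          unfolding C_def using TX xy eq i by (intro cyc_same_imp_height_cong[OF _ _ n le]) auto
        moreover have "C y i / real n - C x i / real n = (C y i - C x i) / real n" by (simp add: diff_divide_distrib)
        ultimately show ?thesis using n_pos by auto
      qed
      then show "g x = g y" unfolding g_iff by simp
    qed
    show "g x = g y \<longleftrightarrow> (\<forall>i<n. A x i = A y i \<and> B x i = B y i)"
      if xy: "x \<in> topspace X" "y \<in> topspace X" for x y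
    proof (cases "fst x \<le> fst y")
      case True
      then show ?thesis by (rule ker[OF xy])
    next
      case False
      then have "g y = g x \<longleftrightarrow> (\<forall>i<n. A y i = A x i \<and> B y i = B x i)" by (intro ker xy(2,1)) simp
      then show ?thesis by (auto simp: eq_commute)
    qed
  qed auto
qed

end


section \<open>Continuants and the discriminant\<close>

text \<open>Euler's continuant: the determinant of the tridiagonal block of size \<open>m\<close>
  starting at index \<open>s\<close>, with \<open>\<beta> i\<close> the product of the two entries
  that couple \<open>i\<close> and \<open>Suc i\<close>. The general ring covers polynomials and
  their values alike.\<close>

fun continuant :: "(nat \<Rightarrow> 'a::comm_ring_1) \<Rightarrow> (nat \<Rightarrow> 'a) \<Rightarrow> nat \<Rightarrow> nat \<Rightarrow> 'a" where
  "continuant d \<beta> s 0 = 1"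
| "continuant d \<beta> s (Suc 0) = d s"
| "continuant d \<beta> s (Suc (Suc m)) =
     d (s + Suc m) * continuant d \<beta> s (Suc m) - \<beta> (s + m) * continuant d \<beta> s m"

lemma continuant_left:
  "continuant d \<beta> s (Suc (Suc m)) =
     d s * continuant d \<beta> (Suc s) (Suc m) - \<beta> s * continuant d \<beta> (Suc (Suc s)) m"
proof (induction m rule: less_induct)
  case (less m)
  consider "m = 0" | "m = 1" | k where "m = Suc (Suc k)" by (metis One_nat_def old.nat.exhaust)
  then show ?case
  proof cases
    case 3
    define D B where "D = d (s + Suc (Suc (Suc k)))" and "B = \<beta> (s + Suc (Suc k))"
    have "continuant d \<beta> s (Suc (Suc m)) = D * continuant d \<beta> s (Suc (Suc (Suc k))) - B * continuant d \<beta> s (Suc (Suc k))"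
      unfolding 3 D_def B_def by (rule continuant.simps(3))
    also have "\<dots> = d s * (D * continuant d \<beta> (Suc s) (Suc (Suc k)) - B * continuant d \<beta> (Suc s) (Suc k))
        - \<beta> s * (D * continuant d \<beta> (Suc (Suc s)) (Suc k) - B * continuant d \<beta> (Suc (Suc s)) k)"
      unfolding less.IH[of "Suc k", unfolded 3, OF lessI] less.IH[of k, unfolded 3, OF less_SucI[OF lessI]]
      by (simp only: algebra_simps)
    also have "\<dots> = d s * continuant d \<beta> (Suc s) (Suc m) - \<beta> s * continuant d \<beta> (Suc (Suc s)) m"
      by (simp only: 3 D_def B_def continuant.simps(3) add_Suc add_Suc_right)
    finally show ?thesis .
  qed (simp_all add: algebra_simps)
qed

lemma continuant_shift:
  "continuant d \<beta> (Suc s) m = continuant (\<lambda>i. d (Suc i)) (\<lambda>i. \<beta> (Suc i)) s m"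
  by (induction d \<beta> s m rule: continuant.induct) simp_all

lemma continuant_cong:
  assumes "\<And>i. s \<le> i \<Longrightarrow> i < s + m \<Longrightarrow> d i = d' i" "\<And>i. s \<le> i \<Longrightarrow> Suc i < s + m \<Longrightarrow> \<beta> i = \<beta>' i"
  shows "continuant d \<beta> s m = continuant d' \<beta>' s m"
  using assms by (induction d \<beta> s m rule: continuant.induct) simp_all

text \<open>Discrete Wronskian of the recurrence: enlarging \<open>m\<close> multiplies it by one
  more \<open>\<beta>\<close>.\<close>

lemma continuant_wronskian:
  "continuant d \<beta> s (Suc m) * continuant d \<beta> (Suc s) (Suc m)
     - continuant d \<beta> s (Suc (Suc m)) * continuant d \<beta> (Suc s) m = (\<Prod>i=s..s + m. \<beta> i)"
proof (induction m)
  case (Suc m)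
  have "continuant d \<beta> s (Suc (Suc m)) * continuant d \<beta> (Suc s) (Suc (Suc m))
     - continuant d \<beta> s (Suc (Suc (Suc m))) * continuant d \<beta> (Suc s) (Suc m) =
     \<beta> (s + Suc m) * (continuant d \<beta> s (Suc m) * continuant d \<beta> (Suc s) (Suc m)
     - continuant d \<beta> s (Suc (Suc m)) * continuant d \<beta> (Suc s) m)"
    by (simp add: algebra_simps)
  then show ?case unfolding Suc by simp
qed simp

lemma sum_two_terms:
  fixes f :: "'a \<Rightarrow> 'b::comm_monoid_add"
  assumes "finite A" "a \<in> A" "b \<in> A" "a \<noteq> b" "\<And>i. i \<in> A \<Longrightarrow> i \<noteq> a \<Longrightarrow> i \<noteq> b \<Longrightarrow> f i = 0"
  shows "sum f A = f a + f b"
proof -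
  have "sum f A = sum f {a, b}" using assms by (intro sum.mono_neutral_right) auto
  then show ?thesis using assms(4) by simp
qed

lemma det_tridiagonal:
  fixes d u l :: "nat \<Rightarrow> 'a::comm_ring_1"
  shows "det (Matrix.mat m m (\<lambda>(i, j). if j = i then d (s + i) else if j = Suc i then u (s + i)
      else if i = Suc j then l (s + j) else 0)) = continuant d (\<lambda>i. u i * l i) s m"
proof (induction m rule: less_induct)
  case (less m)
  define f where "f i j = (if j = i then d (s + i) else if j = Suc i then u (s + i)
      else if i = Suc j then l (s + j) else 0)" for i j
  define T where "T m = Matrix.mat m m (\<lambda>(i, j). f i j)" for m
  have IH: "det (T k) = continuant d (\<lambda>i. u i * l i) s k" if "k < m" for k
    using less.IH[OF that] by (simp add: T_def f_def)
  consider "m = 0" | "m = 1" | k where "m = Suc (Suc k)" by (metis One_nat_def old.nat.exhaust)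
  then have "det (T m) = continuant d (\<lambda>i. u i * l i) s m"
  proof cases
    case 1
    then show ?thesis by (simp add: T_def)
  next
    case 2
    then show ?thesis by (simp add: T_def f_def det_single)
  next
    case 3
    have c: "T m \<in> carrier_mat m m" by (simp add: T_def)
    have "det (T m) = (\<Sum>j<m. T m $$ (Suc k, j) * cofactor (T m) (Suc k) j)"
      using 3 by (intro laplace_expansion_row[OF c]) simp
    also have "\<dots> = T m $$ (Suc k, k) * cofactor (T m) (Suc k) k
        + T m $$ (Suc k, Suc k) * cofactor (T m) (Suc k) (Suc k)"
      by (intro sum_two_terms) (auto simp: T_def f_def 3)
    also have "T m $$ (Suc k, k) = l (s + k)" by (simp add: T_def f_def 3)
    also have "T m $$ (Suc k, Suc k) = d (s + Suc k)" by (simp add: T_def f_def 3)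
    also have "cofactor (T m) (Suc k) (Suc k) = det (T (Suc k))"
    proof -
      have "mat_delete (T m) (Suc k) (Suc k) = T (Suc k)"
        unfolding mat_delete_def T_def by (intro eq_matI) (auto simp: 3)
      then show ?thesis by (simp add: cofactor_def)
    qed
    also have "cofactor (T m) (Suc k) k = - (u (s + k) * det (T k))"
    proof -
      define B where "B = mat_delete (T m) (Suc k) k"
      have B: "B \<in> carrier_mat (Suc k) (Suc k)" by (simp add: B_def mat_delete_def T_def 3)
      have Bf: "B $$ (i, j) = f i (if j < k then j else Suc j)" if "i \<le> k" "j \<le> k" for i j
        using that by (simp add: B_def mat_delete_def T_def 3)
      have "det B = (\<Sum>i<Suc k. B $$ (i, k) * cofactor B i k)"
        by (intro laplace_expansion_column[OF B]) simp
      also have "\<dots> = (\<Sum>i\<in>{k}. B $$ (i, k) * cofactor B i k)"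
        by (intro sum.mono_neutral_right) (auto simp: Bf f_def)
      also have "\<dots> = u (s + k) * cofactor B k k" by (simp add: Bf f_def)
      also have "mat_delete B k k = T k"
        using B by (intro eq_matI) (auto simp: mat_delete_def Bf T_def)
      then have "cofactor B k k = det (T k)" by (simp add: cofactor_def)
      finally show ?thesis by (simp add: cofactor_def B_def)
    qed
    finally show ?thesis using IH[of k] IH[of "Suc k"] 3 by (simp add: algebra_simps)
  qed
  then show ?case by (simp add: T_def f_def)
qed

text \<open>Expansion along the last row sorts the permutations by their use of the two closing
  entries: none, both as a transposition, or a single one; in the last case the permutation is a
  full cycle, of sign \<open>(-1) ^ (n - 1)\<close>.\<close>

lemma det_cyclic_tridiagonal:
  fixes d u l :: "nat \<Rightarrow> 'a::comm_ring_1"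
  assumes n: "3 \<le> n"
  shows "det (Matrix.mat n n (\<lambda>(i, j). if j = i then d i else if j = Suc i mod n then u i
      else if i = Suc j mod n then l j else 0)) =
    continuant d (\<lambda>i. u i * l i) 0 n - u (n - 1) * l (n - 1) * continuant d (\<lambda>i. u i * l i) 1 (n - 2)
      + (-1) ^ (n - 1) * ((\<Prod>i<n. u i) + (\<Prod>i<n. l i))"
proof -
  obtain m where m: "n = Suc (Suc (Suc m))"
    using le_Suc_ex[OF n] by (auto simp: numeral_3_eq_3)
  define f where "f i j = (if j = i then d i else if j = Suc i mod n then u i
      else if i = Suc j mod n then l j else 0)" for i j
  define A where "A = Matrix.mat n n (\<lambda>(i, j). f i j)"
  define T where "T s k = Matrix.mat k k (\<lambda>(i, j). if j = i then d (s + i) else if j = Suc i then u (s + i)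
      else if i = Suc j then l (s + j) else 0)" for s k
  define K where "K = continuant d (\<lambda>i. u i * l i)"
  have T: "det (T s k) = K s k" for s k unfolding T_def K_def by (rule det_tridiagonal)
  have f_less: "f i j = (if j = i then d i else if j = Suc i then u i else if i = Suc j then l j else 0)"
    if "i \<le> Suc m" "j \<le> Suc m" for i j
    using that by (simp add: f_def m)
  have f_col: "f i (Suc (Suc m)) = (if i = 0 then l (Suc (Suc m)) else if i = Suc m then u (Suc m) else 0)"
    if "i \<le> Suc m" for i
    using that by (auto simp: f_def m)
  have c: "A \<in> carrier_mat n n" by (simp add: A_def)
  have det2: "det B = B $$ (0, Suc m) * ((-1) ^ Suc m * det (mat_delete B 0 (Suc m)))
      + B $$ (Suc m, Suc m) * det (mat_delete B (Suc m) (Suc m))"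
    if B: "B \<in> carrier_mat (Suc (Suc m)) (Suc (Suc m))"
      and z: "\<And>i. i \<le> Suc m \<Longrightarrow> i \<noteq> 0 \<Longrightarrow> i \<noteq> Suc m \<Longrightarrow> B $$ (i, Suc m) = 0" for B :: "'a mat"
  proof -
    have "det B = (\<Sum>i<Suc (Suc m). B $$ (i, Suc m) * cofactor B i (Suc m))"
      by (intro laplace_expansion_column[OF B]) simp
    also have "\<dots> = B $$ (0, Suc m) * cofactor B 0 (Suc m) + B $$ (Suc m, Suc m) * cofactor B (Suc m) (Suc m)"
      using z by (intro sum_two_terms) auto
    finally show ?thesis by (simp add: cofactor_def)
  qed
  have lastrow: "f (Suc (Suc m)) j = (if j = 0 then u (Suc (Suc m)) else if j = Suc m then l (Suc m)
      else if j = Suc (Suc m) then d (Suc (Suc m)) else 0)" if "j < n" for j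
    using that by (auto simp: f_def m)
  have "det A = (\<Sum>j<n. A $$ (Suc (Suc m), j) * cofactor A (Suc (Suc m)) j)"
    using m by (intro laplace_expansion_row[OF c]) simp
  also have "\<dots> = (\<Sum>j\<in>{0, Suc m, Suc (Suc m)}. A $$ (Suc (Suc m), j) * cofactor A (Suc (Suc m)) j)"
    using m lastrow by (intro sum.mono_neutral_right) (auto simp: A_def)
  also have "\<dots> = u (Suc (Suc m)) * cofactor A (Suc (Suc m)) 0 + (l (Suc m) * cofactor A (Suc (Suc m)) (Suc m)
      + d (Suc (Suc m)) * cofactor A (Suc (Suc m)) (Suc (Suc m)))"
    using m lastrow by (simp add: A_def)
  also have "cofactor A (Suc (Suc m)) (Suc (Suc m)) = K 0 (Suc (Suc m))"
  proof -
    have "mat_delete A (Suc (Suc m)) (Suc (Suc m)) = T 0 (Suc (Suc m))"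
      unfolding mat_delete_def A_def T_def using f_less by (intro eq_matI) (auto simp: m)
    then show ?thesis using T by (simp add: cofactor_def)
  qed
  also have "cofactor A (Suc (Suc m)) (Suc m) =
     - (l (Suc (Suc m)) * ((-1) ^ Suc m * (\<Prod>i<Suc m. l i)) + u (Suc m) * K 0 (Suc m))"
  proof -
    define B where "B = mat_delete A (Suc (Suc m)) (Suc m)"
    have B: "B \<in> carrier_mat (Suc (Suc m)) (Suc (Suc m))" by (simp add: B_def mat_delete_def A_def m)
    have Bf: "B $$ (i, j) = f i (if j < Suc m then j else Suc j)" if "i \<le> Suc m" "j \<le> Suc m" for i j
      using that by (simp add: B_def mat_delete_def A_def m)
    have d1: "det (mat_delete B 0 (Suc m)) = (\<Prod>i<Suc m. l i)"
    proof -
      define C where "C = mat_delete B 0 (Suc m)"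
      have C: "C \<in> carrier_mat (Suc m) (Suc m)" using B by (simp add: C_def mat_delete_def)
      have Cf: "C $$ (i, j) = f (Suc i) j" if "i \<le> m" "j \<le> m" for i j
        using that B by (simp add: C_def mat_delete_def Bf)
      have "upper_triangular C"
        using C by (intro upper_triangularI) (auto simp: Cf f_less)
      then have "det C = (\<Prod>i<Suc m. C $$ (i, i))"
        using det_upper_triangular[OF _ C] C by (simp add: prod_list_diag_prod atLeast0LessThan)
      also have "\<dots> = (\<Prod>i<Suc m. l i)" by (intro prod.cong) (auto simp: Cf f_less)
      finally show ?thesis by (simp add: C_def)
    qed
    have d2: "mat_delete B (Suc m) (Suc m) = T 0 (Suc m)"
      using B f_less by (intro eq_matI) (auto simp: mat_delete_def Bf T_def)
    have "det B = l (Suc (Suc m)) * ((-1) ^ Suc m * (\<Prod>i<Suc m. l i)) + u (Suc m) * K 0 (Suc m)"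
      using det2[OF B] unfolding d1 d2 T by (simp add: Bf f_col)
    then show ?thesis by (simp add: cofactor_def B_def)
  qed
  also have "cofactor A (Suc (Suc m)) 0 =
     (-1) ^ Suc (Suc m) * (l (Suc (Suc m)) * ((-1) ^ Suc m * K 1 (Suc m)) + u (Suc m) * (\<Prod>i<Suc m. u i))"
  proof -
    define B where "B = mat_delete A (Suc (Suc m)) 0"
    have B: "B \<in> carrier_mat (Suc (Suc m)) (Suc (Suc m))" by (simp add: B_def mat_delete_def A_def m)
    have Bf: "B $$ (i, j) = f i (Suc j)" if "i \<le> Suc m" "j \<le> Suc m" for i j
      using that by (simp add: B_def mat_delete_def A_def m)
    have d1: "mat_delete B 0 (Suc m) = T 1 (Suc m)"
      using B f_less by (intro eq_matI) (auto simp: mat_delete_def Bf T_def)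
    have d2: "det (mat_delete B (Suc m) (Suc m)) = (\<Prod>i<Suc m. u i)"
    proof -
      define C where "C = mat_delete B (Suc m) (Suc m)"
      have C: "C \<in> carrier_mat (Suc m) (Suc m)" using B by (simp add: C_def mat_delete_def)
      have Cf: "C $$ (i, j) = f i (Suc j)" if "i \<le> m" "j \<le> m" for i j
        using that B by (simp add: C_def mat_delete_def Bf)
      have "det C = (\<Prod>i<Suc m. C $$ (i, i))"
        using det_lower_triangular[OF _ C] C by (simp add: prod_list_diag_prod atLeast0LessThan Cf f_less)
      also have "\<dots> = (\<Prod>i<Suc m. u i)" by (intro prod.cong) (auto simp: Cf f_less)
      finally show ?thesis by (simp add: C_def)
    qed
    have "det B = l (Suc (Suc m)) * ((-1) ^ Suc m * K 1 (Suc m)) + u (Suc m) * (\<Prod>i<Suc m. u i)"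
      using det2[OF B] unfolding d1 d2 T by (simp add: Bf f_col)
    then show ?thesis by (simp add: cofactor_def B_def)
  qed
  finally have "det A = d (Suc (Suc m)) * K 0 (Suc (Suc m)) - u (Suc m) * l (Suc m) * K 0 (Suc m)
      - u (Suc (Suc m)) * l (Suc (Suc m)) * K 1 (Suc m)
      + (-1) ^ Suc (Suc m) * ((\<Prod>i<n. u i) + (\<Prod>i<n. l i))"
  proof -
    have sq: "(-1 :: 'a) ^ m * (-1) ^ m = 1" by (simp flip: power_add mult_2)
    assume "det A = u (Suc (Suc m)) * ((-1) ^ Suc (Suc m) * (l (Suc (Suc m)) * ((-1) ^ Suc m * K 1 (Suc m)) + u (Suc m) * (\<Prod>i<Suc m. u i)))
      + (l (Suc m) * - (l (Suc (Suc m)) * ((-1) ^ Suc m * (\<Prod>i<Suc m. l i)) + u (Suc m) * K 0 (Suc m))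
      + d (Suc (Suc m)) * K 0 (Suc (Suc m)))"
    then have "det A = - ((-1) ^ m * (-1) ^ m) * (u (Suc (Suc m)) * l (Suc (Suc m)) * K 1 (Suc m))
      + (-1) ^ m * (u (Suc (Suc m)) * (u (Suc m) * (\<Prod>i<Suc m. u i)))
      + (-1) ^ m * (l (Suc (Suc m)) * (l (Suc m) * (\<Prod>i<Suc m. l i)))
      - u (Suc m) * l (Suc m) * K 0 (Suc m) + d (Suc (Suc m)) * K 0 (Suc (Suc m))"
      by (simp add: algebra_simps del: prod.lessThan_Suc)
    then show ?thesis unfolding sq by (simp add: m algebra_simps)
  qed
  also have "d (Suc (Suc m)) * K 0 (Suc (Suc m)) - u (Suc m) * l (Suc m) * K 0 (Suc m) = K 0 n"
    by (simp add: K_def m)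
  finally show ?thesis by (simp add: A_def f_def K_def m)
qed

lemma poly_continuant: "poly (continuant d \<beta> s m) x = continuant (\<lambda>i. poly (d i) x) (\<lambda>i. poly (\<beta> i) x) s m"
  by (induction d \<beta> s m rule: continuant.induct) simp_all

lemma of_real_continuant:
  "complex_of_real (continuant d \<beta> s m) = continuant (\<lambda>i. complex_of_real (d i)) (\<lambda>i. complex_of_real (\<beta> i)) s m"
  by (induction d \<beta> s m rule: continuant.induct) simp_all

section \<open>Hill's discriminant\<close>

text \<open>Hill's discriminant in monic normalisation, with \<open>\<beta>\<close> the squared
  moduli: the part of the characteristic polynomial that is blind to the phases.\<close>

definition discriminant_poly :: "nat \<Rightarrow> (nat \<Rightarrow> real) \<Rightarrow> (nat \<Rightarrow> real) \<Rightarrow> real poly" where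
  "discriminant_poly n a \<beta> = continuant (\<lambda>i. [:- a i, 1:]) (\<lambda>i. [:\<beta> i:]) 0 n
     - [:\<beta> (n - 1):] * continuant (\<lambda>i. [:- a i, 1:]) (\<lambda>i. [:\<beta> i:]) 1 (n - 2)"

lemma poly_char_poly_periodic_tridiagonal:
  assumes n: "3 \<le> n"
  shows "poly (char_poly (periodic_tridiagonal n a b)) (complex_of_real x) =
     complex_of_real (poly (discriminant_poly n a (\<lambda>i. (cmod (b i))\<^sup>2)) x - 2 * Re (\<Prod>i<n. b i))"
proof -
  let ?L = "periodic_tridiagonal n a b"
  define d where "d i = [:- complex_of_real (a i), 1:]" for i
  define u where "u i = [:- b i:]" for i
  define l where "l i = [:- cnj (b i):]" for i
  have "char_poly_matrix ?L = Matrix.mat n n (\<lambda>(i, j). if j = i then d i else if j = Suc i mod n then u i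
      else if i = Suc j mod n then l j else 0)"
    unfolding char_poly_matrix_def
    by (intro eq_matI) (auto simp: periodic_tridiagonal_def d_def u_def l_def)
  then have "char_poly ?L = continuant d (\<lambda>i. u i * l i) 0 n - u (n - 1) * l (n - 1) * continuant d (\<lambda>i. u i * l i) 1 (n - 2)
      + (-1) ^ (n - 1) * ((\<Prod>i<n. u i) + (\<Prod>i<n. l i))"
    unfolding char_poly_def by (simp only: det_cyclic_tridiagonal[OF n])
  moreover have ul: "poly (u i * l i) y = complex_of_real ((cmod (b i))\<^sup>2)" for i y
    unfolding u_def l_def by (simp add: complex_norm_square del: of_real_power)
  moreover have "poly (d i) (complex_of_real x) = complex_of_real (x - a i)" for i by (simp add: d_def)
  ultimately have "poly (char_poly ?L) (complex_of_real x) =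
     complex_of_real (continuant (\<lambda>i. x - a i) (\<lambda>i. (cmod (b i))\<^sup>2) 0 n)
     - complex_of_real ((cmod (b (n - 1)))\<^sup>2) * complex_of_real (continuant (\<lambda>i. x - a i) (\<lambda>i. (cmod (b i))\<^sup>2) 1 (n - 2))
     + (-1) ^ (n - 1) * ((\<Prod>i<n. - b i) + (\<Prod>i<n. - cnj (b i)))"
    unfolding of_real_continuant
    by (simp only: poly_diff poly_add poly_mult[of "u (n - 1) * l (n - 1)"] poly_mult[of "(-1) ^ (n - 1)"] poly_continuant)
      (simp add: poly_prod u_def l_def)
  also have "(-1) ^ (n - 1) * ((\<Prod>i<n. - b i) + (\<Prod>i<n. - cnj (b i))) = - complex_of_real (2 * Re (\<Prod>i<n. b i))"
  proof -
    obtain k where k: "n = Suc k" using n by (cases n) auto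
    have neg: "(\<Prod>i<n. - c i) = (-1) ^ n * (\<Prod>i<n. c i)" for c :: "nat \<Rightarrow> complex"
      by (simp add: prod_uminus)
    have sq: "(-1 :: complex) ^ k * (-1) ^ k = 1" by (simp flip: power_add mult_2)
    have "(-1) ^ (n - 1) * ((\<Prod>i<n. - b i) + (\<Prod>i<n. - cnj (b i))) =
       - ((-1) ^ k * (-1) ^ k) * ((\<Prod>i<n. b i) + (\<Prod>i<n. cnj (b i)))"
      unfolding neg by (simp add: k algebra_simps)
    also have "\<dots> = - ((\<Prod>i<n. b i) + cnj (\<Prod>i<n. b i))" unfolding sq by simp
    also have "\<dots> = - complex_of_real (2 * Re (\<Prod>i<n. b i))" unfolding complex_add_cnj ..
    finally show ?thesis .
  qed
  finally show ?thesis by (simp add: discriminant_poly_def poly_continuant)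
qed

lemma monic_eq_prod_roots:
  fixes p :: "'a::field poly"
  assumes "degree p = n" "Polynomial.coeff p n = 1" "inj_on r {..<n}" "\<And>i. i < n \<Longrightarrow> poly p (r i) = 0"
  shows "p = (\<Prod>i<n. [:- r i, 1:])"
proof -
  have *: "degree q = n \<Longrightarrow> (\<forall>i<n. poly q (r i) = 0) \<Longrightarrow> Polynomial.coeff q n = 1 \<Longrightarrow> inj_on r {..<n} \<Longrightarrow>
     q = (\<Prod>i<n. [:- r i, 1:])" for q
  proof (induction n arbitrary: q)
    case 0
    then show ?case by (metis degree_eq_zeroE coeff_pCons_0 lessThan_0 one_pCons prod.empty)
  next
    case (Suc n)
    have "poly q (r n) = 0" using Suc.prems by simp
    then obtain k where k: "q = [:- r n, 1:] * k" by (auto simp: poly_eq_0_iff_dvd elim: dvdE)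
    have k0: "k \<noteq> 0" using k Suc.prems(3) by auto
    have dk: "degree k = n"
      using Suc.prems(1) k0 unfolding k by (subst (asm) degree_mult_eq) auto
    have "lead_coeff q = lead_coeff k" unfolding k by (subst lead_coeff_mult) simp
    then have "Polynomial.coeff k n = 1" using Suc.prems(1,3) dk by simp
    moreover have "poly k (r i) = 0" if "i < n" for i
    proof -
      have "poly q (r i) = 0" using Suc.prems(2) that by simp
      moreover have "r i \<noteq> r n" using Suc.prems(4) that by (auto simp: inj_on_def)
      ultimately show ?thesis unfolding k by simp
    qed
    moreover have "inj_on r {..<n}" using Suc.prems(4) by (auto simp: inj_on_def)
    ultimately have "k = (\<Prod>i<n. [:- r i, 1:])" using Suc.IH dk by blast
    then show ?case using k by (simp add: mult.commute)
  qed
  show ?thesis using *[of p] assms by blast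
qed

text \<open>Since the \<open>n\<close> prescribed eigenvalues are distinct, having them as spectrum
  fixes the monic characteristic polynomial of degree \<open>n\<close>; and polynomials that agree
  on the real line are equal.\<close>

lemma isospectral_iff_discriminant:
  assumes n: "3 \<le> n" and lam: "strict_mono_on {1..n} lam"
  shows "periodic_tridiagonal n a b \<in> isospectral n lam \<longleftrightarrow>
    (\<forall>x. poly (discriminant_poly n a (\<lambda>i. (cmod (b i))\<^sup>2)) x = spectral_poly n lam x + 2 * Re (\<Prod>i<n. b i))"
proof -
  let ?L = "periodic_tridiagonal n a b"
  define \<Lambda> where "\<Lambda> i = complex_of_real (lam (Suc i))" for i
  define q where "q = (\<Prod>i<n. [:- \<Lambda> i, 1:])"
  have L: "?L \<in> carrier_mat n n" by (simp add: periodic_tridiagonal_def)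
  have cp: "degree (char_poly ?L) = n" "Polynomial.coeff (char_poly ?L) n = 1"
    using degree_monic_char_poly[OF L] by auto
  have spec: "spectrum ?L = {k. poly (char_poly ?L) k = 0}"
    unfolding spectrum_def using eigenvalue_root_char_poly[OF L] by auto
  have img: "(\<lambda>i. complex_of_real (lam i)) ` {1..n} = \<Lambda> ` {..<n}"
  proof -
    have "{1..n} = Suc ` {..<n}" by (metis One_nat_def image_Suc_lessThan)
    then show ?thesis by (simp add: image_image \<Lambda>_def)
  qed
  have inj: "inj_on \<Lambda> {..<n}"
    unfolding inj_on_def \<Lambda>_def
  proof (intro ballI impI)
    fix i j assume ij: "i \<in> {..<n}" "j \<in> {..<n}" "complex_of_real (lam (Suc i)) = complex_of_real (lam (Suc j))"
    have "inj_on lam {1..n}" using lam by (rule strict_mono_on_imp_inj_on)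
    from inj_onD[OF this, of "Suc i" "Suc j"] ij show "i = j" by simp
  qed
  have q0: "poly q y = 0 \<longleftrightarrow> y \<in> \<Lambda> ` {..<n}" for y by (auto simp: q_def poly_prod)
  have qx: "poly q (complex_of_real x) = complex_of_real (spectral_poly n lam x)" for x
  proof -
    have "(\<Prod>i=1..n. x - lam i) = (\<Prod>i<n. x - lam (Suc i))"
      by (rule prod.reindex_bij_witness[of _ Suc "\<lambda>i. i - 1"]) auto
    then show ?thesis by (simp add: q_def poly_prod spectral_poly_def \<Lambda>_def)
  qed
  have "?L \<in> isospectral n lam \<longleftrightarrow> spectrum ?L = \<Lambda> ` {..<n}"
    unfolding isospectral_def img by blast
  also have "\<dots> \<longleftrightarrow> char_poly ?L = q"
  proof
    assume "spectrum ?L = \<Lambda> ` {..<n}"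
    then have "poly (char_poly ?L) (\<Lambda> i) = 0" if "i < n" for i using that unfolding spec by auto
    then show "char_poly ?L = q" unfolding q_def by (intro monic_eq_prod_roots cp inj) auto
  next
    assume "char_poly ?L = q"
    then show "spectrum ?L = \<Lambda> ` {..<n}" unfolding spec using q0 by auto
  qed
  also have "\<dots> \<longleftrightarrow> (\<forall>x. poly (char_poly ?L) (complex_of_real x) = poly q (complex_of_real x))"
  proof
    assume eq: "\<forall>x. poly (char_poly ?L) (complex_of_real x) = poly q (complex_of_real x)"
    show "char_poly ?L = q"
    proof (rule ccontr)
      assume "char_poly ?L \<noteq> q"
      then have "finite {x. poly (char_poly ?L - q) x = 0}" by (intro poly_roots_finite) simp
      moreover have "range complex_of_real \<subseteq> {x. poly (char_poly ?L - q) x = 0}"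
      proof
        fix y assume "y \<in> range complex_of_real"
        then obtain x where "y = complex_of_real x" by blast
        then show "y \<in> {x. poly (char_poly ?L - q) x = 0}"
          using eq[rule_format, of x] by (simp only: mem_Collect_eq poly_diff right_minus_eq)
      qed
      ultimately have "finite (range complex_of_real)" by (rule rev_finite_subset)
      then have "finite (UNIV :: real set)"
        by (rule finite_imageD) (simp add: inj_on_def)
      then show False using infinite_UNIV_char_0 by blast
    qed
  qed simp
  also have "\<dots> \<longleftrightarrow> (\<forall>x. poly (discriminant_poly n a (\<lambda>i. (cmod (b i))\<^sup>2)) x = spectral_poly n lam x + 2 * Re (\<Prod>i<n. b i))"
    unfolding poly_char_poly_periodic_tridiagonal[OF n] qx of_real_eq_iff by (simp only: diff_eq_eq)
  finally show ?thesis .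
qed


section \<open>Interlacing and the inverse spectral problem\<close>

definition monic_deg :: "real poly \<Rightarrow> nat \<Rightarrow> bool" where
  "monic_deg p m \<longleftrightarrow> degree p = m \<and> Polynomial.coeff p m = 1"

lemma monic_degD: "monic_deg p m \<Longrightarrow> degree p = m" "monic_deg p m \<Longrightarrow> Polynomial.coeff p m = 1"
  by (simp_all add: monic_deg_def)

lemma monic_deg_prod: "monic_deg (\<Prod>i<m. [:- r i, 1:]) m"
proof -
  have "degree (\<Prod>i<m. [:- r i, 1:]) = m"
    by (subst degree_prod_eq_sum_degree) auto
  moreover have "lead_coeff (\<Prod>i<m. [:- r i, 1:]) = 1" by (simp add: lead_coeff_prod)
  ultimately show ?thesis by (simp add: monic_deg_def)
qed

lemma monic_deg_step:
  assumes "monic_deg p (Suc m)" "degree q \<le> Suc m"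
  shows "monic_deg ([:- a, 1:] * p - q) (Suc (Suc m))"
proof -
  have p0: "p \<noteq> 0" using assms(1) by (auto simp: monic_deg_def)
  have d: "degree ([:- a, 1:] * p) = Suc (Suc m)"
    using assms(1) p0 by (subst degree_mult_eq) (auto simp: monic_deg_def)
  have "lead_coeff ([:- a, 1:] * p) = 1"
    using assms(1) by (subst lead_coeff_mult) (simp add: monic_deg_def)
  then have c: "Polynomial.coeff ([:- a, 1:] * p) (Suc (Suc m)) = 1" using d by simp
  have "Polynomial.coeff q (Suc (Suc m)) = 0" using assms(2) by (intro coeff_eq_0) simp
  then have c1: "Polynomial.coeff ([:- a, 1:] * p - q) (Suc (Suc m)) = 1" using c by simp
  have "degree ([:- a, 1:] * p - q) \<le> Suc (Suc m)" using d assms(2) by (intro degree_diff_le) auto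
  moreover have "Suc (Suc m) \<le> degree ([:- a, 1:] * p - q)" using c1 by (intro le_degree) simp
  ultimately show ?thesis using c1 by (simp add: monic_deg_def)
qed

abbreviation cpoly :: "(nat \<Rightarrow> real) \<Rightarrow> (nat \<Rightarrow> real) \<Rightarrow> nat \<Rightarrow> nat \<Rightarrow> real poly" where
  "cpoly a \<beta> \<equiv> continuant (\<lambda>i. [:- a i, 1:]) (\<lambda>i. [:\<beta> i:])"

lemma degree_const_mult_le: "degree ([:c:] * p) \<le> degree (p :: real poly)"
  by (cases "c = 0") auto

lemma monic_deg_cpoly: "monic_deg (cpoly a \<beta> s m) m"
proof (induction m rule: less_induct)
  case (less m)
  consider "m = 0" | "m = 1" | k where "m = Suc (Suc k)" by (metis One_nat_def old.nat.exhaust)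
  then show ?case
  proof cases
    case 3
    have "degree ([:\<beta> (s + k):] * cpoly a \<beta> s k) \<le> Suc k"
      using degree_const_mult_le[of "\<beta> (s + k)" "cpoly a \<beta> s k"] monic_degD(1)[OF less.IH[of k]] 3 by simp
    then show ?thesis unfolding 3 continuant.simps(3)
      using less.IH[of "Suc k"] 3 by (intro monic_deg_step) auto
  qed (auto simp: monic_deg_def)
qed

lemma prod_minus_sign:
  fixes \<nu> :: "nat \<Rightarrow> real"
  assumes "j \<le> M" "\<And>k. k < j \<Longrightarrow> \<nu> k < x" "\<And>k. j \<le> k \<Longrightarrow> k < M \<Longrightarrow> x < \<nu> k"
  shows "0 < (-1) ^ (M - j) * (\<Prod>k<M. x - \<nu> k)"
  using assms
proof (induction M)
  case (Suc M)
  show ?case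
  proof (cases "j = Suc M")
    case True
    then show ?thesis using Suc.prems(2) by (auto intro!: prod_pos mult_pos_pos)
  next
    case False
    then have "0 < (-1) ^ (M - j) * (\<Prod>k<M. x - \<nu> k)" using Suc by auto
    moreover have "x < \<nu> M" using Suc.prems False by auto
    ultimately have "0 < ((-1) ^ (M - j) * (\<Prod>k<M. x - \<nu> k)) * (\<nu> M - x)" by simp
    also have "\<dots> = (-1) ^ (Suc M - j) * (\<Prod>k<Suc M. x - \<nu> k)"
      using False Suc.prems(1) by (simp add: Suc_diff_le algebra_simps)
    finally show ?thesis .
  qed
qed simp

lemma prod_remove_sign:
  fixes \<nu> :: "nat \<Rightarrow> real"
  assumes "strict_mono_on {..<N} \<nu>" "k < N"
  shows "0 < (-1) ^ (N - 1 - k) * (\<Prod>i\<in>{..<N} - {k}. \<nu> k - \<nu> i)"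
proof -
  define f where "f i = (if i < k then i else Suc i)" for i
  have "(\<Prod>i\<in>{..<N} - {k}. \<nu> k - \<nu> i) = (\<Prod>i<N - 1. \<nu> k - \<nu> (f i))"
    by (rule prod.reindex_bij_witness[of _ f "\<lambda>i. if i < k then i else i - 1"]) (use assms(2) in \<open>auto simp: f_def\<close>)
  moreover have "0 < (-1) ^ (N - 1 - k) * (\<Prod>i<N - 1. \<nu> k - \<nu> (f i))"
    using assms by (intro prod_minus_sign) (auto simp: f_def intro!: strict_mono_onD[of "{..<N}" \<nu>])
  ultimately show ?thesis by simp
qed

definition lagrange :: "nat \<Rightarrow> (nat \<Rightarrow> real) \<Rightarrow> (nat \<Rightarrow> real) \<Rightarrow> real poly" where
  "lagrange N \<nu> y = (\<Sum>k<N. [:y k / (\<Prod>i\<in>{..<N} - {k}. \<nu> k - \<nu> i):] * (\<Prod>i\<in>{..<N} - {k}. [:- \<nu> i, 1:]))"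

lemma poly_lagrange:
  assumes "inj_on \<nu> {..<N}" "k < N"
  shows "poly (lagrange N \<nu> y) (\<nu> k) = y k"
proof -
  have "poly (lagrange N \<nu> y) (\<nu> k) = (\<Sum>j<N. y j / (\<Prod>i\<in>{..<N} - {j}. \<nu> j - \<nu> i) * (\<Prod>i\<in>{..<N} - {j}. \<nu> k - \<nu> i))"
    by (simp add: lagrange_def poly_sum poly_prod)
  also have "\<dots> = (\<Sum>j\<in>{k}. y j / (\<Prod>i\<in>{..<N} - {j}. \<nu> j - \<nu> i) * (\<Prod>i\<in>{..<N} - {j}. \<nu> k - \<nu> i))"
    using assms(2) by (intro sum.mono_neutral_right) auto
  also have "\<dots> = y k"
  proof -
    have "(\<Prod>i\<in>{..<N} - {k}. \<nu> k - \<nu> i) \<noteq> 0" using assms by (auto simp: inj_on_def)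
    then show ?thesis by simp
  qed
  finally show ?thesis .
qed

lemma monic_prod_remove:
  assumes "k < N"
  shows "monic_deg (\<Prod>i\<in>{..<N} - {k}. [:- \<nu> i, 1:]) (N - 1)"
proof -
  have "degree (\<Prod>i\<in>{..<N} - {k}. [:- \<nu> i, 1:]) = card ({..<N} - {k})"
    by (subst degree_prod_eq_sum_degree) auto
  also have "\<dots> = N - 1" using assms by simp
  finally have "degree (\<Prod>i\<in>{..<N} - {k}. [:- \<nu> i, 1:]) = N - 1" .
  moreover have "lead_coeff (\<Prod>i\<in>{..<N} - {k}. [:- \<nu> i, 1:]) = 1" by (simp add: lead_coeff_prod)
  ultimately show ?thesis by (simp add: monic_deg_def)
qed

lemma degree_lagrange: "degree (lagrange N \<nu> y) \<le> N - 1"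
  unfolding lagrange_def
proof (rule degree_sum_le)
  fix k assume "k \<in> {..<N}"
  then show "degree ([:y k / (\<Prod>i\<in>{..<N} - {k}. \<nu> k - \<nu> i):] * (\<Prod>i\<in>{..<N} - {k}. [:- \<nu> i, 1:])) \<le> N - 1"
    using order_trans[OF degree_const_mult_le] monic_degD(1)[OF monic_prod_remove] by simp
qed simp

lemma coeff_lagrange:
  "Polynomial.coeff (lagrange N \<nu> y) (N - 1) = (\<Sum>k<N. y k / (\<Prod>i\<in>{..<N} - {k}. \<nu> k - \<nu> i))"
proof -
  have "Polynomial.coeff ([:c:] * (\<Prod>i\<in>{..<N} - {k}. [:- \<nu> i, 1:])) (N - 1) = c" if "k < N" for c k
    using monic_degD(2)[OF monic_prod_remove[OF that, of \<nu>]] by simp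
  then show ?thesis unfolding lagrange_def coeff_sum by (intro sum.cong refl) blast
qed

lemma poly_eq_at_points:
  fixes p q :: "real poly"
  assumes "degree p < N" "degree q < N" "inj_on \<nu> {..<N}" "\<And>k. k < N \<Longrightarrow> poly p (\<nu> k) = poly q (\<nu> k)"
  shows "p = q"
proof (rule ccontr)
  assume "p \<noteq> q"
  then have nz: "p - q \<noteq> 0" by simp
  have "\<nu> ` {..<N} \<subseteq> {x. poly (p - q) x = 0}" using assms(4) by auto
  then have "card (\<nu> ` {..<N}) \<le> card {x. poly (p - q) x = 0}" using poly_roots_finite[OF nz] card_mono by blast
  also have "\<dots> \<le> degree (p - q)" by (rule poly_roots_degree[OF nz])
  also have "\<dots> < N" using assms(1,2) by (rule degree_diff_less)
  finally show False using card_image[OF assms(3)] by simp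
qed

lemma lagrange_unique:
  assumes "degree p < N" "inj_on \<nu> {..<N}"
  shows "p = lagrange N \<nu> (\<lambda>k. poly p (\<nu> k))"
proof (rule poly_eq_at_points[OF assms(1) _ assms(2)])
  show "degree (lagrange N \<nu> (\<lambda>k. poly p (\<nu> k))) < N"
    using degree_lagrange[of N \<nu> "\<lambda>k. poly p (\<nu> k)"] assms(1) by linarith
qed (simp add: poly_lagrange[OF assms(2)])

text \<open>Lagrange's formula gives this coefficient as the sum of the values at the nodes, each
  divided by the product of the differences to the other nodes. These products alternate in sign
  exactly as the values do.\<close>

lemma alternating_coeff_pos:
  fixes \<nu> :: "nat \<Rightarrow> real"
  assumes "degree p < N" "strict_mono_on {..<N} \<nu>" "\<And>k. k < N \<Longrightarrow> 0 < (-1) ^ (N - 1 - k) * poly p (\<nu> k)"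
  shows "0 < Polynomial.coeff p (N - 1)"
proof -
  have "p = lagrange N \<nu> (\<lambda>k. poly p (\<nu> k))"
    using assms by (intro lagrange_unique strict_mono_on_imp_inj_on)
  then have "Polynomial.coeff p (N - 1) = (\<Sum>k<N. poly p (\<nu> k) / (\<Prod>i\<in>{..<N} - {k}. \<nu> k - \<nu> i))"
    using coeff_lagrange by metis
  also have "0 < \<dots>"
  proof (rule sum_pos)
    fix k assume "k \<in> {..<N}"
    then have k: "k < N" by simp
    define e where "e = (-1 :: real) ^ (N - 1 - k)"
    have e: "e * e = 1" by (simp add: e_def flip: power_add mult_2)
    have "0 < (e * poly p (\<nu> k)) / (e * (\<Prod>i\<in>{..<N} - {k}. \<nu> k - \<nu> i))"
      unfolding e_def using assms(3)[OF k] prod_remove_sign[OF assms(2) k] by (rule divide_pos_pos)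
    also have "\<dots> = poly p (\<nu> k) / (\<Prod>i\<in>{..<N} - {k}. \<nu> k - \<nu> i)" using e by auto
    finally show "0 < poly p (\<nu> k) / (\<Prod>i\<in>{..<N} - {k}. \<nu> k - \<nu> i)" .
  qed (use assms(1) in auto)
  finally show ?thesis .
qed

lemma alternating_roots:
  fixes \<eta> :: "nat \<Rightarrow> real"
  assumes mono: "\<And>k. k < m \<Longrightarrow> \<eta> k < \<eta> (Suc k)"
    and sgn: "\<And>k. k \<le> m \<Longrightarrow> 0 < (-1) ^ (m - k) * poly p (\<eta> k)"
  obtains r where "\<And>k. k < m \<Longrightarrow> \<eta> k < r k \<and> r k < \<eta> (Suc k) \<and> poly p (r k) = 0" "strict_mono_on {..<m} r"
proof -
  have "\<exists>x. \<eta> k < x \<and> x < \<eta> (Suc k) \<and> poly p x = 0" if k: "k < m" for k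
  proof -
    define e where "e = (-1 :: real) ^ (m - Suc k)"
    have e: "e * e = 1" by (simp add: e_def flip: power_add mult_2)
    have "m - k = Suc (m - Suc k)" using k by simp
    then have "0 < - e * poly p (\<eta> k)" using sgn[of k] k by (simp add: e_def)
    moreover have "0 < e * poly p (\<eta> (Suc k))" using sgn[of "Suc k"] k by (simp add: e_def)
    ultimately have "0 < (- e * poly p (\<eta> k)) * (e * poly p (\<eta> (Suc k)))" by (rule mult_pos_pos)
    also have "\<dots> = - (e * e) * (poly p (\<eta> k) * poly p (\<eta> (Suc k)))" by (simp add: mult_ac)
    finally have "poly p (\<eta> k) * poly p (\<eta> (Suc k)) < 0" unfolding e by simp
    then show ?thesis using poly_IVT[OF mono[OF k]] by blast
  qed
  then obtain r where r: "\<And>k. k < m \<Longrightarrow> \<eta> k < r k \<and> r k < \<eta> (Suc k) \<and> poly p (r k) = 0" by metis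
  have le: "\<eta> i \<le> \<eta> j" if "i \<le> j" "j \<le> m" for i j
    using that
  proof (induction j rule: dec_induct)
    case (step j)
    then show ?case using mono[of j] by simp
  qed simp
  have "strict_mono_on {..<m} r"
  proof (rule strict_mono_onI)
    fix i j assume ij: "i \<in> {..<m}" "j \<in> {..<m}" "i < j"
    have "r i < \<eta> (Suc i)" using r ij by simp
    also have "\<dots> \<le> \<eta> j" using le ij by simp
    also have "\<dots> < r j" using r ij by simp
    finally show "r i < r j" .
  qed
  with r show ?thesis using that by blast
qed

section \<open>Interlacing pairs and continued fractions\<close>

text \<open>Interlacing is expressed by the alternating signs of \<open>E\<close> at the roots of
  \<open>D\<close>, the form in which the intermediate value theorem and Lagrange's formula use
  it.\<close>

definition interlacing :: "real poly \<Rightarrow> real poly \<Rightarrow> nat \<Rightarrow> (nat \<Rightarrow> real) \<Rightarrow> bool" where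
  "interlacing D E N \<mu> \<longleftrightarrow> strict_mono_on {..<N} \<mu> \<and> D = (\<Prod>j<N. [:- \<mu> j, 1:]) \<and> monic_deg E (N - 1) \<and>
     (\<forall>j<N. 0 < (-1) ^ (N - 1 - j) * poly E (\<mu> j))"

text \<open>One step of Stieltjes' continued fraction for \<open>E / D\<close>, that is, of Euclid's
  algorithm. At the roots of \<open>E\<close> the remainder equals \<open>- D\<close>, which
  alternates, so its leading coefficient \<open>\<beta>\<close> is positive and the pair
  \<open>E\<close>, \<open>E2\<close> interlaces again.\<close>

lemma interlacing_down:
  assumes I: "interlacing D E (Suc (Suc M)) \<mu>"
  obtains a \<beta> E2 \<nu> where "0 < \<beta>" "D = [:- a, 1:] * E - [:\<beta>:] * E2" "interlacing E E2 (Suc M) \<nu>"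
proof -
  have mono: "strict_mono_on {..<Suc (Suc M)} \<mu>" and D: "D = (\<Prod>j<Suc (Suc M). [:- \<mu> j, 1:])"
    and E: "monic_deg E (Suc M)" and sgn: "\<And>j. j < Suc (Suc M) \<Longrightarrow> 0 < (-1) ^ (Suc M - j) * poly E (\<mu> j)"
    using I by (auto simp: interlacing_def)
  have lt: "\<mu> i < \<mu> j" if "i < j" "j < Suc (Suc M)" for i j
    using strict_mono_onD[OF mono, of i j] that by simp
  obtain \<nu> where \<nu>: "\<And>k. k < Suc M \<Longrightarrow> \<mu> k < \<nu> k \<and> \<nu> k < \<mu> (Suc k) \<and> poly E (\<nu> k) = 0"
    and \<nu>m: "strict_mono_on {..<Suc M} \<nu>"
    using alternating_roots[of "Suc M" \<mu> E] lt sgn by (metis Suc_mono lessI le_imp_less_Suc)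
  have E\<nu>: "E = (\<Prod>j<Suc M. [:- \<nu> j, 1:])"
    using E \<nu> strict_mono_on_imp_inj_on[OF \<nu>m] by (intro monic_eq_prod_roots) (auto simp: monic_deg_def)
  have D\<nu>: "0 < (-1) ^ (Suc M - k) * poly D (\<nu> k)" if k: "k < Suc M" for k
  proof -
    have "0 < (-1) ^ (Suc (Suc M) - Suc k) * (\<Prod>j<Suc (Suc M). \<nu> k - \<mu> j)"
    proof (rule prod_minus_sign)
      show "\<mu> j < \<nu> k" if "j < Suc k" for j
        using \<nu>[OF k] lt[of j k] that k by (cases "j = k") auto
      show "\<nu> k < \<mu> j" if "Suc k \<le> j" "j < Suc (Suc M)" for j
        using \<nu>[OF k] lt[of "Suc k" j] that by (cases "j = Suc k") auto
    qed (use k in simp)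
    then show ?thesis unfolding D poly_prod by simp
  qed
  have Dm: "monic_deg D (Suc (Suc M))" unfolding D by (rule monic_deg_prod)
  \<comment> \<open>Chosen to cancel the coefficient of degree \<open>Suc M\<close>, so that the
    remainder has degree at most \<open>M\<close>.\<close>
  define a where "a = Polynomial.coeff E M - Polynomial.coeff D (Suc M)"
  define G where "G = [:- a, 1:] * E - D"
  have "degree G \<le> M"
  proof (rule degree_le, intro allI impI)
    fix i assume "M < i"
    then consider "i = Suc M" | "i = Suc (Suc M)" | "Suc (Suc M) < i" by linarith
    then show "Polynomial.coeff G i = 0"
    proof cases
      case 1
      then show ?thesis using monic_degD(2)[OF E] by (simp add: G_def a_def)
    next
      case 2
      have "Polynomial.coeff E (Suc (Suc M)) = 0" using monic_degD(1)[OF E] by (intro coeff_eq_0) simp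
      then show ?thesis using 2 monic_degD(2)[OF E] monic_degD(2)[OF Dm] by (simp add: G_def)
    next
      case 3
      then obtain i' where i': "i = Suc i'" "Suc M < i'" by (cases i) auto
      have "Polynomial.coeff E i = 0" "Polynomial.coeff E i' = 0" "Polynomial.coeff D i = 0"
        using 3 i' monic_degD(1)[OF E] monic_degD(1)[OF Dm] by (auto intro!: coeff_eq_0)
      then show ?thesis using i' by (simp add: G_def)
    qed
  qed
  have G\<nu>: "poly G (\<nu> k) = - poly D (\<nu> k)" if "k < Suc M" for k using \<nu>[OF that] by (simp add: G_def)
  have Gs: "0 < (-1) ^ (M - k) * poly G (\<nu> k)" if "k < Suc M" for k
    using D\<nu>[OF that] G\<nu>[OF that] that by (simp add: Suc_diff_le)
  define \<beta> where "\<beta> = Polynomial.coeff G M"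
  have \<beta>: "0 < \<beta>"
    using alternating_coeff_pos[OF _ \<nu>m, of G] Gs \<open>degree G \<le> M\<close> by (simp add: \<beta>_def)
  define E2 where "E2 = [:1 / \<beta>:] * G"
  have "monic_deg E2 M"
  proof -
    have c: "Polynomial.coeff E2 M = 1" using \<beta> by (simp add: E2_def \<beta>_def)
    then have "M \<le> degree E2" by (intro le_degree) simp
    moreover have "degree E2 \<le> M"
      unfolding E2_def by (rule order_trans[OF degree_const_mult_le \<open>degree G \<le> M\<close>])
    ultimately show ?thesis using c by (simp add: monic_deg_def)
  qed
  moreover have "0 < (-1) ^ (M - k) * poly E2 (\<nu> k)" if "k < Suc M" for k
    using Gs[OF that] \<beta> by (simp add: E2_def)
  ultimately have "interlacing E E2 (Suc M) \<nu>" unfolding interlacing_def using \<nu>m E\<nu> by simp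
  moreover have "D = [:- a, 1:] * E - [:\<beta>:] * E2" using \<beta> by (simp add: E2_def G_def)
  ultimately show ?thesis using \<beta> that by blast
qed

lemma monic_pos_right:
  assumes "monic_deg p m"
  obtains x where "c < x" "0 < poly p x"
proof -
  have "0 < lead_coeff p" using assms by (simp add: monic_deg_def)
  then obtain N where "\<And>x. N \<le> x \<Longrightarrow> lead_coeff p \<le> poly p x" using poly_pinfty_gt_lc by blast
  then have "0 < poly p (max N (c + 1))" using \<open>0 < lead_coeff p\<close> by (meson less_le_trans max.cobounded1)
  then show ?thesis using that[of "max N (c + 1)"] by auto
qed

lemma monic_sign_left:
  assumes "monic_deg p m"
  obtains x where "x < c" "0 < (-1) ^ m * poly p x"
proof -
  define q where "q = [:(-1) ^ m:] * (p \<circ>\<^sub>p [:0, -1:])"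
  have d: "degree (p \<circ>\<^sub>p [:0, -1:]) = m" using assms by (simp add: monic_deg_def degree_pcompose)
  have lc: "lead_coeff (p \<circ>\<^sub>p [:0, -1:]) = (-1) ^ m"
    using assms by (subst lead_coeff_comp) (auto simp: monic_deg_def)
  have "(-1 :: real) ^ m * (-1) ^ m = 1" by (simp flip: power_add mult_2)
  then have "monic_deg q m" using d lc by (simp add: q_def monic_deg_def)
  then obtain x where "- c < x" "0 < poly q x" by (rule monic_pos_right)
  then show ?thesis using that[of "- x"] by (simp add: q_def poly_pcompose)
qed

text \<open>At the roots of \<open>E\<close> the new polynomial has the sign of \<open>- E2\<close>,
  which alternates; the signs far to the left and far to the right supply the two outer
  roots.\<close>

lemma interlacing_up:
  assumes I: "interlacing E E2 (Suc M) \<nu>" and \<beta>: "0 < \<beta>"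
  obtains \<mu> where "interlacing ([:- a, 1:] * E - [:\<beta>:] * E2) E (Suc (Suc M)) \<mu>"
proof -
  have mono: "strict_mono_on {..<Suc M} \<nu>" and E: "E = (\<Prod>j<Suc M. [:- \<nu> j, 1:])"
    and E2: "monic_deg E2 M" and sgn: "\<And>j. j < Suc M \<Longrightarrow> 0 < (-1) ^ (M - j) * poly E2 (\<nu> j)"
    using I by (auto simp: interlacing_def)
  define D where "D = [:- a, 1:] * E - [:\<beta>:] * E2"
  have Em: "monic_deg E (Suc M)" unfolding E by (rule monic_deg_prod)
  have Dm: "monic_deg D (Suc (Suc M))"
    unfolding D_def using degree_const_mult_le[of \<beta> E2] monic_degD(1)[OF E2] by (intro monic_deg_step[OF Em]) simp
  have D\<nu>: "0 < (-1) ^ (Suc M - k) * poly D (\<nu> k)" if k: "k < Suc M" for k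
  proof -
    have "poly E (\<nu> k) = 0"
      unfolding E poly_prod using k by (intro prod_zero bexI[of _ k]) auto
    then have "poly D (\<nu> k) = - \<beta> * poly E2 (\<nu> k)" by (simp add: D_def)
    then have "(-1) ^ (Suc M - k) * poly D (\<nu> k) = \<beta> * ((-1) ^ (M - k) * poly E2 (\<nu> k))"
      using k by (simp add: Suc_diff_le)
    then show ?thesis using sgn[OF k] \<beta> by simp
  qed
  obtain y0 where y0: "y0 < \<nu> 0" "0 < (-1) ^ Suc (Suc M) * poly D y0" by (rule monic_sign_left[OF Dm])
  obtain y1 where y1: "\<nu> M < y1" "0 < poly D y1" by (rule monic_pos_right[OF Dm])
  define \<eta> where "\<eta> k = (if k = 0 then y0 else if k = Suc (Suc M) then y1 else \<nu> (k - 1))" for k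
  have "\<eta> k < \<eta> (Suc k)" if k: "k < Suc (Suc M)" for k
  proof -
    consider "k = 0" | "k = Suc M" "k \<noteq> 0" | "0 < k" "k < Suc M" using k by linarith
    then show ?thesis
    proof cases
      case 3
      then show ?thesis using strict_mono_onD[OF mono, of "k - 1" k] by (auto simp: \<eta>_def)
    qed (use y0 y1 in \<open>auto simp: \<eta>_def\<close>)
  qed
  moreover have "0 < (-1) ^ (Suc (Suc M) - k) * poly D (\<eta> k)" if k: "k \<le> Suc (Suc M)" for k
  proof -
    consider "k = 0" | "k = Suc (Suc M)" | j where "k = Suc j" "j < Suc M" using k
      by (cases k) (auto simp: le_Suc_eq less_Suc_eq_le)
    then show ?thesis
    proof cases
      case 3
      then show ?thesis using D\<nu>[of j] by (simp add: \<eta>_def)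
    qed (use y0 y1 in \<open>auto simp: \<eta>_def\<close>)
  qed
  ultimately obtain \<mu> where \<mu>: "\<And>k. k < Suc (Suc M) \<Longrightarrow> \<eta> k < \<mu> k \<and> \<mu> k < \<eta> (Suc k) \<and> poly D (\<mu> k) = 0"
    and \<mu>m: "strict_mono_on {..<Suc (Suc M)} \<mu>"
    using alternating_roots[of "Suc (Suc M)" \<eta> D] by metis
  have "D = (\<Prod>j<Suc (Suc M). [:- \<mu> j, 1:])"
    using Dm \<mu> strict_mono_on_imp_inj_on[OF \<mu>m] by (intro monic_eq_prod_roots) (auto simp: monic_deg_def)
  moreover have "0 < (-1) ^ (Suc M - j) * poly E (\<mu> j)" if j: "j < Suc (Suc M)" for j
  proof -
    have le: "\<nu> i \<le> \<nu> k" if "i \<le> k" "k < Suc M" for i k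
      using strict_mono_onD[OF mono, of i k] that by (cases "i = k") auto
    have "0 < (-1) ^ (Suc M - j) * (\<Prod>k<Suc M. \<mu> j - \<nu> k)"
    proof (rule prod_minus_sign)
      show "\<nu> k < \<mu> j" if "k < j" for k
      proof -
        have "\<nu> k \<le> \<nu> (j - 1)" using that j by (intro le) auto
        also have "\<nu> (j - 1) = \<eta> j" using that j by (simp add: \<eta>_def)
        also have "\<dots> < \<mu> j" using \<mu>[OF j] by simp
        finally show ?thesis .
      qed
      show "\<mu> j < \<nu> k" if "j \<le> k" "k < Suc M" for k
      proof -
        have "\<mu> j < \<eta> (Suc j)" using \<mu>[OF j] by simp
        also have "\<eta> (Suc j) = \<nu> j" using that by (simp add: \<eta>_def)
        also have "\<dots> \<le> \<nu> k" using that by (intro le) auto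
        finally show ?thesis .
      qed
    qed (use j in simp)
    then show ?thesis unfolding E poly_prod by simp
  qed
  ultimately have "interlacing D E (Suc (Suc M)) \<mu>"
    unfolding interlacing_def using \<mu>m Em by simp
  then show ?thesis using that by (simp add: D_def)
qed

lemma cpoly_interlacing:
  assumes "\<And>i. s \<le> i \<Longrightarrow> i < s + N \<Longrightarrow> 0 < \<beta> i"
  shows "\<exists>\<mu>. interlacing (cpoly a \<beta> s (Suc N)) (cpoly a \<beta> (Suc s) N) (Suc N) \<mu>"
  using assms
proof (induction N arbitrary: s)
  case 0
  have "interlacing [:- a s, 1:] 1 (Suc 0) (\<lambda>_. a s)"
    by (auto simp: interlacing_def monic_deg_def strict_mono_on_def)
  then show ?case by auto
next
  case (Suc N)
  have "\<exists>\<nu>. interlacing (cpoly a \<beta> (Suc s) (Suc N)) (cpoly a \<beta> (Suc (Suc s)) N) (Suc N) \<nu>"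
    by (rule Suc.IH) (use Suc.prems in auto)
  then obtain \<nu> where "interlacing (cpoly a \<beta> (Suc s) (Suc N)) (cpoly a \<beta> (Suc (Suc s)) N) (Suc N) \<nu>" ..
  moreover have "0 < \<beta> s" using Suc.prems by simp
  ultimately show ?case unfolding continuant_left by (metis interlacing_up)
qed

text \<open>Inverse problem for Jacobi matrices: each \<open>interlacing_down\<close> splits off the
  first site, until one site is left.\<close>

lemma interlacing_realizable:
  assumes "interlacing D E (Suc N) \<mu>"
  shows "\<exists>a \<beta>. (\<forall>i<N. 0 < \<beta> i) \<and> D = cpoly a \<beta> 0 (Suc N) \<and> E = cpoly a \<beta> 1 N"
  using assms
proof (induction N arbitrary: D E \<mu>)
  case 0
  then have "D = [:- \<mu> 0, 1:]" "E = 1"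
    by (auto simp: interlacing_def monic_deg_def one_pCons elim: degree_eq_zeroE)
  then show ?case by (intro exI[of _ \<mu>] exI[of _ "\<lambda>_. 1"]) simp
next
  case (Suc M)
  then obtain a0 \<beta>0 E2 \<nu> where 1: "0 < \<beta>0" "D = [:- a0, 1:] * E - [:\<beta>0:] * E2" "interlacing E E2 (Suc M) \<nu>"
    using interlacing_down by metis
  obtain a \<beta> where 2: "\<forall>i<M. 0 < \<beta> i" "E = cpoly a \<beta> 0 (Suc M)" "E2 = cpoly a \<beta> 1 M"
    using Suc.IH[OF 1(3)] by blast
  define a' where "a' = case_nat a0 a"
  define \<beta>' where "\<beta>' = case_nat \<beta>0 \<beta>"
  have shift: "cpoly a' \<beta>' (Suc s) m = cpoly a \<beta> s m" for s m
    unfolding continuant_shift[of _ _ s m] by (simp add: a'_def \<beta>'_def)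
  have "\<forall>i<Suc M. 0 < \<beta>' i" using 1(1) 2(1) by (auto simp: \<beta>'_def split: nat.splits)
  moreover have "E = cpoly a' \<beta>' 1 (Suc M)" using shift[of 0] 2(2) by simp
  moreover have "D = cpoly a' \<beta>' 0 (Suc (Suc M))"
    unfolding continuant_left shift using 1(2) 2 by (simp add: a'_def \<beta>'_def shift)
  ultimately show ?case by blast
qed

text \<open>Comparison of coefficients: the one below the leading coefficient yields
  \<open>a s\<close>, then the leading coefficient of the remainder yields \<open>\<beta> s\<close>,
  and the nonzero \<open>\<beta> s\<close> can be cancelled to go on.\<close>

lemma cpoly_inj:
  assumes "cpoly a \<beta> s (Suc N) = cpoly a' \<beta>' s (Suc N)" "cpoly a \<beta> (Suc s) N = cpoly a' \<beta>' (Suc s) N"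
    and "\<And>i. s \<le> i \<Longrightarrow> i < s + N \<Longrightarrow> \<beta> i \<noteq> 0" "s \<le> i"
  shows "(i \<le> s + N \<longrightarrow> a i = a' i) \<and> (i < s + N \<longrightarrow> \<beta> i = \<beta>' i)"
  using assms
proof (induction N arbitrary: s)
  case 0
  then show ?case by auto
next
  case (Suc M)
  define E where "E = cpoly a \<beta> (Suc s) (Suc M)"
  define K where "K = cpoly a \<beta> (Suc (Suc s)) M"
  define K' where "K' = cpoly a' \<beta>' (Suc (Suc s)) M"
  have EE: "E = cpoly a' \<beta>' (Suc s) (Suc M)" using Suc.prems(2) by (simp add: E_def)
  have "[:- a s, 1:] * E - [:\<beta> s:] * K = [:- a' s, 1:] * E - [:\<beta>' s:] * K'"
    using Suc.prems(1) unfolding continuant_left EE[symmetric] E_def[symmetric] K_def K'_def .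
  then have eq: "[:a' s - a s:] * E = [:\<beta> s:] * K - [:\<beta>' s:] * K'" by (simp add: algebra_simps smult_diff_left)
  have Em: "monic_deg E (Suc M)" and Km: "monic_deg K M" "monic_deg K' M"
    by (auto simp: E_def K_def K'_def monic_deg_cpoly)
  have "degree ([:\<beta> s:] * K - [:\<beta>' s:] * K') \<le> M"
    using degree_const_mult_le[of "\<beta> s" K] degree_const_mult_le[of "\<beta>' s" K'] monic_degD(1)[OF Km(1)] monic_degD(1)[OF Km(2)]
    by (intro degree_diff_le) auto
  then have "Polynomial.coeff ([:a' s - a s:] * E) (Suc M) = 0" unfolding eq by (intro coeff_eq_0) simp
  then have as: "a s = a' s" using monic_degD(2)[OF Em] by simp
  then have bK: "[:\<beta> s:] * K = [:\<beta>' s:] * K'" using eq by simp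
  have "Polynomial.coeff ([:\<beta> s:] * K) M = Polynomial.coeff ([:\<beta>' s:] * K') M" unfolding bK ..
  then have bs: "\<beta> s = \<beta>' s" using monic_degD(2)[OF Km(1)] monic_degD(2)[OF Km(2)] by simp
  have "\<beta> s \<noteq> 0" using Suc.prems(3) by simp
  moreover have "[:\<beta> s:] * (K - K') = 0" using bK bs by (simp add: smult_diff_right)
  ultimately have KK: "K = K'" by simp
  show ?case
  proof (cases "i = s")
    case True
    then show ?thesis using as bs by simp
  next
    case False
    then have "(i \<le> Suc s + M \<longrightarrow> a i = a' i) \<and> (i < Suc s + M \<longrightarrow> \<beta> i = \<beta>' i)"
      using Suc.prems KK by (intro Suc.IH) (auto simp: K_def K'_def)
    then show ?thesis by simp
  qed
qed

section \<open>The spectral curve and the inverse problem on the cycle\<close>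

lemma discriminant_poly_expand:
  assumes "3 \<le> n"
  shows "discriminant_poly n a \<beta> = [:- a (n - 1), 1:] * cpoly a \<beta> 0 (n - 1)
     - ([:\<beta> (n - 2):] * cpoly a \<beta> 0 (n - 2) + [:\<beta> (n - 1):] * cpoly a \<beta> 1 (n - 2))"
proof -
  obtain m where m: "n = Suc (Suc m)" using le_Suc_ex[OF assms] by (auto simp: numeral_3_eq_3)
  show ?thesis by (simp add: discriminant_poly_def m algebra_simps)
qed

text \<open>At a root of the leading minor the discriminant loses its term with
  \<open>a (n - 1)\<close> and is the sum of the other two, whose product comes from the Wronskian
  identity. So \<open>(x, w)\<close> is a point of the spectral curve.\<close>

lemma discriminant_curve:
  assumes n: "3 \<le> n" and root: "poly (cpoly a \<beta> 0 (n - 1)) x = 0"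
  defines "w \<equiv> - \<beta> (n - 1) * poly (cpoly a \<beta> 1 (n - 2)) x"
    and "w' \<equiv> - \<beta> (n - 2) * poly (cpoly a \<beta> 0 (n - 2)) x"
  shows "w + w' = poly (discriminant_poly n a \<beta>) x" "w * w' = (\<Prod>i<n. \<beta> i)"
proof -
  show "w + w' = poly (discriminant_poly n a \<beta>) x"
    unfolding discriminant_poly_expand[OF n] w_def w'_def using root by simp
  obtain m where m: "n = Suc (Suc (Suc m))" using le_Suc_ex[OF n] by (auto simp: numeral_3_eq_3)
  have "cpoly a \<beta> 0 (Suc m) * cpoly a \<beta> (Suc 0) (Suc m)
     - cpoly a \<beta> 0 (Suc (Suc m)) * cpoly a \<beta> (Suc 0) m = (\<Prod>i=0..0 + m. [:\<beta> i:])"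
    by (rule continuant_wronskian)
  then have "poly (cpoly a \<beta> 0 (Suc m) * cpoly a \<beta> (Suc 0) (Suc m)
     - cpoly a \<beta> 0 (Suc (Suc m)) * cpoly a \<beta> (Suc 0) m) x = poly (\<Prod>i=0..0 + m. [:\<beta> i:]) x" by simp
  then have "poly (cpoly a \<beta> 0 (Suc m)) x * poly (cpoly a \<beta> (Suc 0) (Suc m)) x = (\<Prod>i=0..m. \<beta> i)"
    using root by (simp add: m poly_prod del: continuant.simps)
  moreover have "{0..m} = {..<Suc m}" by auto
  ultimately have "poly (cpoly a \<beta> 0 (Suc m)) x * poly (cpoly a \<beta> (Suc 0) (Suc m)) x = (\<Prod>i<Suc m. \<beta> i)"
    by simp
  then show "w * w' = (\<Prod>i<n. \<beta> i)"
    by (simp add: w_def w'_def m mult_ac del: continuant.simps)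
qed

text \<open>The values at \<open>n - 1\<close> points determine a polynomial of degree
  \<open>n - 2\<close>. Its leading coefficient is \<open>\<beta> (n - 1)\<close>, and its monic
  part together with the leading minor determines the first \<open>n - 1\<close> sites by
  \<open>cpoly_inj\<close>; \<open>\<beta> (n - 2)\<close> is left to the product and
  \<open>a (n - 1)\<close> to the discriminant.\<close>

lemma discriminant_inj:
  assumes n: "3 \<le> n" and pos: "\<And>i. i < n \<Longrightarrow> 0 < \<beta> i" "\<And>i. i < n \<Longrightarrow> 0 < \<beta>' i"
    and pr: "(\<Prod>i<n. \<beta> i) = (\<Prod>i<n. \<beta>' i)"
    and dp: "discriminant_poly n a \<beta> = discriminant_poly n a' \<beta>'" and \<mu>: "inj_on \<mu> {..<n - 1}"
    and root: "\<And>j. j < n - 1 \<Longrightarrow> poly (cpoly a \<beta> 0 (n - 1)) (\<mu> j) = 0"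
      "\<And>j. j < n - 1 \<Longrightarrow> poly (cpoly a' \<beta>' 0 (n - 1)) (\<mu> j) = 0"
    and w: "\<And>j. j < n - 1 \<Longrightarrow> \<beta> (n - 1) * poly (cpoly a \<beta> 1 (n - 2)) (\<mu> j)
       = \<beta>' (n - 1) * poly (cpoly a' \<beta>' 1 (n - 2)) (\<mu> j)" and i: "i < n"
  shows "a i = a' i \<and> \<beta> i = \<beta>' i"
proof -
  obtain m where m: "n = Suc (Suc m)" using le_Suc_ex[OF n] by (auto simp: numeral_3_eq_3)
  have D: "cpoly a \<beta> 0 (Suc m) = (\<Prod>j<Suc m. [:- \<mu> j, 1:])" "cpoly a' \<beta>' 0 (Suc m) = (\<Prod>j<Suc m. [:- \<mu> j, 1:])"
  proof -
    have "cpoly c \<gamma> 0 (Suc m) = (\<Prod>j<Suc m. [:- \<mu> j, 1:])"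
      if "\<And>j. j < n - 1 \<Longrightarrow> poly (cpoly c \<gamma> 0 (n - 1)) (\<mu> j) = 0" for c \<gamma>
      by (rule monic_eq_prod_roots)
        (use that \<mu> monic_degD[OF monic_deg_cpoly] in \<open>auto simp: m simp del: continuant.simps\<close>)
    then show "cpoly a \<beta> 0 (Suc m) = (\<Prod>j<Suc m. [:- \<mu> j, 1:])" "cpoly a' \<beta>' 0 (Suc m) = (\<Prod>j<Suc m. [:- \<mu> j, 1:])"
      using root by blast+
  qed
  have d: "degree ([:c:] * cpoly a \<beta> 1 m) < Suc m" for c a \<beta>
    using degree_const_mult_le[of c "cpoly a \<beta> 1 m"] monic_degD(1)[OF monic_deg_cpoly] by (simp add: le_imp_less_Suc)
  have H: "[:\<beta> (Suc m):] * cpoly a \<beta> 1 m = [:\<beta>' (Suc m):] * cpoly a' \<beta>' 1 m"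
  proof (rule poly_eq_at_points[OF d d])
    show "inj_on \<mu> {..<Suc m}" using \<mu> by (simp add: m)
    show "poly ([:\<beta> (Suc m):] * cpoly a \<beta> 1 m) (\<mu> k) = poly ([:\<beta>' (Suc m):] * cpoly a' \<beta>' 1 m) (\<mu> k)"
      if "k < Suc m" for k using w[of k] that by (simp add: m)
  qed
  have "Polynomial.coeff ([:\<beta> (Suc m):] * cpoly a \<beta> 1 m) m = Polynomial.coeff ([:\<beta>' (Suc m):] * cpoly a' \<beta>' 1 m) m"
    unfolding H ..
  then have b1: "\<beta> (Suc m) = \<beta>' (Suc m)"
    using monic_degD(2)[OF monic_deg_cpoly] by (simp del: continuant.simps)
  then have "[:\<beta> (Suc m):] * (cpoly a \<beta> 1 m - cpoly a' \<beta>' 1 m) = 0"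
    using H by (simp add: smult_diff_right)
  moreover have "\<beta> (Suc m) \<noteq> 0" using pos(1)[of "Suc m"] m by simp
  ultimately have E: "cpoly a \<beta> 1 m = cpoly a' \<beta>' 1 m" by simp
  have inj: "(i \<le> m \<longrightarrow> a i = a' i) \<and> (i < m \<longrightarrow> \<beta> i = \<beta>' i)" for i
    using cpoly_inj[of a \<beta> 0 m a' \<beta>' i] D E pos(1) m by (auto simp: less_imp_neq[THEN not_sym])
  have b2: "\<beta> m = \<beta>' m"
  proof -
    have "(\<Prod>i<m. \<beta> i) = (\<Prod>i<m. \<beta>' i)" using inj by (intro prod.cong) auto
    moreover have "(\<Prod>i<m. \<beta> i) > 0" using pos(1) m by (intro prod_pos) auto
    ultimately show ?thesis using pr b1 pos(1)[of "Suc m"] by (simp add: m del: prod_zero_iff)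
  qed
  have "cpoly a \<beta> 0 m = cpoly a' \<beta>' 0 m"
    using inj by (intro continuant_cong) auto
  then have "[:- a (Suc m), 1:] * cpoly a \<beta> 0 (Suc m) = [:- a' (Suc m), 1:] * cpoly a \<beta> 0 (Suc m)"
    using dp b1 b2 E D unfolding discriminant_poly_expand[OF n] by (simp add: m del: continuant.simps)
  moreover have "cpoly a \<beta> 0 (Suc m) \<noteq> 0" using monic_degD(2)[OF monic_deg_cpoly, of a \<beta> 0 "Suc m"] by auto
  moreover have "([:- a (Suc m), 1:] - [:- a' (Suc m), 1:]) * cpoly a \<beta> 0 (Suc m) = 0"
    unfolding left_diff_distrib calculation(1) by (rule diff_self)
  ultimately have "[:- a (Suc m), 1:] - [:- a' (Suc m), 1:] = 0" by (metis mult_eq_0_iff)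
  then have "a (Suc m) = a' (Suc m)" by simp
  then show ?thesis using inj[of i] b1 b2 i m by (auto simp: less_Suc_eq le_less)
qed

lemma discriminant_roots:
  assumes n: "3 \<le> n" and pos: "\<And>i. i < n \<Longrightarrow> 0 < \<beta> i"
  obtains \<mu> where "strict_mono_on {..<n - 1} \<mu>" "\<And>j. j < n - 1 \<Longrightarrow> poly (cpoly a \<beta> 0 (n - 1)) (\<mu> j) = 0"
    "\<And>j. j < n - 1 \<Longrightarrow> 0 < (-1) ^ (n - 1 - j) * (- \<beta> (n - 1) * poly (cpoly a \<beta> 1 (n - 2)) (\<mu> j))"
proof -
  obtain m where m: "n = Suc (Suc m)" using le_Suc_ex[OF n] by (auto simp: numeral_3_eq_3)
  obtain \<mu> where I: "interlacing (cpoly a \<beta> 0 (Suc m)) (cpoly a \<beta> (Suc 0) m) (Suc m) \<mu>"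
    using cpoly_interlacing[of 0 m \<beta> a] pos m by auto
  show ?thesis
  proof (rule that[of \<mu>])
    show "strict_mono_on {..<n - 1} \<mu>" using I by (simp add: interlacing_def m)
    fix j assume "j < n - 1"
    then have j: "j < Suc m" by (simp add: m)
    have "cpoly a \<beta> 0 (Suc m) = (\<Prod>j<Suc m. [:- \<mu> j, 1:])" using I by (simp add: interlacing_def)
    then have "poly (cpoly a \<beta> 0 (Suc m)) (\<mu> j) = (\<Prod>k<Suc m. \<mu> j - \<mu> k)" by (simp only: poly_prod) simp
    also have "\<dots> = 0" using j by (intro prod_zero bexI[of _ j]) auto
    finally show "poly (cpoly a \<beta> 0 (n - 1)) (\<mu> j) = 0" by (simp add: m del: continuant.simps)
    have "0 < \<beta> (Suc m) * ((-1) ^ (m - j) * poly (cpoly a \<beta> 1 m) (\<mu> j))"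
      using I j pos[of "Suc m"] m
      by - (rule mult_pos_pos, simp_all add: interlacing_def)
    then show "0 < (-1) ^ (n - 1 - j) * (- \<beta> (n - 1) * poly (cpoly a \<beta> 1 (n - 2)) (\<mu> j))"
      using j by (simp add: m Suc_diff_le mult_ac)
  qed
qed

text \<open>Reverses the reading of \<open>discriminant_inj\<close>. Interpolation of
  \<open>- w\<close> gives \<open>\<beta> (n - 1)\<close> times the inner minor; by the sign
  condition it interlaces with the polynomial that has the roots \<open>\<mu>\<close>, so
  \<open>interlacing_realizable\<close> yields a Jacobi matrix for all sites but the last.\<close>

lemma discriminant_realizable:
  assumes n: "3 \<le> n" and P: "monic_deg P n" and r: "0 < r" and \<mu>: "strict_mono_on {..<n - 1} \<mu>"
    and sgn: "\<And>j. j < n - 1 \<Longrightarrow> 0 < (-1) ^ (n - 1 - j) * w j"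
    and curve: "\<And>j. j < n - 1 \<Longrightarrow> w j + r / w j = poly P (\<mu> j)"
  obtains a \<beta> where "\<And>i. i < n \<Longrightarrow> 0 < \<beta> i" "(\<Prod>i<n. \<beta> i) = r" "discriminant_poly n a \<beta> = P"
    "\<And>j. j < n - 1 \<Longrightarrow> poly (cpoly a \<beta> 0 (n - 1)) (\<mu> j) = 0"
    "\<And>j. j < n - 1 \<Longrightarrow> - \<beta> (n - 1) * poly (cpoly a \<beta> 1 (n - 2)) (\<mu> j) = w j"
proof -
  obtain m where m: "n = Suc (Suc m)" using le_Suc_ex[OF n] by (auto simp: numeral_3_eq_3)
  have \<mu>m: "strict_mono_on {..<Suc m} \<mu>" using \<mu> by (simp add: m)
  note inj = strict_mono_on_imp_inj_on[OF \<mu>m]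
  have w0: "w j \<noteq> 0" if "j < Suc m" for j using sgn[of j] that by (auto simp: m)
  define D where "D = (\<Prod>j<Suc m. [:- \<mu> j, 1:])"
  have Dm: "monic_deg D (Suc m)" unfolding D_def by (rule monic_deg_prod)
  have D0: "poly D (\<mu> j) = 0" if "j < Suc m" for j
    unfolding D_def poly_prod using that by (intro prod_zero bexI[of _ j]) auto
  define H where "H = lagrange (Suc m) \<mu> (\<lambda>j. - w j)"
  have H\<mu>: "poly H (\<mu> j) = - w j" if "j < Suc m" for j unfolding H_def by (rule poly_lagrange[OF inj that])
  have Hd: "degree H \<le> m" using degree_lagrange[of "Suc m"] by (simp add: H_def)
  define b where "b = Polynomial.coeff H m"
  have Hs: "0 < (-1) ^ (m - k) * poly H (\<mu> k)" if "k < Suc m" for k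
    using sgn[of k] that H\<mu>[OF that] by (simp add: m Suc_diff_le)
  have b: "0 < b" unfolding b_def using alternating_coeff_pos[OF _ \<mu>m, of H] Hd Hs by simp
  define E where "E = [:1 / b:] * H"
  have Em: "monic_deg E m"
  proof -
    have c: "Polynomial.coeff E m = 1" using b by (simp add: E_def b_def)
    then have "m \<le> degree E" by (intro le_degree) simp
    moreover have "degree E \<le> m" unfolding E_def by (rule order_trans[OF degree_const_mult_le Hd])
    ultimately show ?thesis using c by (simp add: monic_deg_def)
  qed
  have E\<mu>: "poly E (\<mu> j) = - w j / b" if "j < Suc m" for j using H\<mu>[OF that] by (simp add: E_def)
  have "interlacing D E (Suc m) \<mu>"
    unfolding interlacing_def using \<mu>m D_def Em Hs b by (auto simp: E_def)
  then obtain a0 \<beta>0 where ab0: "\<forall>i<m. 0 < \<beta>0 i" "D = cpoly a0 \<beta>0 0 (Suc m)" "E = cpoly a0 \<beta>0 1 m"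
    using interlacing_realizable by blast
  define p where "p = (\<Prod>i<m. \<beta>0 i)"
  have p: "0 < p" unfolding p_def using ab0(1) by (intro prod_pos) auto
  \<comment> \<open>The value at \<open>m\<close> is what the prescribed product leaves over;
    \<open>b\<close> closes the cycle.\<close>
  define \<beta> where "\<beta> i = (if i < m then \<beta>0 i else if i = m then r / (b * p) else b)" for i
  \<comment> \<open>The last diagonal entry, fixed by the coefficient of degree \<open>n - 1\<close>
    of the discriminant.\<close>
  define c where "c = Polynomial.coeff D m - Polynomial.coeff P (Suc m)"
  define a where "a i = (if i \<le> m then a0 i else c)" for i
  have D: "cpoly a \<beta> 0 (Suc m) = D" unfolding ab0(2) by (intro continuant_cong) (auto simp: a_def \<beta>_def)
  have E: "cpoly a \<beta> 1 m = E" unfolding ab0(3) by (intro continuant_cong) (auto simp: a_def \<beta>_def)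
  have \<beta>pos: "0 < \<beta> i" for i using ab0(1) r b p by (auto simp: \<beta>_def)
  have "(\<Prod>i<n. \<beta> i) = (\<Prod>i<m. \<beta> i) * \<beta> m * \<beta> (Suc m)" by (simp add: m)
  also have "(\<Prod>i<m. \<beta> i) = p" unfolding p_def by (intro prod.cong) (auto simp: \<beta>_def)
  also have "p * \<beta> m * \<beta> (Suc m) = r" using b p by (simp add: \<beta>_def)
  finally have \<beta>prod: "(\<Prod>i<n. \<beta> i) = r" .
  have root: "poly (cpoly a \<beta> 0 (n - 1)) (\<mu> j) = 0" if "j < n - 1" for j
    using D0[of j] D that by (simp add: m del: continuant.simps)
  have wj: "- \<beta> (n - 1) * poly (cpoly a \<beta> 1 (n - 2)) (\<mu> j) = w j" if "j < n - 1" for j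
    using E\<mu>[of j] E that b by (simp add: m \<beta>_def del: continuant.simps)
  define G where "G = [:- c, 1:] * D - P"
  have "degree G < Suc m"
  proof -
    have "degree G \<le> m"
    proof (rule degree_le, intro allI impI)
      fix i assume "m < i"
      then consider "i = Suc m" | "i = Suc (Suc m)" | "Suc (Suc m) < i" by linarith
      then show "Polynomial.coeff G i = 0"
      proof cases
        case 1
        then show ?thesis using monic_degD(2)[OF Dm] by (simp add: G_def c_def)
      next
        case 2
        have "Polynomial.coeff D (Suc (Suc m)) = 0" using monic_degD(1)[OF Dm] by (intro coeff_eq_0) simp
        then show ?thesis using 2 monic_degD(2)[OF Dm] monic_degD(2)[OF P] m by (simp add: G_def)
      next
        case 3
        then obtain i' where i': "i = Suc i'" "Suc m < i'" by (cases i) auto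
        have "Polynomial.coeff D i = 0" "Polynomial.coeff D i' = 0" "Polynomial.coeff P i = 0"
          using 3 i' monic_degD(1)[OF Dm] monic_degD(1)[OF P] m by (auto intro!: coeff_eq_0)
        then show ?thesis using i' by (simp add: G_def)
      qed
    qed
    then show ?thesis by simp
  qed
  moreover define R where "R = [:\<beta> m:] * cpoly a \<beta> 0 m + [:\<beta> (Suc m):] * cpoly a \<beta> 1 m"
  have "degree R < Suc m"
  proof -
    have "degree ([:\<beta> m:] * cpoly a \<beta> 0 m) \<le> m" "degree ([:\<beta> (Suc m):] * cpoly a \<beta> 1 m) \<le> m"
      using degree_const_mult_le[of "\<beta> m" "cpoly a \<beta> 0 m"] degree_const_mult_le[of "\<beta> (Suc m)" "cpoly a \<beta> 1 m"]
        monic_degD(1)[OF monic_deg_cpoly] by auto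
    then show ?thesis unfolding R_def by (simp only: less_Suc_eq_le degree_add_le)
  qed
  \<comment> \<open>This is the curve equation at \<open>\<mu> j\<close>; for polynomials of degree
    below \<open>n - 1\<close> agreement at these \<open>n - 1\<close> points suffices.\<close>
  moreover have "poly G (\<mu> j) = poly R (\<mu> j)" if j: "j < Suc m" for j
  proof -
    have j': "j < n - 1" using j by (simp add: m)
    have "(- \<beta> (n - 1) * poly (cpoly a \<beta> 1 (n - 2)) (\<mu> j)) * (- \<beta> (n - 2) * poly (cpoly a \<beta> 0 (n - 2)) (\<mu> j)) = r"
      unfolding discriminant_curve(2)[OF n root[OF j']] by (rule \<beta>prod)
    then have "w j * (- \<beta> m * poly (cpoly a \<beta> 0 m) (\<mu> j)) = r"
      unfolding wj[OF j'] by (simp add: m del: continuant.simps)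
    then have "- \<beta> m * poly (cpoly a \<beta> 0 m) (\<mu> j) = r / w j" using w0[OF j] by (simp add: field_simps)
    moreover have "- \<beta> (Suc m) * poly (cpoly a \<beta> 1 m) (\<mu> j) = w j" using wj[OF j'] by (simp add: m del: continuant.simps)
    ultimately have "poly R (\<mu> j) = - (w j + r / w j)" by (simp add: R_def del: continuant.simps)
    also have "\<dots> = poly G (\<mu> j)" unfolding curve[OF j'] using D0[OF j] by (simp add: G_def)
    finally show ?thesis ..
  qed
  ultimately have "G = R" by (intro poly_eq_at_points[OF _ _ inj])
  moreover have "discriminant_poly n a \<beta> = [:- c, 1:] * D - R"
    unfolding discriminant_poly_expand[OF n] using D by (simp add: m R_def a_def del: continuant.simps)
  ultimately have "discriminant_poly n a \<beta> = P" by (simp add: G_def)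
  then show ?thesis using that[OF \<beta>pos \<beta>prod _ root wj] by blast
qed

lemma coeff_cpoly:
  "Polynomial.coeff (cpoly a \<beta> s (Suc m)) m = - (\<Sum>i<Suc m. a (s + i))"
  "2 * Polynomial.coeff (cpoly a \<beta> s (Suc (Suc m))) m =
     (\<Sum>i<Suc (Suc m). a (s + i))\<^sup>2 - (\<Sum>i<Suc (Suc m). (a (s + i))\<^sup>2) - 2 * (\<Sum>i<Suc m. \<beta> (s + i))"
proof -
  have 1: "Polynomial.coeff (cpoly a \<beta> s (Suc m)) m = - (\<Sum>i<Suc m. a (s + i))" for m
  proof (induction m)
    case (Suc m)
    have "Polynomial.coeff (cpoly a \<beta> s m) (Suc m) = 0"
      using monic_degD(1)[OF monic_deg_cpoly, of a \<beta> s m] by (intro coeff_eq_0) simp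
    then show ?case
      using Suc monic_degD(2)[OF monic_deg_cpoly, of a \<beta> s "Suc m"]
      unfolding continuant.simps(3) by (simp del: continuant.simps)
  qed simp
  then show "Polynomial.coeff (cpoly a \<beta> s (Suc m)) m = - (\<Sum>i<Suc m. a (s + i))" .
  show "2 * Polynomial.coeff (cpoly a \<beta> s (Suc (Suc m))) m =
     (\<Sum>i<Suc (Suc m). a (s + i))\<^sup>2 - (\<Sum>i<Suc (Suc m). (a (s + i))\<^sup>2) - 2 * (\<Sum>i<Suc m. \<beta> (s + i))"
  proof (induction m)
    case 0
    then show ?case by (simp add: power2_eq_square algebra_simps)
  next
    case (Suc m)
    define S where "S = (\<Sum>i<Suc (Suc m). a (s + i))"
    define x where "x = a (s + Suc (Suc m))"
    define y where "y = \<beta> (s + Suc m)"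
    have "Polynomial.coeff (cpoly a \<beta> s (Suc (Suc (Suc m)))) (Suc m) =
       Polynomial.coeff (cpoly a \<beta> s (Suc (Suc m))) m + x * S - y"
      unfolding continuant.simps(3)[of _ _ s "Suc m"] x_def y_def
      using 1[of "Suc m"] monic_degD(2)[OF monic_deg_cpoly, of a \<beta> s "Suc m"]
      by (simp add: S_def del: continuant.simps sum.lessThan_Suc)
    moreover have "(\<Sum>i<Suc (Suc (Suc m)). a (s + i)) = S + x" by (simp add: S_def x_def)
    moreover have "(\<Sum>i<Suc (Suc (Suc m)). (a (s + i))\<^sup>2) = (\<Sum>i<Suc (Suc m). (a (s + i))\<^sup>2) + x\<^sup>2" by (simp add: x_def)
    moreover have "(\<Sum>i<Suc (Suc m). \<beta> (s + i)) = (\<Sum>i<Suc m. \<beta> (s + i)) + y" by (simp add: y_def)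
    moreover have "2 * Polynomial.coeff (cpoly a \<beta> s (Suc (Suc m))) m =
       S\<^sup>2 - (\<Sum>i<Suc (Suc m). (a (s + i))\<^sup>2) - 2 * (\<Sum>i<Suc m. \<beta> (s + i))" using Suc by (simp only: S_def)
    ultimately show ?case by (simp only:) (simp add: power2_eq_square algebra_simps)
  qed
qed

text \<open>With squared moduli for \<open>\<beta>\<close> both sides are the trace of the square of
  the matrix, the right-hand side by Newton's identity. A fixed discriminant thus bounds all
  entries, which makes the parameter spaces over \<open>z \<noteq> 0\<close> compact.\<close>

lemma discriminant_bound:
  assumes n: "3 \<le> n"
  shows "(\<Sum>i<n. (a i)\<^sup>2) + 2 * (\<Sum>i<n. \<beta> i) =
    (Polynomial.coeff (discriminant_poly n a \<beta>) (n - 1))\<^sup>2 - 2 * Polynomial.coeff (discriminant_poly n a \<beta>) (n - 2)"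
proof -
  obtain m where m: "n = Suc (Suc m)" using le_Suc_ex[OF n] by (auto simp: numeral_3_eq_3)
  define K where "K = cpoly a \<beta> 0 (Suc (Suc m))"
  have P: "discriminant_poly n a \<beta> = K - [:\<beta> (Suc m):] * cpoly a \<beta> 1 m"
    by (simp add: discriminant_poly_def m K_def)
  have "Polynomial.coeff (cpoly a \<beta> 1 m) (Suc m) = 0" "Polynomial.coeff (cpoly a \<beta> 1 m) m = 1"
    using monic_degD[OF monic_deg_cpoly, of a \<beta> 1 m] by (auto intro!: coeff_eq_0)
  then have "Polynomial.coeff (discriminant_poly n a \<beta>) (Suc m) = Polynomial.coeff K (Suc m)"
    "Polynomial.coeff (discriminant_poly n a \<beta>) m = Polynomial.coeff K m - \<beta> (Suc m)"
    unfolding P by (simp_all del: continuant.simps)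
  moreover have "Polynomial.coeff K (Suc m) = - (\<Sum>i<n. a i)"
    using coeff_cpoly(1)[of a \<beta> 0 "Suc m"] by (simp only: K_def m add_0)
  moreover have "2 * Polynomial.coeff K m = (\<Sum>i<n. a i)\<^sup>2 - (\<Sum>i<n. (a i)\<^sup>2) - 2 * (\<Sum>i<Suc m. \<beta> i)"
    using coeff_cpoly(2)[of a \<beta> 0 m] by (simp only: K_def m add_0)
  moreover have "(\<Sum>i<n. \<beta> i) = (\<Sum>i<Suc m. \<beta> i) + \<beta> (Suc m)" by (simp add: m)
  ultimately show ?thesis by (simp add: m del: sum.lessThan_Suc)
qed


section \<open>The region and its boundary\<close>

lemma cos_Arg: "cmod z * cos (Arg z) = Re z"
  using Re_rcis[of "cmod z" "Arg z"] by (simp add: rcis_cmod_Arg)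

lemma ereal_div_bound:
  assumes "0 < M" "0 \<le> c"
  shows "ereal r \<le> ereal (1/2) * (ereal M / ereal c) \<longleftrightarrow> 2 * (r * c) \<le> M"
proof (cases "c = 0")
  case True
  then show ?thesis using assms by (simp add: divide_ereal_def)
next
  case False
  then show ?thesis using assms by (simp add: field_simps)
qed

lemma ereal_div_eq:
  assumes "0 < M" "0 \<le> c" "2 * (r * c) = M"
  shows "ereal M / ereal c = ereal (2 * r)"
proof -
  have "c \<noteq> 0" using assms by auto
  then show ?thesis using assms by (simp add: field_simps)
qed

lemma ereal_div_less:
  assumes "0 < M" "0 \<le> c" "2 * (r * c) < M"
  shows "ereal (2 * r) < ereal M / ereal c"
proof (cases "c = 0")
  case True
  then show ?thesis using assms by (simp add: divide_ereal_def)
next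
  case False
  then show ?thesis using assms by (simp add: field_simps)
qed

lemma cos_Arg_bounds: "0 \<le> 1 + cos (Arg z)" "0 \<le> 1 - cos (Arg z)"
  using cos_ge_minus_one[of "Arg z"] cos_le_one[of "Arg z"] by linarith+

lemma modulus_cos_Arg:
  "2 * (cmod z * (1 - cos (Arg z))) = 2 * (cmod z - Re z)"
  "2 * (cmod z * (1 + cos (Arg z))) = 2 * (cmod z + Re z)"
  by (simp_all add: right_diff_distrib distrib_left cos_Arg)

locale spectral_data =
  fixes n :: nat and lam :: "nat \<Rightarrow> real"
  assumes n3: "3 \<le> n" and lam_mono: "strict_mono_on {1..n} lam"
begin

abbreviation F :: "real \<Rightarrow> real" where "F \<equiv> spectral_poly n lam"

definition Fp :: "real poly" where "Fp = (\<Prod>i<n. [:- lam (Suc i), 1:])"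

text \<open>Sign of \<open>F\<close> between its roots \<open>lam (Suc j)\<close> and
  \<open>lam (Suc (Suc j))\<close>. Gaps are counted from 0, critical points from 1.\<close>

definition sg :: "nat \<Rightarrow> real" where "sg j = (-1) ^ (n - 1 - j)"

abbreviation crit :: "nat \<Rightarrow> real" where "crit j \<equiv> crit_pt n lam (Suc j)"

lemma sg_cases: "sg j = 1 \<or> sg j = -1"
  by (simp add: sg_def minus_one_power_iff)

lemma lam_less: "i < j \<Longrightarrow> j < n \<Longrightarrow> lam (Suc i) < lam (Suc j)"
  using strict_mono_onD[OF lam_mono, of "Suc i" "Suc j"] by simp

lemma lam_le: "i \<le> j \<Longrightarrow> j < n \<Longrightarrow> lam (Suc i) \<le> lam (Suc j)"
  using lam_less[of i j] by (cases "i = j") auto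

lemma F_prod: "F x = (\<Prod>i<n. x - lam (Suc i))"
  unfolding spectral_poly_def by (rule prod.reindex_bij_witness[of _ Suc "\<lambda>i. i - 1"]) auto

lemma poly_Fp: "poly Fp x = F x"
  by (simp add: Fp_def poly_prod F_prod)

lemma monic_Fp: "monic_deg Fp n"
  unfolding Fp_def by (rule monic_deg_prod)

lemma F_lam: "i < n \<Longrightarrow> F (lam (Suc i)) = 0"
  unfolding F_prod by (intro prod_zero bexI[of _ i]) auto

lemma F_sign:
  assumes "j \<le> n" "\<And>i. i < j \<Longrightarrow> lam (Suc i) < x" "\<And>i. j \<le> i \<Longrightarrow> i < n \<Longrightarrow> x < lam (Suc i)"
  shows "0 < (-1) ^ (n - j) * F x"
  unfolding F_prod using assms by (rule prod_minus_sign)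

lemma F_sign_between:
  assumes j: "j < n - 1" and x: "lam (Suc j) < x" "x < lam (Suc (Suc j))"
  shows "0 < sg j * F x"
proof -
  have "0 < (-1) ^ (n - Suc j) * F x"
  proof (rule F_sign)
    show "lam (Suc i) < x" if "i < Suc j" for i
    proof -
      have "lam (Suc i) \<le> lam (Suc j)" using that j by (intro lam_le) auto
      then show ?thesis using x(1) by simp
    qed
    show "x < lam (Suc i)" if "Suc j \<le> i" "i < n" for i
      using lam_le[of "Suc j" i] that x(2) by simp
  qed (use j in simp)
  then show ?thesis by (simp add: sg_def)
qed

lemma DERIV_F: "(F has_real_derivative poly (pderiv Fp) x) (at x)"
proof -
  have "F = poly Fp" by (simp add: fun_eq_iff poly_Fp)
  then show ?thesis by (simp add: poly_DERIV)
qed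

lemma isCont_F: "isCont F x"
  using DERIV_F by (rule DERIV_isCont)

lemma continuous_on_F: "continuous_on S F"
  using isCont_F by (simp add: continuous_at_imp_continuous_on)

text \<open>Rolle's theorem puts a zero of the derivative into each of the \<open>n - 1\<close>
  intervals between roots, and the degree admits no more. Listed by intervals the zeros are already
  sorted.\<close>

lemma crit_facts:
  shows crit_deriv: "{x. deriv F x = 0} = crit ` {..<n - 1}"
    and crit_between: "j < n - 1 \<Longrightarrow> lam (Suc j) < crit j \<and> crit j < lam (Suc (Suc j))"
    and crit_mono: "strict_mono_on {..<n - 1} crit"
    and pderiv_Fp: "pderiv Fp = [:real n:] * (\<Prod>j<n - 1. [:- crit j, 1:])"
proof -
  have "\<exists>y. lam (Suc j) < y \<and> y < lam (Suc (Suc j)) \<and> poly (pderiv Fp) y = 0" if j: "j < n - 1" for j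
  proof -
    have "F (lam (Suc j)) = F (lam (Suc (Suc j)))" using F_lam[of j] F_lam[of "Suc j"] j by simp
    moreover have "lam (Suc j) < lam (Suc (Suc j))" using lam_less[of j "Suc j"] j by simp
    ultimately obtain y where y: "lam (Suc j) < y" "y < lam (Suc (Suc j))" "DERIV F y :> 0"
      using Rolle[of "lam (Suc j)" "lam (Suc (Suc j))" F] continuous_on_F DERIV_F
      by (metis real_differentiable_def)
    then show ?thesis using DERIV_unique[OF y(3) DERIV_F] by auto
  qed
  then obtain y where y: "\<And>j. j < n - 1 \<Longrightarrow> lam (Suc j) < y j \<and> y j < lam (Suc (Suc j)) \<and> poly (pderiv Fp) (y j) = 0"
    by metis
  have ylt: "y i < y j" if "i < j" "j < n - 1" for i j
  proof -
    have "y i < lam (Suc (Suc i))" using y[of i] that by simp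
    also have "\<dots> \<le> lam (Suc j)" using lam_le[of "Suc i" j] that by simp
    also have "\<dots> < y j" using y[of j] that by simp
    finally show ?thesis .
  qed
  have ymono: "strict_mono_on {..<n - 1} y" using ylt by (intro strict_mono_onI) auto
  have d: "degree (pderiv Fp) = n - 1" using monic_degD(1)[OF monic_Fp] by (simp add: degree_pderiv)
  have c: "Polynomial.coeff (pderiv Fp) (n - 1) = real n"
    using monic_degD(2)[OF monic_Fp] n3 by (simp add: coeff_pderiv)
  have "[:1 / real n:] * pderiv Fp = (\<Prod>j<n - 1. [:- y j, 1:])"
  proof (rule monic_eq_prod_roots)
    show "degree ([:1 / real n:] * pderiv Fp) = n - 1" using d n3 by simp
    show "Polynomial.coeff ([:1 / real n:] * pderiv Fp) (n - 1) = 1" using c n3 by simp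
    show "inj_on y {..<n - 1}" using ymono by (rule strict_mono_on_imp_inj_on)
  qed (use y in simp)
  then have "[:real n:] * ([:1 / real n:] * pderiv Fp) = [:real n:] * (\<Prod>j<n - 1. [:- y j, 1:])" by simp
  then have pd: "pderiv Fp = [:real n:] * (\<Prod>j<n - 1. [:- y j, 1:])" using n3 by simp
  have dF: "deriv F x = poly (pderiv Fp) x" for x using DERIV_F by (rule DERIV_imp_deriv)
  have crits: "{x. deriv F x = 0} = y ` {..<n - 1}"
    unfolding dF pd using n3 by (auto simp: poly_prod)
  have "sorted_list_of_set (y ` {..<n - 1}) = map y [0..<n - 1]"
  proof -
    have "sorted (map y [0..<n - 1])"
      unfolding sorted_iff_nth_mono by (auto simp: le_less intro: less_imp_le ylt)
    moreover have "distinct (map y [0..<n - 1])"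
      using strict_mono_on_imp_inj_on[OF ymono] by (simp add: distinct_map atLeast0LessThan)
    ultimately have "sorted_list_of_set (set (map y [0..<n - 1])) = map y [0..<n - 1]"
      by (rule sorted_list_of_set.idem_if_sorted_distinct)
    then show ?thesis by (simp add: atLeast0LessThan)
  qed
  then have cy: "crit j = y j" if "j < n - 1" for j
    using that by (simp add: crit_pt_def crits)
  show "{x. deriv F x = 0} = crit ` {..<n - 1}" unfolding crits using cy by (intro image_cong) auto
  show "j < n - 1 \<Longrightarrow> lam (Suc j) < crit j \<and> crit j < lam (Suc (Suc j))" using y cy by simp
  show "strict_mono_on {..<n - 1} crit" using ylt cy by (intro strict_mono_onI) auto
  have "(\<Prod>j<n - 1. [:- y j, 1:]) = (\<Prod>j<n - 1. [:- crit j, 1:])" using cy by (intro prod.cong) auto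
  then show "pderiv Fp = [:real n:] * (\<Prod>j<n - 1. [:- crit j, 1:])" using pd by simp
qed

lemma deriv_sign:
  assumes "j \<le> n - 1" "\<And>i. i < j \<Longrightarrow> crit i < x" "\<And>i. j \<le> i \<Longrightarrow> i < n - 1 \<Longrightarrow> x < crit i"
  shows "0 < (-1) ^ (n - 1 - j) * poly (pderiv Fp) x"
proof -
  have "0 < (-1) ^ (n - 1 - j) * (\<Prod>i<n - 1. x - crit i)" using assms by (rule prod_minus_sign)
  then have "0 < real n * ((-1) ^ (n - 1 - j) * (\<Prod>i<n - 1. x - crit i))" using n3 by simp
  then show ?thesis unfolding pderiv_Fp by (simp add: poly_prod mult_ac)
qed

lemma crit_less: "i < j \<Longrightarrow> j < n - 1 \<Longrightarrow> crit i < crit j"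
  using strict_mono_onD[OF crit_mono, of i j] by simp

lemma crit_le: "i \<le> j \<Longrightarrow> j < n - 1 \<Longrightarrow> crit i \<le> crit j"
  using crit_less[of i j] by (cases "i = j") auto

lemma F_increasing:
  assumes j: "j < n - 1" and xy: "lam (Suc j) \<le> x" "x < y" "y \<le> crit j"
  shows "sg j * F x < sg j * F y"
proof (rule DERIV_pos_imp_increasing_open[OF xy(2), of "\<lambda>t. sg j * F t"])
  fix t assume t: "x < t" "t < y"
  have "0 < (-1) ^ (n - 1 - j) * poly (pderiv Fp) t"
  proof (rule deriv_sign)
    show "crit i < t" if "i < j" for i
    proof -
      have "crit i < lam (Suc (Suc i))" using crit_between[of i] that j by simp
      also have "\<dots> \<le> lam (Suc j)" using lam_le[of "Suc i" j] that j by simp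
      finally show ?thesis using t xy by simp
    qed
    show "t < crit i" if "j \<le> i" "i < n - 1" for i
      using crit_le[of j i] that t xy by simp
  qed (use j in simp)
  moreover have "((\<lambda>t. sg j * F t) has_real_derivative sg j * poly (pderiv Fp) t) (at t)"
    by (intro DERIV_cmult DERIV_F)
  ultimately show "\<exists>d. ((\<lambda>t. sg j * F t) has_real_derivative d) (at t) \<and> 0 < d"
    unfolding sg_def by blast
qed (intro continuous_intros continuous_on_F)

lemma F_decreasing:
  assumes j: "j < n - 1" and xy: "crit j \<le> x" "x < y" "y \<le> lam (Suc (Suc j))"
  shows "sg j * F y < sg j * F x"
proof (rule DERIV_neg_imp_decreasing_open[OF xy(2), of "\<lambda>t. sg j * F t"])
  fix t assume t: "x < t" "t < y"
  have "0 < (-1) ^ (n - 1 - Suc j) * poly (pderiv Fp) t"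
  proof (rule deriv_sign)
    show "crit i < t" if "i < Suc j" for i
      using crit_le[of i j] that t xy j by simp
    show "t < crit i" if "Suc j \<le> i" "i < n - 1" for i
    proof -
      have "lam (Suc (Suc j)) \<le> lam (Suc i)" using lam_le[of "Suc j" i] that j by simp
      also have "\<dots> < crit i" using crit_between[of i] that by simp
      finally show ?thesis using t xy by simp
    qed
  qed (use j in simp)
  moreover have "n - 1 - j = Suc (n - 1 - Suc j)" using j by simp
  ultimately have "sg j * poly (pderiv Fp) t < 0" by (simp add: sg_def)
  moreover have "((\<lambda>t. sg j * F t) has_real_derivative sg j * poly (pderiv Fp) t) (at t)"
    by (intro DERIV_cmult DERIV_F)
  ultimately show "\<exists>d. ((\<lambda>t. sg j * F t) has_real_derivative d) (at t) \<and> d < 0" by blast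
qed (intro continuous_intros continuous_on_F)

lemma F_le_crit:
  assumes j: "j < n - 1" and x: "lam (Suc j) \<le> x" "x \<le> lam (Suc (Suc j))"
  shows "sg j * F x \<le> sg j * F (crit j)"
  using F_increasing[OF j x(1), of "crit j"] F_decreasing[OF j _ _ x(2), of "crit j"]
  by (cases x "crit j" rule: linorder_cases) auto

lemma F_crit_pos: "j < n - 1 \<Longrightarrow> 0 < sg j * F (crit j)"
  using crit_between F_sign_between by blast

text \<open>A point too far to the left would lie, by order and induction, in the previous interval
  or left of all roots, where \<open>F\<close> has the wrong strict sign. The other bound is
  obtained in the same way, starting from the last point.\<close>

lemma weak_interlacing:
  assumes \<mu>: "strict_mono_on {..<n - 1} \<mu>" and sgn: "\<And>j. j < n - 1 \<Longrightarrow> 0 \<le> sg j * F (\<mu> j)"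
    and j: "j < n - 1"
  shows "lam (Suc j) \<le> \<mu> j" "\<mu> j \<le> lam (Suc (Suc j))"
proof -
  have neg: "\<not> 0 < (-1) ^ (n - 1 - j) * - F (\<mu> j)" if "j < n - 1" for j
    using sgn[OF that] by (simp add: sg_def)
  show "lam (Suc j) \<le> \<mu> j" using j
  proof (induction j)
    case 0
    show ?case
    proof (rule ccontr)
      assume "\<not> lam (Suc 0) \<le> \<mu> 0"
      then have "0 < (-1) ^ (n - 0) * F (\<mu> 0)"
      proof (intro F_sign)
        show "\<mu> 0 < lam (Suc i)" if "\<not> lam (Suc 0) \<le> \<mu> 0" "0 \<le> i" "i < n" for i
          using lam_le[of 0 i] that by simp
      qed auto
      moreover have "(-1 :: real) ^ n = - ((-1) ^ (n - 1))" using n3 by (cases n) auto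
      ultimately show False using neg[OF 0] by simp
    qed
  next
    case (Suc j)
    have lt: "\<mu> j < \<mu> (Suc j)" using strict_mono_onD[OF \<mu>, of j "Suc j"] Suc.prems by simp
    show ?case
    proof (rule ccontr)
      assume "\<not> lam (Suc (Suc j)) \<le> \<mu> (Suc j)"
      then have "0 < sg j * F (\<mu> (Suc j))" using Suc lt by (intro F_sign_between) auto
      moreover have "n - 1 - j = Suc (n - 1 - Suc j)" using Suc.prems by simp
      ultimately show False using neg[OF Suc.prems] by (simp add: sg_def)
    qed
  qed
  have "j \<le> n - 2" using j by simp
  then show "\<mu> j \<le> lam (Suc (Suc j))"
  proof (induction j rule: inc_induct)
    case base
    show ?case
    proof (rule ccontr)
      assume "\<not> \<mu> (n - 2) \<le> lam (Suc (Suc (n - 2)))"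
      then have gt: "lam (Suc (n - 1)) < \<mu> (n - 2)"
      proof -
        have "Suc (Suc (n - 2)) = Suc (n - 1)" using n3 by auto
        then show ?thesis using \<open>\<not> \<mu> (n - 2) \<le> lam (Suc (Suc (n - 2)))\<close> by (simp only: not_le)
      qed
      have "0 < (-1) ^ (n - n) * F (\<mu> (n - 2))"
      proof (rule F_sign)
        show "lam (Suc i) < \<mu> (n - 2)" if "i < n" for i
        proof -
          have "lam (Suc i) \<le> lam (Suc (n - 1))" using that by (intro lam_le) auto
          then show ?thesis using gt by simp
        qed
      qed auto
      moreover have "n - 1 - (n - 2) = 1" "n - 2 < n - 1" using n3 by simp_all
      ultimately show False using neg[of "n - 2"] by simp
    qed
  next
    case (step k)
    have k: "Suc k < n - 1" using step by simp
    have lt: "\<mu> k < \<mu> (Suc k)" using strict_mono_onD[OF \<mu>, of k "Suc k"] k by simp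
    show ?case
    proof (rule ccontr)
      assume "\<not> \<mu> k \<le> lam (Suc (Suc k))"
      then have "0 < sg (Suc k) * F (\<mu> k)" using step.IH lt k by (intro F_sign_between) auto
      moreover have "n - 1 - k = Suc (n - 1 - Suc k)" using k by simp
      ultimately show False using neg[of k] k by (simp add: sg_def)
    qed
  qed
qed

definition maxima :: "nat set" where "maxima = {j. j < n - 1 \<and> even (n - 1 - j)}"
definition minima :: "nat set" where "minima = {j. j < n - 1 \<and> odd (n - 1 - j)}"

lemma maxima_minima: "finite maxima" "finite minima" "maxima \<inter> minima = {}" "maxima \<union> minima = {..<n - 1}"
  by (auto simp: maxima_def minima_def)

lemma sg_maxima: "j \<in> maxima \<Longrightarrow> sg j = 1"
  and sg_minima: "j \<in> minima \<Longrightarrow> sg j = -1"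
  by (auto simp: maxima_def minima_def sg_def)

lemma maxima_ne: "n - 3 \<in> maxima" and minima_ne: "n - 2 \<in> minima"
proof -
  have "n - 1 - (n - 3) = 2" "n - 1 - (n - 2) = 1" using n3 by auto
  then show "n - 3 \<in> maxima" "n - 2 \<in> minima" using n3 by (auto simp: maxima_def minima_def)
qed

lemma reindex_crit:
  "{f (crit_pt n lam (n - i)) | i. i \<in> {1..n-1} \<and> P i} = (\<lambda>j. f (crit j)) ` {j. j < n - 1 \<and> P (n - 1 - j)}"
proof (rule Set.set_eqI, rule iffI)
  fix x assume "x \<in> {f (crit_pt n lam (n - i)) | i. i \<in> {1..n-1} \<and> P i}"
  then obtain i where i: "x = f (crit_pt n lam (n - i))" "1 \<le> i" "i \<le> n - 1" "P i" by auto
  have "Suc (n - 1 - i) = n - i" "n - 1 - (n - 1 - i) = i" "n - 1 - i < n - 1" using i by auto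
  then show "x \<in> (\<lambda>j. f (crit j)) ` {j. j < n - 1 \<and> P (n - 1 - j)}"
    using i by (intro image_eqI[of _ _ "n - 1 - i"]) auto
next
  fix x assume "x \<in> (\<lambda>j. f (crit j)) ` {j. j < n - 1 \<and> P (n - 1 - j)}"
  then obtain j where j: "x = f (crit j)" "j < n - 1" "P (n - 1 - j)" by auto
  have "n - (n - 1 - j) = Suc j" "1 \<le> n - 1 - j" "n - 1 - j \<le> n - 1" using j by auto
  then show "x \<in> {f (crit_pt n lam (n - i)) | i. i \<in> {1..n-1} \<and> P i}"
    using j by (intro CollectI exI[of _ "n - 1 - j"]) auto
qed

lemma lowest_max_eq: "lowest_max n lam = Min ((\<lambda>j. F (crit j)) ` maxima)"
  unfolding lowest_max_def reindex_crit maxima_def ..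

lemma lowest_min_depth_eq: "lowest_min_depth n lam = Min ((\<lambda>j. - F (crit j)) ` minima)"
  unfolding lowest_min_depth_def minima_def
  using reindex_crit[of "\<lambda>x. - F x" odd] by simp

lemma lowest_max_le_iff: "x \<le> lowest_max n lam \<longleftrightarrow> (\<forall>j\<in>maxima. x \<le> sg j * F (crit j))"
  unfolding lowest_max_eq using maxima_minima maxima_ne sg_maxima by (subst Min_ge_iff) auto

lemma lowest_min_depth_le_iff: "x \<le> lowest_min_depth n lam \<longleftrightarrow> (\<forall>j\<in>minima. x \<le> sg j * F (crit j))"
  unfolding lowest_min_depth_eq using maxima_minima minima_ne sg_minima by (subst Min_ge_iff) auto

lemma lowest_max_pos: "0 < lowest_max n lam"
proof -
  have "lowest_max n lam \<in> (\<lambda>j. F (crit j)) ` maxima"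
    unfolding lowest_max_eq using maxima_minima maxima_ne by (intro Min_in) auto
  then show ?thesis using F_crit_pos sg_maxima by (force simp: maxima_def)
qed

lemma lowest_min_depth_pos: "0 < lowest_min_depth n lam"
proof -
  have "lowest_min_depth n lam \<in> (\<lambda>j. - F (crit j)) ` minima"
    unfolding lowest_min_depth_eq using maxima_minima minima_ne by (intro Min_in) auto
  then show ?thesis using F_crit_pos sg_minima by (force simp: minima_def)
qed

lemma inj_on_crit: "inj_on crit {..<n - 1}"
  using crit_mono by (rule strict_mono_on_imp_inj_on)

lemma local_extremum_crit:
  assumes "(\<forall>\<^sub>F y in nhds x. F y \<le> F x) \<or> (\<forall>\<^sub>F y in nhds x. F y \<ge> F x)"
  shows "\<exists>j<n - 1. x = crit j"
proof -
  have "poly (pderiv Fp) x = 0"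
    using assms
  proof
    assume "\<forall>\<^sub>F y in nhds x. F y \<le> F x"
    then obtain d where "0 < d" "\<And>y. dist y x < d \<Longrightarrow> F y \<le> F x" by (auto simp: eventually_nhds_metric)
    then show ?thesis using DERIV_local_max[OF DERIV_F, of d] by (auto simp: dist_real_def abs_minus_commute)
  next
    assume "\<forall>\<^sub>F y in nhds x. F y \<ge> F x"
    then obtain d where "0 < d" "\<And>y. dist y x < d \<Longrightarrow> F x \<le> F y" by (auto simp: eventually_nhds_metric)
    then show ?thesis using DERIV_local_min[OF DERIV_F, of d] by (auto simp: dist_real_def abs_minus_commute)
  qed
  then have "deriv F x = 0" using DERIV_imp_deriv[OF DERIV_F] by simp
  then show ?thesis using crit_deriv by auto
qed

lemma eventually_F_le_crit:
  assumes j: "j < n - 1"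
  shows "\<forall>\<^sub>F y in nhds (crit j). sg j * F y \<le> sg j * F (crit j)"
proof -
  have "\<forall>\<^sub>F y in nhds (crit j). y \<in> {lam (Suc j)<..<lam (Suc (Suc j))}"
    using crit_between[OF j] by (intro eventually_nhds_in_open) auto
  then show ?thesis by eventually_elim (use F_le_crit[OF j] in auto)
qed

text \<open>The definition counts arbitrary local maxima at the lowest level. They are critical
  points, and the positive level singles out the intervals where \<open>F\<close> is
  positive.\<close>

lemma num_maxima_eq: "num_maxima n lam = card {j \<in> maxima. sg j * F (crit j) = lowest_max n lam}"
proof -
  have "{x. (\<forall>\<^sub>F y in nhds x. F y \<le> F x) \<and> F x = lowest_max n lam} =
      crit ` {j \<in> maxima. sg j * F (crit j) = lowest_max n lam}" (is "?A = ?B")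
  proof
    show "?A \<subseteq> ?B"
    proof
      fix x assume x: "x \<in> ?A"
      then obtain j where j: "j < n - 1" "x = crit j" using local_extremum_crit by blast
      have "sg j = 1" using F_crit_pos[OF j(1)] x j lowest_max_pos sg_cases[of j] by auto
      then have "j \<in> maxima" using j(1) sg_minima maxima_minima by fastforce
      then show "x \<in> ?B" using x j \<open>sg j = 1\<close> by auto
    qed
    show "?B \<subseteq> ?A"
    proof
      fix x assume "x \<in> ?B"
      then obtain j where j: "j \<in> maxima" "sg j * F (crit j) = lowest_max n lam" "x = crit j" by blast
      then show "x \<in> ?A" using eventually_F_le_crit[of j] sg_maxima[OF j(1)] by (auto simp: maxima_def)
    qed
  qed
  moreover have "inj_on crit {j \<in> maxima. sg j * F (crit j) = lowest_max n lam}"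
    using inj_on_crit by (rule inj_on_subset) (auto simp: maxima_def)
  ultimately show ?thesis unfolding num_maxima_def by (simp add: card_image)
qed

lemma num_minima_eq: "num_minima n lam = card {j \<in> minima. sg j * F (crit j) = lowest_min_depth n lam}"
proof -
  have "{x. (\<forall>\<^sub>F y in nhds x. F y \<ge> F x) \<and> F x = - lowest_min_depth n lam} =
      crit ` {j \<in> minima. sg j * F (crit j) = lowest_min_depth n lam}" (is "?A = ?B")
  proof
    show "?A \<subseteq> ?B"
    proof
      fix x assume x: "x \<in> ?A"
      then obtain j where j: "j < n - 1" "x = crit j" using local_extremum_crit by blast
      have "sg j = -1" using F_crit_pos[OF j(1)] x j lowest_min_depth_pos sg_cases[of j] by auto
      then have "j \<in> minima" using j(1) sg_maxima maxima_minima by fastforce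
      then show "x \<in> ?B" using x j \<open>sg j = -1\<close> by auto
    qed
    show "?B \<subseteq> ?A"
    proof
      fix x assume "x \<in> ?B"
      then obtain j where j: "j \<in> minima" "sg j * F (crit j) = lowest_min_depth n lam" "x = crit j" by blast
      then show "x \<in> ?A" using eventually_F_le_crit[of j] sg_minima[OF j(1)]
        by (auto simp: minima_def elim!: eventually_mono)
    qed
  qed
  moreover have "inj_on crit {j \<in> minima. sg j * F (crit j) = lowest_min_depth n lam}"
    using inj_on_crit by (rule inj_on_subset) (auto simp: minima_def)
  ultimately show ?thesis unfolding num_minima_def by (simp add: card_image)
qed

text \<open>Rearranged from \<open>2 * cmod z \<le> sg j * (F x + 2 * Re z)\<close>, the condition
  for real points of the curve over \<open>x\<close> in interval \<open>j\<close>.\<close>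

definition threshold :: "complex \<Rightarrow> nat \<Rightarrow> real" where
  "threshold z j = 2 * (cmod z - sg j * Re z)"

lemma in_region_iff:
  "z \<in> region n lam \<longleftrightarrow> 2 * (cmod z - Re z) \<le> lowest_max n lam \<and> 2 * (cmod z + Re z) \<le> lowest_min_depth n lam"
proof -
  have half: "ereal (1/2) * min x y = min (ereal (1/2) * x) (ereal (1/2) * y)" for x y :: ereal
    by (cases x y rule: le_cases) (simp_all add: min_absorb1 min_absorb2 ereal_mult_left_mono)
  have "z \<in> region n lam \<longleftrightarrow> ereal (cmod z) \<le> ereal (1/2) * min_bound n lam z \<and> ereal (cmod z) \<le> ereal (1/2) * max_bound n lam z"
    unfolding region_def half by simp
  also have "ereal (cmod z) \<le> ereal (1/2) * min_bound n lam z \<longleftrightarrow> 2 * (cmod z * (1 + cos (Arg z))) \<le> lowest_min_depth n lam"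
    unfolding min_bound_def by (rule ereal_div_bound[OF lowest_min_depth_pos cos_Arg_bounds(1)])
  also have "ereal (cmod z) \<le> ereal (1/2) * max_bound n lam z \<longleftrightarrow> 2 * (cmod z * (1 - cos (Arg z))) \<le> lowest_max n lam"
    unfolding max_bound_def by (rule ereal_div_bound[OF lowest_max_pos cos_Arg_bounds(2)])
  finally show ?thesis unfolding modulus_cos_Arg by blast
qed

lemma in_region_iff_threshold: "z \<in> region n lam \<longleftrightarrow> (\<forall>j<n - 1. threshold z j \<le> sg j * F (crit j))"
proof -
  have "z \<in> region n lam \<longleftrightarrow> (\<forall>j\<in>maxima. threshold z j \<le> sg j * F (crit j)) \<and> (\<forall>j\<in>minima. threshold z j \<le> sg j * F (crit j))"
    unfolding in_region_iff lowest_max_le_iff lowest_min_depth_le_iff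
    using sg_maxima sg_minima by (simp add: threshold_def)
  then show ?thesis using maxima_minima(4) by blast
qed

text \<open>Both left-hand sides are positively homogeneous in \<open>z\<close>, so room for a
  slight dilation of a nonzero \<open>z\<close> makes the inequalities strict.\<close>

lemma in_interior_region_iff:
  "z \<in> interior (region n lam) \<longleftrightarrow>
     2 * (cmod z - Re z) < lowest_max n lam \<and> 2 * (cmod z + Re z) < lowest_min_depth n lam"
proof
  assume z: "z \<in> interior (region n lam)"
  show "2 * (cmod z - Re z) < lowest_max n lam \<and> 2 * (cmod z + Re z) < lowest_min_depth n lam"
  proof (cases "z = 0")
    case True
    then show ?thesis using lowest_max_pos lowest_min_depth_pos by simp
  next
    case False
    obtain e where e: "0 < e" "ball z e \<subseteq> region n lam" using z by (auto simp: mem_interior)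
    define t where "t = e / (2 * cmod z)"
    have t: "0 < t" using e False by (simp add: t_def)
    have "dist z (of_real (1 + t) * z) = cmod (of_real t * z)"
      by (simp add: dist_norm algebra_simps norm_minus_commute)
    also have "\<dots> = t * cmod z" using t by (simp only: norm_mult norm_of_real abs_of_pos)
    also have "\<dots> = e / 2" using False by (simp add: t_def)
    also have "\<dots> < e" using e by simp
    finally have "of_real (1 + t) * z \<in> region n lam" using e(2) by auto
    moreover have "cmod (of_real (1 + t) * z) = (1 + t) * cmod z" using t by (simp add: norm_mult del: of_real_add)
    moreover have "Re (of_real (1 + t) * z) = (1 + t) * Re z" by simp
    ultimately have scaled: "(1 + t) * (2 * (cmod z - Re z)) \<le> lowest_max n lam" "(1 + t) * (2 * (cmod z + Re z)) \<le> lowest_min_depth n lam"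
      unfolding in_region_iff by (simp_all add: algebra_simps)
    have less: "x < M" if "(1 + t) * x \<le> M" "0 < M" for x M :: real
    proof (cases "0 < x")
      case True
      then have "x < (1 + t) * x" using t by simp
      then show ?thesis using that(1) by simp
    qed (use that(2) in simp)
    show ?thesis using less[OF scaled(1) lowest_max_pos] less[OF scaled(2) lowest_min_depth_pos] ..
  qed
next
  assume "2 * (cmod z - Re z) < lowest_max n lam \<and> 2 * (cmod z + Re z) < lowest_min_depth n lam"
  then have "z \<in> {z. 2 * (cmod z - Re z) < lowest_max n lam} \<inter> {z. 2 * (cmod z + Re z) < lowest_min_depth n lam}" by simp
  moreover have "open ({z. 2 * (cmod z - Re z) < lowest_max n lam} \<inter> {z. 2 * (cmod z + Re z) < lowest_min_depth n lam})"
    by (intro open_Int open_Collect_less continuous_intros)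
  moreover have "{z. 2 * (cmod z - Re z) < lowest_max n lam} \<inter> {z. 2 * (cmod z + Re z) < lowest_min_depth n lam} \<subseteq> region n lam"
    by (intro subsetI) (simp only: in_region_iff Int_iff mem_Collect_eq less_imp_le)
  ultimately show "z \<in> interior (region n lam)" using interior_maximal by blast
qed

text \<open>On the boundary at least one inequality is an equality. For that one the bound is
  exactly twice the modulus, for a strict one it is larger, so comparing the bounds tells which is
  attained.\<close>

lemma frontier_region_cases:
  assumes z: "z \<in> frontier (region n lam)"
  obtains "z \<in> region n lam" "z \<noteq> 0" "2 * (cmod z - Re z) = lowest_max n lam" "2 * (cmod z + Re z) < lowest_min_depth n lam"
      "max_bound n lam z < min_bound n lam z"
    | "z \<in> region n lam" "z \<noteq> 0" "2 * (cmod z - Re z) < lowest_max n lam" "2 * (cmod z + Re z) = lowest_min_depth n lam"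
      "min_bound n lam z < max_bound n lam z"
    | "z \<in> region n lam" "z \<noteq> 0" "2 * (cmod z - Re z) = lowest_max n lam" "2 * (cmod z + Re z) = lowest_min_depth n lam"
      "min_bound n lam z = max_bound n lam z"
proof -
  have "region n lam = {z. 2 * (cmod z - Re z) \<le> lowest_max n lam} \<inter> {z. 2 * (cmod z + Re z) \<le> lowest_min_depth n lam}"
    by (rule Set.set_eqI) (simp only: in_region_iff Int_iff mem_Collect_eq)
  also have "closed \<dots>" by (intro closed_Int closed_Collect_le continuous_intros)
  finally have zR: "z \<in> region n lam" and zI: "z \<notin> interior (region n lam)"
    using z by (auto simp: frontier_def)
  have "z \<noteq> 0"
  proof
    assume "z = 0"
    then show False using zI lowest_max_pos lowest_min_depth_pos by (simp add: in_interior_region_iff)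
  qed
  have max_less: "ereal (2 * cmod z) < max_bound n lam z" if "2 * (cmod z - Re z) < lowest_max n lam"
    unfolding max_bound_def using that
    by (intro ereal_div_less[OF lowest_max_pos cos_Arg_bounds(2)]) (simp only: modulus_cos_Arg)
  have max_eq: "max_bound n lam z = ereal (2 * cmod z)" if "2 * (cmod z - Re z) = lowest_max n lam"
    unfolding max_bound_def using that
    by (intro ereal_div_eq[OF lowest_max_pos cos_Arg_bounds(2)]) (simp only: modulus_cos_Arg)
  have min_less: "ereal (2 * cmod z) < min_bound n lam z" if "2 * (cmod z + Re z) < lowest_min_depth n lam"
    unfolding min_bound_def using that
    by (intro ereal_div_less[OF lowest_min_depth_pos cos_Arg_bounds(1)]) (simp only: modulus_cos_Arg)
  have min_eq: "min_bound n lam z = ereal (2 * cmod z)" if "2 * (cmod z + Re z) = lowest_min_depth n lam"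
    unfolding min_bound_def using that
    by (intro ereal_div_eq[OF lowest_min_depth_pos cos_Arg_bounds(1)]) (simp only: modulus_cos_Arg)
  show ?thesis
    using that zR zI \<open>z \<noteq> 0\<close> max_less max_eq min_less min_eq
    unfolding in_region_iff in_interior_region_iff by (metis le_less)
qed

end


section \<open>The fibres over nonzero points\<close>

lemma compact_zero_set:
  fixes f :: "'i \<Rightarrow> 'a::t2_space \<Rightarrow> real"
  assumes "compact K" "\<And>i. i \<in> I \<Longrightarrow> continuous_on K (f i)"
  shows "compact {x \<in> K. \<forall>i\<in>I. f i x = 0}"
proof -
  have "closed (K \<inter> f i -` {0})" if "i \<in> I" for i
    using assms that by (intro continuous_closed_preimage compact_imp_closed closed_singleton)
  then have "closed (\<Inter>i\<in>I. K \<inter> f i -` {0})" by (intro closed_INT ballI)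
  with assms(1) have "compact (K \<inter> (\<Inter>i\<in>I. K \<inter> f i -` {0}))" by (rule compact_Int_closed)
  moreover have "K \<inter> (\<Inter>i\<in>I. K \<inter> f i -` {0}) = {x \<in> K. \<forall>i\<in>I. f i x = 0}" by auto
  ultimately show ?thesis by simp
qed

lemma continuous_on_continuant:
  fixes d \<beta> :: "nat \<Rightarrow> 'a::topological_space \<Rightarrow> real"
  assumes "\<And>i. continuous_on S (d i)" "\<And>i. continuous_on S (\<beta> i)"
  shows "continuous_on S (\<lambda>x. continuant (\<lambda>i. d i x) (\<lambda>i. \<beta> i x) s m)"
proof (induction m rule: less_induct)
  case (less m)
  consider "m = 0" | "m = 1" | k where "m = Suc (Suc k)" by (metis One_nat_def old.nat.exhaust)
  then show ?case
    using assms less.IH by cases (auto intro!: continuous_intros)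
qed

lemma continuous_on_poly_cpoly:
  assumes "\<And>i. continuous_on S (\<lambda>x. a x i)" "\<And>i. continuous_on S (\<lambda>x. b x i)" "continuous_on S y"
  shows "continuous_on S (\<lambda>x. poly (cpoly (a x) (b x) s m) (y x))"
  unfolding poly_continuant using assms
  by (intro continuous_on_continuant) (auto intro!: continuous_intros)

section \<open>The circle over a gap\<close>

definition gap_x :: "real \<Rightarrow> real \<Rightarrow> complex \<Rightarrow> real" where
  "gap_x e f \<theta> = (e + f) / 2 + (f - e) / 2 * Re \<theta>"

text \<open>The real points of the spectral curve \<open>w + r\<^sup>2/w = p(x)\<close> over a gap \<open>[e, f]\<close> form a circle:
  its two halves are the two sheets, which meet over the end points, where the
  discriminant vanishes.\<close>

definition gap_w :: "(real \<Rightarrow> real) \<Rightarrow> real \<Rightarrow> real \<Rightarrow> real \<Rightarrow> complex \<Rightarrow> real" where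
  "gap_w p r e f \<theta> = (if Im \<theta> \<le> 0 then (p (gap_x e f \<theta>) - sqrt ((p (gap_x e f \<theta>))\<^sup>2 - 4 * r\<^sup>2)) / 2
     else (p (gap_x e f \<theta>) + sqrt ((p (gap_x e f \<theta>))\<^sup>2 - 4 * r\<^sup>2)) / 2)"

locale gap =
  fixes p :: "real \<Rightarrow> real" and r e f \<sigma> :: real
  assumes ef: "e \<le> f" and r: "0 < r" and cp: "continuous_on UNIV p" and \<sigma>: "\<sigma> = 1 \<or> \<sigma> = -1"
    and ge: "\<And>x. e \<le> x \<Longrightarrow> x \<le> f \<Longrightarrow> 2 * r \<le> \<sigma> * p x"
    and eq: "\<And>x. e \<le> x \<Longrightarrow> x \<le> f \<Longrightarrow> \<sigma> * p x = 2 * r \<longleftrightarrow> x = e \<or> x = f"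
begin

abbreviation "X \<equiv> gap_x e f"
abbreviation "W \<equiv> gap_w p r e f"
abbreviation "S x \<equiv> sqrt ((p x)\<^sup>2 - 4 * r\<^sup>2)"

lemma X_bounds:
  assumes "cmod \<theta> = 1"
  shows "e \<le> X \<theta>" "X \<theta> \<le> f"
proof -
  have "(f - e) * (- 1) \<le> (f - e) * Re \<theta>" "(f - e) * Re \<theta> \<le> (f - e) * 1"
    using ef abs_Re_le_cmod[of \<theta>] assms by (intro mult_left_mono; simp add: abs_le_iff)+
  then show "e \<le> X \<theta>" "X \<theta> \<le> f" by (simp_all add: gap_x_def field_simps)
qed

lemma disc_nonneg:
  assumes "e \<le> x" "x \<le> f"
  shows "0 \<le> (p x)\<^sup>2 - 4 * r\<^sup>2" "S x < \<sigma> * p x" "S x = 0 \<longleftrightarrow> x = e \<or> x = f"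
proof -
  have sq: "(\<sigma> * p x)\<^sup>2 = (p x)\<^sup>2" using \<sigma> by (auto simp: power_mult_distrib)
  have "(2 * r)\<^sup>2 \<le> (\<sigma> * p x)\<^sup>2" using ge[OF assms] r by (intro power_mono) auto
  then show 0: "0 \<le> (p x)\<^sup>2 - 4 * r\<^sup>2" unfolding sq by (simp add: power_mult_distrib)
  have "(p x)\<^sup>2 - 4 * r\<^sup>2 < (\<sigma> * p x)\<^sup>2" unfolding sq using r by simp
  then have "S x < sqrt ((\<sigma> * p x)\<^sup>2)" by (rule real_sqrt_less_mono)
  then show "S x < \<sigma> * p x" using ge[OF assms] r by simp
  have "S x = 0 \<longleftrightarrow> (\<sigma> * p x)\<^sup>2 = (2 * r)\<^sup>2" unfolding sq by (simp add: power_mult_distrib)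
  also have "\<dots> \<longleftrightarrow> \<sigma> * p x = 2 * r" using ge[OF assms] r by (intro power2_eq_iff_nonneg) auto
  finally show "S x = 0 \<longleftrightarrow> x = e \<or> x = f" using eq[OF assms] by simp
qed

text \<open>\<open>W\<close> is a root of \<open>w\<^sup>2 - p w + r\<^sup>2 = 0\<close>; the two
  roots have the positive product \<open>r\<^sup>2\<close>, hence both have the sign of
  \<open>p\<close>.\<close>

lemma W_facts:
  assumes "cmod \<theta> = 1"
  shows "0 < \<sigma> * W \<theta>" "W \<theta> + r\<^sup>2 / W \<theta> = p (X \<theta>)"
proof -
  define x where "x = X \<theta>"
  have x: "e \<le> x" "x \<le> f" using X_bounds[OF assms] by (auto simp: x_def)
  obtain t where t: "t = 1 \<or> t = -1" "W \<theta> = (p x + t * S x) / 2"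
  proof (cases "Im \<theta> \<le> 0")
    case True
    then show ?thesis using that[of "-1"] by (simp add: gap_w_def x_def)
  next
    case False
    then show ?thesis using that[of 1] by (simp add: gap_w_def x_def)
  qed
  have S: "0 \<le> S x" "S x < \<sigma> * p x" "(S x)\<^sup>2 = (p x)\<^sup>2 - 4 * r\<^sup>2"
    using disc_nonneg[OF x] by auto
  have "\<sigma> * t = 1 \<or> \<sigma> * t = -1" using t(1) \<sigma> by auto
  then have "- S x \<le> (\<sigma> * t) * S x" using S(1) by auto
  with S(2) have "0 < \<sigma> * p x + (\<sigma> * t) * S x" by - (rule less_le_trans[of 0 "\<sigma> * p x - S x"], simp_all)
  moreover have "\<sigma> * W \<theta> = (\<sigma> * p x + (\<sigma> * t) * S x) / 2" by (simp only: t(2)) (simp add: algebra_simps)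
  ultimately show pos: "0 < \<sigma> * W \<theta>" by simp
  define s where "s = S x"
  have s: "s\<^sup>2 = (p x)\<^sup>2 - 4 * r\<^sup>2" "W \<theta> = (p x + t * s) / 2" "t\<^sup>2 = 1"
    using S(3) t by (auto simp only: s_def power_one power2_minus)
  have "4 * (W \<theta>)\<^sup>2 = (p x)\<^sup>2 + 2 * (t * (p x * s)) + t\<^sup>2 * s\<^sup>2"
    unfolding s(2) by (simp add: power2_eq_square algebra_simps)
  moreover have "4 * (p x * W \<theta>) = 2 * (p x)\<^sup>2 + 2 * (t * (p x * s))"
    unfolding s(2) by (simp add: power2_eq_square algebra_simps)
  ultimately have "(W \<theta>)\<^sup>2 + r\<^sup>2 = p x * W \<theta>" unfolding s(1,3) by simp
  moreover have "W \<theta> \<noteq> 0" using pos by auto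
  ultimately show "W \<theta> + r\<^sup>2 / W \<theta> = p (X \<theta>)"
    by (simp add: x_def[symmetric] field_simps power2_eq_square)
qed

lemma degenerate:
  assumes "e = f"
  shows "X \<theta> = X \<theta>'" "W \<theta> = W \<theta>'"
proof -
  have "S e = 0" using disc_nonneg(3)[of e] ef by simp
  moreover have "X \<theta> = e" for \<theta> using assms by (simp add: gap_x_def)
  ultimately show "X \<theta> = X \<theta>'" "W \<theta> = W \<theta>'" by (simp_all add: gap_w_def)
qed

text \<open>The sign of \<open>2 * w - p x\<close> tells which root \<open>w\<close> is, hence which
  half of the circle carries it.\<close>

lemma surj:
  assumes x: "e \<le> x" "x \<le> f" and w: "w \<noteq> 0" "w + r\<^sup>2 / w = p x"
  obtains \<theta> where "cmod \<theta> = 1" "X \<theta> = x" "W \<theta> = w"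
proof -
  have "w\<^sup>2 + r\<^sup>2 = p x * w" using w by (simp add: field_simps power2_eq_square)
  then have "(2 * w - p x)\<^sup>2 = (p x)\<^sup>2 - 4 * r\<^sup>2" by (simp add: power2_eq_square algebra_simps)
  then have S: "S x = \<bar>2 * w - p x\<bar>" by (metis real_sqrt_abs)
  show ?thesis
  proof (cases "e = f")
    case True
    then have "x = e" using x by simp
    moreover have "S e = 0" using disc_nonneg(3)[of e] ef by simp
    ultimately have "W 1 = w" "X 1 = x" using S True by (auto simp: gap_w_def gap_x_def)
    then show ?thesis using that[of 1] by simp
  next
    case False
    then have lt: "e < f" using ef by simp
    define u where "u = (2 * x - e - f) / (f - e)"
    have u: "- 1 \<le> u" "u \<le> 1" using x lt by (auto simp: u_def field_simps)
    have u2: "u\<^sup>2 \<le> 1" using u by (simp add: abs_square_le_1 abs_le_iff)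
    define v where "v = sqrt (1 - u\<^sup>2)"
    have v: "0 \<le> v" "u\<^sup>2 + v\<^sup>2 = 1" using u2 by (auto simp: v_def)
    have Xu: "X (Complex u y) = x" for y using lt by (simp add: gap_x_def u_def field_simps)
    show ?thesis
    proof (cases "2 * w - p x \<le> 0")
      case True
      have "W (Complex u (- v)) = w" using v(1) S True Xu by (simp add: gap_w_def)
      moreover have "cmod (Complex u (- v)) = 1" using v(2) by (simp add: cmod_def)
      ultimately show ?thesis using that Xu by blast
    next
      case F: False
      then have "x \<noteq> e" "x \<noteq> f" using disc_nonneg(3)[OF x] S by auto
      then have "- 1 < u" "u < 1" using x lt by (auto simp: u_def field_simps)
      then have "u\<^sup>2 < 1" by (simp add: abs_square_less_1 abs_less_iff)
      then have "0 < v" by (simp add: v_def)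
      then have "W (Complex u v) = w" using S F Xu by (simp add: gap_w_def)
      moreover have "cmod (Complex u v) = 1" using v(2) by (simp add: cmod_def)
      ultimately show ?thesis using that Xu by blast
    qed
  qed
qed

lemma sphere_im_zero:
  assumes "cmod \<theta> = 1" "Im \<theta> = 0"
  shows "S (X \<theta>) = 0"
proof -
  have "(Re \<theta>)\<^sup>2 = 1" using assms cmod_power2[of \<theta>] by simp
  then have "Re \<theta> = 1 \<or> Re \<theta> = -1" by (simp add: power2_eq_1_iff)
  then have "X \<theta> = e \<or> X \<theta> = f" by (auto simp: gap_x_def field_simps)
  then show ?thesis using disc_nonneg(3)[OF X_bounds[OF assms(1)]] by blast
qed

text \<open>Equal \<open>X\<close> leaves a point and its conjugate. If these also have equal
  \<open>W\<close>, the two roots coincide, which happens only over the end points, where the circle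
  meets the real axis.\<close>

lemma inj:
  assumes "e < f" "cmod \<theta> = 1" "cmod \<theta>' = 1" "X \<theta> = X \<theta>'" "W \<theta> = W \<theta>'"
  shows "\<theta> = \<theta>'"
proof -
  have Re: "Re \<theta> = Re \<theta>'" using assms(1,4) by (simp add: gap_x_def)
  have "(Im \<theta>)\<^sup>2 = (Im \<theta>')\<^sup>2" using Re assms(2,3) cmod_power2[of \<theta>] cmod_power2[of \<theta>'] by simp
  then have "Im \<theta> = Im \<theta>' \<or> Im \<theta> = - Im \<theta>'" by (simp only: power2_eq_iff)
  then consider "Im \<theta> = Im \<theta>'" | "Im \<theta> = - Im \<theta>'" "Im \<theta> \<noteq> 0" by force
  then show ?thesis
  proof cases
    case 1
    then show ?thesis using Re by (simp add: complex_eq_iff)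
  next
    case 2
    then have "S (X \<theta>) = 0"
      using assms(4,5) by (cases "Im \<theta> \<le> 0"; cases "Im \<theta>' \<le> 0") (auto simp: gap_w_def)
    then have "X \<theta> = e \<or> X \<theta> = f" using disc_nonneg(3)[OF X_bounds[OF assms(2)]] by blast
    then have "(f - e) * (Re \<theta> + 1) = 0 \<or> (f - e) * (Re \<theta> - 1) = 0"
      by (auto simp: gap_x_def field_simps)
    then have "(Re \<theta>)\<^sup>2 = 1" using assms(1) by (auto simp: add_eq_0_iff)
    then have "Im \<theta> = 0" using assms(2) cmod_power2[of \<theta>] by simp
    then show ?thesis using 2 by simp
  qed
qed

lemma continuous_X: "continuous_on T X"
  unfolding gap_x_def by (intro continuous_intros)

lemma continuous_pX: "continuous_on T (\<lambda>\<theta>. p (X \<theta>))"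
  using continuous_on_compose2[OF cp continuous_X] by simp

lemma continuous_W: "continuous_on (sphere 0 1) W"
  unfolding gap_w_def
  by (rule continuous_on_cases_le)
    (use sphere_im_zero in \<open>auto intro!: continuous_intros continuous_pX simp del: real_sqrt_eq_zero_cancel_iff\<close>)

end

context spectral_data
begin

text \<open>\<open>sg j * F\<close> rises strictly from 0 to its value at the critical point and
  falls strictly back to 0, so every level in between is attained once on each side.\<close>

lemma gap_endpoints:
  assumes j: "j < n - 1" and \<tau>: "0 \<le> \<tau>" "\<tau> \<le> sg j * F (crit j)"
  shows "\<exists>e f. lam (Suc j) \<le> e \<and> e \<le> f \<and> f \<le> lam (Suc (Suc j)) \<and>
    (\<forall>x. lam (Suc j) \<le> x \<longrightarrow> x \<le> lam (Suc (Suc j)) \<longrightarrow> (\<tau> \<le> sg j * F x \<longleftrightarrow> e \<le> x \<and> x \<le> f)) \<and>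
    (\<forall>x. e \<le> x \<longrightarrow> x \<le> f \<longrightarrow> (sg j * F x = \<tau> \<longleftrightarrow> x = e \<or> x = f)) \<and> (e < f \<longleftrightarrow> \<tau> < sg j * F (crit j))"
proof -
  note cb = crit_between[OF j]
  have z: "sg j * F (lam (Suc j)) = 0" "sg j * F (lam (Suc (Suc j))) = 0"
    using F_lam[of j] F_lam[of "Suc j"] j by auto
  have c: "continuous_on S (\<lambda>x. sg j * F x)" for S by (intro continuous_intros continuous_on_F)
  obtain e where e: "lam (Suc j) \<le> e" "e \<le> crit j" "sg j * F e = \<tau>"
    using IVT'[of "\<lambda>x. sg j * F x" "lam (Suc j)" \<tau> "crit j"] z \<tau> cb c by auto
  obtain f where f: "crit j \<le> f" "f \<le> lam (Suc (Suc j))" "sg j * F f = \<tau>"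
    using IVT2'[of "\<lambda>x. sg j * F x" "lam (Suc (Suc j))" \<tau> "crit j"] z \<tau> cb c by auto
  have inc: "sg j * F x < sg j * F y" if "lam (Suc j) \<le> x" "x < y" "y \<le> crit j" for x y
    using F_increasing[OF j that] .
  have dec: "sg j * F y < sg j * F x" if "crit j \<le> x" "x < y" "y \<le> lam (Suc (Suc j))" for x y
    using F_decreasing[OF j that] .
  have 1: "\<tau> < sg j * F x" if "e < x" "x < f" for x
    using inc[of e x] dec[of x f] e f that by (cases "x \<le> crit j") auto
  have 2: "sg j * F x < \<tau>" if "lam (Suc j) \<le> x" "x < e" for x using inc[of x e] e that by simp
  have 3: "sg j * F x < \<tau>" if "f < x" "x \<le> lam (Suc (Suc j))" for x using dec[of f x] f that by simp
  have 4: "\<tau> \<le> sg j * F x \<longleftrightarrow> e \<le> x \<and> x \<le> f" if "lam (Suc j) \<le> x" "x \<le> lam (Suc (Suc j))" for x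
  proof (cases "x < e \<or> f < x")
    case True
    then have "sg j * F x < \<tau>" using 2[of x] 3[of x] that by blast
    then show ?thesis using True by linarith
  next
    case False
    then consider "x = e" | "x = f" | "e < x" "x < f" by linarith
    then have "\<tau> \<le> sg j * F x" by cases (use 1[of x] e(3) f(3) in auto)
    then show ?thesis using False by simp
  qed
  have 5: "sg j * F x = \<tau> \<longleftrightarrow> x = e \<or> x = f" if "e \<le> x" "x \<le> f" for x
    using 1[of x] e(3) f(3) that by (auto simp: le_less)
  have 6: "e < f \<longleftrightarrow> \<tau> < sg j * F (crit j)"
  proof
    assume "e < f"
    then have "e < crit j \<or> crit j < f" by linarith
    then show "\<tau> < sg j * F (crit j)" using inc[of e "crit j"] dec[of "crit j" f] e f by auto
  next
    assume "\<tau> < sg j * F (crit j)"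
    then have "e \<noteq> crit j" using e(3) by auto
    then show "e < f" using e(2) f(1) by simp
  qed
  show ?thesis
    using e f 4 5 6 by (intro exI[of _ e] exI[of _ f]) auto
qed

lemma threshold_nonneg: "0 \<le> threshold z j"
  using abs_Re_le_cmod[of z] sg_cases[of j] by (auto simp: threshold_def)

lemma F_continuous_shift: "continuous_on S (\<lambda>x. F x + 2 * Re z)"
  by (intro continuous_intros continuous_on_F)

text \<open>The matrix gives a point of the curve for each root \<open>\<mu> j\<close>. From
  \<open>\<bar>w\<bar> + \<bar>z\<bar>\<^sup>2 / \<bar>w\<bar> \<ge> 2 \<bar>z\<bar>\<close> the
  threshold is reached at \<open>\<mu> j\<close>, and the resulting signs place the roots by
  \<open>weak_interlacing\<close>.\<close>

lemma isospectral_divisor: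
  assumes iso: "periodic_tridiagonal n a b \<in> isospectral n lam" and z: "(\<Prod>i<n. b i) = z" "z \<noteq> 0"
  defines "\<beta> \<equiv> \<lambda>i. (cmod (b i))\<^sup>2"
  obtains \<mu> where "strict_mono_on {..<n - 1} \<mu>" "\<And>j. j < n - 1 \<Longrightarrow> poly (cpoly a \<beta> 0 (n - 1)) (\<mu> j) = 0"
    "\<And>j. j < n - 1 \<Longrightarrow> - \<beta> (n - 1) * poly (cpoly a \<beta> 1 (n - 2)) (\<mu> j) \<noteq> 0"
    "\<And>j. j < n - 1 \<Longrightarrow> - \<beta> (n - 1) * poly (cpoly a \<beta> 1 (n - 2)) (\<mu> j)
       + (cmod z)\<^sup>2 / (- \<beta> (n - 1) * poly (cpoly a \<beta> 1 (n - 2)) (\<mu> j)) = F (\<mu> j) + 2 * Re z"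
    "\<And>j. j < n - 1 \<Longrightarrow> lam (Suc j) \<le> \<mu> j" "\<And>j. j < n - 1 \<Longrightarrow> \<mu> j \<le> lam (Suc (Suc j))"
    "\<And>j. j < n - 1 \<Longrightarrow> threshold z j \<le> sg j * F (\<mu> j)"
proof -
  have pos: "0 < \<beta> i" if "i < n" for i
    using z that by (auto simp: \<beta>_def)
  have pr: "(\<Prod>i<n. \<beta> i) = (cmod z)\<^sup>2"
    unfolding \<beta>_def z(1)[symmetric] prod_power_distrib[symmetric] prod_norm[symmetric] ..
  have disc: "poly (discriminant_poly n a \<beta>) x = F x + 2 * Re z" for x
    using iso isospectral_iff_discriminant[OF n3 lam_mono, of a b] z(1) by (simp add: \<beta>_def)
  obtain \<mu> where \<mu>: "strict_mono_on {..<n - 1} \<mu>" "\<And>j. j < n - 1 \<Longrightarrow> poly (cpoly a \<beta> 0 (n - 1)) (\<mu> j) = 0"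
    "\<And>j. j < n - 1 \<Longrightarrow> 0 < (-1) ^ (n - 1 - j) * (- \<beta> (n - 1) * poly (cpoly a \<beta> 1 (n - 2)) (\<mu> j))"
    using discriminant_roots[OF n3, of \<beta> a] pos by blast
  define w where "w j = - \<beta> (n - 1) * poly (cpoly a \<beta> 1 (n - 2)) (\<mu> j)" for j
  have w: "0 < sg j * w j" if "j < n - 1" for j using \<mu>(3)[OF that] by (simp add: w_def sg_def)
  have w0: "w j \<noteq> 0" if "j < n - 1" for j using w[OF that] by auto
  have curve: "w j + (cmod z)\<^sup>2 / w j = F (\<mu> j) + 2 * Re z" if j: "j < n - 1" for j
  proof -
    define w' where "w' = - \<beta> (n - 2) * poly (cpoly a \<beta> 0 (n - 2)) (\<mu> j)"
    have "w j * w' = (cmod z)\<^sup>2" "w j + w' = F (\<mu> j) + 2 * Re z"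
      using discriminant_curve[OF n3 \<mu>(2)[OF j]] pr disc by (simp_all only: w_def w'_def)
    moreover from this(1) have "w' = (cmod z)\<^sup>2 / w j" using w0[OF j] by (simp add: field_simps)
    ultimately show ?thesis by simp
  qed
  have thr: "threshold z j \<le> sg j * F (\<mu> j)" if j: "j < n - 1" for j
  proof -
    define t where "t = sg j * w j"
    have t: "0 < t" using w[OF j] by (simp add: t_def)
    have "0 \<le> (t - cmod z)\<^sup>2 / t" using t by simp
    also have "\<dots> = t + (cmod z)\<^sup>2 / t - 2 * cmod z" using t by (simp add: power2_eq_square field_simps)
    also have "t + (cmod z)\<^sup>2 / t = sg j * (w j + (cmod z)\<^sup>2 / w j)"
      using sg_cases[of j] by (auto simp: t_def)
    also have "\<dots> = sg j * F (\<mu> j) + 2 * (sg j * Re z)" unfolding curve[OF j] by (simp add: distrib_left)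
    finally show ?thesis by (simp add: threshold_def)
  qed
  have nonneg: "0 \<le> sg j * F (\<mu> j)" if "j < n - 1" for j using thr[OF that] threshold_nonneg[of z j] by simp
  have between: "lam (Suc j) \<le> \<mu> j" "\<mu> j \<le> lam (Suc (Suc j))" if "j < n - 1" for j
    using weak_interlacing[OF \<mu>(1) _ that] nonneg by blast+
  show ?thesis
    by (rule that[OF \<mu>(1)])
      ((erule \<mu>(2) w0[unfolded w_def] curve[unfolded w_def] between(1) between(2) thr)+)
qed

lemma isospectral_prod_in_region:
  assumes iso: "periodic_tridiagonal n a b \<in> isospectral n lam"
  shows "(\<Prod>i<n. b i) \<in> region n lam"
proof (cases "(\<Prod>i<n. b i) = 0")
  case True
  then show ?thesis using lowest_max_pos lowest_min_depth_pos unfolding in_region_iff by (simp only:) simp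
next
  case False
  obtain \<mu> where "\<And>j. j < n - 1 \<Longrightarrow> lam (Suc j) \<le> \<mu> j" "\<And>j. j < n - 1 \<Longrightarrow> \<mu> j \<le> lam (Suc (Suc j))"
    "\<And>j. j < n - 1 \<Longrightarrow> threshold (\<Prod>i<n. b i) j \<le> sg j * F (\<mu> j)"
    using isospectral_divisor[OF iso refl False] by metis
  then show ?thesis unfolding in_region_iff_threshold using F_le_crit order_trans by blast
qed

text \<open>The compact space for \<open>fiber_homeomorphic_torus\<close> is the correspondence
  \<open>Y\<close> between matrices and angles, cut out by equations in a box. In this way
  continuity of the inverse spectral map becomes compactness of its graph.\<close>

theorem fiber_nonzero_homeomorphic_torus:
  assumes z: "z \<noteq> 0" "z \<in> region n lam"
  shows "fiber n lam z homeomorphic_space torus (card {j. j < n - 1 \<and> threshold z j < sg j * F (crit j)})"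
proof -
  define r where "r = cmod z"
  have r: "0 < r" using z by (simp add: r_def)
  define p where "p x = F x + 2 * Re z" for x
  define G where "G j e f \<longleftrightarrow> lam (Suc j) \<le> e \<and> e \<le> f \<and> f \<le> lam (Suc (Suc j)) \<and>
    (\<forall>x. lam (Suc j) \<le> x \<longrightarrow> x \<le> lam (Suc (Suc j)) \<longrightarrow> (threshold z j \<le> sg j * F x \<longleftrightarrow> e \<le> x \<and> x \<le> f)) \<and>
    (\<forall>x. e \<le> x \<longrightarrow> x \<le> f \<longrightarrow> (sg j * F x = threshold z j \<longleftrightarrow> x = e \<or> x = f)) \<and> (e < f \<longleftrightarrow> threshold z j < sg j * F (crit j))"
    for j e f
  have "\<exists>e f. G j e f" if "j < n - 1" for j
    unfolding G_def using z(2) that unfolding in_region_iff_threshold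
    by (intro gap_endpoints[OF that threshold_nonneg]) blast
  then obtain e f where G: "\<And>j. j < n - 1 \<Longrightarrow> G j (e j) (f j)" by metis
  have ef: "\<And>j. j < n - 1 \<Longrightarrow> lam (Suc j) \<le> e j \<and> e j \<le> f j \<and> f j \<le> lam (Suc (Suc j))"
    "\<And>j x. j < n - 1 \<Longrightarrow> lam (Suc j) \<le> x \<Longrightarrow> x \<le> lam (Suc (Suc j)) \<Longrightarrow> threshold z j \<le> sg j * F x \<longleftrightarrow> e j \<le> x \<and> x \<le> f j"
    "\<And>j x. j < n - 1 \<Longrightarrow> e j \<le> x \<Longrightarrow> x \<le> f j \<Longrightarrow> sg j * F x = threshold z j \<longleftrightarrow> x = e j \<or> x = f j"
    "\<And>j. j < n - 1 \<Longrightarrow> e j < f j \<longleftrightarrow> threshold z j < sg j * F (crit j)"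
    using G unfolding G_def by blast+
  have p_thr: "sg j * p x - 2 * r = sg j * F x - threshold z j" for j x
    by (simp add: p_def r_def threshold_def algebra_simps)
  have gapj: "gap p r (e j) (f j) (sg j)" if j: "j < n - 1" for j
  proof
    show "e j \<le> f j" using ef(1)[OF j] by simp
    show "continuous_on UNIV p" unfolding p_def by (rule F_continuous_shift)
    show "sg j = 1 \<or> sg j = -1" by (rule sg_cases)
    fix x assume x: "e j \<le> x" "x \<le> f j"
    show "2 * r \<le> sg j * p x" using ef(1)[OF j] ef(2)[OF j, of x] x p_thr[of j x] by auto
    show "sg j * p x = 2 * r \<longleftrightarrow> x = e j \<or> x = f j" using ef(3)[OF j x] p_thr[of j x] by auto
  qed (rule r)
  define X where "X j = gap_x (e j) (f j)" for j
  define W where "W j = gap_w p r (e j) (f j)" for j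
  \<comment> \<open>Neighbouring gaps could meet only in a common eigenvalue, where \<open>F\<close>
    is 0. Both thresholds would then be at most 0, and as \<open>sg\<close> changes sign this forces
    \<open>z = 0\<close>.\<close>
  have gap_order: "x < y" if j: "j < k" "k < n - 1" and x: "e j \<le> x" "x \<le> f j" and y: "e k \<le> y" "y \<le> f k" for j k x y
  proof (rule ccontr)
    assume "\<not> x < y"
    have jn: "j < n - 1" using j by simp
    have 1: "x \<le> lam (Suc (Suc j))" using ef(1)[OF jn] x by simp
    have 2: "lam (Suc (Suc j)) \<le> lam (Suc k)" using lam_le[of "Suc j" k] j by simp
    have 3: "lam (Suc k) \<le> y" using ef(1)[OF j(2)] y by simp
    have xy: "x = lam (Suc (Suc j))" "y = lam (Suc k)" "lam (Suc (Suc j)) = lam (Suc k)"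
      using \<open>\<not> x < y\<close> 1 2 3 by auto
    have "k < n" using j by simp
    then have jk: "k = Suc j" using xy(3) lam_less[of "Suc j" k] j by (cases "Suc j < k") auto
    have F0: "F x = 0" "F y = 0" using F_lam[of "Suc j"] F_lam[of k] xy j by auto
    have "threshold z j \<le> sg j * F x" using ef(1)[OF jn] ef(2)[OF jn, of x] x by auto
    moreover have "threshold z k \<le> sg k * F y" using ef(1)[OF j(2)] ef(2)[OF j(2), of y] y by auto
    moreover have "sg k = - sg j"
    proof -
      have "n - 1 - j = Suc (n - 1 - k)" using j jk by simp
      then show ?thesis by (simp add: sg_def)
    qed
    ultimately have "2 * (cmod z - sg j * Re z) \<le> 0" "2 * (cmod z + sg j * Re z) \<le> 0"
      unfolding threshold_def F0 by simp_all
    then have "cmod z \<le> 0" by argo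
    then show False using z by simp
  qed
  \<comment> \<open>The open gaps; \<open>\<iota>\<close> numbers them by the coordinates of the
    torus, and in \<open>th\<close> a degenerate gap gets the dummy angle 1.\<close>
  define ND where "ND = {j. j < n - 1 \<and> threshold z j < sg j * F (crit j)}"
  define d where "d = card ND"
  have ND: "finite ND" "j \<in> ND \<longleftrightarrow> j < n - 1 \<and> e j < f j" for j using ef(4)[of j] by (auto simp: ND_def)
  obtain \<iota> where \<iota>: "bij_betw \<iota> {..<d} ND"
    using ex_bij_betw_nat_finite[OF ND(1)] by (auto simp: d_def atLeast0LessThan)
  define \<kappa> where "\<kappa> = the_inv_into {..<d} \<iota>"
  have \<kappa>: "\<kappa> j < d" "\<iota> (\<kappa> j) = j" if "j \<in> ND" for j
    using \<iota> that f_the_inv_into_f_bij_betw[OF \<iota>] the_inv_into_into[of \<iota> "{..<d}" j "{..<d}"]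
    by (auto simp: \<kappa>_def bij_betw_def)
  have \<kappa>\<iota>: "\<kappa> (\<iota> i) = i" "\<iota> i \<in> ND" if "i < d" for i
    using \<iota> that the_inv_into_f_f[of \<iota> "{..<d}" i] by (auto simp: \<kappa>_def bij_betw_def)
  define th where "th t j = (if j \<in> ND then t (\<kappa> j) else 1)" for t :: "nat \<Rightarrow> complex" and j
  define P where "P = Fp + [:2 * Re z:]"
  have Pm: "monic_deg P n"
  proof -
    have "Polynomial.coeff P n = 1" using monic_degD(2)[OF monic_Fp] n3 by (simp add: P_def coeff_pCons split: nat.splits)
    moreover have "degree P = n"
      unfolding P_def using monic_degD(1)[OF monic_Fp] n3 by (subst degree_add_eq_left) auto
    ultimately show ?thesis by (simp add: monic_deg_def)
  qed
  have Pp: "poly P x = p x" for x by (simp add: P_def p_def poly_Fp)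
  \<comment> \<open>The trace of the square of the matrix according to
    \<open>discriminant_bound\<close>; it determines the size of the box.\<close>
  define B where "B = (Polynomial.coeff P (n - 1))\<^sup>2 - 2 * Polynomial.coeff P (n - 2)"
  define C where "C = sqrt (\<bar>B\<bar>)"
  define K where "K = {a. \<forall>i. a i \<in> (if i < n then {-C..C} else {0})} \<times> {b. \<forall>i. b i \<in> (if i < n then {0..C} else {0})}
     \<times> {t. \<forall>i. t i \<in> (if i < d then sphere (0::complex) 1 else {1})}"
  define bs where "bs x = (\<lambda>i. (fst (snd x) i)\<^sup>2)" for x :: "(nat \<Rightarrow> real) \<times> (nat \<Rightarrow> real) \<times> (nat \<Rightarrow> complex)"
  define xi where "xi j x = X j (th (snd (snd x)) j)" for j and x :: "(nat \<Rightarrow> real) \<times> (nat \<Rightarrow> real) \<times> (nat \<Rightarrow> complex)"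
  define om where "om j x = W j (th (snd (snd x)) j)" for j and x :: "(nat \<Rightarrow> real) \<times> (nat \<Rightarrow> real) \<times> (nat \<Rightarrow> complex)"
  \<comment> \<open>The index sets \<open>{()}\<close> and \<open>UNIV\<close> bring the first two
    conditions into the form of \<open>compact_zero_set\<close>.\<close>
  define Y where "Y = {x \<in> K. \<forall>i\<in>{()}. (\<Prod>i<n. fst (snd x) i) - r = 0} \<inter>
     ({x \<in> K. \<forall>y\<in>UNIV. poly (discriminant_poly n (fst x) (bs x)) y - p y = 0} \<inter>
     ({x \<in> K. \<forall>j\<in>{..<n - 1}. poly (cpoly (fst x) (bs x) 0 (n - 1)) (xi j x) = 0} \<inter>
      {x \<in> K. \<forall>j\<in>{..<n - 1}. - bs x (n - 1) * poly (cpoly (fst x) (bs x) 1 (n - 2)) (xi j x) - om j x = 0}))"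
  have cK: "compact K"
    unfolding K_def by (intro compact_Times compact_fun_box) (auto simp: compact_Icc)
  have ca: "continuous_on K (\<lambda>x. fst x i)" and cb: "continuous_on K (\<lambda>x. fst (snd x) i)"
    and ct: "continuous_on K (\<lambda>x. snd (snd x) i)" for i
    by (rule continuous_on_product_then_coordinatewise,
        (rule continuous_on_fst continuous_on_snd continuous_on_id)+)+
  have cbs: "continuous_on K (\<lambda>x. bs x i)" for i unfolding bs_def by (intro continuous_intros cb)
  have cth: "continuous_on K (\<lambda>x. th (snd (snd x)) j)" for j
    unfolding th_def by (cases "j \<in> ND") (auto intro: ct)
  have KD: "fst (snd x) i \<in> (if i < n then {0..C} else {0})"
    "snd (snd x) i \<in> (if i < d then sphere 0 1 else {1})" if "x \<in> K" for x i
    using that unfolding K_def mem_Times_iff mem_Collect_eq by blast+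
  have th1: "cmod (th (snd (snd x)) j) = 1" if "x \<in> K" for x j
  proof (cases "j \<in> ND")
    case True
    from KD(2)[OF that, of "\<kappa> j"] show ?thesis using \<kappa>(1)[OF True] True by (simp add: th_def)
  qed (simp add: th_def)
  have cxi: "continuous_on K (\<lambda>x. xi j x)" if "j < n - 1" for j
    unfolding xi_def X_def using continuous_on_compose2[OF gap.continuous_X[OF gapj[OF that], of UNIV] cth] by simp
  have com: "continuous_on K (\<lambda>x. om j x)" if "j < n - 1" for j
    unfolding om_def W_def using th1
    by (intro continuous_on_compose2[OF gap.continuous_W[OF gapj[OF that]] cth]) auto
  have ccp: "continuous_on K (\<lambda>x. poly (cpoly (fst x) (bs x) s m) (y x))" if "continuous_on K y" for s m y
    using ca cbs that by (rule continuous_on_poly_cpoly)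
  have cY: "compact Y"
    unfolding Y_def discriminant_poly_def
    by (intro compact_Int compact_zero_set cK)
      (auto intro!: continuous_intros ccp cxi com cb cbs)
  have YK: "x \<in> K" if "x \<in> Y" for x using that by (simp add: Y_def)
  have YK': "Y \<subseteq> K" by (rule subsetI, rule YK)
  have Yfacts: "(\<Prod>i<n. fst (snd x) i) = r" "discriminant_poly n (fst x) (bs x) = P"
    "\<And>j. j < n - 1 \<Longrightarrow> poly (cpoly (fst x) (bs x) 0 (n - 1)) (xi j x) = 0"
    "\<And>j. j < n - 1 \<Longrightarrow> - bs x (n - 1) * poly (cpoly (fst x) (bs x) 1 (n - 2)) (xi j x) = om j x"
    if "x \<in> Y" for x
  proof -
    show "(\<Prod>i<n. fst (snd x) i) = r" using that by (simp add: Y_def)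
    have "poly (discriminant_poly n (fst x) (bs x)) y = poly P y" for y using that by (simp add: Y_def Pp)
    then show "discriminant_poly n (fst x) (bs x) = P" by (simp add: poly_eq_poly_eq_iff[symmetric] fun_eq_iff)
    show "poly (cpoly (fst x) (bs x) 0 (n - 1)) (xi j x) = 0" if "j < n - 1" for j
      using \<open>x \<in> Y\<close> that unfolding Y_def by blast
    show "- bs x (n - 1) * poly (cpoly (fst x) (bs x) 1 (n - 2)) (xi j x) = om j x" if "j < n - 1" for j
    proof -
      have "- bs x (n - 1) * poly (cpoly (fst x) (bs x) 1 (n - 2)) (xi j x) - om j x = 0"
        using \<open>x \<in> Y\<close> that unfolding Y_def by blast
      then show ?thesis by (simp only: right_minus_eq)
    qed
  qed
  have YI: "x \<in> Y" if "x \<in> K" "(\<Prod>i<n. fst (snd x) i) = r" "discriminant_poly n (fst x) (bs x) = P"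
    "\<And>j. j < n - 1 \<Longrightarrow> poly (cpoly (fst x) (bs x) 0 (n - 1)) (xi j x) = 0"
    "\<And>j. j < n - 1 \<Longrightarrow> - bs x (n - 1) * poly (cpoly (fst x) (bs x) 1 (n - 2)) (xi j x) = om j x" for x
    unfolding Y_def using that Pp by auto
  have bpos: "0 < fst (snd x) i" if x: "x \<in> Y" and i: "i < n" for x i
  proof -
    have "fst (snd x) i \<in> {0..C}" using KD(1)[OF YK[OF x], of i] i by simp
    moreover have "fst (snd x) i \<noteq> 0"
    proof
      assume "fst (snd x) i = 0"
      with i have "(\<Prod>i<n. fst (snd x) i) = 0" by (intro prod_zero) auto
      then show False using Yfacts(1)[OF x] r by simp
    qed
    ultimately show ?thesis by simp
  qed
  have xi_mono: "strict_mono_on {..<n - 1} (\<lambda>j. xi j x)" if "x \<in> K" for x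
  proof (rule strict_mono_onI)
    fix j k assume jk: "j \<in> {..<n - 1}" "k \<in> {..<n - 1}" "j < k"
    show "xi j x < xi k x"
      unfolding xi_def X_def using jk th1[OF that] gap.X_bounds[OF gapj] by (intro gap_order[of j k]) auto
  qed
  have bounds: "\<bar>a i\<bar> \<le> C" "b i \<le> C"
    if dp: "discriminant_poly n a (\<lambda>i. (b i)\<^sup>2) = P" and b: "\<And>i. i < n \<Longrightarrow> 0 \<le> b i" and i: "i < n" for a b i
  proof -
    have tot: "(\<Sum>i<n. (a i)\<^sup>2) + 2 * (\<Sum>i<n. (b i)\<^sup>2) = B"
      using discriminant_bound[OF n3, of a "\<lambda>i. (b i)\<^sup>2"] dp by (simp add: B_def)
    have "(a i)\<^sup>2 \<le> (\<Sum>i<n. (a i)\<^sup>2)" "(b i)\<^sup>2 \<le> (\<Sum>i<n. (b i)\<^sup>2)"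
      using i by (auto intro!: member_le_sum[of i _ "\<lambda>i. (a i)\<^sup>2"] member_le_sum[of i _ "\<lambda>i. (b i)\<^sup>2"])
    moreover have "0 \<le> (\<Sum>i<n. (a i)\<^sup>2)" "0 \<le> (\<Sum>i<n. (b i)\<^sup>2)" by (auto intro: sum_nonneg)
    ultimately have "(a i)\<^sup>2 \<le> \<bar>B\<bar>" "(b i)\<^sup>2 \<le> \<bar>B\<bar>" using tot by linarith+
    then have "sqrt ((a i)\<^sup>2) \<le> C" "sqrt ((b i)\<^sup>2) \<le> C" unfolding C_def by (blast intro: real_sqrt_le_mono)+
    then show "\<bar>a i\<bar> \<le> C" "b i \<le> C" using b[OF i] by simp_all
  qed
  define \<omega> where "\<omega> = z / of_real r"
  define g where "g x = restrict (snd (snd x)) {..<d}" for x :: "(nat \<Rightarrow> real) \<times> (nat \<Rightarrow> real) \<times> (nat \<Rightarrow> complex)"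
  have "fiber n lam z homeomorphic_space torus d"
  proof (rule fiber_homeomorphic_torus[where X = "top_of_set Y" and A = fst and B = "\<lambda>x. fst (snd x)"
        and \<omega> = \<omega> and g = g, OF n3])
    show "compact_space (top_of_set Y)"
      using cY by (simp add: compact_space_subtopology compactin_euclidean_iff)
    show "continuous_map (top_of_set Y) euclideanreal (\<lambda>x. fst x i)" for i
      using continuous_on_subset[OF ca YK'] by simp
    show "continuous_map (top_of_set Y) euclideanreal (\<lambda>x. fst (snd x) i)" for i
      using continuous_on_subset[OF cb YK'] by simp
    show "0 \<le> fst (snd x) i" if "x \<in> topspace (top_of_set Y)" "i < n" for x i
      using bpos[of x i] that by simp
    show "cmod \<omega> = 1" "z = \<omega> * of_real (cmod z)"
      using r by (simp_all add: \<omega>_def r_def norm_divide)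
    show "(\<Prod>i<n. fst (snd x) i) = cmod z" if "x \<in> topspace (top_of_set Y)" for x
      using Yfacts(1)[of x] that by (simp add: r_def)
    show "periodic_tridiagonal n (fst x) (\<lambda>i. if i = n - 1 then \<omega> * of_real (fst (snd x) i) else of_real (fst (snd x) i)) \<in> isospectral n lam"
      (is "periodic_tridiagonal n _ ?ph \<in> _") if "x \<in> topspace (top_of_set Y)" for x
    proof -
      have x: "x \<in> Y" using that by simp
      obtain m where m: "n = Suc m" using n3 by (cases n) auto
      have "(\<Prod>i<n. ?ph i) = (\<Prod>i<m. of_real (fst (snd x) i)) * (\<omega> * of_real (fst (snd x) m))"
        by (simp add: m)
      also have "\<dots> = \<omega> * of_real (\<Prod>i<n. fst (snd x) i)" by (simp add: m)
      also have "\<dots> = z" unfolding Yfacts(1)[OF x] using r by (simp add: \<omega>_def)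
      finally have pz: "(\<Prod>i<n. ?ph i) = z" .
      have "cmod \<omega> = 1" using r by (simp add: \<omega>_def r_def norm_divide)
      then have "(\<lambda>i. (cmod (?ph i))\<^sup>2) = bs x" by (auto simp: bs_def norm_mult)
      then show ?thesis
        unfolding isospectral_iff_discriminant[OF n3 lam_mono] pz using Yfacts(2)[OF x] Pp by (simp add: p_def)
    qed
    show "\<exists>x\<in>topspace (top_of_set Y). \<forall>i<n. fst x i = a i \<and> fst (snd x) i = cmod (b i)"
      if iso: "periodic_tridiagonal n a b \<in> isospectral n lam" and pb: "(\<Prod>i<n. b i) = z" for a b
    proof -
      define a' where "a' i = (if i < n then a i else 0)" for i
      define b' where "b' i = (if i < n then cmod (b i) else 0)" for i
      have L: "periodic_tridiagonal n a' (\<lambda>i. if i < n then b i else 0) = periodic_tridiagonal n a b"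
        by (intro periodic_tridiagonal_cong) (auto simp: a'_def)
      have iso': "periodic_tridiagonal n a' (\<lambda>i. if i < n then b i else 0) \<in> isospectral n lam"
        unfolding L by (rule iso)
      have pb': "(\<Prod>i<n. if i < n then b i else 0) = z" using pb by simp
      have sq: "(\<lambda>i. (cmod (if i < n then b i else 0))\<^sup>2) = (\<lambda>i. (b' i)\<^sup>2)" by (auto simp: b'_def)
      obtain \<mu> where \<mu>: "strict_mono_on {..<n - 1} \<mu>" "\<And>j. j < n - 1 \<Longrightarrow> poly (cpoly a' (\<lambda>i. (b' i)\<^sup>2) 0 (n - 1)) (\<mu> j) = 0"
        "\<And>j. j < n - 1 \<Longrightarrow> - (b' (n - 1))\<^sup>2 * poly (cpoly a' (\<lambda>i. (b' i)\<^sup>2) 1 (n - 2)) (\<mu> j) \<noteq> 0"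
        "\<And>j. j < n - 1 \<Longrightarrow> - (b' (n - 1))\<^sup>2 * poly (cpoly a' (\<lambda>i. (b' i)\<^sup>2) 1 (n - 2)) (\<mu> j)
           + (cmod z)\<^sup>2 / (- (b' (n - 1))\<^sup>2 * poly (cpoly a' (\<lambda>i. (b' i)\<^sup>2) 1 (n - 2)) (\<mu> j)) = F (\<mu> j) + 2 * Re z"
        "\<And>j. j < n - 1 \<Longrightarrow> lam (Suc j) \<le> \<mu> j" "\<And>j. j < n - 1 \<Longrightarrow> \<mu> j \<le> lam (Suc (Suc j))"
        "\<And>j. j < n - 1 \<Longrightarrow> threshold z j \<le> sg j * F (\<mu> j)"
        using isospectral_divisor[OF iso' pb' z(1)] unfolding sq fun_cong[OF sq] by blast
      define w where "w j = - (b' (n - 1))\<^sup>2 * poly (cpoly a' (\<lambda>i. (b' i)\<^sup>2) 1 (n - 2)) (\<mu> j)" for j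
      have "\<exists>\<theta>. cmod \<theta> = 1 \<and> X j \<theta> = \<mu> j \<and> W j \<theta> = w j" if j: "j < n - 1" for j
      proof -
        have "e j \<le> \<mu> j \<and> \<mu> j \<le> f j" using ef(2)[OF j \<mu>(5,6)[OF j]] \<mu>(7)[OF j] by blast
        moreover have "w j \<noteq> 0" "w j + r\<^sup>2 / w j = p (\<mu> j)"
          unfolding w_def r_def p_def by (rule \<mu>(3)[OF j], rule \<mu>(4)[OF j])
        ultimately show ?thesis unfolding X_def W_def using gap.surj[OF gapj[OF j], of "\<mu> j" "w j"] by metis
      qed
      then obtain \<theta> where \<theta>: "\<And>j. j < n - 1 \<Longrightarrow> cmod (\<theta> j) = 1 \<and> X j (\<theta> j) = \<mu> j \<and> W j (\<theta> j) = w j" by metis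
      define t where "t i = (if i < d then \<theta> (\<iota> i) else 1)" for i
      have tht: "X j (th t j) = \<mu> j" "W j (th t j) = w j" if j: "j < n - 1" for j
      proof -
        have "X j (th t j) = X j (\<theta> j) \<and> W j (th t j) = W j (\<theta> j)"
        proof (cases "j \<in> ND")
          case True
          then show ?thesis using \<kappa>[OF True] by (simp add: th_def t_def)
        next
          case False
          then have "e j = f j" using ND(2)[of j] j ef(1)[OF j] by auto
          then show ?thesis
            unfolding X_def W_def using gap.degenerate[OF gapj[OF j]] by blast
        qed
        then show "X j (th t j) = \<mu> j" "W j (th t j) = w j" using \<theta>[OF j] by auto
      qed
      define x where "x = (a', b', t)"
      have fx: "fst x = a'" "fst (snd x) = b'" by (simp_all add: x_def)
      have bsx: "bs x = (\<lambda>i. (b' i)\<^sup>2)" by (simp add: bs_def x_def)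
      have xix: "xi j x = \<mu> j" "om j x = w j" if "j < n - 1" for j
        using tht[OF that] by (simp_all add: xi_def om_def x_def)
      have dp: "discriminant_poly n a' (\<lambda>i. (b' i)\<^sup>2) = P"
      proof -
        have "poly (discriminant_poly n a' (\<lambda>i. (b' i)\<^sup>2)) y = poly P y" for y
          using iso' unfolding isospectral_iff_discriminant[OF n3 lam_mono] pb' sq by (simp add: Pp p_def)
        then show ?thesis by (simp add: poly_eq_poly_eq_iff[symmetric] fun_eq_iff)
      qed
      have "x \<in> K"
      proof -
        have "a' i \<in> (if i < n then {-C..C} else {0})" "b' i \<in> (if i < n then {0..C} else {0})" for i
          using bounds[OF dp, of i] by (auto simp: a'_def b'_def abs_le_iff)
        moreover have "t i \<in> (if i < d then sphere 0 1 else {1})" for i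
          using \<kappa>\<iota>(2)[of i] \<theta>[of "\<iota> i"] ND(2)[of "\<iota> i"] by (auto simp: t_def)
        ultimately show ?thesis by (simp add: K_def x_def)
      qed
      moreover have "(\<Prod>i<n. b' i) = r"
        unfolding r_def pb[symmetric] prod_norm[symmetric] by (intro prod.cong) (auto simp: b'_def)
      ultimately have "x \<in> Y"
        using dp xix \<mu>(2) by (intro YI) (simp_all add: bsx fx w_def)
      moreover have "\<forall>i<n. fst x i = a i \<and> fst (snd x) i = cmod (b i)" by (simp add: x_def a'_def b'_def)
      ultimately show ?thesis by auto
    qed
    show "continuous_map (top_of_set Y) (torus d) g"
      unfolding torus_def g_def
    proof (subst continuous_map_componentwise, intro conjI ballI)
      show "(\<lambda>x. restrict (snd (snd x)) {..<d}) ` topspace (top_of_set Y) \<subseteq> extensional {..<d}" by auto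
      fix i assume i: "i \<in> {..<d}"
      have "continuous_on Y (\<lambda>x. snd (snd x) i)" by (rule continuous_on_subset[OF ct YK'])
      moreover have "snd (snd x) i \<in> sphere 0 1" if "x \<in> Y" for x
        using KD(2)[OF YK[OF that], of i] i by simp
      ultimately show "continuous_map (top_of_set Y) (top_of_set (sphere 0 1)) (\<lambda>x. restrict (snd (snd x)) {..<d} i)"
        using i by (auto simp: continuous_map_in_subtopology)
    qed
    show "g ` topspace (top_of_set Y) = topspace (torus d)"
    proof
      show "g ` topspace (top_of_set Y) \<subseteq> topspace (torus d)"
      proof
        fix t assume "t \<in> g ` topspace (top_of_set Y)"
        then obtain x where x: "x \<in> Y" "t = g x" by auto
        have "cmod (snd (snd x) i) = 1" if "i < d" for i using KD(2)[OF YK[OF x(1)], of i] that by simp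
        then show "t \<in> topspace (torus d)" using x(2) by (simp add: torus_topspace_iff g_def)
      qed
      show "topspace (torus d) \<subseteq> g ` topspace (top_of_set Y)"
      proof
        fix s assume s: "s \<in> topspace (torus d)"
        define t where "t i = (if i < d then s i else 1)" for i
        have t1: "cmod (t i) = 1" for i using s by (simp add: t_def torus_topspace_iff)
        have tht1: "cmod (th t j) = 1" for j using t1 by (simp add: th_def)
        define \<mu> where "\<mu> j = X j (th t j)" for j
        define w where "w j = W j (th t j)" for j
        have \<mu>m: "strict_mono_on {..<n - 1} \<mu>"
        proof (rule strict_mono_onI)
          fix j k assume jk: "j \<in> {..<n - 1}" "k \<in> {..<n - 1}" "j < k"
          show "\<mu> j < \<mu> k"
            unfolding \<mu>_def X_def using jk tht1 gap.X_bounds[OF gapj] by (intro gap_order[of j k]) auto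
        qed
        have wsg: "0 < (-1) ^ (n - 1 - j) * w j" and wc: "w j + r\<^sup>2 / w j = poly P (\<mu> j)" if "j < n - 1" for j
          using gap.W_facts[OF gapj[OF that] tht1[of j]] by (simp_all add: w_def W_def \<mu>_def X_def Pp sg_def)
        have r2: "0 < r\<^sup>2" using r by simp
        obtain a \<beta> where ab: "\<And>i. i < n \<Longrightarrow> 0 < \<beta> i" "(\<Prod>i<n. \<beta> i) = r\<^sup>2" "discriminant_poly n a \<beta> = P"
          "\<And>j. j < n - 1 \<Longrightarrow> poly (cpoly a \<beta> 0 (n - 1)) (\<mu> j) = 0"
          "\<And>j. j < n - 1 \<Longrightarrow> - \<beta> (n - 1) * poly (cpoly a \<beta> 1 (n - 2)) (\<mu> j) = w j"
          using discriminant_realizable[OF n3 Pm r2 \<mu>m wsg wc] by blast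
        define a' where "a' i = (if i < n then a i else 0)" for i
        define b' where "b' i = (if i < n then sqrt (\<beta> i) else 0)" for i
        have b2: "(b' i)\<^sup>2 = \<beta> i" if "i < n" for i using ab(1)[OF that] that by (simp add: b'_def)
        have cc: "cpoly a' (\<lambda>i. (b' i)\<^sup>2) s m = cpoly a \<beta> s m" if "s + m \<le> n" for s m
          using that b2 by (intro continuant_cong) (auto simp: a'_def)
        have dp: "discriminant_poly n a' (\<lambda>i. (b' i)\<^sup>2) = P"
          unfolding ab(3)[symmetric] discriminant_poly_def using cc[of 0 n] cc[of 1 "n - 2"] b2[of "n - 1"] n3 by simp
        define x where "x = (a', b', t)"
        have fx: "fst x = a'" "fst (snd x) = b'" by (simp_all add: x_def)
        have bsx: "bs x = (\<lambda>i. (b' i)\<^sup>2)" by (simp add: bs_def x_def)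
        have xix: "xi j x = \<mu> j" "om j x = w j" for j by (simp_all add: xi_def om_def x_def \<mu>_def w_def)
        have b0: "0 \<le> b' i" for i by (simp add: b'_def ab(1) less_imp_le)
        have "x \<in> K"
        proof -
          have "a' i \<in> (if i < n then {-C..C} else {0})" "b' i \<in> (if i < n then {0..C} else {0})" for i
            using bounds[OF dp b0, of i] b0[of i] by (auto simp: a'_def b'_def abs_le_iff)
          moreover have "t i \<in> (if i < d then sphere 0 1 else {1})" for i
            using t1[of i] by (auto simp: t_def)
          ultimately show ?thesis by (simp add: K_def x_def)
        qed
        moreover have "(\<Prod>i<n. b' i) = r"
        proof -
          have "(\<Prod>i<n. b' i)\<^sup>2 = (\<Prod>i<n. \<beta> i)" unfolding prod_power_distrib using b2 by (intro prod.cong) auto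
          then have "(\<Prod>i<n. b' i)\<^sup>2 = r\<^sup>2" using ab(2) by simp
          moreover have "0 \<le> (\<Prod>i<n. b' i)" using b0 by (intro prod_nonneg) auto
          ultimately show ?thesis using r by (simp add: power2_eq_iff_nonneg)
        qed
        ultimately have "x \<in> Y"
          using dp xix ab(4,5) cc[of 0 "n - 1"] cc[of 1 "n - 2"] b2[of "n - 1"] n3 by (intro YI) (simp_all add: bsx fx)
        moreover have "g x = s"
          using s by (auto simp: g_def x_def t_def torus_topspace_iff extensional_def)
        ultimately show "s \<in> g ` topspace (top_of_set Y)" by auto
      qed
    qed
    show "g x = g y \<longleftrightarrow> (\<forall>i<n. fst x i = fst y i \<and> fst (snd x) i = fst (snd y) i)"
      if "x \<in> topspace (top_of_set Y)" "y \<in> topspace (top_of_set Y)" for x y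
    proof -
      have xy: "x \<in> Y" "y \<in> Y" using that by auto
      note xK = YK[OF xy(1)] and yK = YK[OF xy(2)]
      have "bs x i > 0" "bs y i > 0" if "i < n" for i
        using bpos[OF xy(1) that] bpos[OF xy(2) that] by (simp_all add: bs_def)
      note bspos = this
      show ?thesis
      proof
        assume "g x = g y"
        then have same: "snd (snd x) i = snd (snd y) i" if "i < d" for i
          using that by (metis g_def lessThan_iff restrict_apply')
        have "th (snd (snd x)) j = th (snd (snd y)) j" for j
          using same \<kappa>(1)[of j] by (simp add: th_def)
        then have xo: "xi j x = xi j y" "om j x = om j y" for j by (simp_all add: xi_def om_def)
        have "fst x i = fst y i \<and> bs x i = bs y i" if i: "i < n" for i
        proof (rule discriminant_inj[OF n3, where \<mu> = "\<lambda>j. xi j x"])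
          show "(\<Prod>i<n. bs x i) = (\<Prod>i<n. bs y i)"
            unfolding bs_def prod_power_distrib[symmetric] Yfacts(1)[OF xy(1)] Yfacts(1)[OF xy(2)] ..
          show "discriminant_poly n (fst x) (bs x) = discriminant_poly n (fst y) (bs y)"
            using Yfacts(2)[OF xy(1)] Yfacts(2)[OF xy(2)] by simp
          show "inj_on (\<lambda>j. xi j x) {..<n - 1}" using xi_mono[OF xK] by (rule strict_mono_on_imp_inj_on)
          fix j assume j: "j < n - 1"
          show "poly (cpoly (fst x) (bs x) 0 (n - 1)) (xi j x) = 0" using Yfacts(3)[OF xy(1) j] .
          show "poly (cpoly (fst y) (bs y) 0 (n - 1)) (xi j x) = 0" using Yfacts(3)[OF xy(2) j] by (simp add: xo)
          show "bs x (n - 1) * poly (cpoly (fst x) (bs x) 1 (n - 2)) (xi j x) =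
            bs y (n - 1) * poly (cpoly (fst y) (bs y) 1 (n - 2)) (xi j x)"
            using Yfacts(4)[OF xy(1) j] Yfacts(4)[OF xy(2) j] by (simp add: xo)
        qed (use bspos i in auto)
        moreover have "fst (snd x) i = fst (snd y) i" if "bs x i = bs y i" "i < n" for i
          using that bpos[OF xy(1)] bpos[OF xy(2)] by (simp add: bs_def power2_eq_iff_nonneg less_imp_le)
        ultimately show "\<forall>i<n. fst x i = fst y i \<and> fst (snd x) i = fst (snd y) i" by blast
      next
        assume eq: "\<forall>i<n. fst x i = fst y i \<and> fst (snd x) i = fst (snd y) i"
        have cc: "cpoly (fst x) (bs x) s m = cpoly (fst y) (bs y) s m" if "s + m \<le> n" for s m
          using that eq by (intro continuant_cong) (auto simp: bs_def)
        have D: "cpoly (fst x) (bs x) 0 (n - 1) = (\<Prod>j<n - 1. [:- xi j x, 1:])"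
          using monic_degD[OF monic_deg_cpoly] Yfacts(3)[OF xy(1)] xi_mono[OF xK]
          by (intro monic_eq_prod_roots strict_mono_on_imp_inj_on) auto
        have inside: "e j \<le> xi j x' \<and> xi j x' \<le> f j" if "x' \<in> K" "j < n - 1" for j x'
          unfolding xi_def X_def using gap.X_bounds[OF gapj[OF that(2)] th1[OF that(1)]] by blast
        \<comment> \<open>\<open>xi j y\<close> is a root of the common leading minor and lies in
          gap \<open>j\<close>. The gaps are disjoint and contain one root each, so it is
          \<open>xi j x\<close>.\<close>
        have xieq: "xi j x = xi j y" if j: "j < n - 1" for j
        proof -
          have "poly (cpoly (fst x) (bs x) 0 (n - 1)) (xi j y) = 0"
            using Yfacts(3)[OF xy(2) j] cc[of 0 "n - 1"] by simp
          then obtain k where k: "k < n - 1" "xi j y = xi k x" unfolding D by (auto simp: poly_prod)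
          have "k = j"
          proof (rule ccontr)
            assume "k \<noteq> j"
            then consider "k < j" | "j < k" by linarith
            then show False
              using gap_order[of k j "xi k x" "xi j y"] gap_order[of j k "xi j y" "xi k x"]
                inside[OF xK k(1)] inside[OF yK j] j k by cases auto
          qed
          then show ?thesis using k by simp
        qed
        have omeq: "om j x = om j y" if j: "j < n - 1" for j
        proof -
          have "bs x (n - 1) = bs y (n - 1)" using eq n3 by (simp add: bs_def)
          then show ?thesis
            using Yfacts(4)[OF xy(1) j] Yfacts(4)[OF xy(2) j] cc[of 1 "n - 2"] xieq[OF j] n3 by simp
        qed
        have "snd (snd x) i = snd (snd y) i" if i: "i < d" for i
        proof -
          define j where "j = \<iota> i"
          have j: "j \<in> ND" "\<kappa> j = i" using \<kappa>\<iota>[OF i] by (auto simp: j_def)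
          then have jn: "j < n - 1" "e j < f j" using ND(2) by auto
          have "th (snd (snd x)) j = th (snd (snd y)) j"
            by (rule gap.inj[OF gapj[OF jn(1)] jn(2) th1[OF xK] th1[OF yK]])
              (use xieq[OF jn(1)] omeq[OF jn(1)] in \<open>simp_all add: xi_def om_def X_def W_def\<close>)
          then show ?thesis using j by (simp add: th_def)
        qed
        then show "g x = g y" unfolding g_def by (intro restrict_ext) auto
      qed
    qed
  qed
  then show ?thesis by (simp add: d_def ND_def)
qed

section \<open>Surjectivity and the dimensions of the fibres\<close>

text \<open>A torus is not empty, so the description of the fibres also shows that every point of
  the region is attained.\<close>

lemma fiber_homeomorphic_torus_nonempty:
  assumes "fiber n lam z homeomorphic_space torus d"
  shows "z \<in> off_diagonal_prod n ` isospectral n lam"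
proof -
  obtain h where "homeomorphic_map (fiber n lam z) (torus d) h"
    using assms by (auto simp: homeomorphic_space)
  then have "h ` topspace (fiber n lam z) = topspace (torus d)" by (rule homeomorphic_imp_surjective_map)
  moreover have "(\<lambda>i\<in>{..<d}. 1) \<in> topspace (torus d)" by (simp add: torus_topspace_iff)
  ultimately obtain orb where "orb \<in> topspace (fiber n lam z)" by (metis imageE)
  then obtain L where "L \<in> isospectral n lam" "induced_prod n (torus_orbit n L) = z"
    by (auto simp: fiber_def orbit_space_def)
  then show ?thesis using induced_prod_torus_orbit[OF n3] by blast
qed

text \<open>A gap is degenerate iff its threshold equals the critical height. The threshold is the
  same for all maxima and at most the lowest height, so equality singles out the lowest maxima, and
  only if \<open>z\<close> attains that bound; the same holds for the minima.\<close>

lemma torus_dim_eq: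
  assumes z: "z \<in> region n lam"
    and A: "A = {j \<in> maxima. 2 * (cmod z - Re z) = lowest_max n lam \<and> sg j * F (crit j) = lowest_max n lam}"
    and B: "B = {j \<in> minima. 2 * (cmod z + Re z) = lowest_min_depth n lam \<and> sg j * F (crit j) = lowest_min_depth n lam}"
  shows "card {j. j < n - 1 \<and> threshold z j < sg j * F (crit j)} = n - 1 - card A - card B"
proof -
  have reg: "2 * (cmod z - Re z) \<le> lowest_max n lam" "2 * (cmod z + Re z) \<le> lowest_min_depth n lam"
    using z in_region_iff by blast+
  have mx: "\<not> threshold z j < sg j * F (crit j) \<longleftrightarrow> j \<in> A" if "j \<in> maxima" for j
  proof -
    have "lowest_max n lam \<le> sg j * F (crit j)" using lowest_max_le_iff[of "lowest_max n lam"] that by blast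
    moreover have "threshold z j = 2 * (cmod z - Re z)" unfolding threshold_def sg_maxima[OF that] by simp
    ultimately show ?thesis unfolding A mem_Collect_eq using reg(1) that by linarith
  qed
  have mn: "\<not> threshold z j < sg j * F (crit j) \<longleftrightarrow> j \<in> B" if "j \<in> minima" for j
  proof -
    have "lowest_min_depth n lam \<le> sg j * F (crit j)" using lowest_min_depth_le_iff[of "lowest_min_depth n lam"] that by blast
    moreover have "threshold z j = 2 * (cmod z + Re z)" unfolding threshold_def sg_minima[OF that] by simp
    ultimately show ?thesis unfolding B mem_Collect_eq using reg(2) that by linarith
  qed
  have AB: "A \<subseteq> maxima" "B \<subseteq> minima" unfolding A B by blast+
  then have fin: "finite A" "finite B" "A \<inter> B = {}" "A \<subseteq> {..<n - 1}" "B \<subseteq> {..<n - 1} - A"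
    using maxima_minima finite_subset by blast+
  have "{j. j < n - 1 \<and> threshold z j < sg j * F (crit j)} = {..<n - 1} - A - B"
  proof (rule Set.set_eqI)
    fix j
    consider "j \<in> maxima" "j < n - 1" "j \<notin> B" | "j \<in> minima" "j < n - 1" "j \<notin> A" | "\<not> j < n - 1"
      using AB maxima_minima(3,4) by blast
    then show "j \<in> {j. j < n - 1 \<and> threshold z j < sg j * F (crit j)} \<longleftrightarrow> j \<in> {..<n - 1} - A - B"
      unfolding mem_Collect_eq Diff_iff lessThan_iff
      by cases (use mx[of j] mn[of j] in blast)+
  qed
  then show ?thesis using fin by (simp add: card_Diff_subset)
qed

lemma fiber_zero: "fiber n lam 0 homeomorphic_space torus (n - 1)"
proof -
  have "inj_on (\<lambda>i. lam (Suc i)) {..<n}"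
  proof (rule inj_onI)
    fix i j assume ij: "i \<in> {..<n}" "j \<in> {..<n}" "lam (Suc i) = lam (Suc j)"
    have "Suc i = Suc j"
      by (rule inj_onD[OF strict_mono_on_imp_inj_on[OF lam_mono] ij(3)]) (use ij in auto)
    then show "i = j" by simp
  qed
  then interpret simple_spectrum n "\<lambda>i. lam (Suc i)" using n3 by unfold_locales auto
  show ?thesis by (rule fiber_zero_homeomorphic_torus[OF n3]) simp
qed

lemma off_diagonal_prod_image: "off_diagonal_prod n ` isospectral n lam = region n lam"
proof
  show "off_diagonal_prod n ` isospectral n lam \<subseteq> region n lam"
  proof
    fix z assume "z \<in> off_diagonal_prod n ` isospectral n lam"
    then obtain L where L: "L \<in> isospectral n lam" "z = off_diagonal_prod n L" by blast
    then obtain a b where ab: "L = periodic_tridiagonal n a b" by (auto simp: isospectral_def)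
    show "z \<in> region n lam"
      using isospectral_prod_in_region[of a b] L off_diagonal_prod_periodic_tridiagonal[OF n3, of a b]
      unfolding ab by simp
  qed
  show "region n lam \<subseteq> off_diagonal_prod n ` isospectral n lam"
  proof
    fix z assume z: "z \<in> region n lam"
    show "z \<in> off_diagonal_prod n ` isospectral n lam"
    proof (cases "z = 0")
      case True
      show ?thesis unfolding True by (rule fiber_homeomorphic_torus_nonempty[OF fiber_zero])
    next
      case False
      show ?thesis by (rule fiber_homeomorphic_torus_nonempty[OF fiber_nonzero_homeomorphic_torus[OF False z]])
    qed
  qed
qed

lemma fiber_interior:
  assumes "z \<in> interior (region n lam)"
  shows "fiber n lam z homeomorphic_space torus (n - 1)"
proof (cases "z = 0")
  case True
  show ?thesis unfolding True by (rule fiber_zero)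
next
  case False
  have z: "z \<in> region n lam" using assms interior_subset by blast
  have "{j \<in> maxima. 2 * (cmod z - Re z) = lowest_max n lam \<and> sg j * F (crit j) = lowest_max n lam} = {}"
    "{j \<in> minima. 2 * (cmod z + Re z) = lowest_min_depth n lam \<and> sg j * F (crit j) = lowest_min_depth n lam} = {}"
    using assms unfolding in_interior_region_iff by simp_all
  then have "card {j. j < n - 1 \<and> threshold z j < sg j * F (crit j)} = n - 1"
    using torus_dim_eq[OF z refl refl] by (simp only: card.empty diff_zero)
  then show ?thesis using fiber_nonzero_homeomorphic_torus[OF False z] by simp
qed

lemma fiber_frontier:
  assumes "z \<in> frontier (region n lam)"
  shows "max_bound n lam z < min_bound n lam z \<Longrightarrow> fiber n lam z homeomorphic_space torus (n - 1 - num_maxima n lam)"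
    and "min_bound n lam z < max_bound n lam z \<Longrightarrow> fiber n lam z homeomorphic_space torus (n - 1 - num_minima n lam)"
    and "min_bound n lam z = max_bound n lam z \<Longrightarrow>
      fiber n lam z homeomorphic_space torus (n - 1 - num_maxima n lam - num_minima n lam)"
proof -
  have dim: "fiber n lam z homeomorphic_space torus (n - 1 - (if 2 * (cmod z - Re z) = lowest_max n lam then num_maxima n lam else 0)
       - (if 2 * (cmod z + Re z) = lowest_min_depth n lam then num_minima n lam else 0))"
    if "z \<in> region n lam" "z \<noteq> 0"
  proof -
    have "card {j \<in> maxima. P \<and> sg j * F (crit j) = lowest_max n lam} = (if P then num_maxima n lam else 0)"
      "card {j \<in> minima. P \<and> sg j * F (crit j) = lowest_min_depth n lam} = (if P then num_minima n lam else 0)" for P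
      by (cases P; simp only: num_maxima_eq num_minima_eq simp_thms if_True if_False Collect_empty_eq card.empty; simp)+
    then show ?thesis
      using fiber_nonzero_homeomorphic_torus[OF that(2,1)] unfolding torus_dim_eq[OF that(1) refl refl] by simp
  qed
  have "(max_bound n lam z < min_bound n lam z \<longrightarrow> fiber n lam z homeomorphic_space torus (n - 1 - num_maxima n lam)) \<and>
    (min_bound n lam z < max_bound n lam z \<longrightarrow> fiber n lam z homeomorphic_space torus (n - 1 - num_minima n lam)) \<and>
    (min_bound n lam z = max_bound n lam z \<longrightarrow>
      fiber n lam z homeomorphic_space torus (n - 1 - num_maxima n lam - num_minima n lam))"
    using assms
  proof (cases rule: frontier_region_cases)
    case 1
    have "\<not> min_bound n lam z < max_bound n lam z" "min_bound n lam z \<noteq> max_bound n lam z" using 1(5) by auto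
    with dim[OF 1(1,2)] 1(3-5) show ?thesis by simp
  next
    case 2
    have "\<not> max_bound n lam z < min_bound n lam z" "min_bound n lam z \<noteq> max_bound n lam z" using 2(5) by auto
    with dim[OF 2(1,2)] 2(3-5) show ?thesis by simp
  next
    case 3
    with dim[OF 3(1,2)] 3(3-5) show ?thesis by simp
  qed
  then show "max_bound n lam z < min_bound n lam z \<Longrightarrow> fiber n lam z homeomorphic_space torus (n - 1 - num_maxima n lam)"
    and "min_bound n lam z < max_bound n lam z \<Longrightarrow> fiber n lam z homeomorphic_space torus (n - 1 - num_minima n lam)"
    and "min_bound n lam z = max_bound n lam z \<Longrightarrow>
      fiber n lam z homeomorphic_space torus (n - 1 - num_maxima n lam - num_minima n lam)"
    by blast+
qed

end

theorem theorem3p4: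
  fixes n :: nat and lam :: "nat \<Rightarrow> real"
  assumes "3 \<le> n" and "strict_mono_on {1..n} lam"
  shows "off_diagonal_prod n ` isospectral n lam = region n lam \<and>
    (\<forall>z \<in> interior (region n lam).
       fiber n lam z homeomorphic_space torus (n - 1)) \<and>
    (\<forall>z \<in> frontier (region n lam). max_bound n lam z < min_bound n lam z \<longrightarrow>
       fiber n lam z homeomorphic_space torus (n - 1 - num_maxima n lam)) \<and>
    (\<forall>z \<in> frontier (region n lam). min_bound n lam z < max_bound n lam z \<longrightarrow>
       fiber n lam z homeomorphic_space torus (n - 1 - num_minima n lam)) \<and>
    (\<forall>z \<in> frontier (region n lam). min_bound n lam z = max_bound n lam z \<longrightarrow>
       fiber n lam z homeomorphic_space torus (n - 1 - num_maxima n lam - num_minima n lam))"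
proof -
  interpret spectral_data n lam using assms by unfold_locales
  show ?thesis
    using off_diagonal_prod_image fiber_interior fiber_frontier by blast
qed

end
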